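(* Let $\nu$ be a finite non-negative Borel measure on $(0,\infty)$ and let $g:\mathbb{R}\to\mathbb{R}$ be given by $$g(x)=\int_0^\infty e^{-\pi\lambda x^2}\,d\nu(\lambda).$$ (i) There exists a unique extremal minorant $l(z)$ of exponential type $2\pi$ for $g(x)$. The function $l(x)$ interpolates the values of $g(x)$ at $\mathbb{Z}+\frac12$ and satisfies $$\int_{-\infty}^\infty\{g(x)-l(x)\}\,dx=\int_0^\infty\Bigl\{\sum_{n\in\mathbb{Z},\,n\ne0}(-1)^{n+1}\,\widehat{G}_\lambda(n)\Bigr\}d\nu(\lambda).$$ (ii) There exists a unique extremal majorant $m(z)$ of exponential type $2\pi$ for $g(x)$. The function $m(x)$ interpolates the values of $g(x)$ at $\mathbb{Z}$ and satisfies $$\int_{-\infty}^\infty\{m(x)-g(x)\}\,dx=\int_0^\infty\Bigl\{\sum_{n\in\mathbb{Z},\,n\ne0}\widehat{G}_\lambda(n)\Bigr\}d\nu(\lambda).$$ (iii) There exists a unique best approximation $k(z)$ of exponential type $\pi$ for $g(x)$. The function $k(x)$ interpolates the values of $g(x)$ at $\mathbb{Z}+\frac12$ and satisfies $$\int_{-\infty}^\infty|g(x)-k(x)|\,dx=\int_0^\infty\Bigl\{\frac1\pi\sum_{n=-\infty}^\infty\frac{(-1)^n}{n+\frac12}\,\widehat{G}_\lambda\bigl(n+\tfrac12\bigr)\Bigr\}d\nu(\lambda).$$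
   Context: For $\lambda>0$, $\widehat{G}_\lambda(t)=\lambda^{-1/2}e^{-\pi\lambda^{-1}t^2}$ (the Fourier transform of $G_\lambda(x)=e^{-\pi\lambda x^2}$). An entire function $F$ is of exponential type (at most) $2\pi\delta$ if for every $\epsilon>0$ there is $C>0$ with $|F(z)|\le Ce^{(2\pi\delta+\epsilon)|z|}$ for all $z\in\mathbb{C}$. An extremal minorant (resp. majorant) of exponential type $2\pi$ for $g$ is an entire function $F$ of exponential type at most $2\pi$, real valued on $\mathbb{R}$, with $F(x)\le g(x)$ (resp. $F(x)\ge g(x)$) for all real $x$, minimizing $\int_{-\infty}^\infty|g(x)-F(x)|\,dx$ among all such functions. A best approximation of exponential type $\pi$ for $g$ is an entire function $F$ of exponential type at most $\pi$ minimizing $\int_{-\infty}^\infty|g(x)-F(x)|\,dx$ among all entire functions of exponential type at most $\pi$. *)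

theory Defs
  imports "HOL-Complex_Analysis.Complex_Analysis"
begin

definition gaussian_hat :: "real \<Rightarrow> real \<Rightarrow> real" where
  "gaussian_hat s t = s powr (-1/2) * exp (- pi * inverse s * t\<^sup>2)"

definition gaussian_mixture :: "real measure \<Rightarrow> real \<Rightarrow> real" where
  "gaussian_mixture \<nu> x = (LINT s|\<nu>. exp (- pi * s * x\<^sup>2))"

definition entire_of_exp_type :: "real \<Rightarrow> (complex \<Rightarrow> complex) \<Rightarrow> bool" where
  "entire_of_exp_type \<tau> F \<longleftrightarrow>
     F holomorphic_on UNIV \<and>
     (\<forall>\<epsilon>>0. \<exists>C>0. \<forall>z. cmod (F z) \<le> C * exp ((\<tau> + \<epsilon>) * cmod z))"

text \<open>The distance takes values in \<open>[0, \<infinity>]\<close>: for the Bochner integral a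
  non-integrable difference would have distance 0 and be a spurious minimizer.\<close>

definition L1_dist :: "(real \<Rightarrow> real) \<Rightarrow> (complex \<Rightarrow> complex) \<Rightarrow> ennreal" where
  "L1_dist g F =
     (\<integral>\<^sup>+x. ennreal (cmod (complex_of_real (g x) - F (complex_of_real x))) \<partial>lborel)"

definition minorant :: "real \<Rightarrow> (real \<Rightarrow> real) \<Rightarrow> (complex \<Rightarrow> complex) \<Rightarrow> bool" where
  "minorant \<tau> g F \<longleftrightarrow> entire_of_exp_type \<tau> F \<and>
     (\<forall>x::real. F (complex_of_real x) \<in> \<real> \<and> Re (F (complex_of_real x)) \<le> g x)"

definition majorant :: "real \<Rightarrow> (real \<Rightarrow> real) \<Rightarrow> (complex \<Rightarrow> complex) \<Rightarrow> bool" where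
  "majorant \<tau> g F \<longleftrightarrow> entire_of_exp_type \<tau> F \<and>
     (\<forall>x::real. F (complex_of_real x) \<in> \<real> \<and> Re (F (complex_of_real x)) \<ge> g x)"

definition extremal_minorant :: "real \<Rightarrow> (real \<Rightarrow> real) \<Rightarrow> (complex \<Rightarrow> complex) \<Rightarrow> bool" where
  "extremal_minorant \<tau> g F \<longleftrightarrow>
     minorant \<tau> g F \<and> (\<forall>H. minorant \<tau> g H \<longrightarrow> L1_dist g F \<le> L1_dist g H)"

definition extremal_majorant :: "real \<Rightarrow> (real \<Rightarrow> real) \<Rightarrow> (complex \<Rightarrow> complex) \<Rightarrow> bool" where
  "extremal_majorant \<tau> g F \<longleftrightarrow>
     majorant \<tau> g F \<and> (\<forall>H. majorant \<tau> g H \<longrightarrow> L1_dist g F \<le> L1_dist g H)"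

text \<open>Competitors for best approximation need not be real valued on the real line.\<close>

definition best_approximation :: "real \<Rightarrow> (real \<Rightarrow> real) \<Rightarrow> (complex \<Rightarrow> complex) \<Rightarrow> bool" where
  "best_approximation \<tau> g F \<longleftrightarrow>
     entire_of_exp_type \<tau> F \<and>
     (\<forall>H. entire_of_exp_type \<tau> H \<longrightarrow> L1_dist g F \<le> L1_dist g H)"

definition interpolates_at :: "(complex \<Rightarrow> complex) \<Rightarrow> (real \<Rightarrow> real) \<Rightarrow> real set \<Rightarrow> bool" where
  "interpolates_at F g S \<longleftrightarrow> (\<forall>x\<in>S. F (complex_of_real x) = complex_of_real (g x))"

end

theory Submission
  imports Defs "HOL-Probability.Probability" "HOL-Real_Asymp.Real_Asymp"
begin

text \<open>
Fix \<open>s > 0\<close> and let \<open>w(z)\<close> be \<open>-sin\<^sup>2(\<pi>z)/\<pi>\<close>, \<open>cos\<^sup>2(\<pi>z)/\<pi>\<close> or \<open>cos(\<pi>z)\<close>: an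
even function of exponential type \<open>\<tau> = 2\<pi>\<close>, \<open>2\<pi>\<close> or \<open>\<pi>\<close> that vanishes at the nodes of
interpolation. In each case \<open>1/w(\<i>y)\<close> is a Laplace transform,
\<open>1/w(\<i>y) = \<integral>\<^sub>0\<^sup>\<infinity> \<Phi>(u) exp(-\<pi>uy\<^sup>2) du\<close> for \<open>y > 0\<close>, of a bounded and \<^emph>\<open>nonnegative\<close>
kernel \<open>\<Phi>\<close>. The extremal function of the Gaussian \<open>exp(-\<pi>sx\<^sup>2)\<close> is then

  \<open>E\<^sub>s(z) = exp(-\<pi>sz\<^sup>2) - w(z) \<integral>\<^sub>0\<^sup>s \<Phi>(u) exp(-\<pi>(s-u)z\<^sup>2) du\<close>.

On the real line the subtracted term is \<open>w(x)\<close> times a nonnegative number, so \<open>E\<^sub>s\<close>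
interpolates at the zeros of \<open>w\<close> and lies above the Gaussian, lies below it, or changes sides
together with \<open>cos(\<pi>x)\<close>. It has exponential type \<open>\<tau>\<close>: where \<open>Re z\<^sup>2 \<ge> -1\<close> all exponentials
in the formula are bounded, and where \<open>Re z\<^sup>2 < -1\<close> the analytically continued Laplace identity
rewrites it as \<open>w(z) \<integral>\<^sub>s\<^sup>\<infinity> \<Phi>(u) exp(\<pi>(u-s)z\<^sup>2) du\<close>, which is \<open>O(\<bar>w(z)\<bar>)\<close>
(lemma \<open>approximant_growth\<close>).

Expanding \<open>1/w(\<i>y)\<close> in powers of \<open>exp(-2\<pi>y)\<close> and inverting term by term with Levy's
integral exhibits \<open>\<Phi>\<close> as a series of theta type (\<open>theta_kernel_laplace\<close>). Its sign and size are
read off this series for \<open>u < 1\<close>, and for \<open>u \<ge> 1\<close> off the series with \<open>u\<close> in place of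
\<open>1/u\<close> that Poisson summation produces from it (\<open>theta_second_derivative\<close>,
\<open>theta_first_derivative\<close>); in both ranges the first term dominates.

The error \<open>exp(-\<pi>sx\<^sup>2) - E\<^sub>s(x)\<close> is at most \<open>D/(1+x\<^sup>2)\<close> with \<open>D\<close> independent of \<open>s\<close>. So
\<open>\<bar>E\<^sub>s\<bar> \<le> 1 + D\<close> on the real line, and the Phragmen-Lindeloef principle
(\<open>phragmen_lindelof_exp_type\<close>) bounds \<open>E\<^sub>s(z)\<close> by \<open>(1+D) exp(\<tau>\<bar>Im z\<bar>)\<close>, again
uniformly in \<open>s\<close>. Hence \<open>\<integral> E\<^sub>s d\<nu>(s)\<close> is entire of exponential type \<open>\<tau>\<close>, has the same sign
pattern relative to \<open>g\<close>, and its error can be integrated by Fubini's theorem.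

For extremality, let \<open>F\<close> be the difference of two competitors at finite distance from \<open>g\<close>; it
is integrable on the real line. For type \<open>2\<pi>\<close>, Paley-Wiener and Poisson summation give
\<open>\<integral>F = \<Sum>\<^sub>n F(n+a)\<close> (\<open>quadrature\<close>), and at the nodes a one-sided competitor cannot beat an
interpolating one. For type \<open>\<pi>\<close>, the square wave \<open>sgn(cos(\<pi>x))\<close> has only frequencies at which
the transform of \<open>F\<close> vanishes, so it is orthogonal to \<open>F\<close>, and it is the sign of the error.
For an equally good competitor, \<open>F\<close> (or, for type \<open>\<pi>\<close>, its square) is forced to have double
zeros at the nodes and is zero by \<open>double_zeros_imp_zero\<close>. That lemma spares one node, because
the majorant kernel has infinite integral and the error of the averaged majorant need not be
quadratically small at \<open>0\<close>.

The values of the minimal integrals compare the quadrature formula for \<open>E\<^sub>s\<close> with Poisson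
summation for the Gaussian, respectively expand the square wave.
\<close>

section \<open>Holomorphic parameter integrals\<close>

lemma Cauchy_estimate_entire:
  assumes "f holomorphic_on UNIV" "R > 0" "\<And>w. cmod (w - z) \<le> R \<Longrightarrow> cmod (f w) \<le> B"
  shows "cmod ((deriv ^^ n) f z) \<le> fact n * B / R ^ n"
proof (rule Cauchy_inequality)
  show "f holomorphic_on ball z R" using assms(1) by (rule holomorphic_on_subset) auto
  show "continuous_on (cball z R) f"
    using holomorphic_on_imp_continuous_on[OF assms(1)] continuous_on_subset by blast
qed (use assms in \<open>auto simp: norm_minus_commute\<close>)

text \<open>Cauchy's estimate converts the integrable bound on the integrand into one on its
  difference quotients, and dominated convergence applies to these.\<close>

lemma has_field_derivative_parameter_integral:
  fixes f :: "complex \<Rightarrow> 'a \<Rightarrow> complex"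
  assumes S: "open S" and z: "z \<in> S"
    and hol: "\<And>x. x \<in> space M \<Longrightarrow> (\<lambda>z. f z x) holomorphic_on S"
    and meas: "\<And>z. z \<in> S \<Longrightarrow> f z \<in> borel_measurable M"
    and h: "integrable M h"
    and bound: "\<And>z x. z \<in> S \<Longrightarrow> x \<in> space M \<Longrightarrow> cmod (f z x) \<le> h x"
  shows "integrable M (\<lambda>x. deriv (\<lambda>z. f z x) z)"
    and "((\<lambda>z. \<integral>x. f z x \<partial>M) has_field_derivative (\<integral>x. deriv (\<lambda>z. f z x) z \<partial>M)) (at z)"
proof -
  obtain r where r: "r > 0" "cball z r \<subseteq> S" using S z open_contains_cball by blast
  define d where "d = r / 2"
  have d: "d > 0" using r by (simp add: d_def)
  have der: "((\<lambda>z. f z x) has_field_derivative deriv (\<lambda>z. f z x) w) (at w)"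
    if "x \<in> space M" "w \<in> S" for x w
    using hol[OF that(1)] S that(2) by (simp add: holomorphic_derivI)
  have dbound: "cmod (deriv (\<lambda>z. f z x) w) \<le> h x / d" if "x \<in> space M" "w \<in> cball z d" for x w
  proof -
    have sub: "cball w d \<subseteq> S"
    proof
      fix y assume "y \<in> cball w d"
      then have "dist z y \<le> r" using that dist_triangle[of z y w] by (auto simp: d_def)
      then show "y \<in> S" using r by auto
    qed
    have "cmod ((deriv ^^ 1) (\<lambda>z. f z x) w) \<le> fact 1 * h x / d ^ 1"
    proof (rule Cauchy_inequality)
      show "(\<lambda>z. f z x) holomorphic_on ball w d"
        by (rule holomorphic_on_subset[OF hol[OF that(1)]]) (use sub in auto)
      show "continuous_on (cball w d) (\<lambda>z. f z x)"
        by (rule continuous_on_subset[OF holomorphic_on_imp_continuous_on[OF hol[OF that(1)]] sub])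
      fix y assume "cmod (w - y) = d"
      then have "y \<in> S" using sub by (auto simp: dist_norm)
      then show "cmod (f y x) \<le> h x" using bound that by auto
    qed (rule d)
    then show ?thesis by simp
  qed
  (* The mean value inequality on the disc turns the derivative bound into one for the
    quotients. *)
  have qbound: "cmod ((f w x - f z x) / (w - z)) \<le> h x / d"
    if "x \<in> space M" "w \<in> cball z d" for x w
  proof -
    have "cmod (f w x - f z x) \<le> h x / d * cmod (w - z)"
    proof (rule field_differentiable_bound[where S = "cball z d" and f' = "deriv (\<lambda>z. f z x)"])
      fix y assume "y \<in> cball z d"
      then have "y \<in> S" using r d by (auto simp: d_def)
      then show "((\<lambda>z. f z x) has_field_derivative deriv (\<lambda>z. f z x) y) (at y within cball z d)"
        using der that by (meson has_field_derivative_at_within)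
    qed (use that dbound d in auto)
    moreover have "0 \<le> h x / d"
      using order_trans[OF norm_ge_zero bound[OF z that(1)]] d by simp
    ultimately show ?thesis
      by (cases "w = z") (auto simp: norm_divide divide_le_eq)
  qed
  have int: "integrable M (f w)" if "w \<in> S" for w
    by (rule Bochner_Integration.integrable_bound[OF h]) (use meas bound that order_trans[OF bound] in \<open>auto intro!: AE_I2\<close>)
  have lim: "(\<lambda>n. (f (X n) x - f z x) / (X n - z)) \<longlonglongrightarrow> deriv (\<lambda>z. f z x) z"
    if X: "\<forall>i. X i \<in> UNIV - {z}" "X \<longlonglongrightarrow> z" and x: "x \<in> space M" for X :: "nat \<Rightarrow> complex" and x
    using der[OF x z] X unfolding has_field_derivative_iff tendsto_at_iff_sequentially
    by (auto simp: comp_def)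
  have main: "integrable M (\<lambda>x. deriv (\<lambda>z. f z x) z) \<and>
     (\<lambda>n. ((\<integral>x. f (X n) x \<partial>M) - (\<integral>x. f z x \<partial>M)) / (X n - z)) \<longlonglongrightarrow> (\<integral>x. deriv (\<lambda>z. f z x) z \<partial>M)"
    if X: "\<forall>i. X i \<in> UNIV - {z}" "X \<longlonglongrightarrow> z" for X :: "nat \<Rightarrow> complex"
  proof -
    have "eventually (\<lambda>n. X n \<in> ball z d) sequentially"
      by (rule topological_tendstoD[OF X(2)]) (use d in auto)
    then obtain N where N: "\<And>n. n \<ge> N \<Longrightarrow> X n \<in> cball z d"
      unfolding eventually_sequentially using ball_subset_cball by blast
    have inS: "X n \<in> S" if "n \<ge> N" for n using N[OF that] r d by (auto simp: d_def)
    define q where "q = (\<lambda>n x. (f (X (n + N)) x - f z x) / (X (n + N) - z))"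
    have qm: "q n \<in> borel_measurable M" for n
      unfolding q_def using meas[OF inS[of "n + N"]] meas[OF z] by auto
    have ql: "AE x in M. (\<lambda>n. q n x) \<longlonglongrightarrow> deriv (\<lambda>z. f z x) z"
      using LIMSEQ_ignore_initial_segment[OF lim[OF X]] unfolding q_def by (intro AE_I2) auto
    have dm: "(\<lambda>x. deriv (\<lambda>z. f z x) z) \<in> borel_measurable M"
      by (rule borel_measurable_LIMSEQ_metric[where f = q])
        (use qm LIMSEQ_ignore_initial_segment[OF lim[OF X]] in \<open>auto simp: q_def\<close>)
    have hd: "integrable M (\<lambda>x. h x / d)" using h by simp
    have qb: "AE x in M. norm (q n x) \<le> h x / d" for n
      using qbound N unfolding q_def by (intro AE_I2) auto
    have "integrable M (\<lambda>x. deriv (\<lambda>z. f z x) z)"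
      by (rule integrable_dominated_convergence[OF dm qm hd ql qb])
    moreover have "(\<lambda>n. integral\<^sup>L M (q n)) \<longlonglongrightarrow> (\<integral>x. deriv (\<lambda>z. f z x) z \<partial>M)"
      by (rule integral_dominated_convergence[OF dm qm hd ql qb])
    moreover have "integral\<^sup>L M (q n) = ((\<integral>x. f (X (n + N)) x \<partial>M) - (\<integral>x. f z x \<partial>M)) / (X (n + N) - z)" for n
      unfolding q_def using int[OF inS[of "n + N"]] int[OF z] by simp
    ultimately show ?thesis by (auto intro: LIMSEQ_offset[where k = N])
  qed
  have "\<exists>X::nat \<Rightarrow> complex. (\<forall>i. X i \<in> UNIV - {z}) \<and> X \<longlonglongrightarrow> z"
    using islimpt_UNIV[of z] unfolding islimpt_sequential by blast
  then show "integrable M (\<lambda>x. deriv (\<lambda>z. f z x) z)" using main by blast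
  show "((\<lambda>z. \<integral>x. f z x \<partial>M) has_field_derivative (\<integral>x. deriv (\<lambda>z. f z x) z \<partial>M)) (at z)"
    unfolding has_field_derivative_iff tendsto_at_iff_sequentially
    using main by (auto simp: comp_def)
qed

lemma holomorphic_on_parameter_integral:
  fixes f :: "complex \<Rightarrow> 'a \<Rightarrow> complex"
  assumes S: "open S"
    and hol: "\<And>x. x \<in> space M \<Longrightarrow> (\<lambda>z. f z x) holomorphic_on S"
    and meas: "\<And>z. z \<in> S \<Longrightarrow> f z \<in> borel_measurable M"
    and bound: "\<And>z0. z0 \<in> S \<Longrightarrow> \<exists>r>0. \<exists>h. integrable M h \<and>
      (\<forall>z\<in>ball z0 r \<inter> S. \<forall>x\<in>space M. cmod (f z x) \<le> h x)"
  shows "(\<lambda>z. \<integral>x. f z x \<partial>M) holomorphic_on S"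
proof -
  have "(\<lambda>z. \<integral>x. f z x \<partial>M) field_differentiable at z0" if z0: "z0 \<in> S" for z0
  proof -
    obtain r h where r: "r > 0" "integrable M h"
      "\<And>z x. z \<in> ball z0 r \<inter> S \<Longrightarrow> x \<in> space M \<Longrightarrow> cmod (f z x) \<le> h x"
      using bound[OF z0] by blast
    have "((\<lambda>z. \<integral>x. f z x \<partial>M) has_field_derivative (\<integral>x. deriv (\<lambda>z. f z x) z0 \<partial>M)) (at z0)"
      by (rule has_field_derivative_parameter_integral[where S = "ball z0 r \<inter> S"])
        (use S z0 r meas holomorphic_on_subset[OF hol] in \<open>auto intro!: open_Int\<close>)
    then show ?thesis unfolding field_differentiable_def by blast
  qed
  then show ?thesis by (simp add: S field_differentiable_at_within holomorphic_on_def)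
qed

section \<open>The Phragmen-Lindeloef principle for exponential type\<close>

text \<open>The common step of the Phragmen-Lindeloef arguments below: a multiplier \<open>g\<close> of modulus
  at most \<open>1\<close> makes \<open>f\<close> small far away, so that the maximum principle applies to a bounded
  piece of the unbounded set \<open>S\<close>. Afterwards \<open>g\<close> is let tend to \<open>1\<close>.\<close>

lemma maximum_modulus_with_multiplier:
  assumes S: "closed S"
    and f: "f holomorphic_on T" and g: "g holomorphic_on T" and T: "open T" "S \<subseteq> T"
    and g1: "\<And>z. z \<in> S \<Longrightarrow> cmod (g z) \<le> 1"
    and fB: "\<And>z. z \<in> frontier S \<Longrightarrow> cmod (f z) \<le> B"
    and far: "\<And>z. z \<in> S \<Longrightarrow> cmod z \<ge> R \<Longrightarrow> cmod (f z * g z) \<le> B"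
    and z: "z \<in> S"
  shows "cmod (f z * g z) \<le> B"
proof (cases "cmod z \<ge> R")
  case True then show ?thesis using far z by auto
next
  case False
  define K where "K = S \<inter> cball 0 R"
  have K: "closed K" "bounded K" unfolding K_def using S by (auto intro: bounded_Int)
  have KT: "K \<subseteq> T" using T K_def by auto
  have hol: "(\<lambda>z. f z * g z) holomorphic_on T" by (intro holomorphic_intros f g)
  show ?thesis
  proof (rule maximum_modulus_frontier[where S = K and f = "\<lambda>z. f z * g z" and \<xi> = z])
    show "(\<lambda>z. f z * g z) holomorphic_on interior K"
      using hol KT interior_subset holomorphic_on_subset by (metis order_trans)
    show "continuous_on (closure K) (\<lambda>z. f z * g z)"
      using K KT hol by (metis closure_closed continuous_on_subset holomorphic_on_imp_continuous_on)
    show "bounded K" by (rule K)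
    show "z \<in> K" using z False by (auto simp: K_def)
    fix w assume w: "w \<in> frontier K"
    then have wK: "w \<in> K" using K frontier_subset_eq by blast
    show "norm (f w * g w) \<le> B"
    proof (cases "w \<in> frontier S")
      case True
      have "cmod (f w * g w) \<le> cmod (f w) * 1"
        unfolding norm_mult by (intro mult_left_mono g1) (use wK K_def in auto)
      then show ?thesis using fB[OF True] by simp
    next
      case False
      then have "w \<in> interior S" using wK closure_subset S by (auto simp: frontier_def K_def)
      then have "w \<notin> ball 0 R"
        using w by (auto simp: frontier_def K_def interior_Int)
      then show ?thesis using far[of w] wK by (auto simp: K_def)
    qed
  qed
qed

lemma frontier_quadrant: "frontier {z. Re z \<ge> 0 \<and> Im z \<ge> 0} \<subseteq> {z. Re z \<ge> 0 \<and> Im z \<ge> 0 \<and> (Re z = 0 \<or> Im z = 0)}"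
proof -
  have c: "closed {z. Re z \<ge> 0 \<and> Im z \<ge> 0}"
    by (intro closed_Collect_conj closed_Collect_le continuous_intros)
  have o: "open {z. Re z > 0 \<and> Im z > 0}"
    by (intro open_Collect_conj open_Collect_less continuous_intros)
  have "{z. Re z > 0 \<and> Im z > 0} \<subseteq> interior {z. Re z \<ge> 0 \<and> Im z \<ge> 0}"
    by (rule interior_maximal[OF _ o]) auto
  then show ?thesis using c unfolding frontier_def
    by (auto simp: closure_closed subset_iff) (metis linorder_le_less_linear order_antisym)+
qed

lemma Im_Ln_le_pi4:
  assumes "Re u > 0" "\<bar>Im u\<bar> \<le> Re u"
  shows "\<bar>Im (Ln u)\<bar> \<le> pi / 4"
proof -
  have "Im (Ln u) = arctan (Im u / Re u)" using assms by (subst Im_Ln_eq) auto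
  moreover have "arctan (Im u / Re u) \<le> arctan 1"
    by (rule arctan_monotone') (use assms in \<open>auto simp: field_simps\<close>)
  moreover have "arctan (-1) \<le> arctan (Im u / Re u)"
    by (rule arctan_monotone') (use assms in \<open>auto simp: field_simps\<close>)
  ultimately show ?thesis by (simp add: arctan_one arctan_minus)
qed

lemma superlinear_at_bot:
  fixes A k :: real
  assumes k: "k > 0"
  shows "filterlim (\<lambda>x. A * x - k * x powr (3/2)) at_bot at_top"
  unfolding filterlim_at_bot
proof
  fix Z :: real
  define b where "b = (\<bar>A\<bar> + 1) / k"
  show "eventually (\<lambda>x. A * x - k * x powr (3/2) \<le> Z) at_top"
    using eventually_ge_at_top[of "max (- Z) (b\<^sup>2)"] eventually_gt_at_top[of 0]
  proof eventually_elim
    case (elim x)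
    have b: "b \<ge> 0" using k by (simp add: b_def)
    have "x powr (3/2) = x powr (1 + 1/2)" by simp
    also have "\<dots> = x * sqrt x" using elim by (simp only: powr_add powr_half_sqrt) simp
    finally have p: "x powr (3/2) = x * sqrt x" .
    have "b \<le> sqrt x" using elim b real_le_rsqrt by auto
    then have "\<bar>A\<bar> + 1 \<le> k * sqrt x" using k by (simp add: b_def field_simps)
    then have "x * (\<bar>A\<bar> + 1) \<le> x * (k * sqrt x)" using elim by (intro mult_left_mono) auto
    moreover have "x * A \<le> x * \<bar>A\<bar>" using elim by (intro mult_left_mono) auto
    then have "A * x \<le> x * \<bar>A\<bar>" by (simp only: mult.commute)
    ultimately have "A * x - k * (x * sqrt x) \<le> - x" by (simp add: distrib_left mult.left_commute[of x])
    then show ?case using elim unfolding p by simp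
  qed
qed

text \<open>A function of finite exponential type is of order at most \<open>1\<close>, which is less than the
  order \<open>2\<close> of \<open>exp(-\<i>z\<^sup>2)\<close> that a quarter plane tolerates: a multiplier of the intermediate
  order \<open>3/2\<close> tames it.\<close>

lemma phragmen_lindelof_quadrant:
  assumes f: "f holomorphic_on UNIV" and B: "B > 0"
    and growth: "\<And>z. cmod (f z) \<le> C * exp (A * cmod z)"
    and re: "\<And>x. x \<ge> 0 \<Longrightarrow> cmod (f (of_real x)) \<le> B"
    and im: "\<And>y. y \<ge> 0 \<Longrightarrow> cmod (f (\<i> * of_real y)) \<le> B"
    and z: "Re z \<ge> 0" "Im z \<ge> 0"
  shows "cmod (f z) \<le> B"
proof -
  define S where "S = {z. Re z \<ge> 0 \<and> Im z \<ge> 0}"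
  have S: "closed S" unfolding S_def
    by (intro closed_Collect_conj closed_Collect_le continuous_intros)
  (* Rotate the quadrant onto the sector \<open>\<bar>arg\<bar> \<le> \<pi>/4\<close> and shift it off the branch point, so
    that \<open>u\<^sup>3\<^sup>/\<^sup>2\<close> is holomorphic on a neighbourhood; since \<open>3/2 * \<pi>/4 < \<pi>/2\<close>, its real part
    grows like \<open>\<bar>z\<bar>\<^sup>3\<^sup>/\<^sup>2\<close>. *)
  define u where "u = (\<lambda>z. cis (-pi/4) * z + 1)"
  define T where "T = {z. Re (u z) > 0}"
  have T: "open T" unfolding T_def u_def by (intro open_Collect_less continuous_intros)
  have cs: "cos (pi/4) = sqrt 2 / 2" "sin (pi/4) = sqrt 2 / 2" by (auto simp: cos_45 sin_45)
  have Reu: "Re (u z) = sqrt 2 / 2 * (Re z + Im z) + 1" for z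
    by (simp add: u_def cs algebra_simps)
  have Imu: "Im (u z) = sqrt 2 / 2 * (Im z - Re z)" for z
    by (simp add: u_def cs algebra_simps)
  have ST: "S \<subseteq> T"
  proof
    fix z assume "z \<in> S"
    then have "sqrt 2 / 2 * (Re z + Im z) \<ge> 0" by (auto simp: S_def)
    then show "z \<in> T" by (simp add: T_def Reu)
  qed
  define p where "p = (\<lambda>z. exp (3/2 * Ln (u z)))"
  have p: "p holomorphic_on T" unfolding p_def u_def
    by (intro holomorphic_intros) (auto simp: T_def u_def complex_nonpos_Reals_iff)
  define c where "c = cos (3 * pi / 8)"
  have c: "c > 0" unfolding c_def by (rule cos_gt_zero_pi) auto
  have Rep: "Re (p z) \<ge> c * cmod z powr (3/2)" if zS: "z \<in> S" for z
  proof -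
    have pos: "sqrt 2 / 2 * (Re z + Im z) \<ge> 0" using zS by (auto simp: S_def)
    have ru: "Re (u z) > 0" using pos by (simp add: Reu)
    have "\<bar>Im (u z)\<bar> = sqrt 2 / 2 * \<bar>Im z - Re z\<bar>" by (simp add: Imu abs_mult)
    also have "\<dots> \<le> sqrt 2 / 2 * (Re z + Im z)"
      by (intro mult_left_mono) (use zS in \<open>auto simp: S_def\<close>)
    finally have "\<bar>Im (u z)\<bar> \<le> Re (u z)" by (simp add: Reu)
    then have a: "\<bar>Im (Ln (u z))\<bar> \<le> pi / 4" using ru by (intro Im_Ln_le_pi4) auto
    have "cos (3/2 * Im (Ln (u z))) = cos (\<bar>3/2 * Im (Ln (u z))\<bar>)" by (simp only: cos_abs_real)
    also have "\<dots> \<ge> c" unfolding c_def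
      by (rule cos_monotone_0_pi_le) (use a in auto)
    finally have co: "cos (3/2 * Im (Ln (u z))) \<ge> c" .
    have nz: "u z \<noteq> 0" using ru by auto
    have "(cmod z)\<^sup>2 \<le> (cmod (u z))\<^sup>2"
    proof -
      have "(cmod (u z))\<^sup>2 = (sqrt 2 / 2 * (Re z + Im z) + 1)\<^sup>2 + (sqrt 2 / 2 * (Im z - Re z))\<^sup>2"
        by (simp add: cmod_power2 Reu Imu)
      also have "\<dots> = (Re z)\<^sup>2 + (Im z)\<^sup>2 + 2 * (sqrt 2 / 2 * (Re z + Im z)) + 1"
        by (simp add: power2_sum power2_diff power_mult_distrib field_simps power2_eq_square)
      finally show ?thesis using pos by (simp add: cmod_power2)
    qed
    then have zu: "cmod z \<le> cmod (u z)" by (simp add: power2_le_iff_abs_le)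
    have "Re (p z) = exp (3/2 * ln (cmod (u z))) * cos (3/2 * Im (Ln (u z)))"
      using nz by (simp add: p_def Re_exp)
    also have "exp (3/2 * ln (cmod (u z))) = cmod (u z) powr (3/2)"
      using nz by (simp add: powr_def)
    finally have "Re (p z) = cmod (u z) powr (3/2) * cos (3/2 * Im (Ln (u z)))" .
    also have "\<dots> \<ge> cmod z powr (3/2) * c"
      by (intro mult_mono powr_mono2 zu co) (use c in auto)
    finally show ?thesis by (simp add: mult.commute)
  qed
  have *: "cmod (f z * exp (- of_real \<delta> * p z)) \<le> B" if d: "\<delta> > 0" for \<delta>
  proof -
    have dc: "\<delta> * c > 0" using d c by simp
    have "((\<lambda>x::real. C * exp (A * x) * exp (- (\<delta> * c) * x powr (3/2))) \<longlongrightarrow> 0) at_top"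
    proof -
      have "((\<lambda>x::real. exp (A * x - (\<delta> * c) * x powr (3/2))) \<longlongrightarrow> 0) at_top"
        by (rule filterlim_compose[OF exp_at_bot superlinear_at_bot[OF dc]])
      moreover have "C * exp (A * x) * exp (- (\<delta> * c) * x powr (3/2))
        = C * exp (A * x - (\<delta> * c) * x powr (3/2))" for x
        by (simp only: mult.assoc exp_add[symmetric] mult_minus_left diff_conv_add_uminus)
      ultimately show ?thesis by (simp only: tendsto_mult_right_zero)
    qed
    then have "eventually (\<lambda>x::real. C * exp (A * x) * exp (- (\<delta> * c) * x powr (3/2)) < B) at_top"
      using B by (rule order_tendstoD)
    then obtain R where R: "\<And>x. x \<ge> R \<Longrightarrow> C * exp (A * x) * exp (- (\<delta> * c) * x powr (3/2)) < B"
      by (auto simp: eventually_at_top_linorder)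
    have ng: "cmod (exp (- of_real \<delta> * p z)) \<le> exp (- (\<delta> * c) * cmod z powr (3/2))" if "z \<in> S" for z
      using mult_left_mono[OF Rep[OF that], of \<delta>] d by (simp add: mult.assoc)
    show ?thesis
    proof (rule maximum_modulus_with_multiplier[where S = S and T = T and f = f and z = z and R = R])
      show "f holomorphic_on T" using f holomorphic_on_subset by blast
      show "(\<lambda>z. exp (- of_real \<delta> * p z)) holomorphic_on T" by (intro holomorphic_intros p)
      show "z \<in> S" using z by (simp add: S_def)
      fix z assume z: "z \<in> S"
      have "exp (- (\<delta> * c) * cmod z powr (3/2)) \<le> 1" using dc by simp
      then show "cmod (exp (- of_real \<delta> * p z)) \<le> 1" using ng[OF z] by linarith
      assume zR: "R \<le> cmod z"
      have "cmod (f z * exp (- of_real \<delta> * p z)) \<le> (C * exp (A * cmod z)) * exp (- (\<delta> * c) * cmod z powr (3/2))"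
        unfolding norm_mult by (intro mult_mono growth ng z)  (use order_trans[OF norm_ge_zero growth] in auto)
      then show "cmod (f z * exp (- of_real \<delta> * p z)) \<le> B" using R[OF zR] by linarith
    next
      fix w assume "w \<in> frontier S"
      then have "Re w \<ge> 0" "Im w \<ge> 0" "Re w = 0 \<or> Im w = 0" using frontier_quadrant by (auto simp: S_def)
      moreover have "w = of_real (Re w) \<or> w = \<i> * of_real (Im w)" using calculation
        by (auto simp: complex_eq_iff)
      ultimately show "cmod (f w) \<le> B" using re[of "Re w"] im[of "Im w"] by metis
    qed (use S T ST in auto)
  qed
  have "((\<lambda>\<delta>. cmod (f z * exp (- of_real \<delta> * p z))) \<longlongrightarrow> cmod (f z * exp (- of_real 0 * p z))) (at_right 0)"
    by (intro tendsto_intros)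
  then have "cmod (f z * exp (- of_real 0 * p z)) \<le> B"
    by (rule tendsto_upperbound) (use * in \<open>auto simp: eventually_at_filter\<close>)
  then show ?thesis by simp
qed

text \<open>In a half plane boundedness is assumed, and only the constant is improved to the one on
  the boundary.\<close>

lemma phragmen_lindelof_halfplane:
  assumes f: "f holomorphic_on UNIV" and M: "M > 0"
    and bdd: "\<And>z. Im z \<ge> 0 \<Longrightarrow> cmod (f z) \<le> C"
    and re: "\<And>x. cmod (f (of_real x)) \<le> M"
    and z: "Im z \<ge> 0"
  shows "cmod (f z) \<le> M"
proof -
  define S where "S = {z. Im z \<ge> 0}"
  have S: "closed S" unfolding S_def
    by (intro closed_Collect_le continuous_intros)
  (* The multiplier \<open>1/(1 - \<i>\<delta>z)\<close> has its pole in the lower half plane and decays at infinity.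
    *)
  have *: "cmod (f z * (1 / (1 - \<i> * of_real \<delta> * z))) \<le> M" if d: "\<delta> > 0" for \<delta>
  proof -
    define T where "T = {z. 1 - \<i> * of_real \<delta> * z \<noteq> 0}"
    have T: "open T" unfolding T_def
      by (intro open_Collect_neq continuous_intros)
    have lower: "cmod (1 - \<i> * of_real \<delta> * z) \<ge> 1" "cmod (1 - \<i> * of_real \<delta> * z) \<ge> \<delta> * cmod z"
      if "z \<in> S" for z
    proof -
      have z: "Im z \<ge> 0" using that by (simp add: S_def)
      have e: "(cmod (1 - \<i> * of_real \<delta> * z))\<^sup>2 = 1 + 2 * \<delta> * Im z + (\<delta> * cmod z)\<^sup>2"
        unfolding cmod_power2 power_mult_distrib by (simp add: power2_eq_square algebra_simps)
      have "(cmod (1 - \<i> * of_real \<delta> * z))\<^sup>2 \<ge> 1\<^sup>2" "(cmod (1 - \<i> * of_real \<delta> * z))\<^sup>2 \<ge> (\<delta> * cmod z)\<^sup>2"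
        unfolding e using z d by auto
      then show "cmod (1 - \<i> * of_real \<delta> * z) \<ge> 1" "cmod (1 - \<i> * of_real \<delta> * z) \<ge> \<delta> * cmod z"
        using power2_le_imp_le norm_ge_zero by blast+
    qed
    show ?thesis
    proof (rule maximum_modulus_with_multiplier[where S = S and T = T and f = f and z = z and R = "max 1 (C / (\<delta> * M))"])
      show "f holomorphic_on T" using f holomorphic_on_subset by blast
      show "(\<lambda>z. 1 / (1 - \<i> * of_real \<delta> * z)) holomorphic_on T"
        unfolding T_def by (intro holomorphic_intros) auto
      show "z \<in> S" using z by (simp add: S_def)
      fix z assume z: "z \<in> S"
      then show "cmod (1 / (1 - \<i> * of_real \<delta> * z)) \<le> 1"
        using lower(1)[OF z] by (auto simp: norm_divide divide_le_eq)
      assume zR: "max 1 (C / (\<delta> * M)) \<le> cmod z"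
      have "C \<le> M * (\<delta> * cmod z)" using zR d M by (simp add: field_simps)
      also have "\<dots> \<le> M * cmod (1 - \<i> * of_real \<delta> * z)" using lower(2)[OF z] M by simp
      finally have "cmod (f z) \<le> M * cmod (1 - \<i> * of_real \<delta> * z)"
        using bdd[of z] z by (auto simp: S_def)
      moreover have "cmod (1 - \<i> * of_real \<delta> * z) > 0" using lower(1)[OF z] by linarith
      ultimately show "cmod (f z * (1 / (1 - \<i> * of_real \<delta> * z))) \<le> M"
        by (simp add: norm_mult norm_divide divide_le_eq)
    next
      fix w assume "w \<in> frontier S"
      moreover have "frontier S = {z. Im z = 0}"
        using frontier_halfspace_ge[of \<i> 0] by (simp add: S_def inner_complex_def)
      ultimately have "w = of_real (Re w)" by (auto simp: complex_eq_iff)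
      then show "cmod (f w) \<le> M" using re[of "Re w"] by metis
    next
      show "S \<subseteq> T" using lower(1) by (force simp: T_def)
    qed (use S T in auto)
  qed
  have "((\<lambda>\<delta>. cmod (f z * (1 / (1 - \<i> * of_real \<delta> * z)))) \<longlongrightarrow> cmod (f z * (1 / (1 - \<i> * of_real 0 * z)))) (at_right 0)"
    by (intro tendsto_intros) auto
  then have "cmod (f z * (1 / (1 - \<i> * of_real 0 * z))) \<le> M"
    by (rule tendsto_upperbound) (use * in \<open>auto simp: eventually_at_filter\<close>)
  then show ?thesis by simp
qed

text \<open>A bound on the positive imaginary axis comes from the exponential type itself once the
  factor \<open>exp(\<i>(\<tau>+\<epsilon>)z)\<close> is attached. The two quadrants then give some bound on the upper half
  plane, and the half-plane principle gives the sharp one.\<close>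

lemma exp_type_upper:
  assumes F: "entire_of_exp_type \<tau> F" and \<tau>: "\<tau> \<ge> 0" and M: "M > 0"
    and re: "\<And>x. cmod (F (of_real x)) \<le> M" and z: "Im z \<ge> 0"
  shows "cmod (F z) \<le> M * exp (\<tau> * Im z)"
proof -
  have hol: "F holomorphic_on UNIV" using F by (simp add: entire_of_exp_type_def)
  have *: "cmod (F z) \<le> M * exp ((\<tau> + \<epsilon>) * Im z)" if e: "\<epsilon> > 0" for \<epsilon>
  proof -
    obtain C where C: "C > 0" "\<And>z. cmod (F z) \<le> C * exp ((\<tau> + \<epsilon>) * cmod z)"
      using F e unfolding entire_of_exp_type_def by blast
    define G where "G = (\<lambda>z. F z * exp (\<i> * of_real (\<tau> + \<epsilon>) * z))"
    have nG: "cmod (G z) = cmod (F z) * exp (- (\<tau> + \<epsilon>) * Im z)" for z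
      by (simp add: G_def norm_mult algebra_simps)
    have G: "G holomorphic_on UNIV" unfolding G_def by (intro holomorphic_intros hol)
    have Gi: "(\<lambda>z. G (\<i> * z)) holomorphic_on UNIV"
      by (rule holomorphic_on_compose_gen[of "\<lambda>z. \<i> * z" UNIV G UNIV, unfolded comp_def])
         (use G in \<open>auto intro!: holomorphic_intros\<close>)
    define B where "B = max M C"
    have gr: "cmod (G z) \<le> C * exp (2 * (\<tau> + \<epsilon>) * cmod z)" for z
    proof -
      have "cmod (G z) \<le> (C * exp ((\<tau> + \<epsilon>) * cmod z)) * exp ((\<tau> + \<epsilon>) * cmod z)"
        unfolding nG
      proof (intro mult_mono C(2))
        have "(\<tau> + \<epsilon>) * (- Im z) \<le> (\<tau> + \<epsilon>) * cmod z"
          by (intro mult_left_mono) (use abs_Im_le_cmod[of z] e \<tau> in auto)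
        then show "exp (- (\<tau> + \<epsilon>) * Im z) \<le> exp ((\<tau> + \<epsilon>) * cmod z)" by (simp add: algebra_simps)
      qed (use C(1) in auto)
      then show ?thesis by (simp add: exp_add[symmetric] algebra_simps)
    qed
    have re': "cmod (G (of_real x)) \<le> B" for x using re[of x] by (simp add: nG B_def)
    have im': "cmod (G (\<i> * of_real y)) \<le> B" if "y \<ge> 0" for y
    proof -
      have "cmod (G (\<i> * of_real y)) \<le> C * exp ((\<tau> + \<epsilon>) * y) * exp (- (\<tau> + \<epsilon>) * y)"
        unfolding nG using mult_right_mono[OF C(2)[of "\<i> * of_real y"]] that by (simp add: norm_mult)
      also have "\<dots> = C * exp ((\<tau> + \<epsilon>) * y + - (\<tau> + \<epsilon>) * y)" by (simp only: exp_add mult.assoc)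
      also have "(\<tau> + \<epsilon>) * y + - (\<tau> + \<epsilon>) * y = 0" by (simp add: algebra_simps)
      also have "C * exp 0 = C" by simp
      finally show ?thesis by (simp add: B_def)
    qed
    have q1: "cmod (G z) \<le> B" if "Re z \<ge> 0" "Im z \<ge> 0" for z
      by (rule phragmen_lindelof_quadrant[OF G _ gr]) (use re' im' that M in \<open>auto simp: B_def\<close>)
    (* The second quadrant is the first one turned by \<open>\<i>\<close>. *)
    have q2: "cmod (G z) \<le> B" if "Re z \<le> 0" "Im z \<ge> 0" for z
    proof -
      have "cmod (G (\<i> * (- \<i> * z))) \<le> B"
      proof (rule phragmen_lindelof_quadrant[OF Gi])
        show "cmod (G (\<i> * z)) \<le> C * exp (2 * (\<tau> + \<epsilon>) * cmod z)" for z
          using gr[of "\<i> * z"] by (simp add: norm_mult)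
        show "cmod (G (\<i> * (\<i> * complex_of_real y))) \<le> B" for y
          using re'[of "- y"] by simp
      qed (use that im' M in \<open>auto simp: B_def\<close>)
      then show ?thesis by (simp add: mult.assoc[symmetric])
    qed
    have "cmod (G z) \<le> M"
      by (rule phragmen_lindelof_halfplane[OF G M, where C = B])
         (use q1 q2 re z nG in \<open>auto, metis linear\<close>)
    then have a: "cmod (F z) * exp (- (\<tau> + \<epsilon>) * Im z) \<le> M" unfolding nG .
    have "cmod (F z) = cmod (F z) * exp (- (\<tau> + \<epsilon>) * Im z) * exp ((\<tau> + \<epsilon>) * Im z)"
      unfolding mult.assoc exp_add[symmetric] by (simp add: algebra_simps)
    also have "\<dots> \<le> M * exp ((\<tau> + \<epsilon>) * Im z)" by (intro mult_right_mono a) auto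
    finally show ?thesis .
  qed
  have "((\<lambda>\<epsilon>. M * exp ((\<tau> + \<epsilon>) * Im z)) \<longlongrightarrow> M * exp ((\<tau> + 0) * Im z)) (at_right 0)"
    by (intro tendsto_intros)
  then have "cmod (F z) \<le> M * exp ((\<tau> + 0) * Im z)"
    by (rule tendsto_lowerbound) (use * in \<open>auto simp: eventually_at_filter\<close>)
  then show ?thesis by simp
qed

lemma entire_of_exp_type_uminus:
  assumes "entire_of_exp_type \<tau> F" shows "entire_of_exp_type \<tau> (\<lambda>z. F (- z))"
  unfolding entire_of_exp_type_def
proof (intro conjI allI impI)
  show "(\<lambda>z. F (- z)) holomorphic_on UNIV"
    by (rule holomorphic_on_compose_gen[of "\<lambda>z. - z" UNIV F UNIV, unfolded comp_def])
       (use assms in \<open>auto intro!: holomorphic_intros simp: entire_of_exp_type_def\<close>)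
  fix \<epsilon> :: real assume "\<epsilon> > 0"
  then obtain C where "C > 0" "\<And>z. cmod (F z) \<le> C * exp ((\<tau> + \<epsilon>) * cmod z)"
    using assms unfolding entire_of_exp_type_def by blast
  then show "\<exists>C>0. \<forall>z. cmod (F (- z)) \<le> C * exp ((\<tau> + \<epsilon>) * cmod z)"
    by (metis norm_minus_cancel)
qed

text \<open>The bound has no \<open>\<epsilon>\<close> in the exponent and the constant of the real line. This uniformity
  is what permits integrating families of functions of exponential type, and it is the source
  of the \<open>L\<^sup>1\<close> bounds on derivatives below.\<close>

theorem phragmen_lindelof_exp_type:
  assumes F: "entire_of_exp_type \<tau> F" and \<tau>: "\<tau> \<ge> 0"
    and re: "\<And>x. cmod (F (of_real x)) \<le> M"
  shows "cmod (F z) \<le> M * exp (\<tau> * \<bar>Im z\<bar>)"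
proof -
  have pos: "cmod (F z) \<le> M' * exp (\<tau> * \<bar>Im z\<bar>)" if M': "M' > 0" "M \<le> M'" for M'
  proof (cases "Im z \<ge> 0")
    case True
    have "cmod (F x) \<le> M'" for x :: real using re[of x] M' by linarith
    then show ?thesis using exp_type_upper[OF F \<tau> M'(1) _ True] True by simp
  next
    case False
    have "cmod (F (- of_real x)) \<le> M'" for x :: real using re[of "-x"] M' by simp
    then show ?thesis
      using exp_type_upper[OF entire_of_exp_type_uminus[OF F] \<tau> M'(1), of "- z"] False by simp
  qed
  have M0: "0 \<le> M" using order_trans[OF norm_ge_zero re] .
  have "((\<lambda>\<eta>. (M + \<eta>) * exp (\<tau> * \<bar>Im z\<bar>)) \<longlongrightarrow> (M + 0) * exp (\<tau> * \<bar>Im z\<bar>)) (at_right 0)"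
    by (intro tendsto_intros)
  then have "cmod (F z) \<le> (M + 0) * exp (\<tau> * \<bar>Im z\<bar>)"
    by (rule tendsto_lowerbound) (use pos M0 in \<open>auto simp: eventually_at_filter\<close>)
  then show ?thesis by simp
qed

section \<open>Derivatives of integrable functions of exponential type\<close>

lemma integrable_of_bounded_truncations:
  fixes f :: "real \<Rightarrow> complex"
  assumes f: "continuous_on UNIV f"
    and B: "\<And>N::nat. (\<integral>x. indicator {- real N..real N} x * cmod (f x) \<partial>lborel) \<le> B"
  shows "integrable lborel f" "(\<integral>x. cmod (f x) \<partial>lborel) \<le> B"
proof -
  define g where "g = (\<lambda>(N::nat) x. indicator {- real N..real N} x * cmod (f x))"
  have m[measurable]: "f \<in> borel_measurable borel" using f by (rule borel_measurable_continuous_onI)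
  have gi: "integrable lborel (g N)" for N
  proof -
    have "continuous_on {- real N..real N} (\<lambda>x. cmod (f x))"
      by (intro continuous_on_norm continuous_on_subset[OF f]) simp
    from borel_integrable_compact[OF compact_Icc this] show ?thesis by (simp add: g_def)
  qed
  have mono: "AE x in lborel. mono (\<lambda>N. g N x)"
    by (intro AE_I2 monoI) (auto simp: g_def indicator_def)
  have lim: "AE x in lborel. (\<lambda>N. g N x) \<longlonglongrightarrow> cmod (f x)"
  proof (intro AE_I2)
    fix x :: real
    obtain N0 :: nat where "\<bar>x\<bar> \<le> real N0" using real_arch_simple by blast
    then have "eventually (\<lambda>N. g N x = cmod (f x)) sequentially"
      unfolding eventually_sequentially by (intro exI[of _ N0]) (auto simp: g_def indicator_def)
    then show "(\<lambda>N. g N x) \<longlonglongrightarrow> cmod (f x)" by (rule tendsto_eventually)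
  qed
  have inc: "incseq (\<lambda>N. integral\<^sup>L lborel (g N))"
    by (intro monoI integral_mono gi) (auto simp: g_def indicator_def)
  moreover have "\<forall>N. integral\<^sup>L lborel (g N) \<le> B" using B by (simp add: g_def)
  ultimately obtain L where L: "(\<lambda>N. integral\<^sup>L lborel (g N)) \<longlonglongrightarrow> L"
    using incseq_convergent by blast
  have "L \<le> B" by (rule LIMSEQ_le_const2[OF L]) (use B in \<open>auto simp: g_def\<close>)
  have mm: "(\<lambda>x. cmod (f x)) \<in> borel_measurable lborel" by simp
  have "integrable lborel (\<lambda>x. cmod (f x))" "(\<integral>x. cmod (f x) \<partial>lborel) = L"
    by (rule integrable_monotone_convergence[OF gi mono lim L mm]
             integral_monotone_convergence[OF gi mono lim L mm])+
  then show "integrable lborel f" "(\<integral>x. cmod (f x) \<partial>lborel) \<le> B"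
    using \<open>L \<le> B\<close> by (auto simp: integrable_norm_iff)
qed

lemma entire_of_exp_type_holo: "entire_of_exp_type \<tau> F \<Longrightarrow> F holomorphic_on UNIV"
  by (simp add: entire_of_exp_type_def)

lemma entire_continuous_of_real:
  assumes "F holomorphic_on UNIV" shows "continuous_on UNIV (\<lambda>x::real. F (z + of_real x))"
  by (rule continuous_on_compose2[OF holomorphic_on_imp_continuous_on[OF assms]])
     (auto intro!: continuous_intros)

lemma entire_measurable_of_real:
  assumes "F holomorphic_on UNIV" shows "(\<lambda>x::real. F (z + of_real x)) \<in> borel_measurable borel"
  using entire_continuous_of_real[OF assms] by (rule borel_measurable_continuous_onI)

lemma integrable_indicator_Icc [simp]: "integrable lborel (indicator {a..b::real} :: real \<Rightarrow> real)"
  by (rule integrable_real_indicator) (auto simp: emeasure_lborel_Icc_eq)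

text \<open>The convolution of \<open>F\<close> with a reflected truncated phase \<open>\<phi>\<close>. It has the exponential type
  of \<open>F\<close> and is bounded on the real line by the \<open>L\<^sup>1\<close> norm of \<open>F\<close>, so that it trades an
  integral norm for a pointwise one.\<close>

definition smear :: "real \<Rightarrow> (real \<Rightarrow> complex) \<Rightarrow> (complex \<Rightarrow> complex) \<Rightarrow> complex \<Rightarrow> complex" where
  "smear N \<phi> F z = (\<integral>t. indicator {-N..N} t *\<^sub>R (F (z + of_real t) * \<phi> t) \<partial>lborel)"

lemma smear_bounded:
  assumes F: "F holomorphic_on UNIV"
  obtains C where "C \<ge> 0" "\<And>z t. z \<in> ball z0 1 \<Longrightarrow> t \<in> {-N..N} \<Longrightarrow> cmod (F (z + of_real t)) \<le> C"
proof -
  have "compact (F ` cball z0 (1 + \<bar>N\<bar>))"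
    by (intro compact_continuous_image continuous_on_subset[OF holomorphic_on_imp_continuous_on[OF F]]) auto
  then have "bounded (F ` cball z0 (1 + \<bar>N\<bar>))" by (rule compact_imp_bounded)
  then obtain C where C: "C > 0" "\<And>w. w \<in> cball z0 (1 + \<bar>N\<bar>) \<Longrightarrow> cmod (F w) \<le> C"
    unfolding bounded_pos by auto
  show thesis
  proof (rule that[of C])
    fix z t assume "z \<in> ball z0 1" "t \<in> {-N..N}"
    then have "dist z0 (z + of_real t) \<le> 1 + \<bar>N\<bar>"
      using norm_triangle_ineq4[of "z0 - z" "of_real t"] unfolding dist_norm diff_diff_eq
      by (simp add: dist_norm) linarith
    then show "cmod (F (z + of_real t)) \<le> C" using C by auto
  qed (use C in auto)
qed

lemma smear_deriv:
  assumes F: "F holomorphic_on UNIV" and \<phi>[measurable]: "\<phi> \<in> borel_measurable borel" and \<phi>1: "\<And>t. cmod (\<phi> t) \<le> 1"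
  shows "(smear N \<phi> F has_field_derivative smear N \<phi> (deriv F) z) (at z)"
proof -
  note [measurable] = entire_measurable_of_real[OF F]
  obtain C where C: "C \<ge> 0" "\<And>w t. w \<in> ball z 1 \<Longrightarrow> t \<in> {-N..N} \<Longrightarrow> cmod (F (w + of_real t)) \<le> C"
    using smear_bounded[OF F] by blast
  define f where "f = (\<lambda>w t. indicator {-N..N} t *\<^sub>R (F (w + of_real t) * \<phi> t))"
  have der: "((\<lambda>w. f w t) has_field_derivative indicator {-N..N} t *\<^sub>R (deriv F (w + of_real t) * \<phi> t)) (at w)" for w t
  proof -
    have "((\<lambda>w. F (w + of_real t)) has_field_derivative deriv F (w + of_real t)) (at w)"
      by (rule DERIV_shift[THEN iffD1, OF holomorphic_derivI[OF F open_UNIV UNIV_I]])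
    then show ?thesis unfolding f_def scaleR_conv_of_real
      by (auto intro!: derivative_eq_intros)
  qed
  have "((\<lambda>w. \<integral>t. f w t \<partial>lborel) has_field_derivative (\<integral>t. deriv (\<lambda>w. f w t) z \<partial>lborel)) (at z)"
  proof (rule has_field_derivative_parameter_integral(2)[where S = "ball z 1" and h = "\<lambda>t. indicator {-N..N} t * C"])
    show "(\<lambda>w. f w t) holomorphic_on ball z 1" for t
      using der by (meson field_differentiable_at_within field_differentiable_def holomorphic_onI)
    show "f w \<in> borel_measurable lborel" for w unfolding f_def by measurable
    show "integrable lborel (\<lambda>t. indicator {-N..N} t * C)" by simp
    fix w t assume w: "w \<in> ball z 1"
    show "cmod (f w t) \<le> indicator {-N..N} t * C"
    proof (cases "t \<in> {-N..N}")
      case True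
      have "cmod (F (w + of_real t)) * cmod (\<phi> t) \<le> C * 1" by (intro mult_mono C \<phi>1) (use True w C in auto)
      then show ?thesis using True by (auto simp: f_def norm_mult)
    qed (auto simp: f_def)
  qed auto
  moreover have "deriv (\<lambda>w. f w t) z = indicator {-N..N} t *\<^sub>R (deriv F (z + of_real t) * \<phi> t)" for t
    by (rule DERIV_imp_deriv[OF der])
  ultimately show ?thesis unfolding smear_def[abs_def] f_def by simp
qed

lemma smear_higher_deriv:
  assumes F: "F holomorphic_on UNIV" and \<phi>: "\<phi> \<in> borel_measurable borel" "\<And>t. cmod (\<phi> t) \<le> 1"
  shows "(deriv ^^ n) (smear N \<phi> F) = smear N \<phi> ((deriv ^^ n) F)"
proof (induction n)
  case (Suc n)
  have "(deriv ^^ n) F holomorphic_on UNIV" by (rule holomorphic_higher_deriv[OF F]) auto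
  from smear_deriv[OF this \<phi>] have "deriv (smear N \<phi> ((deriv ^^ n) F)) = smear N \<phi> (deriv ((deriv ^^ n) F))"
    by (intro ext DERIV_imp_deriv)
  then show ?case by (simp add: Suc)
qed auto

lemma smear_holo:
  assumes F: "F holomorphic_on UNIV" and \<phi>: "\<phi> \<in> borel_measurable borel" "\<And>t. cmod (\<phi> t) \<le> 1"
  shows "smear N \<phi> F holomorphic_on UNIV"
  using smear_deriv[OF assms] by (meson field_differentiable_at_within field_differentiable_def holomorphic_onI)

lemma smear_exp_type:
  assumes F: "entire_of_exp_type \<tau> F" and \<tau>: "\<tau> \<ge> 0" and \<phi>[measurable]: "\<phi> \<in> borel_measurable borel" and \<phi>1: "\<And>t. cmod (\<phi> t) \<le> 1" and N: "N \<ge> 0"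
  shows "entire_of_exp_type \<tau> (smear N \<phi> F)"
  unfolding entire_of_exp_type_def
proof (intro conjI allI impI)
  show "smear N \<phi> F holomorphic_on UNIV"
    by (rule smear_holo) (use entire_of_exp_type_holo[OF F] \<phi> \<phi>1 in auto)
  fix \<epsilon> :: real assume e: "\<epsilon> > 0"
  then obtain C where C: "C > 0" "\<And>z. cmod (F z) \<le> C * exp ((\<tau> + \<epsilon>) * cmod z)"
    using F unfolding entire_of_exp_type_def by blast
  define C' where "C' = (2 * N + 1) * (C * exp ((\<tau> + \<epsilon>) * N))"
  have "cmod (smear N \<phi> F z) \<le> C' * exp ((\<tau> + \<epsilon>) * cmod z)" for z
  proof -
    define b where "b = C * exp ((\<tau> + \<epsilon>) * N) * exp ((\<tau> + \<epsilon>) * cmod z)"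
    have b: "b \<ge> 0" using C by (simp add: b_def)
    have "cmod (smear N \<phi> F z) \<le> (\<integral>t. norm (indicator {-N..N} t *\<^sub>R (F (z + of_real t) * \<phi> t)) \<partial>lborel)"
      unfolding smear_def by (rule integral_norm_bound)
    also have "\<dots> \<le> (\<integral>t. indicator {-N..N} t * b \<partial>lborel)"
    proof (rule integral_mono')
      show "integrable lborel (\<lambda>t. indicator {-N..N} t * b)" by simp
      fix t
      show "norm (indicator {-N..N} t *\<^sub>R (F (z + of_real t) * \<phi> t)) \<le> indicator {-N..N} t * b"
      proof (cases "t \<in> {-N..N}")
        case True
        have "cmod (F (z + of_real t)) \<le> C * exp ((\<tau> + \<epsilon>) * cmod (z + of_real t))" by (rule C)
        also have "(\<tau> + \<epsilon>) * cmod (z + of_real t) \<le> (\<tau> + \<epsilon>) * (N + cmod z)"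
          by (intro mult_left_mono) (use True e \<tau> norm_triangle_ineq[of z "of_real t"] in auto)
        also have "C * exp ((\<tau> + \<epsilon>) * (N + cmod z)) = b" by (simp add: b_def distrib_left exp_add)
        finally have "cmod (F (z + of_real t)) \<le> b" using C by simp
        then have "cmod (F (z + of_real t)) * cmod (\<phi> t) \<le> b * 1" by (intro mult_mono \<phi>1) (use b in auto)
        then show ?thesis using True by (simp add: norm_mult)
      qed auto
      show "0 \<le> indicator {-N..N} t * b" using b by simp
    qed
    also have "\<dots> = 2 * N * b" using N by (simp add: measure_def)
    also have "\<dots> \<le> (2 * N + 1) * b" using b by (simp add: mult_right_mono)
    finally show ?thesis by (simp add: b_def C'_def mult.assoc)
  qed
  moreover have "C' > 0" using C N by (simp add: C'_def)
  ultimately show "\<exists>C>0. \<forall>z. cmod (smear N \<phi> F z) \<le> C * exp ((\<tau> + \<epsilon>) * cmod z)" by blast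
qed

lemma smear_real_bound:
  assumes F: "F holomorphic_on UNIV" and int: "integrable lborel (\<lambda>x. F (of_real x))"
    and \<phi>[measurable]: "\<phi> \<in> borel_measurable borel" and \<phi>1: "\<And>t. cmod (\<phi> t) \<le> 1"
  shows "cmod (smear N \<phi> F (of_real x)) \<le> (\<integral>x. cmod (F (of_real x)) \<partial>lborel)"
proof -
  have int': "integrable lborel (\<lambda>t. F (of_real (x + 1 * t)))" by (rule lborel_integrable_real_affine[OF int]) simp
  have "cmod (smear N \<phi> F (of_real x)) \<le> (\<integral>t. norm (indicator {-N..N} t *\<^sub>R (F (of_real x + of_real t) * \<phi> t)) \<partial>lborel)"
    unfolding smear_def by (rule integral_norm_bound)
  also have "\<dots> \<le> (\<integral>t. cmod (F (of_real (x + 1 * t))) \<partial>lborel)"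
  proof (rule integral_mono')
    show "integrable lborel (\<lambda>t. cmod (F (of_real (x + 1 * t))))" using int' by (rule integrable_norm)
    fix t
    have "cmod (F (of_real (x + t))) * cmod (\<phi> t) \<le> cmod (F (of_real (x + t))) * 1"
      by (intro mult_left_mono \<phi>1) auto
    then show "norm (indicator {-N..N} t *\<^sub>R (F (of_real x + of_real t) * \<phi> t)) \<le> cmod (F (of_real (x + 1 * t)))"
      by (auto simp: norm_mult indicator_def)
  qed auto
  also have "\<dots> = (\<integral>t. cmod (F (of_real t)) \<partial>lborel)"
    using lborel_integral_real_affine[of 1 "\<lambda>t. cmod (F (of_real t))" x] by simp
  finally show ?thesis .
qed

text \<open>An \<open>L\<^sup>1\<close> version of Cauchy's estimate. Smearing with the conjugate phase of \<open>F\<^sup>(\<^sup>n\<^sup>)\<close>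
  yields a function whose \<open>n\<close>-th derivative at \<open>0\<close> is the truncated \<open>L\<^sup>1\<close> norm of \<open>F\<^sup>(\<^sup>n\<^sup>)\<close>;
  Phragmen-Lindeloef bounds that function on discs, and Cauchy's estimate does the rest.\<close>

theorem integrable_higher_deriv:
  assumes F: "entire_of_exp_type \<tau> F" and \<tau>: "\<tau> \<ge> 0" and int: "integrable lborel (\<lambda>x. F (of_real x))" and R: "R > 0"
  shows "integrable lborel (\<lambda>x. (deriv ^^ n) F (of_real x))"
    and "(\<integral>x. cmod ((deriv ^^ n) F (of_real x)) \<partial>lborel) \<le> fact n / R ^ n * exp (\<tau> * R) * (\<integral>x. cmod (F (of_real x)) \<partial>lborel)"
proof -
  note hol = entire_of_exp_type_holo[OF F]
  define I where "I = (\<integral>x. cmod (F (of_real x)) \<partial>lborel)"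
  define g where "g = (\<lambda>x::real. (deriv ^^ n) F (of_real x))"
  have holn: "(deriv ^^ n) F holomorphic_on UNIV" by (rule holomorphic_higher_deriv[OF hol]) auto
  have g: "continuous_on UNIV g" using entire_continuous_of_real[OF holn, of 0] by (simp add: g_def)
  have gm[measurable]: "g \<in> borel_measurable borel" using g by (rule borel_measurable_continuous_onI)
  (* The conjugate phase of the derivative; where the derivative vanishes, division by zero
    makes it \<open>0\<close>. *)
  define \<phi> where "\<phi> = (\<lambda>x. cnj (g x) / of_real (cmod (g x)))"
  have "continuous_on UNIV cnj" by (intro continuous_intros)
  then have [measurable]: "cnj \<in> borel_measurable borel" by (rule borel_measurable_continuous_onI)
  have \<phi>: "\<phi> \<in> borel_measurable borel" unfolding \<phi>_def by measurable
  have \<phi>1: "cmod (\<phi> t) \<le> 1" for t by (simp add: \<phi>_def norm_divide)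
  have g\<phi>: "g t * \<phi> t = of_real (cmod (g t))" for t
    by (simp add: \<phi>_def complex_norm_square[symmetric] power2_eq_square)
  have I0: "I \<ge> 0" by (simp add: I_def)
  have B: "(\<integral>x. indicator {- real N..real N} x * cmod (g x) \<partial>lborel) \<le> fact n / R ^ n * exp (\<tau> * R) * I" for N :: nat
  proof -
    have "cmod ((deriv ^^ n) (smear N \<phi> F) 0) \<le> fact n * (I * exp (\<tau> * R)) / R ^ n"
    proof (rule Cauchy_estimate_entire)
      show "smear N \<phi> F holomorphic_on UNIV" by (rule smear_holo[OF hol \<phi> \<phi>1])
      fix w :: complex assume "cmod (w - 0) \<le> R"
      then have im: "\<bar>Im w\<bar> \<le> R" using abs_Im_le_cmod[of w] by simp
      have "cmod (smear N \<phi> F w) \<le> I * exp (\<tau> * \<bar>Im w\<bar>)"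
        by (rule phragmen_lindelof_exp_type[OF smear_exp_type[OF F \<tau> \<phi> \<phi>1] \<tau>])
           (use smear_real_bound[OF hol int \<phi> \<phi>1] in \<open>auto simp: I_def\<close>)
      also have "\<dots> \<le> I * exp (\<tau> * R)" using mult_left_mono[OF im \<tau>] I0 by (intro mult_left_mono) simp_all
      finally show "cmod (smear N \<phi> F w) \<le> I * exp (\<tau> * R)" .
    qed (rule R)
    moreover have "(deriv ^^ n) (smear N \<phi> F) 0 = of_real (\<integral>x. indicator {- real N..real N} x * cmod (g x) \<partial>lborel)"
    proof -
      have "(deriv ^^ n) (smear N \<phi> F) 0 = smear N \<phi> ((deriv ^^ n) F) 0" by (simp add: smear_higher_deriv[OF hol \<phi> \<phi>1])
      also have "\<dots> = (\<integral>t. of_real (indicator {- real N..real N} t * cmod (g t)) \<partial>lborel)"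
        unfolding smear_def using g\<phi> by (intro Bochner_Integration.integral_cong) (auto simp: g_def scaleR_conv_of_real)
      finally show ?thesis unfolding integral_complex_of_real .
    qed
    moreover have "(\<integral>x. indicator {- real N..real N} x * cmod (g x) \<partial>lborel) \<ge> 0" by simp
    ultimately show ?thesis by (simp add: algebra_simps)
  qed
  from integrable_of_bounded_truncations[OF g this]
  show "integrable lborel (\<lambda>x. (deriv ^^ n) F (of_real x))"
    and "(\<integral>x. cmod ((deriv ^^ n) F (of_real x)) \<partial>lborel) \<le> fact n / R ^ n * exp (\<tau> * R) * (\<integral>x. cmod (F (of_real x)) \<partial>lborel)"
    by (simp_all add: g_def I_def)
qed

section \<open>Fourier transforms and the Paley-Wiener theorem\<close>

definition fourier :: "(real \<Rightarrow> complex) \<Rightarrow> real \<Rightarrow> complex" where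
  "fourier f \<xi> = (\<integral>x. f x * cis (- 2 * pi * \<xi> * x) \<partial>lborel)"

lemma continuous_on_cis_real [continuous_intros]:
  fixes f :: "real \<Rightarrow> real"
  shows "continuous_on A f \<Longrightarrow> continuous_on A (\<lambda>x. cis (f x))"
  unfolding cis_conv_exp by (intro continuous_intros)

lemma cis_measurable [measurable]: "cis \<in> borel_measurable borel"
  by (rule borel_measurable_continuous_onI) (intro continuous_intros)

lemma integrable_mult_cis:
  fixes f :: "real \<Rightarrow> complex"
  assumes "integrable lborel f"
  shows "integrable lborel (\<lambda>x. f x * cis (c * x))"
  by (rule Bochner_Integration.integrable_bound[OF assms])
     (use assms in \<open>auto simp: norm_mult intro!: borel_measurable_times\<close>)

lemma norm_fourier_le:
  shows "cmod (fourier f \<xi>) \<le> (\<integral>x. cmod (f x) \<partial>lborel)"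
proof -
  have "cmod (fourier f \<xi>) \<le> (\<integral>x. cmod (f x * cis (- 2 * pi * \<xi> * x)) \<partial>lborel)"
    unfolding fourier_def by (rule integral_norm_bound)
  then show ?thesis by (simp add: norm_mult)
qed

lemma fourier_shift: "fourier (\<lambda>x. f (x + a)) \<xi> = cis (2 * pi * \<xi> * a) * fourier f \<xi>"
proof -
  have "fourier f \<xi> = (\<integral>x. f (a + x) * cis (- 2 * pi * \<xi> * (a + x)) \<partial>lborel)"
    unfolding fourier_def
    using lborel_integral_real_affine[of 1 "\<lambda>x. f x * cis (- 2 * pi * \<xi> * x)" a] by simp
  also have "\<dots> = (\<integral>x. cis (- 2 * pi * \<xi> * a) * (f (x + a) * cis (- 2 * pi * \<xi> * x)) \<partial>lborel)"
    by (intro Bochner_Integration.integral_cong refl) (simp add: cis_mult algebra_simps)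
  also have "\<dots> = cis (- 2 * pi * \<xi> * a) * fourier (\<lambda>x. f (x + a)) \<xi>"
    by (simp only: fourier_def integral_mult_right_zero)
  finally have "cis (2 * pi * \<xi> * a) * fourier f \<xi> = cis (2 * pi * \<xi> * a) * cis (- 2 * pi * \<xi> * a) * fourier (\<lambda>x. f (x + a)) \<xi>"
    by (simp only: mult.assoc)
  then show ?thesis by (simp add: cis_mult)
qed

lemma fourier_modulate: "fourier (\<lambda>x. f x * cis (2 * pi * b * x)) \<xi> = fourier f (\<xi> - b)"
  unfolding fourier_def
  by (intro Bochner_Integration.integral_cong refl) (simp add: cis_mult mult.assoc algebra_simps)

lemma isCont_fourier:
  assumes f: "integrable lborel f" shows "isCont (fourier f) \<xi>"
proof -
  have [measurable]: "f \<in> borel_measurable borel" using f by auto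
  have "((\<lambda>\<eta>. fourier f \<eta>) \<longlongrightarrow> fourier f \<xi>) (at \<xi>)"
    unfolding tendsto_at_iff_sequentially comp_def
  proof (intro allI impI)
    fix X :: "nat \<Rightarrow> real" assume X: "\<forall>i. X i \<in> UNIV - {\<xi>}" "X \<longlonglongrightarrow> \<xi>"
    show "(\<lambda>n. fourier f (X n)) \<longlonglongrightarrow> fourier f \<xi>"
      unfolding fourier_def
    proof (rule integral_dominated_convergence[where w = "\<lambda>x. cmod (f x)"])
      show "integrable lborel (\<lambda>x. cmod (f x))" using f by (rule integrable_norm)
      have c: "isCont cis y" for y
        using continuous_on_cis_real[of UNIV "\<lambda>x. x"] by (simp add: continuous_on_eq_continuous_at)
      show "AE x in lborel. (\<lambda>n. f x * cis (- 2 * pi * X n * x)) \<longlonglongrightarrow> f x * cis (- 2 * pi * \<xi> * x)"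
        by (intro AE_I2 tendsto_intros isCont_tendsto_compose[OF c] X)
    qed (auto simp: norm_mult)
  qed
  then show ?thesis by (simp add: isCont_def)
qed

text \<open>Continuously differentiable with both \<open>f\<close> and \<open>f'\<close> integrable: the class on which sums
  over the integers converge and Poisson summation holds, and to which every integrable
  function of exponential type belongs.\<close>

definition integrable_C1 :: "(real \<Rightarrow> complex) \<Rightarrow> (real \<Rightarrow> complex) \<Rightarrow> bool" where
  "integrable_C1 f f' \<longleftrightarrow> (\<forall>x. (f has_vector_derivative f' x) (at x)) \<and> continuous_on UNIV f' \<and>
     integrable lborel f \<and> integrable lborel f'"

lemma integrable_C1_continuous: "integrable_C1 f f' \<Longrightarrow> continuous_on UNIV f"
  unfolding integrable_C1_def
  by (meson continuous_at_imp_continuous_on has_vector_derivative_continuous)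

lemma integrable_C1_cell:
  assumes f: "integrable_C1 f f'"
  shows "has_bochner_integral lborel (\<lambda>x. indicator {a..a+1} x *\<^sub>R (f x + (x - c) *\<^sub>R f' x))
    ((a + 1 - c) *\<^sub>R f (a + 1) - (a - c) *\<^sub>R f a)"
proof (rule has_bochner_integral_FTC_Icc[where F = "\<lambda>x. (x - c) *\<^sub>R f x"])
  fix x :: real
  have "((\<lambda>x. (x - c) *\<^sub>R f x) has_vector_derivative ((x - c) *\<^sub>R f' x + 1 *\<^sub>R f x)) (at x)"
    by (rule has_vector_derivative_scaleR)
       (use f in \<open>auto simp: integrable_C1_def intro!: derivative_eq_intros\<close>)
  then show "((\<lambda>x. (x - c) *\<^sub>R f x) has_vector_derivative (f x + (x - c) *\<^sub>R f' x)) (at x within {a..a+1})"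
    by (simp add: add.commute has_vector_derivative_at_within)
next
  have "continuous_on UNIV (\<lambda>x. f x + (x - c) *\<^sub>R f' x)"
    using f integrable_C1_continuous[OF f] by (intro continuous_intros) (auto simp: integrable_C1_def)
  then show "continuous_on {a..a+1} (\<lambda>x. f x + (x - c) *\<^sub>R f' x)"
    by (rule continuous_on_subset) simp
qed simp

text \<open>Integration by parts on a unit cell against the weight that vanishes at the right end
  point.\<close>

lemma integrable_C1_bound_cell:
  assumes f: "integrable_C1 f f'"
  shows "cmod (f a) \<le> (\<integral>x. indicator {a..<a+1} x * (cmod (f x) + cmod (f' x)) \<partial>lborel)"
proof -
  have i: "integrable lborel (\<lambda>x. cmod (f x) + cmod (f' x))"
    using f by (auto simp: integrable_C1_def)
  have i2: "integrable lborel (\<lambda>x. indicator {a..a+1} x * (cmod (f x) + cmod (f' x)))"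
    using integrable_mult_indicator[OF _ i, of "{a..a+1}"] by simp
  have "f a = (\<integral>x. indicator {a..a+1} x *\<^sub>R (f x + (x - (a + 1)) *\<^sub>R f' x) \<partial>lborel)"
    using has_bochner_integral_integral_eq[OF integrable_C1_cell[OF f, of a "a + 1"]] by simp
  then have "cmod (f a) \<le> (\<integral>x. norm (indicator {a..a+1} x *\<^sub>R (f x + (x - (a + 1)) *\<^sub>R f' x)) \<partial>lborel)"
    using integral_norm_bound[of lborel "\<lambda>x. indicator {a..a+1} x *\<^sub>R (f x + (x - (a + 1)) *\<^sub>R f' x)"] by simp
  also have "\<dots> \<le> (\<integral>x. indicator {a..a+1} x * (cmod (f x) + cmod (f' x)) \<partial>lborel)"
  proof (rule integral_mono'[OF i2])
    fix x
    have "cmod (f x + (x - (a + 1)) *\<^sub>R f' x) \<le> cmod (f x) + cmod (f' x)" if "x \<in> {a..a+1}"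
    proof -
      have "cmod (f x + (x - (a + 1)) *\<^sub>R f' x) \<le> cmod (f x) + \<bar>x - (a + 1)\<bar> * cmod (f' x)"
        by (rule order_trans[OF norm_triangle_ineq]) simp
      also have "\<bar>x - (a + 1)\<bar> * cmod (f' x) \<le> 1 * cmod (f' x)"
        by (rule mult_right_mono) (use that in auto)
      finally show ?thesis by simp
    qed
    then show "norm (indicator {a..a+1} x *\<^sub>R (f x + (x - (a + 1)) *\<^sub>R f' x)) \<le> indicator {a..a+1} x * (cmod (f x) + cmod (f' x))"
      by (simp add: indicator_def)
  qed (simp add: indicator_def)
  also have "\<dots> = (\<integral>x. indicator {a..<a+1} x * (cmod (f x) + cmod (f' x)) \<partial>lborel)"
  proof (rule integral_cong_AE)
    have [measurable]: "f \<in> borel_measurable borel" "f' \<in> borel_measurable borel"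
      using f by (auto simp: integrable_C1_def)
    show "(\<lambda>x. indicator {a..a+1} x * (cmod (f x) + cmod (f' x))) \<in> borel_measurable lborel" by measurable
    show "(\<lambda>x. indicator {a..<a+1} x * (cmod (f x) + cmod (f' x))) \<in> borel_measurable lborel" by measurable
    show "AE x in lborel. indicator {a..a+1} x * (cmod (f x) + cmod (f' x)) = indicator {a..<a+1} x * (cmod (f x) + cmod (f' x))"
      using AE_lborel_singleton[of "a+1"] by eventually_elim (auto simp: indicator_def)
  qed
  finally show ?thesis .
qed

lemma indicator_cell_floor: "indicator {real_of_int n..<real_of_int n + 1} x = (if n = \<lfloor>x\<rfloor> then 1 else 0)"
  using floor_eq_iff[of x n] by (auto simp: indicator_def)

lemma sum_cells:
  fixes h :: "real \<Rightarrow> 'a::{banach,second_countable_topology}"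
  assumes h: "integrable lborel h" and A: "finite A"
  shows "(\<Sum>n\<in>A. \<integral>x. indicator {real_of_int n..<real_of_int n + 1} x *\<^sub>R h x \<partial>lborel)
    = (\<integral>x. indicator A \<lfloor>x\<rfloor> *\<^sub>R h x \<partial>lborel)"
proof -
  have "(\<Sum>n\<in>A. \<integral>x. indicator {real_of_int n..<real_of_int n + 1} x *\<^sub>R h x \<partial>lborel)
    = (\<integral>x. (\<Sum>n\<in>A. indicator {real_of_int n..<real_of_int n + 1} x *\<^sub>R h x) \<partial>lborel)"
    by (rule Bochner_Integration.integral_sum[symmetric]) (rule integrable_mult_indicator[OF _ h], simp)
  also have "\<dots> = (\<integral>x. indicator A \<lfloor>x\<rfloor> *\<^sub>R h x \<partial>lborel)"
  proof (intro Bochner_Integration.integral_cong refl)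
    fix x
    have "(\<Sum>n\<in>A. indicator {real_of_int n..<real_of_int n + 1} x *\<^sub>R h x) = (\<Sum>n\<in>A. if n = \<lfloor>x\<rfloor> then h x else 0)"
      unfolding indicator_cell_floor by (intro sum.cong) auto
    then show "(\<Sum>n\<in>A. indicator {real_of_int n..<real_of_int n + 1} x *\<^sub>R h x) = indicator A \<lfloor>x\<rfloor> *\<^sub>R h x"
      using A by (simp add: indicator_def)
  qed
  finally show ?thesis .
qed

lemma integrable_C1_summable:
  assumes f: "integrable_C1 f f'"
  shows "(\<lambda>n::int. cmod (f (of_int n))) summable_on UNIV"
proof (rule nonneg_bdd_above_summable_on)
  define h where "h = (\<lambda>x. cmod (f x) + cmod (f' x))"
  have h: "integrable lborel h" using f unfolding h_def by (auto simp: integrable_C1_def)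
  have "(\<Sum>n\<in>A. cmod (f (of_int n))) \<le> (\<integral>x. h x \<partial>lborel)" if A: "finite A" for A :: "int set"
  proof -
    have "(\<Sum>n\<in>A. cmod (f (of_int n))) \<le> (\<Sum>n\<in>A. \<integral>x. indicator {real_of_int n..<real_of_int n + 1} x *\<^sub>R h x \<partial>lborel)"
      using integrable_C1_bound_cell[OF f] by (intro sum_mono) (simp add: h_def)
    also have "\<dots> = (\<integral>x. indicator A \<lfloor>x\<rfloor> *\<^sub>R h x \<partial>lborel)" by (rule sum_cells[OF h A])
    also have "\<dots> \<le> (\<integral>x. h x \<partial>lborel)"
      by (rule integral_mono'[OF h]) (auto simp: h_def indicator_def)
    finally show ?thesis .
  qed
  then show "bdd_above (sum (\<lambda>n::int. cmod (f (of_int n))) ` {F. F \<subseteq> UNIV \<and> finite F})"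
    by (intro bdd_aboveI2) auto
qed auto

lemma has_sum_int_symmetric_limit:
  fixes f :: "int \<Rightarrow> 'a::{comm_monoid_add,topological_space}"
  assumes "(f has_sum S) UNIV"
  shows "(\<lambda>N. \<Sum>n\<in>{- int N..<int N}. f n) \<longlonglongrightarrow> S"
proof -
  have "filterlim (\<lambda>N. {- int N..<int N}) (finite_subsets_at_top UNIV) sequentially"
    unfolding filterlim_finite_subsets_at_top
  proof (intro allI impI)
    fix X :: "int set" assume X: "finite X \<and> X \<subseteq> UNIV"
    define m where "m = (\<Sum>x\<in>X. \<bar>x\<bar>)"
    have "\<bar>x\<bar> \<le> m" if "x \<in> X" for x unfolding m_def by (rule member_le_sum) (use X that in auto)
    then have "X \<subseteq> {- int N..<int N}" if "N \<ge> nat m + 1" for N using that by force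
    then show "eventually (\<lambda>N. finite {- int N..<int N} \<and> X \<subseteq> {- int N..<int N} \<and> {- int N..<int N} \<subseteq> UNIV) sequentially"
      unfolding eventually_sequentially by auto
  qed
  then show ?thesis using assms unfolding has_sum_def by (rule filterlim_compose[rotated])
qed

lemma integrable_C1_tendsto_0:
  assumes f: "integrable_C1 f f'"
  shows "(\<lambda>N::nat. f (real N)) \<longlonglongrightarrow> 0" "(\<lambda>N::nat. f (- real N)) \<longlonglongrightarrow> 0"
proof -
  define S where "S = (\<Sum>\<^sub>\<infinity>n::int. cmod (f (of_int n)))"
  have s: "((\<lambda>n::int. cmod (f (of_int n))) has_sum S) UNIV"
    using integrable_C1_summable[OF f] unfolding S_def by (rule has_sum_infsum)
  define P where "P = (\<lambda>N. \<Sum>n\<in>{- int N..<int N}. cmod (f (of_int n)))"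
  have P: "P \<longlonglongrightarrow> S" unfolding P_def by (rule has_sum_int_symmetric_limit[OF s])
  then have "(\<lambda>N. P (Suc N)) \<longlonglongrightarrow> S" by (rule LIMSEQ_Suc)
  from tendsto_diff[OF this P] have d: "(\<lambda>N. P (Suc N) - P N) \<longlonglongrightarrow> 0" by simp
  (* The increments of the symmetric partial sums dominate the two outermost values. *)
  have e: "P (Suc N) - P N = cmod (f (real N)) + cmod (f (- real (Suc N)))" for N
  proof -
    have "{- int (Suc N)..<int (Suc N)} = insert (int N) (insert (- int (Suc N)) {- int N..<int N})" by auto
    then show ?thesis unfolding P_def by simp
  qed
  show "(\<lambda>N::nat. f (real N)) \<longlonglongrightarrow> 0"
    by (rule Lim_null_comparison[OF _ d]) (auto simp: e)
  have "(\<lambda>N::nat. f (- real (Suc N))) \<longlonglongrightarrow> 0"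
    by (rule Lim_null_comparison[OF _ d]) (simp only: e, simp)
  then show "(\<lambda>N::nat. f (- real N)) \<longlonglongrightarrow> 0" by (rule LIMSEQ_imp_Suc)
qed

lemma indicator_Icc_tendsto:
  "(\<lambda>N::nat. indicator {- real N..real N} x *\<^sub>R c) \<longlonglongrightarrow> (c :: 'a::real_normed_vector)"
proof (rule tendsto_eventually)
  obtain N0 :: nat where "\<bar>x\<bar> \<le> real N0" using real_arch_simple by blast
  then show "eventually (\<lambda>N. indicator {- real N..real N} x *\<^sub>R c = c) sequentially"
    unfolding eventually_sequentially by (intro exI[of _ N0]) (auto simp: indicator_def)
qed

text \<open>The primitive tends to \<open>0\<close> along the integers because its values there are absolutely
  summable.\<close>

lemma integral_derivative_eq_0:
  assumes f: "integrable_C1 f f'"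
  shows "(\<integral>x. f' x \<partial>lborel) = 0"
proof -
  have i: "integrable lborel f'" using f by (simp add: integrable_C1_def)
  have "(\<lambda>N::nat. \<integral>x. indicator {- real N..real N} x *\<^sub>R f' x \<partial>lborel) \<longlonglongrightarrow> (\<integral>x. f' x \<partial>lborel)"
  proof (rule integral_dominated_convergence[where w = "\<lambda>x. cmod (f' x)"])
    show "integrable lborel (\<lambda>x. cmod (f' x))" using i by simp
    show "AE x in lborel. (\<lambda>N::nat. indicator {- real N..real N} x *\<^sub>R f' x) \<longlonglongrightarrow> f' x"
      by (intro AE_I2 indicator_Icc_tendsto)
  qed (use i in \<open>auto simp: indicator_def\<close>)
  moreover have "(\<integral>x. indicator {- real N..real N} x *\<^sub>R f' x \<partial>lborel) = f (real N) - f (- real N)" for N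
  proof (rule integral_FTC_Icc)
    fix x show "(f has_vector_derivative f' x) (at x within {- real N..real N})"
      using f by (simp add: integrable_C1_def has_vector_derivative_at_within)
    show "continuous_on {- real N..real N} f'"
      by (rule continuous_on_subset[of UNIV]) (use f in \<open>auto simp: integrable_C1_def\<close>)
  qed simp
  moreover have "(\<lambda>N. f (real N) - f (- real N)) \<longlonglongrightarrow> 0 - 0"
    by (intro tendsto_diff integrable_C1_tendsto_0[OF f])
  ultimately show ?thesis using LIMSEQ_unique by auto
qed

lemma has_vector_derivative_cis_linear:
  "((\<lambda>x. cis (c * x)) has_vector_derivative \<i> * of_real c * cis (c * x)) (at x)"
proof -
  have "((\<lambda>x. exp (x *\<^sub>R (\<i> * of_real c))) has_vector_derivative exp (x *\<^sub>R (\<i> * of_real c)) * (\<i> * of_real c)) (at x)"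
    by (rule exp_scaleR_has_vector_derivative_right)
  then show ?thesis by (simp add: cis_conv_exp scaleR_conv_of_real mult_ac)
qed

lemma integrable_C1_modulate:
  assumes f: "integrable_C1 f f'"
  shows "integrable_C1 (\<lambda>x. f x * cis (c * x)) (\<lambda>x. f' x * cis (c * x) + \<i> * of_real c * (f x * cis (c * x)))"
  unfolding integrable_C1_def
proof (intro conjI allI)
  fix x
  have "((\<lambda>x. f x * cis (c * x)) has_vector_derivative f x * (\<i> * of_real c * cis (c * x)) + f' x * cis (c * x)) (at x)"
    by (rule has_vector_derivative_mult[OF _ has_vector_derivative_cis_linear])
       (use f in \<open>auto simp: integrable_C1_def\<close>)
  then show "((\<lambda>x. f x * cis (c * x)) has_vector_derivative f' x * cis (c * x) + \<i> * of_real c * (f x * cis (c * x))) (at x)"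
    by (simp add: mult_ac add.commute)
next
  show "continuous_on UNIV (\<lambda>x. f' x * cis (c * x) + \<i> * of_real c * (f x * cis (c * x)))"
    using f integrable_C1_continuous[OF f] unfolding integrable_C1_def by (intro continuous_intros) auto
qed (use f integrable_mult_cis in \<open>auto simp: integrable_C1_def\<close>)

lemma integrable_C1_shift:
  assumes f: "integrable_C1 f f'"
  shows "integrable_C1 (\<lambda>x. f (x + a)) (\<lambda>x. f' (x + a))"
  unfolding integrable_C1_def
proof (intro conjI allI)
  fix x
  have "((f \<circ> (\<lambda>x. x + a)) has_vector_derivative 1 *\<^sub>R f' (x + a)) (at x)"
    by (rule vector_diff_chain_at) (use f in \<open>auto simp: integrable_C1_def intro!: derivative_eq_intros\<close>)
  then show "((\<lambda>x. f (x + a)) has_vector_derivative f' (x + a)) (at x)" by (simp add: comp_def)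
next
  show "continuous_on UNIV (\<lambda>x. f' (x + a))"
    by (rule continuous_on_compose2[of UNIV f']) (use f in \<open>auto simp: integrable_C1_def intro!: continuous_intros\<close>)
  have "integrable lborel (\<lambda>x. f (a + 1 * x))" "integrable lborel (\<lambda>x. f' (a + 1 * x))"
    by (rule lborel_integrable_real_affine; use f in \<open>simp add: integrable_C1_def\<close>)+
  then show "integrable lborel (\<lambda>x. f (x + a))" "integrable lborel (\<lambda>x. f' (x + a))" by (simp_all add: add.commute)
qed

text \<open>Integration by parts, in the form that the derivative of \<open>f(x) exp(-2\<pi>\<i>\<xi>x)\<close> has integral
  zero.\<close>

lemma fourier_deriv:
  assumes f: "integrable_C1 f f'"
  shows "fourier f' \<xi> = 2 * pi * \<i> * \<xi> * fourier f \<xi>"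
proof -
  define c where "c = - 2 * pi * \<xi>"
  have i: "integrable lborel (\<lambda>x. f x * cis (c * x))" "integrable lborel (\<lambda>x. f' x * cis (c * x))"
    using f by (auto simp: integrable_C1_def intro: integrable_mult_cis)
  have "0 = (\<integral>x. f' x * cis (c * x) + \<i> * of_real c * (f x * cis (c * x)) \<partial>lborel)"
    by (rule integral_derivative_eq_0[OF integrable_C1_modulate[OF f], symmetric])
  also have "\<dots> = fourier f' \<xi> + \<i> * of_real c * fourier f \<xi>"
    using i by (simp add: fourier_def c_def)
  finally show ?thesis by (simp add: c_def algebra_simps eq_neg_iff_add_eq_0)
qed

lemma integrable_C1_higher_deriv:
  assumes F: "entire_of_exp_type \<tau> F" and \<tau>: "\<tau> \<ge> 0" and int: "integrable lborel (\<lambda>x. F (of_real x))"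
  shows "integrable_C1 (\<lambda>x. (deriv ^^ n) F (of_real x)) (\<lambda>x. (deriv ^^ Suc n) F (of_real x))"
  unfolding integrable_C1_def
proof (intro conjI allI)
  have holn: "(deriv ^^ n) F holomorphic_on UNIV" for n
    by (rule holomorphic_higher_deriv[OF entire_of_exp_type_holo[OF F]]) auto
  show "continuous_on UNIV (\<lambda>x::real. (deriv ^^ Suc n) F (of_real x))"
    using entire_continuous_of_real[OF holn[of "Suc n"], of 0] by simp
  show "integrable lborel (\<lambda>x. (deriv ^^ n) F (of_real x))" "integrable lborel (\<lambda>x. (deriv ^^ Suc n) F (of_real x))"
    by (rule integrable_higher_deriv(1)[OF F \<tau> int zero_less_one])+
  fix x
  have "((deriv ^^ n) F has_field_derivative deriv ((deriv ^^ n) F) (of_real x)) (at (of_real x))"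
    by (rule holomorphic_derivI[OF holn]) auto
  then show "((\<lambda>x. (deriv ^^ n) F (of_real x)) has_vector_derivative (deriv ^^ Suc n) F (of_real x)) (at x)"
    using has_vector_derivative_real_field by force
qed

text \<open>Let \<open>a = 2\<pi>\<bar>\<xi>\<bar>\<close> and \<open>A\<close> the modulus of the transform at \<open>\<xi>\<close>. Transforming the \<open>n\<close>-th
  derivative gives \<open>a\<^sup>n A \<le> n! R\<^sup>-\<^sup>n exp(\<tau>R) \<parallel>F\<parallel>\<^sub>1\<close> for every \<open>R > 0\<close> and \<open>n\<close>. Summing over
  \<open>n\<close> yields roughly \<open>A exp(aR) \<le> const * exp(\<tau>R)\<close>, which forces \<open>A = 0\<close> as \<open>R\<close> grows if
  \<open>a > \<tau>\<close>. No contour has to be shifted.\<close>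

theorem paley_wiener:
  assumes F: "entire_of_exp_type \<tau> F" and \<tau>: "\<tau> \<ge> 0" and int: "integrable lborel (\<lambda>x. F (of_real x))"
    and \<xi>: "2 * pi * \<bar>\<xi>\<bar> > \<tau>"
  shows "fourier (\<lambda>x. F (of_real x)) \<xi> = 0"
proof -
  define f where "f = (\<lambda>n (x::real). (deriv ^^ n) F (of_real x))"
  define I where "I = (\<integral>x. cmod (F (of_real x)) \<partial>lborel)"
  define a where "a = 2 * pi * \<bar>\<xi>\<bar>"
  have C1: "integrable_C1 (f n) (f (Suc n))" for n
    unfolding f_def by (rule integrable_C1_higher_deriv[OF F \<tau> int])
  have fn: "fourier (f n) \<xi> = (2 * pi * \<i> * \<xi>) ^ n * fourier (f 0) \<xi>" for n
    by (induction n) (simp_all add: fourier_deriv[OF C1])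
  define A where "A = cmod (fourier (f 0) \<xi>)"
  have b: "(a * R) ^ n / fact n * A \<le> exp (\<tau> * R) * I" if R: "R > 0" for R n
  proof -
    have "a ^ n * A = cmod (fourier (f n) \<xi>)"
      by (simp add: fn[of n] norm_mult norm_power A_def a_def)
    also have "\<dots> \<le> (\<integral>x. cmod (f n x) \<partial>lborel)" by (rule norm_fourier_le)
    also have "\<dots> \<le> fact n / R ^ n * exp (\<tau> * R) * I"
      unfolding f_def I_def by (rule integrable_higher_deriv(2)[OF F \<tau> int R])
    finally have "a ^ n * A * R ^ n \<le> (fact n / R ^ n * exp (\<tau> * R) * I) * R ^ n"
      by (rule mult_right_mono) (use R in simp)
    also have "\<dots> = fact n * (exp (\<tau> * R) * I)" using R by simp
    finally have "a ^ n * A * R ^ n / fact n \<le> exp (\<tau> * R) * I" by (simp add: divide_le_eq mult.commute)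
    then show ?thesis by (simp add: power_mult_distrib mult_ac)
  qed
  have a: "a > \<tau>" "a > 0" using \<xi> \<tau> by (auto simp: a_def)
  (* The factor \<open>q < 1\<close> makes the sum over \<open>n\<close> converge, and \<open>q a > \<tau>\<close> keeps the exponential
    gain. *)
  define q where "q = (1 + \<tau> / a) / 2"
  have q: "0 \<le> q" "q < 1" "q * a > \<tau>" using a \<tau> by (auto simp: q_def field_simps)
  have c: "A * exp (q * a * R) \<le> exp (\<tau> * R) * I / (1 - q)" if R: "R > 0" for R
  proof -
    have "(\<lambda>n. (q * a * R) ^ n /\<^sub>R fact n) sums exp (q * a * R)" by (rule exp_converges)
    then have s1: "(\<lambda>n. A * ((q * a * R) ^ n /\<^sub>R fact n)) sums (A * exp (q * a * R))" by (rule sums_mult)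
    have "(\<lambda>n. q ^ n) sums (1 / (1 - q))" using q by (intro geometric_sums) simp
    then have s2: "(\<lambda>n. (exp (\<tau> * R) * I) * q ^ n) sums ((exp (\<tau> * R) * I) * (1 / (1 - q)))" by (rule sums_mult)
    have "A * exp (q * a * R) \<le> (exp (\<tau> * R) * I) * (1 / (1 - q))"
    proof (rule sums_le[OF _ s1 s2])
      fix n
      have "q ^ n * ((a * R) ^ n / fact n * A) \<le> q ^ n * (exp (\<tau> * R) * I)"
        by (intro mult_left_mono b R) (use q in simp)
      then show "A * ((q * a * R) ^ n /\<^sub>R fact n) \<le> (exp (\<tau> * R) * I) * q ^ n"
        by (simp add: power_mult_distrib field_simps)
    qed
    then show ?thesis by simp
  qed
  have "A \<le> I / (1 - q) * exp (- (q * a - \<tau>) * R)" if R: "R > 0" for R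
  proof -
    have "A = A * exp (q * a * R) * exp (- (q * a * R))" by (simp add: mult.assoc exp_minus)
    also have "\<dots> \<le> exp (\<tau> * R) * I / (1 - q) * exp (- (q * a * R))"
      by (intro mult_right_mono c R) simp
    also have "\<dots> = I / (1 - q) * (exp (\<tau> * R) * exp (- (q * a * R)))" by simp
    also have "exp (\<tau> * R) * exp (- (q * a * R)) = exp (- (q * a - \<tau>) * R)"
      unfolding exp_add[symmetric] by (simp add: algebra_simps)
    finally show ?thesis .
  qed
  then have ev: "eventually (\<lambda>R. A \<le> I / (1 - q) * exp (- (q * a - \<tau>) * R)) at_top"
    by (intro eventually_mono[OF eventually_gt_at_top[of 0]]) blast
  have "filterlim (\<lambda>R::real. - (q * a - \<tau>) * R) at_bot at_top"
    by (rule filterlim_tendsto_neg_mult_at_bot[OF tendsto_const _ filterlim_ident]) (use q in simp)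
  then have "((\<lambda>R. exp (- (q * a - \<tau>) * R)) \<longlongrightarrow> 0) at_top"
    by (rule filterlim_compose[OF exp_at_bot])
  then have "((\<lambda>R. I / (1 - q) * exp (- (q * a - \<tau>) * R)) \<longlongrightarrow> 0) at_top"
    by (rule tendsto_mult_right_zero)
  then have "A \<le> 0" by (rule tendsto_lowerbound[OF _ ev]) simp
  then show ?thesis by (simp add: A_def f_def)
qed

section \<open>Poisson summation and the square wave\<close>

lemma abs_frac_minus_half: "\<bar>frac x - 1/2 :: real\<bar> \<le> 1"
  using frac_lt_1[of x] frac_ge_0[of x] by linarith

text \<open>The first-order Euler-Maclaurin formula over all of \<open>\<int>\<close>; the remainder integral against
  the sawtooth is what Poisson summation expands into a Fourier series.\<close>

lemma euler_maclaurin: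
  assumes f: "integrable_C1 f f'"
  shows "((\<lambda>n::int. f (of_int n)) has_sum (\<integral>x. f x + (frac x - 1/2) *\<^sub>R f' x \<partial>lborel)) UNIV"
proof -
  have fi: "integrable lborel f" "integrable lborel f'" using f by (auto simp: integrable_C1_def)
  have [measurable]: "f \<in> borel_measurable borel" "f' \<in> borel_measurable borel" using fi by auto
  define h where "h = (\<lambda>x. f x + (frac x - 1/2) *\<^sub>R f' x)"
  have [measurable]: "(frac :: real \<Rightarrow> real) \<in> borel_measurable borel" unfolding frac_def by measurable
  have hb: "norm (h x) \<le> cmod (f x) + cmod (f' x)" for x
  proof -
    have "norm (h x) \<le> cmod (f x) + \<bar>frac x - 1/2\<bar> * cmod (f' x)"
      unfolding h_def by (rule order_trans[OF norm_triangle_ineq]) simp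
    also have "\<bar>frac x - 1/2\<bar> * cmod (f' x) \<le> 1 * cmod (f' x)"
      by (intro mult_right_mono abs_frac_minus_half) simp
    finally show ?thesis by simp
  qed
  have hm: "h \<in> borel_measurable lborel" unfolding h_def by measurable
  have wi: "integrable lborel (\<lambda>x. cmod (f x) + cmod (f' x))" using fi by auto
  have hi: "integrable lborel h"
    by (rule Bochner_Integration.integrable_bound[OF wi hm]) (use hb in \<open>auto intro!: AE_I2 order_trans[OF hb]\<close>)
  (* On each cell, integration by parts yields the trapezoidal value. *)
  have cell: "(1/2) *\<^sub>R (f (of_int n) + f (of_int n + 1)) = (\<integral>x. indicator {real_of_int n..<real_of_int n + 1} x *\<^sub>R h x \<partial>lborel)" for n
  proof -
    have "(1/2) *\<^sub>R (f (of_int n) + f (of_int n + 1)) = (\<integral>x. indicator {of_int n..of_int n + 1} x *\<^sub>R (f x + (x - (of_int n + 1/2)) *\<^sub>R f' x) \<partial>lborel)"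
      using has_bochner_integral_integral_eq[OF integrable_C1_cell[OF f, of "of_int n" "of_int n + 1/2"]]
      by (simp add: scaleR_add_right)
    also have "\<dots> = (\<integral>x. indicator {real_of_int n..<real_of_int n + 1} x *\<^sub>R h x \<partial>lborel)"
    proof (rule integral_cong_AE)
      show "(\<lambda>x. indicator {of_int n..of_int n + 1} x *\<^sub>R (f x + (x - (of_int n + 1/2)) *\<^sub>R f' x)) \<in> borel_measurable lborel" by measurable
      show "(\<lambda>x. indicator {real_of_int n..<real_of_int n + 1} x *\<^sub>R h x) \<in> borel_measurable lborel" using hm by measurable
      show "AE x in lborel. indicator {of_int n..of_int n + 1} x *\<^sub>R (f x + (x - (of_int n + 1/2)) *\<^sub>R f' x) = indicator {real_of_int n..<real_of_int n + 1} x *\<^sub>R h x"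
        using AE_lborel_singleton[of "of_int n + 1"]
      proof eventually_elim
        case (elim x)
        show ?case
        proof (cases "x \<in> {real_of_int n..<real_of_int n + 1}")
          case True
          then have "\<lfloor>x\<rfloor> = n" by (simp add: floor_eq_iff)
          then show ?thesis using True by (simp add: h_def frac_def diff_diff_eq)
        qed (use elim in \<open>auto simp: indicator_def\<close>)
      qed
    qed
    finally show ?thesis .
  qed
  define S where "S = (\<Sum>\<^sub>\<infinity>n::int. f (of_int n))"
  have s: "((\<lambda>n::int. f (of_int n)) has_sum S) UNIV"
    unfolding S_def by (rule has_sum_infsum) (rule abs_summable_summable[OF integrable_C1_summable[OF f]])
  have "bij_betw (\<lambda>n::int. n + 1) UNIV UNIV" by (rule bij_betw_byWitness[where f' = "\<lambda>n. n - 1"]) auto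
  from has_sum_reindex_bij_betw[OF this, of "\<lambda>n. f (of_int n)" S] s
  have s1: "((\<lambda>n::int. f (of_int n + 1)) has_sum S) UNIV" by simp
  have "(\<lambda>N. (1/2) *\<^sub>R ((\<Sum>n\<in>{- int N..<int N}. f (of_int n)) + (\<Sum>n\<in>{- int N..<int N}. f (of_int n + 1)))) \<longlonglongrightarrow> (1/2) *\<^sub>R (S + S)"
    by (intro tendsto_intros has_sum_int_symmetric_limit s s1)
  moreover have "(1/2) *\<^sub>R ((\<Sum>n\<in>{- int N..<int N}. f (of_int n)) + (\<Sum>n\<in>{- int N..<int N}. f (of_int n + 1)))
     = (\<integral>x. indicator {- int N..<int N} \<lfloor>x\<rfloor> *\<^sub>R h x \<partial>lborel)" for N
    by (simp add: sum_cells[OF hi, symmetric] cell[symmetric] sum.distrib scaleR_sum_right[symmetric])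
  ultimately have l1: "(\<lambda>N. \<integral>x. indicator {- int N..<int N} \<lfloor>x\<rfloor> *\<^sub>R h x \<partial>lborel) \<longlonglongrightarrow> (1/2) *\<^sub>R (S + S)" by simp
  have l2: "(\<lambda>N. \<integral>x. indicator {- int N..<int N} \<lfloor>x\<rfloor> *\<^sub>R h x \<partial>lborel) \<longlonglongrightarrow> (\<integral>x. h x \<partial>lborel)"
  proof (rule integral_dominated_convergence[where w = "\<lambda>x. norm (h x)"])
    show "AE x in lborel. (\<lambda>N. indicator {- int N..<int N} \<lfloor>x\<rfloor> *\<^sub>R h x) \<longlonglongrightarrow> h x"
    proof (intro AE_I2 tendsto_eventually)
      fix x :: real
      have "indicator {- int N..<int N} \<lfloor>x\<rfloor> *\<^sub>R h x = h x" if "N \<ge> nat (\<bar>\<lfloor>x\<rfloor>\<bar> + 1)" for N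
        using that by (auto simp: indicator_def)
      then show "eventually (\<lambda>N. indicator {- int N..<int N} \<lfloor>x\<rfloor> *\<^sub>R h x = h x) sequentially"
        unfolding eventually_sequentially by blast
    qed
    show "(\<lambda>x. indicator {- int N..<int N} \<lfloor>x\<rfloor> *\<^sub>R h x) \<in> borel_measurable lborel" for N
    proof -
      have "(\<lambda>x::real. indicator {- int N..<int N} \<lfloor>x\<rfloor> :: real) = indicator {- real N..<real N}"
        by (auto simp: fun_eq_iff indicator_def le_floor_iff floor_less_iff)
      then have "(\<lambda>x::real. indicator {- int N..<int N} \<lfloor>x\<rfloor> :: real) \<in> borel_measurable borel" by simp
      then show ?thesis using hm by measurable
    qed
  qed (use hm hi in \<open>auto simp: indicator_def\<close>)
  have "(1/2) *\<^sub>R (S + S) = S" by (simp add: scaleR_2[symmetric])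
  then have "S = (\<integral>x. h x \<partial>lborel)" using LIMSEQ_unique[OF l1 l2] by simp
  then show ?thesis using s by (simp add: h_def)
qed

text \<open>Integrating a trigonometric series with bounded coefficients term by term, by Abel
  summation: the Abel means \<open>K r\<close> are bounded uniformly in \<open>r\<close> and converge almost everywhere
  to \<open>k\<close>. It serves both the sawtooth and the square wave, whose series do not converge
  absolutely.\<close>

lemma integral_trigonometric_kernel:
  fixes g :: "real \<Rightarrow> complex" and t :: "nat \<Rightarrow> real \<Rightarrow> real" and a :: "nat \<Rightarrow> real" and K :: "real \<Rightarrow> real \<Rightarrow> real"
  assumes g: "integrable lborel g"
    and t[measurable]: "\<And>n. t n \<in> borel_measurable borel" and t1: "\<And>n x. \<bar>t n x\<bar> \<le> 1"
    and a: "\<And>n. \<bar>a n\<bar> \<le> A" and e: "\<And>n. e n \<ge> n"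
    and K: "\<And>r x. 0 \<le> r \<Longrightarrow> r < 1 \<Longrightarrow> (\<lambda>n. r ^ e n * a n * t n x) sums K r x"
    and KB: "\<And>r x. 0 \<le> r \<Longrightarrow> r < 1 \<Longrightarrow> \<bar>K r x\<bar> \<le> B"
    and lim: "AE x in lborel. ((\<lambda>r. K r x) \<longlongrightarrow> k x) (at_left 1)"
    and k[measurable]: "k \<in> borel_measurable borel"
    and s: "summable (\<lambda>n. norm (a n *\<^sub>R (\<integral>x. t n x *\<^sub>R g x \<partial>lborel)))"
  shows "(\<integral>x. k x *\<^sub>R g x \<partial>lborel) = (\<Sum>n. a n *\<^sub>R (\<integral>x. t n x *\<^sub>R g x \<partial>lborel))"
proof -
  have [measurable]: "g \<in> borel_measurable borel" using g by auto
  define c where "c = (\<lambda>n. \<integral>x. t n x *\<^sub>R g x \<partial>lborel)"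
  define I where "I = (\<integral>x. cmod (g x) \<partial>lborel)"
  have A: "A \<ge> 0" using order_trans[OF abs_ge_zero a] .
  have tgi: "integrable lborel (\<lambda>x. t n x *\<^sub>R g x)" for n
    by (rule Bochner_Integration.integrable_bound[OF g]) (use mult_right_mono[OF t1 norm_ge_zero] in \<open>auto intro!: AE_I2\<close>)
  have r1: "(\<integral>x. K r x *\<^sub>R g x \<partial>lborel) = (\<Sum>n. (r ^ e n) *\<^sub>R (a n *\<^sub>R c n))" if r: "0 \<le> r" "r < 1" for r
  proof -
    define u where "u = (\<lambda>n x. (r ^ e n * a n) *\<^sub>R (t n x *\<^sub>R g x))"
    have ui: "integrable lborel (u n)" for n unfolding u_def by (intro integrable_scaleR_right tgi)
    have ub: "norm (u n x) \<le> (r ^ n * A) * cmod (g x)" for n x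
    proof -
      have "r ^ e n \<le> r ^ n" by (rule power_decreasing[OF e]) (use r in auto)
      then have 1: "r ^ e n * \<bar>a n\<bar> \<le> r ^ n * A"
        by (rule mult_mono[OF _ a]) (use r in auto)
      have 2: "\<bar>t n x\<bar> * cmod (g x) \<le> 1 * cmod (g x)" by (rule mult_right_mono[OF t1]) simp
      have "norm (u n x) = (r ^ e n * \<bar>a n\<bar>) * (\<bar>t n x\<bar> * cmod (g x))"
        by (simp only: u_def norm_scaleR abs_mult power_abs abs_of_nonneg[OF r(1)])
      also have "\<dots> \<le> (r ^ n * A) * (1 * cmod (g x))"
        by (rule mult_mono[OF 1 2]) (use r A in auto)
      finally show ?thesis by simp
    qed
    have geo: "summable (\<lambda>n. r ^ n * A * cmod (g x))" for x
      using r by (intro summable_mult2 summable_geometric) simp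
    have geoI: "summable (\<lambda>n. r ^ n * A * I)"
      using r by (intro summable_mult2 summable_geometric) simp
    have "(\<integral>x. (\<Sum>n. u n x) \<partial>lborel) = (\<Sum>n. integral\<^sup>L lborel (u n))"
    proof (rule integral_suminf[OF ui])
      show "AE x in lborel. summable (\<lambda>n. norm (u n x))"
        by (intro AE_I2 summable_comparison_test'[OF geo]) (use ub in auto)
      show "summable (\<lambda>n. \<integral>x. norm (u n x) \<partial>lborel)"
      proof (rule summable_comparison_test'[OF geoI])
        fix n
        have "(\<integral>x. norm (u n x) \<partial>lborel) \<le> (\<integral>x. (r ^ n * A) * cmod (g x) \<partial>lborel)"
          by (rule integral_mono) (use ui ub g in \<open>auto intro!: integrable_norm\<close>)
        then show "norm (\<integral>x. norm (u n x) \<partial>lborel) \<le> r ^ n * A * I" by (simp add: I_def)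
      qed
    qed
    moreover have "(\<Sum>n. u n x) = K r x *\<^sub>R g x" for x
      using sums_unique[OF sums_scaleR_left[OF K[OF r, of x], of "g x"]] by (simp add: u_def)
    moreover have "integral\<^sup>L lborel (u n) = (r ^ e n) *\<^sub>R (a n *\<^sub>R c n)" for n
      unfolding u_def c_def integral_scaleR_right by simp
    ultimately show ?thesis by simp
  qed
  (* A sequence of radii, for dominated convergence and for the theorem of Tannery. *)
  define \<rho> where "\<rho> = (\<lambda>j::nat. 1 - 1 / (real j + 2))"
  have \<rho>: "0 \<le> \<rho> j" "\<rho> j < 1" for j by (auto simp: \<rho>_def)
  have \<rho>1: "\<rho> \<longlonglongrightarrow> 1" unfolding \<rho>_def by real_asymp
  then have \<rho>l: "filterlim \<rho> (at_left 1) sequentially"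
    unfolding filterlim_at using \<rho> by (auto intro!: always_eventually simp: less_imp_neq)
  have "(\<lambda>j. \<integral>x. K (\<rho> j) x *\<^sub>R g x \<partial>lborel) \<longlonglongrightarrow> (\<integral>x. k x *\<^sub>R g x \<partial>lborel)"
  proof (rule integral_dominated_convergence[where w = "\<lambda>x. B * cmod (g x)"])
    show "AE x in lborel. (\<lambda>j. K (\<rho> j) x *\<^sub>R g x) \<longlonglongrightarrow> k x *\<^sub>R g x"
      using lim by eventually_elim (intro tendsto_intros filterlim_compose[OF _ \<rho>l])
    show "(\<lambda>x. K (\<rho> j) x *\<^sub>R g x) \<in> borel_measurable lborel" for j
    proof -
      have "K (\<rho> j) = (\<lambda>x. \<Sum>n. \<rho> j ^ e n * a n * t n x)"
        using K[OF \<rho>] by (auto simp: sums_iff)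
      then have [measurable]: "K (\<rho> j) \<in> borel_measurable borel" by simp
      show ?thesis by measurable
    qed
    show "AE x in lborel. norm (K (\<rho> j) x *\<^sub>R g x) \<le> B * cmod (g x)" for j
      using KB[OF \<rho>] by (intro AE_I2) (auto intro!: mult_right_mono)
  qed (use g in auto)
  moreover have "(\<lambda>j. \<integral>x. K (\<rho> j) x *\<^sub>R g x \<partial>lborel) \<longlonglongrightarrow> (\<Sum>n. a n *\<^sub>R c n)"
    unfolding r1[OF \<rho>]
  proof (rule tannerys_theorem[THEN conjunct2, THEN conjunct2])
    show "(\<lambda>j. \<rho> j ^ e n *\<^sub>R a n *\<^sub>R c n) \<longlonglongrightarrow> a n *\<^sub>R c n" for n
    proof -
      have "(\<lambda>j. \<rho> j ^ e n *\<^sub>R a n *\<^sub>R c n) \<longlonglongrightarrow> 1 ^ e n *\<^sub>R a n *\<^sub>R c n" by (intro tendsto_intros \<rho>1)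
      then show ?thesis by simp
    qed
    show "eventually (\<lambda>(n, j). norm (\<rho> j ^ e n *\<^sub>R a n *\<^sub>R c n) \<le> norm (a n *\<^sub>R c n)) (at_top \<times>\<^sub>F sequentially)"
    proof (intro always_eventually allI, clarify)
      fix n j
      have "\<bar>\<rho> j\<bar> ^ e n \<le> 1" using \<rho>[of j] by (intro power_le_one) auto
      then have "\<bar>\<rho> j\<bar> ^ e n * norm (a n *\<^sub>R c n) \<le> 1 * norm (a n *\<^sub>R c n)" by (rule mult_right_mono) simp
      then show "norm (\<rho> j ^ e n *\<^sub>R a n *\<^sub>R c n) \<le> norm (a n *\<^sub>R c n)" by (simp only: norm_scaleR power_abs)
    qed
  qed (use s in \<open>auto simp: c_def\<close>)
  ultimately show ?thesis unfolding c_def by (rule LIMSEQ_unique)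
qed

lemma sin_scaleR_cis: "sin y *\<^sub>R z = (z * cis y - z * cis (- y)) / (2 * \<i>)"
proof -
  have "cis y - cis (- y) = 2 * \<i> * of_real (sin y)" by (simp add: complex_eq_iff)
  then have "z * cis y - z * cis (- y) = z * (2 * \<i> * of_real (sin y))" by (simp only: right_diff_distrib[symmetric])
  then show ?thesis by (simp add: scaleR_conv_of_real mult_ac)
qed

lemma cos_scaleR_cis: "cos y *\<^sub>R z = (z * cis y + z * cis (- y)) / 2"
proof -
  have "cis y + cis (- y) = 2 * of_real (cos y)" by (simp add: complex_eq_iff)
  then have "z * cis y + z * cis (- y) = z * (2 * of_real (cos y))" by (simp only: distrib_left[symmetric])
  then show ?thesis by (simp add: scaleR_conv_of_real)
qed

lemma fourier_sin:
  assumes g: "integrable lborel g"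
  shows "(\<integral>x. sin (2 * pi * \<xi> * x) *\<^sub>R g x \<partial>lborel) = (fourier g (- \<xi>) - fourier g \<xi>) / (2 * \<i>)"
proof -
  have "(\<integral>x. sin (2 * pi * \<xi> * x) *\<^sub>R g x \<partial>lborel) = (\<integral>x. (g x * cis (- 2 * pi * (- \<xi>) * x) - g x * cis (- 2 * pi * \<xi> * x)) / (2 * \<i>) \<partial>lborel)"
    by (intro Bochner_Integration.integral_cong refl) (simp add: sin_scaleR_cis)
  also have "\<dots> = (fourier g (- \<xi>) - fourier g \<xi>) / (2 * \<i>)"
    unfolding fourier_def by (subst integral_divide_zero, subst Bochner_Integration.integral_diff) (intro integrable_mult_cis g refl)+
  finally show ?thesis .
qed

lemma fourier_cos:
  assumes g: "integrable lborel g"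
  shows "(\<integral>x. cos (2 * pi * \<xi> * x) *\<^sub>R g x \<partial>lborel) = (fourier g (- \<xi>) + fourier g \<xi>) / 2"
proof -
  have "(\<integral>x. cos (2 * pi * \<xi> * x) *\<^sub>R g x \<partial>lborel) = (\<integral>x. (g x * cis (- 2 * pi * (- \<xi>) * x) + g x * cis (- 2 * pi * \<xi> * x)) / 2 \<partial>lborel)"
    by (intro Bochner_Integration.integral_cong refl) (simp add: cos_scaleR_cis)
  also have "\<dots> = (fourier g (- \<xi>) + fourier g \<xi>) / 2"
    unfolding fourier_def by (subst integral_divide_zero, subst Bochner_Integration.integral_add) (intro integrable_mult_cis g refl)+
  finally show ?thesis .
qed

text \<open>The chord from \<open>exp(2\<pi>\<i>x)\<close> to \<open>1\<close> has direction \<open>\<pi>(x - 1/2)\<close>; this is the boundary value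
  of the Abel means of the sawtooth.\<close>

lemma Im_Ln_one_minus_cis:
  assumes "0 < x" "x < 1"
  shows "Im (Ln (1 - cis (2 * pi * x))) = pi * (x - 1/2)"
proof -
  have s: "sin (pi * x) > 0" using assms by (intro sin_gt_zero) auto
  have "1 - cis (2 * pi * x) = of_real (2 * sin (pi * x)) * cis (pi * (x - 1/2))"
  proof -
    have c: "cos (2 * pi * x) = 1 - 2 * (sin (pi * x))\<^sup>2" "sin (2 * pi * x) = 2 * sin (pi * x) * cos (pi * x)"
      using cos_double_sin[of "pi * x"] sin_double[of "pi * x"] by (simp_all add: mult.assoc)
    have d: "cos (pi * (x - 1/2)) = sin (pi * x)" "sin (pi * (x - 1/2)) = - cos (pi * x)"
      by (simp_all add: right_diff_distrib cos_diff sin_diff)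
    show ?thesis by (simp add: complex_eq_iff c d power2_eq_square)
  qed
  also have "\<dots> = exp (of_real (ln (2 * sin (pi * x))) + \<i> * of_real (pi * (x - 1/2)))"
    using s by (simp only: exp_add exp_of_real cis_conv_exp) simp
  also have "Ln \<dots> = of_real (ln (2 * sin (pi * x))) + \<i> * of_real (pi * (x - 1/2))"
  proof (rule Ln_exp)
    have im: "Im (of_real (ln (2 * sin (pi * x))) + \<i> * of_real (pi * (x - 1/2))) = pi * (x - 1/2)" by simp
    have "pi * (-1/2) < pi * (x - 1/2)" "pi * (x - 1/2) < pi * (1/2)"
      using assms by (intro mult_strict_left_mono; simp)+
    then show "- pi < Im (of_real (ln (2 * sin (pi * x))) + \<i> * of_real (pi * (x - 1/2)))"
      "Im (of_real (ln (2 * sin (pi * x))) + \<i> * of_real (pi * (x - 1/2))) \<le> pi"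
      unfolding im using pi_gt_zero by linarith+
  qed
  finally show ?thesis by simp
qed

text \<open>Abel means of the Fourier series of \<open>frac x - 1/2\<close>, summed by the series of the
  logarithm.\<close>

definition sawtooth_abel :: "real \<Rightarrow> real \<Rightarrow> real" where
  "sawtooth_abel r x = Im (Ln (1 - of_real r * cis (2 * pi * x))) / pi"

lemma sawtooth_abel_sums:
  assumes "0 \<le> r" "r < 1"
  shows "(\<lambda>n. r ^ n * (- 1 / (real n * pi)) * sin (2 * pi * real n * x)) sums sawtooth_abel r x"
proof -
  have "cmod (- (of_real r * cis (2 * pi * x))) < 1" using assms by (simp add: norm_mult)
  from sums_divide[OF sums_Im[OF Ln_series'[OF this]], of pi]
  have "(\<lambda>n. Im (- ((of_real r * cis (2 * pi * x)) ^ n) / of_nat n) / pi) sums sawtooth_abel r x"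
    by (simp add: sawtooth_abel_def)
  moreover have "Im (- ((of_real r * cis (2 * pi * x)) ^ n) / of_nat n) / pi = r ^ n * (- 1 / (real n * pi)) * sin (2 * pi * real n * x)" for n
  proof -
    have "(of_real r * cis (2 * pi * x)) ^ n = of_real (r ^ n) * cis (2 * pi * real n * x)"
      by (simp add: power_mult_distrib Complex.DeMoivre mult_ac)
    then show ?thesis by (simp add: Im_divide_of_nat)
  qed
  ultimately show ?thesis by (simp only:)
qed

lemma sawtooth_abel_bound:
  assumes "0 \<le> r" "r < 1" shows "\<bar>sawtooth_abel r x\<bar> \<le> 1/2"
proof -
  define z where "z = 1 - of_real r * cis (2 * pi * x)"
  have "r * cos (2 * pi * x) \<le> r * 1" using assms by (intro mult_left_mono) auto
  then have re: "Re z > 0" using assms by (simp add: z_def)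
  then have "z \<noteq> 0" by auto
  then have "\<bar>Im (Ln z)\<bar> < pi / 2" using re Re_Ln_pos_lt by blast
  then show ?thesis unfolding sawtooth_abel_def z_def[symmetric] by (simp add: field_simps)
qed

lemma sawtooth_abel_limit:
  assumes "x \<notin> \<int>"
  shows "((\<lambda>r. sawtooth_abel r x) \<longlongrightarrow> frac x - 1/2) (at_left 1)"
proof -
  have f: "0 < frac x" "frac x < 1" using assms frac_gt_0_iff frac_lt_1 by auto
  have "cis (2 * pi * x) = cis (2 * pi * frac x) * cis (2 * pi * of_int \<lfloor>x\<rfloor>)"
    by (simp add: frac_def cis_mult algebra_simps)
  also have "cis (2 * pi * of_int \<lfloor>x\<rfloor>) = 1" by (rule cis_multiple_2pi) simp
  finally have c: "cis (2 * pi * x) = cis (2 * pi * frac x)" by simp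
  define z where "z = 1 - cis (2 * pi * frac x)"
  have "z \<notin> \<real>\<^sub>\<le>\<^sub>0"
  proof
    assume "z \<in> \<real>\<^sub>\<le>\<^sub>0"
    then have im: "Im z = 0" "Re z \<le> 0" by (auto simp: complex_nonpos_Reals_iff)
    have "Re z \<ge> 0" by (simp add: z_def)
    then have "z = 0" using im by (simp add: complex_eq_iff)
    then have "cos (2 * pi * frac x) = 1" by (simp add: z_def complex_eq_iff)
    then obtain m :: int where "2 * pi * frac x = of_int m * 2 * pi" using cos_one_2pi_int by auto
    then have "frac x = of_int m" by simp
    then show False using f by simp
  qed
  then have "((\<lambda>r. Im (Ln (1 - of_real r * cis (2 * pi * frac x))) / pi) \<longlongrightarrow> Im (Ln (1 - of_real 1 * cis (2 * pi * frac x))) / pi) (at_left 1)"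
    by (intro tendsto_intros) (auto simp: z_def)
  then show ?thesis using Im_Ln_one_minus_cis[OF f] unfolding sawtooth_abel_def c by simp
qed

lemma AE_not_Ints: "AE x in lborel. (x::real) \<notin> \<int>"
proof -
  have "countable (\<int> :: real set)" unfolding Ints_def by simp
  then have "(\<int> :: real set) \<in> null_sets lborel" by (rule countable_imp_null_set_lborel)
  then show ?thesis by (rule AE_not_in)
qed

text \<open>Expand the sawtooth in the Euler-Maclaurin remainder and recognise the sine integrals of
  \<open>f'\<close> as transforms of \<open>f\<close>. Pairing the frequencies \<open>n\<close> and \<open>-n\<close> leaves only the summability
  of the paired terms to be checked.\<close>

theorem poisson_summation:
  assumes f: "integrable_C1 f f'"
    and s: "summable (\<lambda>n. cmod (fourier f (real (Suc n)) + fourier f (- real (Suc n))))"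
  shows "((\<lambda>n::int. f (of_int n)) has_sum
     (fourier f 0 + (\<Sum>n. fourier f (real (Suc n)) + fourier f (- real (Suc n))))) UNIV"
proof -
  have fi: "integrable lborel f" "integrable lborel f'" using f by (auto simp: integrable_C1_def)
  have [measurable]: "(frac :: real \<Rightarrow> real) \<in> borel_measurable borel" unfolding frac_def by measurable
  (* The sawtooth coefficient \<open>-1/(n\<pi>)\<close> cancels the factor \<open>2\<pi>\<i>n\<close> from the derivative; for
    \<open>n = 0\<close> it is \<open>0\<close> as a division by zero. *)
  define b where "b = (\<lambda>n::nat. (- 1 / (real n * pi)) *\<^sub>R (\<integral>x. sin (2 * pi * real n * x) *\<^sub>R f' x \<partial>lborel))"
  have b0: "b 0 = 0" by (simp add: b_def)
  have bS: "b (Suc n) = fourier f (real (Suc n)) + fourier f (- real (Suc n))" for n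
  proof -
    have "(- 1 / (m * pi)) *\<^sub>R ((2 * pi * \<i> * of_real (- m) * A - 2 * pi * \<i> * of_real m * B) / (2 * \<i>)) = B + A"
      if "m > 0" for m :: real and A B :: complex
    proof -
      have "(2 * pi * \<i> * of_real (- m) * A - 2 * pi * \<i> * of_real m * B) / (2 * \<i>) = of_real (- (m * pi)) * (B + A)"
        by (simp add: field_simps)
      then show ?thesis using that by (simp add: scaleR_conv_of_real)
    qed
    from this[of "real (Suc n)" "fourier f (- real (Suc n))" "fourier f (real (Suc n))"]
    show ?thesis unfolding b_def fourier_sin[OF fi(2)] fourier_deriv[OF f] by simp
  qed
  have bs: "summable (\<lambda>n. norm (b n))"
    using s unfolding bS[symmetric] by (subst (asm) summable_Suc_iff)
  have "(\<integral>x. (frac x - 1/2) *\<^sub>R f' x \<partial>lborel) = (\<Sum>n. b n)"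
    unfolding b_def
  proof (rule integral_trigonometric_kernel[where e = "\<lambda>n. n" and A = 1 and B = "1/2" and K = sawtooth_abel])
    show "\<bar>- 1 / (real n * pi)\<bar> \<le> 1" for n
    proof (cases "n = 0")
      case False
      have "1 * 1 \<le> real n * pi" by (rule mult_mono) (use False pi_gt3 in auto)
      then show ?thesis by (simp add: field_simps)
    qed simp
    show "AE x in lborel. ((\<lambda>r. sawtooth_abel r x) \<longlongrightarrow> frac x - 1/2) (at_left 1)"
      using AE_not_Ints by eventually_elim (rule sawtooth_abel_limit)
  qed (use fi bs sawtooth_abel_sums sawtooth_abel_bound in \<open>auto simp: b_def\<close>)
  also have "\<dots> = (\<Sum>n. fourier f (real (Suc n)) + fourier f (- real (Suc n)))"
    using suminf_split_head[OF summable_norm_cancel[OF bs]] by (simp add: b0 bS)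
  finally have e: "(\<integral>x. (frac x - 1/2) *\<^sub>R f' x \<partial>lborel) = (\<Sum>n. fourier f (real (Suc n)) + fourier f (- real (Suc n)))" .
  have "integrable lborel (\<lambda>x. (frac x - 1/2) *\<^sub>R f' x)"
  proof (rule Bochner_Integration.integrable_bound[OF fi(2)])
    show "(\<lambda>x. (frac x - 1/2) *\<^sub>R f' x) \<in> borel_measurable lborel" using fi by measurable
    show "AE x in lborel. norm ((frac x - 1/2) *\<^sub>R f' x) \<le> norm (f' x)"
    proof (intro AE_I2)
      fix x :: real
      have "\<bar>frac x - 1/2\<bar> * cmod (f' x) \<le> 1 * cmod (f' x)"
        by (intro mult_right_mono abs_frac_minus_half) simp
      then show "norm ((frac x - 1/2) *\<^sub>R f' x) \<le> norm (f' x)" by simp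
    qed
  qed
  then have "(\<integral>x. f x + (frac x - 1/2) *\<^sub>R f' x \<partial>lborel) = fourier f 0 + (\<Sum>n. fourier f (real (Suc n)) + fourier f (- real (Suc n)))"
    using fi e by (simp add: fourier_def)
  then show ?thesis using euler_maclaurin[OF f] by simp
qed

text \<open>Abel means of the Fourier series of \<open>sgn(cos(\<pi>x))\<close>, summed by the arctangent series.\<close>

definition square_abel :: "real \<Rightarrow> real \<Rightarrow> real" where
  "square_abel r x = 4 / pi * Re (Arctan (of_real r * cis (pi * x)))"

lemma square_abel_sums:
  assumes "0 \<le> r" "r < 1"
  shows "(\<lambda>n. r ^ (2*n+1) * (4 / pi * (-1) ^ n / real (2*n+1)) * cos (2 * pi * (real n + 1/2) * x)) sums square_abel r x"
proof -
  have "cmod (of_real r * cis (pi * x)) < 1" using assms by (simp add: norm_mult)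
  from sums_mult[OF sums_Re[OF Arctan_series(2)[OF this]], of "4 / pi"]
  have "(\<lambda>n. 4 / pi * Re ((-1) ^ n / of_nat (2*n+1) * (of_real r * cis (pi * x)) ^ (2*n+1))) sums square_abel r x"
    by (simp add: square_abel_def)
  moreover have "4 / pi * Re ((-1) ^ n / of_nat (2*n+1) * (of_real r * cis (pi * x)) ^ (2*n+1))
     = r ^ (2*n+1) * (4 / pi * (-1) ^ n / real (2*n+1)) * cos (2 * pi * (real n + 1/2) * x)" for n
  proof -
    have p: "(of_real r * cis (pi * x)) ^ (2*n+1) = of_real (r ^ (2*n+1)) * cis (2 * pi * (real n + 1/2) * x)"
      unfolding power_mult_distrib Complex.DeMoivre by (simp add: algebra_simps)
    have q: "(-1) ^ n / of_nat (2*n+1) = complex_of_real ((-1) ^ n / real (2*n+1))" by simp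
    show ?thesis unfolding p q by (simp only: mult.assoc[symmetric] of_real_mult[symmetric]) simp
  qed
  ultimately show ?thesis by (simp only:)
qed

lemma abs_Im_less_1_of_norm_less_1: "cmod z < 1 \<Longrightarrow> Re z = 0 \<Longrightarrow> \<bar>Im z\<bar> < 1"
  using abs_Im_le_cmod[of z] by linarith

lemma square_abel_bound:
  assumes "0 \<le> r" "r < 1" shows "\<bar>square_abel r x\<bar> \<le> 2"
proof -
  have "cmod (of_real r * cis (pi * x)) < 1" using assms by (simp add: norm_mult)
  then have "\<bar>Re (Arctan (of_real r * cis (pi * x)))\<bar> < pi / 2"
    using Re_Arctan_bounds abs_Im_less_1_of_norm_less_1 by blast
  then have "\<bar>4 / pi * Re (Arctan (of_real r * cis (pi * x)))\<bar> \<le> 4 / pi * (pi / 2)"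
    unfolding abs_mult by (intro mult_mono) auto
  then show ?thesis by (simp add: square_abel_def)
qed

text \<open>On the unit circle the Moebius transform in the definition of the complex arctangent is
  purely imaginary, and the side of \<open>0\<close> on which it lies is decided by the sign of the
  cosine.\<close>

lemma Re_Arctan_cis:
  assumes "cos \<theta> \<noteq> 0"
  shows "Re (Arctan (cis \<theta>)) = pi / 4 * sgn (cos \<theta>)"
proof -
  define c where "c = cos \<theta>"
  define s where "s = sin \<theta>"
  have cs: "c\<^sup>2 + s\<^sup>2 = 1" by (simp add: c_def s_def)
  have s1: "s < 1"
  proof (rule ccontr)
    assume "\<not> s < 1"
    then have "s = 1" using sin_le_one[of \<theta>] by (simp add: s_def)
    then show False using cs assms by (simp add: c_def)
  qed
  define u where "u = (1 - \<i> * cis \<theta>) / (1 + \<i> * cis \<theta>)"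
  have den: "1 + \<i> * cis \<theta> \<noteq> 0" using assms by (auto simp: complex_eq_iff)
  have "u = - \<i> * of_real (c / (1 - s))"
  proof -
    have "(1 - \<i> * cis \<theta>) = - \<i> * of_real (c / (1 - s)) * (1 + \<i> * cis \<theta>)"
    proof -
      have "c * c = (1 - s) * (1 + s)" using cs by (simp add: power2_eq_square algebra_simps)
      then have e: "c * c / (1 - s) = 1 + s" using s1 by (simp add: field_simps)
      then show ?thesis using s1 by (simp add: complex_eq_iff c_def[symmetric] s_def[symmetric] diff_divide_distrib)
    qed
    then show ?thesis using den by (simp add: u_def field_simps)
  qed
  then have u: "Re u = 0" "Im u = - c / (1 - s)" by auto
  have A: "Re (Arctan (cis \<theta>)) = - Im (Ln u) / 2"
    by (simp add: Arctan_def u_def)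
  have u0: "u \<noteq> 0" using u s1 assms by (auto simp: c_def complex_eq_iff)
  show ?thesis
  proof (cases "c > 0")
    case True
    then have "Im u < 0" unfolding u(2) using s1 by (intro divide_neg_pos) auto
    then have "Im (Ln u) = - pi / 2" using Im_Ln_eq_pi_half(2)[OF u0] u by simp
    then show ?thesis using A True by (simp add: c_def[symmetric])
  next
    case False
    then have c: "c < 0" using assms by (simp add: c_def)
    then have "Im u > 0" unfolding u(2) using c s1 by (intro divide_pos_pos) auto
    then have "Im (Ln u) = pi / 2" using Im_Ln_eq_pi_half(1)[OF u0] u by simp
    then show ?thesis using A c by (simp add: c_def[symmetric])
  qed
qed

lemma square_abel_limit:
  assumes "cos (pi * x) \<noteq> 0"
  shows "((\<lambda>r. square_abel r x) \<longlongrightarrow> sgn (cos (pi * x))) (at_left 1)"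
proof -
  have "isCont Arctan (of_real 1 * cis (pi * x))"
    by (rule continuous_at_Arctan) (use assms in simp)
  then have "((\<lambda>r. Arctan (of_real r * cis (pi * x))) \<longlongrightarrow> Arctan (of_real 1 * cis (pi * x))) (at_left 1)"
    by (rule isCont_tendsto_compose) (intro tendsto_intros)
  then have "((\<lambda>r. 4 / pi * Re (Arctan (of_real r * cis (pi * x)))) \<longlongrightarrow> 4 / pi * Re (Arctan (of_real 1 * cis (pi * x)))) (at_left 1)"
    by (intro tendsto_mult tendsto_const tendsto_Re)
  then show ?thesis using Re_Arctan_cis[OF assms] by (simp add: square_abel_def)
qed

lemma AE_cos_neq_0: "AE x in lborel. cos (pi * x) \<noteq> 0"
proof -
  have "countable ((\<lambda>n::int. of_int n + 1/2 :: real) ` UNIV)" by simp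
  moreover have "{x. cos (pi * x) = 0} \<subseteq> (\<lambda>n::int. of_int n + 1/2 :: real) ` UNIV"
  proof
    fix x assume "x \<in> {x. cos (pi * x) = 0}"
    then obtain n :: int where "pi * x = of_int n * pi + pi / 2" using cos_zero_iff_int2 by auto
    then have "pi * x = pi * (of_int n + 1/2)" by (simp add: algebra_simps)
    then have "x = of_int n + 1/2" by simp
    then show "x \<in> (\<lambda>n::int. of_int n + 1/2 :: real) ` UNIV" by blast
  qed
  ultimately have "countable {x. cos (pi * x) = 0}" using countable_subset by blast
  then have "{x. cos (pi * x) = 0} \<in> null_sets lborel" by (rule countable_imp_null_set_lborel)
  from AE_not_in[OF this] show ?thesis by simp
qed

theorem integral_square_wave:
  assumes g: "integrable lborel g"
    and s: "summable (\<lambda>n. cmod (fourier g (- (real n + 1/2)) + fourier g (real n + 1/2)))"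
  shows "(\<integral>x. sgn (cos (pi * x)) *\<^sub>R g x \<partial>lborel)
    = (\<Sum>n. (2 / pi * (-1) ^ n / real (2*n+1)) *\<^sub>R (fourier g (- (real n + 1/2)) + fourier g (real n + 1/2)))"
proof -
  define a where "a = (\<lambda>n::nat. 4 / pi * (-1) ^ n / real (2*n+1))"
  have a: "\<bar>a n\<bar> \<le> 2" for n
  proof -
    have "\<bar>a n\<bar> = 4 / (pi * real (2*n+1))" by (simp add: a_def abs_mult)
    also have "\<dots> \<le> 4 / (2 * 1)"
    proof (rule divide_left_mono)
      show "2 * 1 \<le> pi * real (2*n+1)" by (rule mult_mono) (use pi_gt3 in auto)
    qed (use pi_gt3 in auto)
    finally show ?thesis by simp
  qed
  have i: "(\<integral>x. cos (2 * pi * (real n + 1/2) * x) *\<^sub>R g x \<partial>lborel) = (fourier g (- (real n + 1/2)) + fourier g (real n + 1/2)) / 2" for n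
    by (rule fourier_cos[OF g])
  have "(\<integral>x. sgn (cos (pi * x)) *\<^sub>R g x \<partial>lborel) = (\<Sum>n. a n *\<^sub>R (\<integral>x. cos (2 * pi * (real n + 1/2) * x) *\<^sub>R g x \<partial>lborel))"
  proof (rule integral_trigonometric_kernel[where e = "\<lambda>n. 2*n+1" and A = 2 and B = 2 and K = square_abel])
    show "AE x in lborel. ((\<lambda>r. square_abel r x) \<longlongrightarrow> sgn (cos (pi * x))) (at_left 1)"
      using AE_cos_neq_0 by eventually_elim (rule square_abel_limit)
    show "(\<lambda>n. r ^ (2*n+1) * a n * cos (2 * pi * (real n + 1/2) * x)) sums square_abel r x" if "0 \<le> r" "r < 1" for r x
      using square_abel_sums[OF that] by (simp only: a_def)
    show "summable (\<lambda>n. norm (a n *\<^sub>R (\<integral>x. cos (2 * pi * (real n + 1/2) * x) *\<^sub>R g x \<partial>lborel)))"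
    proof (rule summable_comparison_test'[OF s])
      fix n
      have "\<bar>a n\<bar> * cmod (fourier g (- (real n + 1/2)) + fourier g (real n + 1/2)) \<le> 2 * cmod (fourier g (- (real n + 1/2)) + fourier g (real n + 1/2))"
        by (rule mult_right_mono[OF a]) simp
      then show "norm (norm (a n *\<^sub>R (\<integral>x. cos (2 * pi * (real n + 1/2) * x) *\<^sub>R g x \<partial>lborel))) \<le> cmod (fourier g (- (real n + 1/2)) + fourier g (real n + 1/2))"
        unfolding i by (simp add: norm_divide)
    qed
  qed (use g a square_abel_bound in auto)
  also have "\<dots> = (\<Sum>n. (2 / pi * (-1) ^ n / real (2*n+1)) *\<^sub>R (fourier g (- (real n + 1/2)) + fourier g (real n + 1/2)))"
  proof (rule suminf_cong)
    fix n
    have h: "(4 / pi * s / d) *\<^sub>R (Z / 2) = (2 / pi * s / d) *\<^sub>R Z" for s d :: real and Z :: complex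
    proof -
      have "Z / 2 = (1/2) *\<^sub>R Z" by (simp add: scaleR_conv_of_real)
      moreover have "4 / pi * s / d * (1/2) = 2 / pi * s / d" by simp
      ultimately show ?thesis by (simp only: scaleR_scaleR)
    qed
    show "a n *\<^sub>R (\<integral>x. cos (2 * pi * (real n + 1/2) * x) *\<^sub>R g x \<partial>lborel) = (2 / pi * (-1) ^ n / real (2*n+1)) *\<^sub>R (fourier g (- (real n + 1/2)) + fourier g (real n + 1/2))"
      unfolding i a_def by (rule h)
  qed
  finally show ?thesis .
qed

section \<open>Quadrature and double zeros for type \<open>2\<pi>\<close>\<close>

text \<open>By continuity of the transform, the vanishing extends to the boundary frequencies, which
  are exactly the ones that occur for integer nodes and for the square wave.\<close>

theorem paley_wiener_closed:
  assumes F: "entire_of_exp_type \<tau> F" and \<tau>: "\<tau> \<ge> 0" and int: "integrable lborel (\<lambda>x. F (of_real x))"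
    and \<xi>: "2 * pi * \<bar>\<xi>\<bar> \<ge> \<tau>" "\<xi> \<noteq> 0"
  shows "fourier (\<lambda>x. F (of_real x)) \<xi> = 0"
proof -
  define X where "X = (\<lambda>n::nat. \<xi> * (1 + 1 / real (Suc n)))"
  have "X \<longlonglongrightarrow> \<xi> * (1 + 0)" unfolding X_def by (intro tendsto_intros LIMSEQ_Suc[OF lim_1_over_n])
  then have "(\<lambda>n. fourier (\<lambda>x. F (of_real x)) (X n)) \<longlonglongrightarrow> fourier (\<lambda>x. F (of_real x)) (\<xi> * (1 + 0))"
    by (rule isCont_tendsto_compose[rotated]) (rule isCont_fourier[OF int])
  moreover have "fourier (\<lambda>x. F (of_real x)) (X n) = 0" for n
  proof (rule paley_wiener[OF F \<tau> int])
    have "\<bar>\<xi>\<bar> * 1 < \<bar>\<xi>\<bar> * (1 + 1 / real (Suc n))" using \<xi> by (intro mult_strict_left_mono) auto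
    also have "\<dots> = \<bar>X n\<bar>" by (simp add: X_def abs_mult)
    finally have "2 * pi * \<bar>\<xi>\<bar> < 2 * pi * \<bar>X n\<bar>" by simp
    then show "\<tau> < 2 * pi * \<bar>X n\<bar>" using \<xi> by linarith
  qed
  ultimately show ?thesis by (simp add: LIMSEQ_const_iff)
qed

lemma entire_of_exp_type_integrable_C1:
  assumes F: "entire_of_exp_type \<tau> F" and \<tau>: "\<tau> \<ge> 0" and int: "integrable lborel (\<lambda>x. F (of_real x))"
  shows "integrable_C1 (\<lambda>x. F (of_real x)) (\<lambda>x. deriv F (of_real x))"
    "integrable_C1 (\<lambda>x. deriv F (of_real x)) (\<lambda>x. deriv (deriv F) (of_real x))"
  using integrable_C1_higher_deriv[OF F \<tau> int, of 0] integrable_C1_higher_deriv[OF F \<tau> int, of 1] by simp_all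

text \<open>A function of type \<open>2\<pi>\<close> has its spectrum in \<open>[-1,1]\<close>, with value \<open>0\<close> at \<open>1\<close> and \<open>-1\<close>, so
  the zero frequency is the only one that survives in Poisson summation.\<close>

theorem quadrature:
  assumes F: "entire_of_exp_type (2 * pi) F" and int: "integrable lborel (\<lambda>x. F (of_real x))"
  shows "((\<lambda>n::int. F (of_real (of_int n + a))) has_sum (\<integral>x. F (of_real x) \<partial>lborel)) UNIV"
proof -
  define f where "f = (\<lambda>x. F (of_real x))"
  have C1: "integrable_C1 (\<lambda>x. f (x + a)) (\<lambda>x. deriv F (of_real (x + a)))"
    unfolding f_def by (rule integrable_C1_shift[OF entire_of_exp_type_integrable_C1(1)[OF F _ int]]) simp
  have v: "fourier f \<xi> = 0" if "\<bar>\<xi>\<bar> \<ge> 1" for \<xi>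
    unfolding f_def by (rule paley_wiener_closed[OF F _ int]) (use that in auto)
  have z: "fourier (\<lambda>x. f (x + a)) (real (Suc n)) + fourier (\<lambda>x. f (x + a)) (- real (Suc n)) = 0" for n
    unfolding fourier_shift using v[of "real (Suc n)"] v[of "- real (Suc n)"] by simp
  have "((\<lambda>n::int. f (of_int n + a)) has_sum (fourier (\<lambda>x. f (x + a)) 0 + (\<Sum>n::nat. 0))) UNIV"
    using poisson_summation[OF C1] unfolding z by simp
  then show ?thesis by (simp add: fourier_shift) (simp add: fourier_def f_def)
qed

lemma sum_roots_of_unity:
  fixes n :: int and j :: nat
  assumes n: "n \<noteq> 0" "\<bar>n\<bar> < int j"
  shows "(\<Sum>l<j. cis (- 2 * pi * (real l / real j) * of_int n)) = 0"
proof -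
  define z where "z = cis (- 2 * pi * of_int n / real j)"
  have j: "j > 0" using n by auto
  have p: "cis (- 2 * pi * (real l / real j) * of_int n) = z ^ l" for l
    unfolding z_def Complex.DeMoivre by (simp add: field_simps)
  have zj: "z ^ j = 1"
  proof -
    have "z ^ j = cis (2 * pi * of_int (- n))" unfolding z_def Complex.DeMoivre using j by (simp add: field_simps)
    also have "\<dots> = 1" by (rule cis_multiple_2pi) simp
    finally show ?thesis .
  qed
  have "z \<noteq> 1"
  proof
    assume "z = 1"
    then have "cos (- 2 * pi * of_int n / real j) = 1" by (simp add: z_def complex_eq_iff)
    then obtain m :: int where "- 2 * pi * of_int n / real j = of_int m * 2 * pi" unfolding cos_one_2pi_int by blast
    then have "2 * pi * (- of_int n / real j) = 2 * pi * of_int m" by (simp add: mult_ac)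
    then have "- of_int n / real j = of_int m" by (simp only: mult_cancel_left) simp
    then have "- (of_int n :: real) = of_int m * real j" using j by (simp add: field_simps)
    then have "- n = m * int j" by (metis of_int_eq_iff of_int_minus of_int_mult of_int_of_nat_eq)
    then have "int j dvd n" by (metis dvd_minus_iff dvd_triv_right)
    then have "int j \<le> \<bar>n\<bar>" using n zdvd_imp_le[of "int j" "\<bar>n\<bar>"] by simp
    then show False using n by simp
  qed
  then show ?thesis unfolding p by (subst geometric_sum) (simp_all add: zj)
qed

text \<open>The coefficient of index \<open>0\<close> is extracted by averaging over the \<open>j\<close>-th roots of unity,
  which replaces an interchange of sum and integral by a finite sum.\<close>

lemma vanishing_fourier_series:
  fixes a :: "int \<Rightarrow> complex"
  assumes s: "(\<lambda>n. cmod (a n)) summable_on UNIV"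
    and z: "\<And>\<xi>. ((\<lambda>n. a n * cis (- 2 * pi * \<xi> * of_int n)) has_sum 0) UNIV"
  shows "a 0 = 0"
proof -
  define S where "S = (\<Sum>\<^sub>\<infinity>n. cmod (a n))"
  have S: "((\<lambda>n. cmod (a n)) has_sum S) UNIV" using s unfolding S_def by (rule has_sum_infsum)
  define P where "P = (\<lambda>m::nat. {- int m..<int m})"
  have fP: "finite (P m)" for m by (simp add: P_def)
  have b: "cmod (a 0) \<le> S - (\<Sum>n\<in>P m. cmod (a n))" if m: "m \<ge> 1" for m :: nat
  proof -
    define j where "j = Suc m"
    have jp: "j > 0" by (simp add: j_def)
    (* The average of the \<open>n\<close>-th character over the \<open>j\<close>-th roots of unity. *)
    define w where "w = (\<lambda>n. (\<Sum>l<j. cis (- 2 * pi * (real l / real j) * of_int n)) / of_nat j)"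
    have w1: "cmod (w n) \<le> 1" for n
    proof -
      have "cmod (\<Sum>l<j. cis (- 2 * pi * (real l / real j) * of_int n)) \<le> real j"
        by (rule order_trans[OF norm_sum]) simp
      moreover have "real j > 0" by (simp add: j_def)
      ultimately show ?thesis by (simp add: w_def norm_divide divide_le_eq)
    qed
    have w0: "w n = (if n = 0 then 1 else 0)" if "n \<in> P m" for n
    proof (cases "n = 0")
      case False
      then have "(\<Sum>l<j. cis (- 2 * pi * (real l / real j) * of_int n)) = 0"
        by (rule sum_roots_of_unity) (use that in \<open>auto simp: P_def j_def\<close>)
      then show ?thesis using False by (simp add: w_def)
    qed (use jp in \<open>simp add: w_def\<close>)
    have near: "cmod ((\<Sum>n\<in>P N. a n * w n) - a 0) \<le> S - (\<Sum>n\<in>P m. cmod (a n))" if N: "N \<ge> m" for N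
    proof -
      have sub: "P m \<subseteq> P N" using N by (auto simp: P_def)
      have "(\<Sum>n\<in>P m. a n * w n) = (\<Sum>n\<in>P m. if n = 0 then a 0 else 0)"
        by (intro sum.cong) (auto simp: w0)
      also have "\<dots> = a 0" using m fP by (simp add: P_def)
      finally have "(\<Sum>n\<in>P N. a n * w n) - a 0 = (\<Sum>n\<in>P N - P m. a n * w n)"
        using sum.subset_diff[OF sub fP, of "\<lambda>n. a n * w n"] by simp
      also have "cmod \<dots> \<le> (\<Sum>n\<in>P N - P m. cmod (a n))"
      proof (rule order_trans[OF norm_sum sum_mono])
        fix n show "cmod (a n * w n) \<le> cmod (a n)"
          using mult_left_mono[OF w1[of n], of "cmod (a n)"] by (simp add: norm_mult)
      qed
      also have "\<dots> = (\<Sum>n\<in>P N. cmod (a n)) - (\<Sum>n\<in>P m. cmod (a n))"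
        using sum.subset_diff[OF sub fP, of "\<lambda>n. cmod (a n)"] by simp
      also have "(\<Sum>n\<in>P N. cmod (a n)) \<le> S"
        using has_sum_mono_neutral[OF has_sum_finite[OF fP[of N]] S] by auto
      finally show ?thesis by simp
    qed
    have "(\<lambda>N. (\<Sum>l<j. \<Sum>n\<in>P N. a n * cis (- 2 * pi * (real l / real j) * of_int n)) / of_nat j) \<longlonglongrightarrow> (\<Sum>l<j. 0) / of_nat j"
      unfolding P_def by (intro tendsto_intros has_sum_int_symmetric_limit z) (use jp in simp)
    moreover have "(\<Sum>l<j. \<Sum>n\<in>P N. a n * cis (- 2 * pi * (real l / real j) * of_int n)) / of_nat j = (\<Sum>n\<in>P N. a n * w n)" for N
      by (subst sum.swap) (simp add: w_def sum_distrib_left sum_divide_distrib)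
    ultimately have "(\<lambda>N. \<Sum>n\<in>P N. a n * w n) \<longlonglongrightarrow> 0" by simp
    then have "(\<lambda>N. cmod ((\<Sum>n\<in>P N. a n * w n) - a 0)) \<longlonglongrightarrow> cmod (0 - a 0)" by (intro tendsto_intros)
    then have "cmod (0 - a 0) \<le> S - (\<Sum>n\<in>P m. cmod (a n))"
      by (rule LIMSEQ_le_const2) (use near in blast)
    then show ?thesis by simp
  qed
  have "(\<lambda>j. S - (\<Sum>n\<in>{- int j..<int j}. cmod (a n))) \<longlonglongrightarrow> S - S"
    by (intro tendsto_intros has_sum_int_symmetric_limit S)
  then have "cmod (a 0) \<le> S - S"
    by (rule LIMSEQ_le_const) (use b in \<open>auto simp: P_def\<close>)
  then show ?thesis by simp
qed

text \<open>On \<open>(0,1)\<close> only the frequencies \<open>\<xi>\<close> and \<open>\<xi>-1\<close> of the modulated function lie in the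
  spectrum. The zeros of \<open>F\<close> say that the transform \<open>\<phi>\<close> of \<open>F\<close> satisfies \<open>\<phi>(\<xi>) + \<phi>(\<xi>-1) = 0\<close>;
  the zeros of \<open>F'\<close> say that \<open>\<xi> \<phi>(\<xi>) + (\<xi>-1) \<phi>(\<xi>-1)\<close> is constant, with \<open>F'(0)\<close> determining the
  constant. So \<open>\<phi>\<close> is constant on \<open>(0,1)\<close>, and it is \<open>0\<close> there because \<open>\<phi>\<close> is continuous and
  vanishes at \<open>1\<close>.\<close>

theorem double_zeros_imp_zero:
  assumes F: "entire_of_exp_type (2 * pi) F" and int: "integrable lborel (\<lambda>x. F (of_real x))"
    and z: "\<And>n::int. F (of_int n) = 0" and dz: "\<And>n::int. n \<noteq> 0 \<Longrightarrow> deriv F (of_int n) = 0"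
  shows "F w = 0"
proof -
  define f where "f = (\<lambda>x. F (of_real x))"
  define g where "g = (\<lambda>x. deriv F (of_real x))"
  have C1: "integrable_C1 f g" "integrable_C1 g (\<lambda>x. deriv (deriv F) (of_real x))"
    using entire_of_exp_type_integrable_C1[OF F _ int] by (simp_all add: f_def g_def)
  have fi: "integrable lborel f" using C1 by (simp add: integrable_C1_def)
  have v: "fourier f \<xi> = 0" if "\<bar>\<xi>\<bar> \<ge> 1" for \<xi>
    unfolding f_def by (rule paley_wiener_closed[OF F _ int]) (use that in auto)
  (* Poisson summation for the modulated function, whose frequency \<open>-1\<close> is the only one left
    besides \<open>0\<close>. *)
  have P: "((\<lambda>n::int. h (of_int n) * cis (- 2 * pi * \<xi> * of_int n)) has_sum (fourier h \<xi> + fourier h (\<xi> - 1))) UNIV"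
    if \<xi>: "0 < \<xi>" "\<xi> < 1" and h: "integrable_C1 h h'" and hv: "\<And>\<xi>. \<bar>\<xi>\<bar> \<ge> 1 \<Longrightarrow> fourier h \<xi> = 0" for \<xi> h h'
  proof -
    define c where "c = - 2 * pi * \<xi>"
    define H where "H = (\<lambda>x. h x * cis (c * x))"
    have HF: "fourier H \<eta> = fourier h (\<eta> + \<xi>)" for \<eta>
      using fourier_modulate[of h "- \<xi>" \<eta>] by (simp add: H_def c_def)
    have b: "fourier H (real (Suc n)) + fourier H (- real (Suc n)) = (if n = 0 then fourier h (\<xi> - 1) else 0)" for n
    proof -
      have "fourier H (real (Suc n)) = 0" unfolding HF by (rule hv) (use \<xi> in auto)
      moreover have "fourier H (- real (Suc n)) = 0" if "n \<noteq> 0"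
      proof -
        have "real n \<ge> 1" using that by simp
        then have "\<bar>- real (Suc n) + \<xi>\<bar> \<ge> 1" using \<xi> by simp
        then show ?thesis unfolding HF by (rule hv)
      qed
      moreover have "fourier H (- real (Suc 0)) = fourier h (\<xi> - 1)" unfolding HF by simp
      ultimately show ?thesis by auto
    qed
    have bs: "(\<lambda>n. if n = 0 then fourier h (\<xi> - 1) else 0) sums fourier h (\<xi> - 1)"
      using sums_single[of 0 "\<lambda>n. fourier h (\<xi> - 1)"] by simp
    have "((\<lambda>n::int. H (of_int n)) has_sum (fourier H 0 + (\<Sum>n. fourier H (real (Suc n)) + fourier H (- real (Suc n))))) UNIV"
    proof (rule poisson_summation[OF integrable_C1_modulate[OF h, of c, folded H_def]])
      show "summable (\<lambda>n. cmod (fourier H (real (Suc n)) + fourier H (- real (Suc n))))"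
        unfolding b by (rule summable_finite[of "{0}"]) auto
    qed
    then show ?thesis unfolding b sums_unique[OF bs, symmetric] by (simp add: HF) (simp add: H_def c_def)
  qed
  have g_hat: "fourier g \<xi> = 2 * pi * \<i> * \<xi> * fourier f \<xi>" for \<xi> by (rule fourier_deriv[OF C1(1)])
  have anti: "fourier f \<xi> + fourier f (\<xi> - 1) = 0" if \<xi>: "0 < \<xi>" "\<xi> < 1" for \<xi>
  proof -
    have "((\<lambda>n::int. 0) has_sum (fourier f \<xi> + fourier f (\<xi> - 1))) UNIV"
      using P[OF \<xi> C1(1) v] z by (simp add: f_def)
    then show ?thesis using has_sum_unique[OF _ has_sum_0, of "\<lambda>n. 0" UNIV] by blast
  qed
  define c where "c = g 0 / (2 * pi * \<i>)"
  have const: "fourier f \<xi> = c" if \<xi>: "0 < \<xi>" "\<xi> < 1" for \<xi>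
  proof -
    have "((\<lambda>n::int. g (of_int n) * cis (- 2 * pi * \<xi> * of_int n)) has_sum (fourier g \<xi> + fourier g (\<xi> - 1))) UNIV"
      using P[OF \<xi> C1(2)] v by (simp add: g_hat)
    moreover have "g (of_int n) * cis (- 2 * pi * \<xi> * of_int n) = (if n = 0 then g 0 else 0)" for n :: int
      using dz[of n] by (auto simp: g_def)
    moreover have "((\<lambda>n::int. if n = 0 then g 0 else 0) has_sum g 0) UNIV"
      by (rule has_sum_finite_neutralI[of "{0}"]) auto
    ultimately have "g 0 = fourier g \<xi> + fourier g (\<xi> - 1)" using has_sum_unique by fastforce
    also have "\<dots> = 2 * pi * \<i> * (\<xi> * (fourier f \<xi> + fourier f (\<xi> - 1)) - fourier f (\<xi> - 1))"
      by (simp add: g_hat algebra_simps)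
    also have "\<dots> = 2 * pi * \<i> * (- fourier f (\<xi> - 1))" by (simp add: anti[OF \<xi>])
    also have "- fourier f (\<xi> - 1) = fourier f \<xi>" using anti[OF \<xi>] by (simp only: add_eq_0_iff2)
    finally show ?thesis by (simp add: c_def)
  qed
  (* Limits from the left carry the value on \<open>(0,1)\<close> to \<open>1\<close> and that on \<open>(-1,0)\<close> to \<open>0\<close>. *)
  have near: "fourier f \<eta> = d" if near: "eventually (\<lambda>\<xi>. fourier f \<xi> = d) (at_left \<eta>)" for d \<eta>
  proof -
    have "(fourier f \<longlongrightarrow> fourier f \<eta>) (at_left \<eta>)"
      using isCont_fourier[OF fi, of \<eta>] filterlim_at_split unfolding isCont_def by blast
    moreover have "(fourier f \<longlongrightarrow> d) (at_left \<eta>)" by (rule tendsto_eventually[OF near])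
    ultimately show ?thesis using tendsto_unique[OF trivial_limit_at_left_real] by blast
  qed
  have "fourier f 1 = c"
    by (rule near) (use const in \<open>auto intro!: eventually_at_leftI[of 0]\<close>)
  then have c0: "c = 0" using v[of 1] by simp
  have neg: "fourier f \<xi> = 0" if "-1 < \<xi>" "\<xi> < 0" for \<xi>
    using anti[of "\<xi> + 1"] const[of "\<xi> + 1"] that c0 by simp
  have "fourier f 0 = 0"
    by (rule near) (use neg in \<open>auto intro!: eventually_at_leftI[of "-1"]\<close>)
  then have all0: "fourier f \<xi> = 0" for \<xi>
    using v[of \<xi>] neg[of \<xi>] const[of \<xi>] c0 by (cases "\<bar>\<xi>\<bar> \<ge> 1"; cases "\<xi> = 0"; cases "\<xi> > 0") (auto simp: abs_real_def split: if_splits)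
  (* Poisson summation turns the vanishing of the transform into that of the samples on each
    translate of \<open>\<int>\<close>. *)
  have real0: "f x0 = 0" for x0
  proof -
    define h where "h = (\<lambda>x. f (x + x0))"
    have h: "integrable_C1 h (\<lambda>x. g (x + x0))" unfolding h_def by (rule integrable_C1_shift[OF C1(1)])
    have h0: "fourier h \<xi> = 0" for \<xi> by (simp add: h_def fourier_shift all0)
    have "((\<lambda>n::int. h (of_int n) * cis (- 2 * pi * \<xi> * of_int n)) has_sum 0) UNIV" for \<xi>
    proof -
      define c where "c = - 2 * pi * \<xi>"
      define H where "H = (\<lambda>x. h x * cis (c * x))"
      have HF: "fourier H \<eta> = 0" for \<eta>
        using fourier_modulate[of h "- \<xi>" \<eta>] by (simp add: H_def c_def h0)
      show ?thesis using poisson_summation[OF integrable_C1_modulate[OF h, of c, folded H_def]] HF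
        by (simp add: H_def c_def)
    qed
    from vanishing_fourier_series[OF integrable_C1_summable[OF h] this]
    show ?thesis by (simp add: h_def)
  qed
  then show ?thesis
    using phragmen_lindelof_exp_type[OF F, of 0 w] by (simp add: f_def)
qed

section \<open>Gaussians and derivatives of theta functions\<close>

definition gauss :: "real \<Rightarrow> real \<Rightarrow> real" where
  "gauss s x = exp (- (pi * s * x\<^sup>2))"

lemma gauss_pos [simp]: "gauss s x > 0" and gauss_nonneg [simp]: "gauss s x \<ge> 0"
  by (simp_all add: gauss_def less_imp_le)

lemma gauss_0 [simp]: "gauss s 0 = 1" by (simp add: gauss_def)

lemma gauss_minus [simp]: "gauss s (- x) = gauss s x" by (simp add: gauss_def)

lemma gauss_le_1: "s \<ge> 0 \<Longrightarrow> gauss s x \<le> 1" by (simp add: gauss_def)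

lemma gauss_eq_std_normal_density:
  assumes s: "s > 0"
  shows "gauss s x = sqrt (2 * pi) * std_normal_density (sqrt (2 * pi * s) * x)"
  using s by (simp add: gauss_def std_normal_density_def power_mult_distrib)

lemma integrable_power_gauss:
  assumes s: "s > 0" shows "integrable lborel (\<lambda>x. x ^ k * gauss s x)"
proof -
  define c where "c = sqrt (2 * pi * s)"
  have c: "c \<noteq> 0" using s by (simp add: c_def)
  have "integrable lborel (\<lambda>x. std_normal_density (0 + c * x) * (0 + c * x) ^ k)"
    by (rule lborel_integrable_real_affine[OF integrable_std_normal_moment c])
  then have "integrable lborel (\<lambda>x. (sqrt (2 * pi) / c ^ k) * (std_normal_density (0 + c * x) * (0 + c * x) ^ k))"
    by (rule integrable_mult_right)
  moreover have "(sqrt (2 * pi) / c ^ k) * (std_normal_density (0 + c * x) * (0 + c * x) ^ k) = x ^ k * gauss s x" for x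
    unfolding gauss_eq_std_normal_density[OF s] c_def[symmetric] using c by (simp add: power_mult_distrib)
  ultimately show ?thesis by (simp only:)
qed

lemma integrable_gauss: "s > 0 \<Longrightarrow> integrable lborel (gauss s)"
  using integrable_power_gauss[of s 0] by simp

lemma fourier_gauss:
  assumes s: "s > 0"
  shows "fourier (\<lambda>x. of_real (gauss s x)) \<xi> = of_real (gauss (1/s) \<xi> / sqrt s)"
proof -
  define c where "c = sqrt (2 * pi * s)"
  have c: "c > 0" "c\<^sup>2 = 2 * pi * s" using s by (simp_all add: c_def)
  define t where "t = - 2 * pi * \<xi> / c"
  have tc: "t * c = - 2 * pi * \<xi>" using c by (simp add: t_def)
  have "complex_of_real (exp (- t\<^sup>2 / 2)) = char std_normal_distribution t"
    by (simp add: char_std_normal_distribution)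
  also have "\<dots> = (\<integral>x. std_normal_density x *\<^sub>R iexp (t * x) \<partial>lborel)"
    unfolding char_def by (subst integral_density) (auto simp: normal_density_nonneg)
  also have "\<dots> = c *\<^sub>R (\<integral>x. std_normal_density (0 + c * x) *\<^sub>R iexp (t * (0 + c * x)) \<partial>lborel)"
    using c lborel_integral_real_affine[of c "\<lambda>x. std_normal_density x *\<^sub>R iexp (t * x)" 0] by simp
  also have "(\<integral>x. std_normal_density (0 + c * x) *\<^sub>R iexp (t * (0 + c * x)) \<partial>lborel)
     = (\<integral>x. of_real (1 / sqrt (2 * pi)) * (of_real (gauss s x) * cis (- 2 * pi * \<xi> * x)) \<partial>lborel)"
  proof (intro Bochner_Integration.integral_cong refl)
    fix x
    have "iexp (t * (0 + c * x)) = cis (- 2 * pi * \<xi> * x)"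
      using tc by (simp add: cis_conv_exp mult.assoc[symmetric])
    then show "std_normal_density (0 + c * x) *\<^sub>R iexp (t * (0 + c * x)) = of_real (1 / sqrt (2 * pi)) * (of_real (gauss s x) * cis (- 2 * pi * \<xi> * x))"
      by (simp add: gauss_eq_std_normal_density[OF s] c_def[symmetric] scaleR_conv_of_real)
  qed
  also have "\<dots> = of_real (1 / sqrt (2 * pi)) * fourier (\<lambda>x. of_real (gauss s x)) \<xi>"
    by (simp only: integral_mult_right_zero fourier_def)
  finally have "complex_of_real (exp (- t\<^sup>2 / 2)) = of_real (c / sqrt (2 * pi)) * fourier (\<lambda>x. of_real (gauss s x)) \<xi>"
    by (simp add: scaleR_conv_of_real)
  moreover have "c / sqrt (2 * pi) = sqrt s" by (simp add: c_def real_sqrt_mult)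
  moreover have "exp (- t\<^sup>2 / 2) = gauss (1/s) \<xi>"
    using s by (simp add: gauss_def t_def power_divide c power_mult_distrib) (simp add: power2_eq_square)
  ultimately show ?thesis using s by (simp add: field_simps)
qed

definition gauss1 where "gauss1 s x = - 2 * pi * s * x * gauss s x"
definition gauss2 where "gauss2 s x = (4 * pi\<^sup>2 * s\<^sup>2 * x\<^sup>2 - 2 * pi * s) * gauss s x"
definition gauss3 where "gauss3 s x = (12 * pi\<^sup>2 * s\<^sup>2 * x - 8 * pi ^ 3 * s ^ 3 * x ^ 3) * gauss s x"

lemma gauss_derivs:
  "(gauss s has_real_derivative gauss1 s x) (at x)"
  "(gauss1 s has_real_derivative gauss2 s x) (at x)"
  "(gauss2 s has_real_derivative gauss3 s x) (at x)"
proof -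
  show g: "(gauss s has_real_derivative gauss1 s x) (at x)" for x
    unfolding gauss_def[abs_def] gauss1_def by (auto intro!: derivative_eq_intros simp: gauss_def)
  show "(gauss1 s has_real_derivative gauss2 s x) (at x)"
    unfolding gauss1_def[abs_def] gauss2_def
    by (auto intro!: derivative_eq_intros g simp: gauss1_def power2_eq_square algebra_simps)
  show "(gauss2 s has_real_derivative gauss3 s x) (at x)"
    unfolding gauss2_def[abs_def] gauss3_def
    by (auto intro!: derivative_eq_intros g simp: gauss1_def power2_eq_square power3_eq_cube algebra_simps)
qed

lemma integrable_C1_of_real:
  assumes "\<And>x. (f has_real_derivative f' x) (at x)" "continuous_on UNIV f'" "integrable lborel f" "integrable lborel f'"
  shows "integrable_C1 (\<lambda>x. of_real (f x)) (\<lambda>x. of_real (f' x))"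
  unfolding integrable_C1_def
  using assms by (auto intro!: has_vector_derivative_of_real continuous_intros integrable_of_real)

lemma gauss_integrable_C1:
  assumes s: "s > 0"
  shows "integrable_C1 (\<lambda>x. of_real (gauss s x)) (\<lambda>x. of_real (gauss1 s x))"
    "integrable_C1 (\<lambda>x. of_real (gauss1 s x)) (\<lambda>x. of_real (gauss2 s x))"
    "integrable_C1 (\<lambda>x. of_real (gauss2 s x)) (\<lambda>x. of_real (gauss3 s x))"
proof -
  note i = integrable_power_gauss[OF s]
  have "integrable lborel (\<lambda>x. - 2 * pi * s * (x ^ 1 * gauss s x))" by (intro integrable_mult_right i)
  then have 1: "integrable lborel (gauss1 s)" by (simp add: gauss1_def[abs_def] mult_ac)
  have "integrable lborel (\<lambda>x. 4 * pi\<^sup>2 * s\<^sup>2 * (x ^ 2 * gauss s x) - 2 * pi * s * (x ^ 0 * gauss s x))"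
    by (intro integrable_mult_right i Bochner_Integration.integrable_diff)
  then have 2: "integrable lborel (gauss2 s)" by (simp add: gauss2_def[abs_def] algebra_simps)
  have "integrable lborel (\<lambda>x. 12 * pi\<^sup>2 * s\<^sup>2 * (x ^ 1 * gauss s x) - 8 * pi ^ 3 * s ^ 3 * (x ^ 3 * gauss s x))"
    by (intro integrable_mult_right i Bochner_Integration.integrable_diff)
  then have 3: "integrable lborel (gauss3 s)" by (simp add: gauss3_def[abs_def] algebra_simps)
  have c: "continuous_on UNIV (gauss1 s)" "continuous_on UNIV (gauss2 s)" "continuous_on UNIV (gauss3 s)"
    unfolding gauss1_def[abs_def] gauss2_def[abs_def] gauss3_def[abs_def] gauss_def by (intro continuous_intros)+
  show "integrable_C1 (\<lambda>x. of_real (gauss s x)) (\<lambda>x. of_real (gauss1 s x))"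
    "integrable_C1 (\<lambda>x. of_real (gauss1 s x)) (\<lambda>x. of_real (gauss2 s x))"
    "integrable_C1 (\<lambda>x. of_real (gauss2 s x)) (\<lambda>x. of_real (gauss3 s x))"
    by (intro integrable_C1_of_real gauss_derivs c 1 2 3 integrable_gauss[OF s])+
qed

lemma square_gauss_le:
  assumes s: "s > 0" and x: "x \<noteq> 0"
  shows "x\<^sup>2 * gauss s x \<le> 2 / (pi * s)\<^sup>2 / x\<^sup>2"
proof -
  define t where "t = pi * s * x\<^sup>2"
  have t: "t > 0" using s x by (simp add: t_def)
  have "t\<^sup>2 / 2 \<le> exp t" using exp_lower_Taylor_quadratic[of t] t by simp
  then have "t\<^sup>2 * exp (- t) \<le> 2" using t by (simp add: exp_minus field_simps)
  then have "(pi * s)\<^sup>2 * (x\<^sup>2 * (x\<^sup>2 * gauss s x)) \<le> 2"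
    by (simp add: t_def gauss_def power_mult_distrib power2_eq_square mult_ac)
  then show ?thesis using s x by (simp add: field_simps)
qed

lemma summable_square_gauss:
  assumes s: "s > 0" and \<alpha>: "\<And>n. \<alpha> n \<ge> (real n + 1) / 2"
  shows "summable (\<lambda>n. (\<alpha> n)\<^sup>2 * gauss s (\<alpha> n))"
proof (rule summable_comparison_test')
  show "summable (\<lambda>n. 8 / (pi * s)\<^sup>2 * inverse (real (Suc n) ^ 2))"
    by (intro summable_mult) (subst summable_Suc_iff, rule inverse_power_summable, simp)
  fix n
  have p: "\<alpha> n > 0" using \<alpha>[of n] by (rule order.strict_trans2[rotated]) simp
  have "((real n + 1) / 2)\<^sup>2 \<le> (\<alpha> n)\<^sup>2" by (rule power_mono[OF \<alpha>]) simp
  then have "1 / (\<alpha> n)\<^sup>2 \<le> 1 / ((real n + 1) / 2)\<^sup>2" by (intro divide_left_mono) (use p in auto)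
  also have "\<dots> = 4 * inverse (real (Suc n) ^ 2)" by (simp add: power_divide field_simps)
  finally have q: "1 / (\<alpha> n)\<^sup>2 \<le> 4 * inverse (real (Suc n) ^ 2)" .
  have "(\<alpha> n)\<^sup>2 * gauss s (\<alpha> n) \<le> 2 / (pi * s)\<^sup>2 * (1 / (\<alpha> n)\<^sup>2)" using square_gauss_le[OF s, of "\<alpha> n"] p by simp
  also have "\<dots> \<le> 2 / (pi * s)\<^sup>2 * (4 * inverse (real (Suc n) ^ 2))" by (intro mult_left_mono q) simp
  finally show "norm ((\<alpha> n)\<^sup>2 * gauss s (\<alpha> n)) \<le> 8 / (pi * s)\<^sup>2 * inverse (real (Suc n) ^ 2)" by simp
qed

text \<open>The modular transformation of the second derivative of the theta function: Poisson
  summation for the second derivative of the Gaussian.\<close>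

lemma theta_second_derivative:
  assumes s: "s > 0"
  shows "((\<lambda>n::int. gauss2 s (of_int n + a)) has_sum
    (- (8 * pi\<^sup>2 / sqrt s) * (\<Sum>n. cos (2 * pi * real (Suc n) * a) * ((real (Suc n))\<^sup>2 * gauss (1/s) (real (Suc n)))))) UNIV"
proof -
  define f where "f = (\<lambda>x. complex_of_real (gauss2 s (x + a)))"
  have C1: "integrable_C1 f (\<lambda>x. of_real (gauss3 s (x + a)))"
    unfolding f_def by (rule integrable_C1_shift[OF gauss_integrable_C1(3)[OF s]])
  have "fourier (\<lambda>x. of_real (gauss2 s x)) \<xi> = (2 * pi * \<i> * \<xi>) * ((2 * pi * \<i> * \<xi>) * of_real (gauss (1/s) \<xi> / sqrt s))" for \<xi>
    by (simp only: fourier_deriv[OF gauss_integrable_C1(2)[OF s]] fourier_deriv[OF gauss_integrable_C1(1)[OF s]] fourier_gauss[OF s])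
  then have h2: "fourier (\<lambda>x. of_real (gauss2 s x)) \<xi> = of_real (- (4 * pi\<^sup>2 / sqrt s) * (\<xi>\<^sup>2 * gauss (1/s) \<xi>))" for \<xi>
    by (simp add: complex_eq_iff power2_eq_square)
  have ff: "fourier f \<xi> = cis (2 * pi * \<xi> * a) * of_real (- (4 * pi\<^sup>2 / sqrt s) * (\<xi>\<^sup>2 * gauss (1/s) \<xi>))" for \<xi>
    unfolding f_def fourier_shift[of "\<lambda>x. complex_of_real (gauss2 s x)"] h2 ..
  have cc: "cis y + cis (- y) = of_real (2 * cos y)" for y by (simp add: complex_eq_iff)
  have fp: "fourier f (real (Suc n)) + fourier f (- real (Suc n)) =
     of_real (- (8 * pi\<^sup>2 / sqrt s) * (cos (2 * pi * real (Suc n) * a) * ((real (Suc n))\<^sup>2 * gauss (1/s) (real (Suc n)))))" for n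
  proof -
    define k where "k = real (Suc n)"
    have "fourier f (- k) = cis (- (2 * pi * k * a)) * of_real (- (4 * pi\<^sup>2 / sqrt s) * (k\<^sup>2 * gauss (1/s) k))"
      unfolding ff gauss_minus by simp
    then have "fourier f k + fourier f (- k) = (cis (2 * pi * k * a) + cis (- (2 * pi * k * a))) * of_real (- (4 * pi\<^sup>2 / sqrt s) * (k\<^sup>2 * gauss (1/s) k))"
      by (simp only: ff[of k] distrib_right)
    also have "\<dots> = of_real (2 * cos (2 * pi * k * a) * (- (4 * pi\<^sup>2 / sqrt s) * (k\<^sup>2 * gauss (1/s) k)))"
      unfolding cc by (simp only: of_real_mult)
    finally show ?thesis unfolding k_def[symmetric] by (simp add: mult_ac)
  qed
  define u where "u = (\<lambda>n. cos (2 * pi * real (Suc n) * a) * ((real (Suc n))\<^sup>2 * gauss (1/s) (real (Suc n))))"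
  have un: "summable (\<lambda>n. norm (u n))"
  proof (rule summable_comparison_test')
    show "summable (\<lambda>n. (real (Suc n))\<^sup>2 * gauss (1/s) (real (Suc n)))"
      by (rule summable_square_gauss) (use s in auto)
    fix n
    have "norm (u n) \<le> (real (Suc n))\<^sup>2 * gauss (1/s) (real (Suc n))"
      unfolding u_def norm_mult by (rule order_trans[OF mult_right_mono[of _ 1]]) auto
    then show "norm (norm (u n)) \<le> (real (Suc n))\<^sup>2 * gauss (1/s) (real (Suc n))" by simp
  qed
  have u: "summable u" by (rule summable_norm_cancel[OF un])
  have "((\<lambda>n::int. f (of_int n)) has_sum
     (fourier f 0 + (\<Sum>n. fourier f (real (Suc n)) + fourier f (- real (Suc n))))) UNIV"
  proof (rule poisson_summation[OF C1])
    show "summable (\<lambda>n. cmod (fourier f (real (Suc n)) + fourier f (- real (Suc n))))"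
      unfolding fp norm_of_real abs_mult[of "- (8 * pi\<^sup>2 / sqrt s)"] using un unfolding u_def by (intro summable_mult) simp
  qed
  also have "fourier f 0 = 0" by (simp add: ff)
  also have "(\<Sum>n. fourier f (real (Suc n)) + fourier f (- real (Suc n))) = (\<Sum>n. of_real (- (8 * pi\<^sup>2 / sqrt s) * u n))"
    by (simp only: fp u_def)
  also have "\<dots> = of_real (\<Sum>n. - (8 * pi\<^sup>2 / sqrt s) * u n)"
    by (rule suminf_of_real[symmetric]) (rule summable_mult[OF u])
  also have "(\<Sum>n. - (8 * pi\<^sup>2 / sqrt s) * u n) = - (8 * pi\<^sup>2 / sqrt s) * suminf u" by (rule suminf_mult[OF u])
  finally have "((\<lambda>n::int. complex_of_real (gauss2 s (of_int n + a))) has_sum of_real (- (8 * pi\<^sup>2 / sqrt s) * suminf u)) UNIV"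
    by (simp add: f_def)
  from has_sum_Re[OF this] show ?thesis by (simp add: u_def)
qed

text \<open>The self-dual identity for an alternating sum over half-integers. The sign \<open>(-1)\<^sup>n\<close>
  shifts the dual frequencies by \<open>1/2\<close>, and the frequencies \<open>n+1\<close> and \<open>-n\<close> contribute
  equally.\<close>

lemma theta_first_derivative:
  assumes s: "s > 0"
  shows "((\<lambda>n::int. (-1) powi n * gauss1 s (of_int n + 1/2)) has_sum
    (- (4 * pi / sqrt s) * (\<Sum>n. (-1) ^ n * ((real n + 1/2) * gauss (1/s) (real n + 1/2))))) UNIV"
proof -
  define F where "F = (\<lambda>x. complex_of_real (gauss1 s (x + 1/2)))"
  define f where "f = (\<lambda>x. F x * cis (pi * x))"
  have C1: "\<exists>f'. integrable_C1 f f'"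
    unfolding f_def F_def using integrable_C1_modulate[OF integrable_C1_shift[OF gauss_integrable_C1(2)[OF s]]] by blast
  have h1: "fourier (\<lambda>x. of_real (gauss1 s x)) \<xi> = 2 * pi * \<i> * \<xi> * of_real (gauss (1/s) \<xi> / sqrt s)" for \<xi>
    by (simp only: fourier_deriv[OF gauss_integrable_C1(1)[OF s]] fourier_gauss[OF s])
  have ff: "fourier f \<xi> = cis (pi * (\<xi> - 1/2)) * (2 * pi * \<i> * (\<xi> - 1/2) * of_real (gauss (1/s) (\<xi> - 1/2) / sqrt s))" for \<xi>
    using fourier_modulate[of F "1/2" \<xi>] fourier_shift[of "\<lambda>x. complex_of_real (gauss1 s x)" "1/2" "\<xi> - 1/2"]
    by (simp add: f_def F_def h1)
  define v where "v = (\<lambda>n::nat. (real n + 1/2) * gauss (1/s) (real n + 1/2))"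
  define c where "c = 2 * pi / sqrt s"
  have cn: "cis (pi * (real n + 1/2)) = \<i> * (-1) ^ n" for n
    by (simp add: complex_eq_iff distrib_left cos_add sin_add)
  have fS: "fourier f (real (Suc n)) = of_real (- c * ((-1) ^ n * v n))" for n
  proof -
    have "fourier f (real (Suc n)) = cis (pi * (real n + 1/2)) * (2 * pi * \<i> * (real n + 1/2) * of_real (gauss (1/s) (real n + 1/2) / sqrt s))"
      unfolding ff by (simp add: algebra_simps)
    also have "\<dots> = (\<i> * \<i>) * (c * ((-1) ^ n * v n))"
      unfolding cn v_def c_def of_real_mult of_real_divide by (simp add: mult_ac)
    finally show ?thesis by simp
  qed
  have fN: "fourier f (- real n) = of_real (- c * ((-1) ^ n * v n))" for n
  proof -
    have m: "- real n - 1/2 = - (real n + 1/2)" by simp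
    have "fourier f (- real n) = cis (- (pi * (real n + 1/2))) * (2 * pi * \<i> * (- (real n + 1/2)) * of_real (gauss (1/s) (real n + 1/2) / sqrt s))"
      unfolding ff m gauss_minus mult_minus_right[of pi "real n + 1/2"] by simp
    also have "cis (- (pi * (real n + 1/2))) = - \<i> * (-1) ^ n"
      by (simp add: cis_cnj[symmetric] cn)
    also have "(- \<i> * (-1) ^ n) * (2 * pi * \<i> * (- (real n + 1/2)) * of_real (gauss (1/s) (real n + 1/2) / sqrt s)) = (\<i> * \<i>) * (c * ((-1) ^ n * v n))"
    proof -
      define r where "r = real n + 1/2"
      have "v n = r * gauss (1/s) r" by (simp add: v_def r_def)
      then show ?thesis unfolding r_def[symmetric] c_def by (simp add: mult_ac)
    qed
    finally show ?thesis by simp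
  qed
  have vs: "summable (\<lambda>n. (-1) ^ n * v n)" "summable (\<lambda>n. norm ((-1) ^ n * v n))"
  proof -
    have sq: "summable (\<lambda>n. 2 * ((real n + 1/2)\<^sup>2 * gauss (1/s) (real n + 1/2)))"
      by (intro summable_mult summable_square_gauss) (use s in auto)
    have "(real n + 1/2) * 1 \<le> (real n + 1/2) * (2 * (real n + 1/2))" for n by (rule mult_left_mono) auto
    then have "v n \<le> 2 * ((real n + 1/2)\<^sup>2 * gauss (1/s) (real n + 1/2))" for n
      unfolding v_def using mult_right_mono[OF _ gauss_nonneg[of "1/s" "real n + 1/2"], of "(real n + 1/2) * 1" "(real n + 1/2) * (2 * (real n + 1/2))"]
      by (simp add: power2_eq_square mult_ac)
    moreover have "v n \<ge> 0" for n by (simp add: v_def)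
    ultimately show "summable (\<lambda>n. norm ((-1) ^ n * v n))"
      by (intro summable_comparison_test'[OF sq]) (auto simp: abs_mult)
    then show "summable (\<lambda>n. (-1) ^ n * v n)" by (rule summable_norm_cancel)
  qed
  define V where "V = (\<Sum>n. (-1) ^ n * v n)"
  have sS: "(\<lambda>n. fourier f (real (Suc n))) sums of_real (- c * V)"
    unfolding fS V_def by (intro sums_of_real sums_mult summable_sums vs)
  have "(\<lambda>n. fourier f (- real n)) sums of_real (- c * V)"
    unfolding fN V_def by (intro sums_of_real sums_mult summable_sums vs)
  then have sN: "(\<lambda>n. fourier f (- real (Suc n))) sums (of_real (- c * V) - fourier f (- real 0))"
    by (subst sums_Suc_iff) simp
  have "((\<lambda>n::int. f (of_int n)) has_sum
     (fourier f 0 + (\<Sum>n. fourier f (real (Suc n)) + fourier f (- real (Suc n))))) UNIV"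
  proof -
    have sn: "summable (\<lambda>n. cmod (fourier f (real (Suc n))) + cmod (fourier f (- real (Suc n))))"
    proof (rule summable_add)
      have b: "summable (\<lambda>n. \<bar>c\<bar> * norm ((-1) ^ n * v n))" by (rule summable_mult[OF vs(2)])
      then show "summable (\<lambda>n. cmod (fourier f (real (Suc n))))" unfolding fS norm_of_real abs_mult[of "- c"] by simp
      have "summable (\<lambda>n. cmod (fourier f (- real n)))" using b unfolding fN norm_of_real abs_mult[of "- c"] by simp
      then show "summable (\<lambda>n. cmod (fourier f (- real (Suc n))))" by (subst summable_Suc_iff)
    qed
    have "summable (\<lambda>n. cmod (fourier f (real (Suc n)) + fourier f (- real (Suc n))))"
      by (rule summable_comparison_test'[OF sn]) (simp only: real_norm_def abs_norm_cancel norm_triangle_ineq)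
    then show ?thesis using C1 poisson_summation by blast
  qed
  also have "(\<Sum>n. fourier f (real (Suc n)) + fourier f (- real (Suc n))) = of_real (- c * V) + (of_real (- c * V) - fourier f (- real 0))"
    by (rule sums_unique[OF sums_add[OF sS sN], symmetric])
  also have "fourier f 0 + (of_real (- c * V) + (of_real (- c * V) - fourier f (- real 0))) = of_real (- (4 * pi / sqrt s) * V)"
    by (simp add: c_def)
  finally have S: "((\<lambda>n::int. f (of_int n)) has_sum of_real (- (4 * pi / sqrt s) * V)) UNIV" .
  have cz: "cis (pi * of_int n) = (-1) powi n" for n
    using cis_power_int[of pi n] by (simp add: mult.commute)
  have fz: "f (of_int n) = of_real ((-1) powi n * gauss1 s (of_int n + 1/2))" for n
    by (simp add: f_def F_def cz mult.commute)
  from has_sum_Re[OF S[unfolded fz]] show ?thesis by (simp only: Re_complex_of_real V_def v_def)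
qed

section \<open>Laplace transforms of theta-type kernels\<close>

definition gauss_cdf :: "real \<Rightarrow> real" where
  "gauss_cdf u = (\<integral>x. indicator {..u} x *\<^sub>R gauss 1 x \<partial>lborel)"

lemma integral_gauss: "(\<integral>x. gauss 1 x \<partial>lborel) = 1"
proof -
  have "complex_of_real (\<integral>x. gauss 1 x \<partial>lborel) = fourier (\<lambda>x. of_real (gauss 1 x)) 0"
    by (simp add: fourier_def)
  also have "\<dots> = 1" by (simp only: fourier_gauss[OF zero_less_one]) simp
  finally show ?thesis by simp
qed

lemma gauss_cdf_at_top: "(gauss_cdf \<longlongrightarrow> 1) at_top"
  using tendsto_integral_at_top[OF sets_lborel integrable_gauss[OF zero_less_one]]
  by (simp add: gauss_cdf_def[abs_def] integral_gauss)

lemma gauss_cdf_minus: "gauss_cdf (- u) = 1 - gauss_cdf u"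
proof -
  have i: "integrable lborel (gauss 1)" by (rule integrable_gauss) simp
  have ii: "integrable lborel (\<lambda>x. indicator A x *\<^sub>R gauss 1 x)" if "A \<in> sets lborel" for A
    by (rule integrable_mult_indicator[OF that i])
  have "gauss_cdf (- u) = (\<integral>x. indicator {..- u} (0 + (-1) * x) *\<^sub>R gauss 1 (0 + (-1) * x) \<partial>lborel)"
    unfolding gauss_cdf_def using lborel_integral_real_affine[of "-1" "\<lambda>x. indicator {..- u} x *\<^sub>R gauss 1 x" 0] by simp
  also have "\<dots> = (\<integral>x. indicator {u..} x *\<^sub>R gauss 1 x \<partial>lborel)"
    by (intro Bochner_Integration.integral_cong refl) (auto simp: indicator_def)
  also have "\<dots> = (\<integral>x. indicator {u<..} x *\<^sub>R gauss 1 x \<partial>lborel)"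
  proof (rule integral_cong_AE)
    show "AE x in lborel. indicator {u..} x *\<^sub>R gauss 1 x = indicator {u<..} x *\<^sub>R gauss 1 x"
      using AE_lborel_singleton[of u] by eventually_elim (auto simp: indicator_def)
  qed (rule borel_measurable_integrable[OF ii], simp)+
  finally have m: "gauss_cdf (- u) = (\<integral>x. indicator {u<..} x *\<^sub>R gauss 1 x \<partial>lborel)" .
  have "gauss_cdf (- u) + gauss_cdf u = (\<integral>x. indicator {u<..} x *\<^sub>R gauss 1 x + indicator {..u} x *\<^sub>R gauss 1 x \<partial>lborel)"
    unfolding m unfolding gauss_cdf_def by (rule Bochner_Integration.integral_add[OF ii ii, symmetric]) auto
  also have "\<dots> = (\<integral>x. gauss 1 x \<partial>lborel)"
    by (intro Bochner_Integration.integral_cong refl) (auto simp: indicator_def)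
  finally show ?thesis by (simp add: integral_gauss)
qed

lemma gauss_cdf_at_bot: "(gauss_cdf \<longlongrightarrow> 0) at_bot"
proof -
  have "((\<lambda>u. 1 - gauss_cdf u) \<longlongrightarrow> 1 - 1) at_top" by (intro tendsto_intros gauss_cdf_at_top)
  then have "((\<lambda>u. gauss_cdf (- u)) \<longlongrightarrow> 0) at_top" by (simp add: gauss_cdf_minus)
  then show ?thesis by (simp add: filterlim_at_bot_mirror)
qed

lemma gauss_cdf_derivative: "(gauss_cdf has_real_derivative gauss 1 u) (at u)"
proof -
  have i: "integrable lborel (gauss 1)" by (rule integrable_gauss) simp
  have ii: "integrable lborel (\<lambda>x. indicator A x *\<^sub>R gauss 1 x)" if "A \<in> sets lborel" for A
    by (rule integrable_mult_indicator[OF that i])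
  have c: "continuous_on A (gauss 1)" for A unfolding gauss_def[abs_def] by (intro continuous_intros)
  define a where "a = u - 1"
  have e: "gauss_cdf x = gauss_cdf a + integral {a..x} (gauss 1)" if "x \<ge> a" for x
  proof -
    have "gauss_cdf x = (\<integral>t. indicator {..a} t *\<^sub>R gauss 1 t + indicator {a<..x} t *\<^sub>R gauss 1 t \<partial>lborel)"
      unfolding gauss_cdf_def by (intro Bochner_Integration.integral_cong refl) (use that in \<open>auto simp: indicator_def\<close>)
    also have "\<dots> = gauss_cdf a + (\<integral>t. indicator {a<..x} t *\<^sub>R gauss 1 t \<partial>lborel)"
      unfolding gauss_cdf_def by (rule Bochner_Integration.integral_add[OF ii ii]) auto
    also have "(\<integral>t. indicator {a<..x} t *\<^sub>R gauss 1 t \<partial>lborel) = (\<integral>t. indicator {a..x} t *\<^sub>R gauss 1 t \<partial>lborel)"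
    proof (rule integral_cong_AE)
      show "AE t in lborel. indicator {a<..x} t *\<^sub>R gauss 1 t = indicator {a..x} t *\<^sub>R gauss 1 t"
        using AE_lborel_singleton[of a] by eventually_elim (auto simp: indicator_def)
    qed (rule borel_measurable_integrable[OF ii], simp)+
    also have "\<dots> = integral {a..x} (gauss 1)"
      using set_borel_integral_eq_integral(2)[of "{a..x}" "gauss 1"] ii[of "{a..x}"]
      by (simp add: set_lebesgue_integral_def set_integrable_def)
    finally show ?thesis .
  qed
  have "((\<lambda>x. integral {a..x} (gauss 1)) has_real_derivative gauss 1 u) (at u within {a..u+1})"
    by (rule integral_has_real_derivative[OF c]) (simp add: a_def)
  then have "((\<lambda>x. gauss_cdf a + integral {a..x} (gauss 1)) has_real_derivative gauss 1 u) (at u within {a..u+1})"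
    by (auto intro!: derivative_eq_intros)
  then have "((\<lambda>x. gauss_cdf a + integral {a..x} (gauss 1)) has_real_derivative gauss 1 u) (at u)"
    using at_within_interior[of u "{a..u+1}"] by (simp add: a_def interior_atLeastAtMost_real)
  then show ?thesis
  proof (rule has_field_derivative_transform_within[where d = 1])
    fix x assume "dist x u < 1"
    then have "x \<ge> a" by (auto simp: dist_real_def a_def)
    then show "gauss_cdf a + integral {a..x} (gauss 1) = gauss_cdf x" by (rule e[symmetric])
  qed auto
qed

text \<open>The density of the first passage time of Brownian motion. The primitive \<open>F\<close> in the proof
  is, up to constants, the classical closed form of the distribution function of the inverse
  Gaussian law, the first passage time with drift.\<close>

lemma levy_laplace:
  fixes a y :: real
  assumes a: "a > 0" and y: "y > 0"
  defines "f \<equiv> \<lambda>u. a / (u * sqrt u) * gauss (1/u) a * exp (- pi * u * y\<^sup>2)"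
  shows "has_bochner_integral lborel (\<lambda>u. indicator {0<..} u * f u) (exp (- 2 * pi * a * y))"
proof -
  define F where "F = (\<lambda>u. - (gauss_cdf (a / sqrt u - y * sqrt u) * exp (- 2 * pi * a * y)
     + gauss_cdf (a / sqrt u + y * sqrt u) * exp (2 * pi * a * y)))"
  have F: "(F has_real_derivative f u) (at u)" if u: "u > 0" for u
  proof -
    define r where "r = sqrt u"
    have r: "r > 0" "r * r = u" using u by (simp_all add: r_def)
    define p where "p = a / sqrt u - y * sqrt u"
    define q where "q = a / sqrt u + y * sqrt u"
    define p' where "p' = - (a / (2 * u * sqrt u)) - y / (2 * sqrt u)"
    define q' where "q' = - (a / (2 * u * sqrt u)) + y / (2 * sqrt u)"
    have dp: "((\<lambda>u. a / sqrt u - y * sqrt u) has_real_derivative p') (at u)"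
      unfolding p'_def using u by (auto intro!: derivative_eq_intros simp: field_simps)
    have dq: "((\<lambda>u. a / sqrt u + y * sqrt u) has_real_derivative q') (at u)"
      unfolding q'_def using u by (auto intro!: derivative_eq_intros simp: field_simps)
    have d: "(F has_real_derivative - (gauss 1 p * p' * exp (- 2 * pi * a * y) + gauss 1 q * q' * exp (2 * pi * a * y))) (at u)"
      unfolding F_def p_def q_def
      by (intro DERIV_minus DERIV_add DERIV_cmult_right DERIV_chain2[OF gauss_cdf_derivative] dp dq)
    have p2: "p\<^sup>2 = a\<^sup>2 / u - 2 * a * y + y\<^sup>2 * u" "q\<^sup>2 = a\<^sup>2 / u + 2 * a * y + y\<^sup>2 * u"
      using r unfolding p_def q_def r_def[symmetric] by (auto simp: power2_eq_square field_simps)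
    (* Completing the square: both Gaussian factors become the same exponential. *)
    have e1: "gauss 1 p * exp (- 2 * pi * a * y) = gauss (1/u) a * exp (- pi * u * y\<^sup>2)"
      unfolding gauss_def p2 exp_add[symmetric] by (rule arg_cong[where f = exp]) (simp add: algebra_simps)
    have e2: "gauss 1 q * exp (2 * pi * a * y) = gauss (1/u) a * exp (- pi * u * y\<^sup>2)"
      unfolding gauss_def p2 exp_add[symmetric] by (rule arg_cong[where f = exp]) (simp add: algebra_simps)
    have "gauss 1 p * p' * exp (- 2 * pi * a * y) + gauss 1 q * q' * exp (2 * pi * a * y)
       = (gauss 1 p * exp (- 2 * pi * a * y)) * p' + (gauss 1 q * exp (2 * pi * a * y)) * q'" by simp
    also have "\<dots> = (gauss (1/u) a * exp (- pi * u * y\<^sup>2)) * (p' + q')" unfolding e1 e2 by (simp add: distrib_left)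
    also have "p' + q' = - (a / (u * sqrt u))" using u by (simp add: p'_def q'_def field_simps)
    finally have "- (gauss 1 p * p' * exp (- 2 * pi * a * y) + gauss 1 q * q' * exp (2 * pi * a * y)) = f u"
      by (simp add: f_def)
    then show ?thesis using d by simp
  qed
  have sqrt_top: "filterlim sqrt at_top at_top" by (rule sqrt_at_top)
  have inv0: "filterlim (\<lambda>u. a / sqrt u) at_top (at_right 0)" using a by real_asymp
  have s0: "((\<lambda>u. y * sqrt u) \<longlongrightarrow> 0) (at_right 0)"
  proof -
    have "((\<lambda>u. y * sqrt u) \<longlongrightarrow> y * sqrt 0) (at_right 0)" by (intro tendsto_intros)
    then show ?thesis by simp
  qed
  have p0: "filterlim (\<lambda>u. a / sqrt u - y * sqrt u) at_top (at_right 0)"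
    using filterlim_tendsto_add_at_top[OF tendsto_minus[OF s0] inv0] by simp
  have q0: "filterlim (\<lambda>u. a / sqrt u + y * sqrt u) at_top (at_right 0)"
    using filterlim_tendsto_add_at_top[OF s0 inv0] by (simp add: add.commute)
  have sI: "filterlim (\<lambda>u. y * sqrt u) at_top at_top"
    by (rule filterlim_tendsto_pos_mult_at_top[OF tendsto_const y sqrt_top])
  have invI: "((\<lambda>u. a / sqrt u) \<longlongrightarrow> 0) at_top"
    by (rule tendsto_divide_0[OF tendsto_const]) (rule filterlim_at_top_imp_at_infinity[OF sqrt_top])
  have qI: "filterlim (\<lambda>u. a / sqrt u + y * sqrt u) at_top at_top"
    by (rule filterlim_tendsto_add_at_top[OF invI sI])
  have pI: "filterlim (\<lambda>u. a / sqrt u - y * sqrt u) at_bot at_top"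
  proof -
    have "filterlim (\<lambda>u. - (a / sqrt u) + y * sqrt u) at_top at_top"
      by (rule filterlim_tendsto_add_at_top[OF tendsto_minus[OF invI] sI])
    then show ?thesis by (simp add: filterlim_uminus_at_bot)
  qed
  have lim0: "(F \<longlongrightarrow> - (1 * exp (- 2 * pi * a * y) + 1 * exp (2 * pi * a * y))) (at_right 0)"
    unfolding F_def
    by (intro tendsto_minus tendsto_add tendsto_mult tendsto_const filterlim_compose[OF gauss_cdf_at_top p0] filterlim_compose[OF gauss_cdf_at_top q0])
  have limI: "(F \<longlongrightarrow> - (0 * exp (- 2 * pi * a * y) + 1 * exp (2 * pi * a * y))) at_top"
    unfolding F_def
    by (intro tendsto_minus tendsto_add tendsto_mult tendsto_const filterlim_compose[OF gauss_cdf_at_bot pI] filterlim_compose[OF gauss_cdf_at_top qI])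
  have f0: "f u \<ge> 0" if "u > 0" for u using that a by (simp add: f_def)
  have fc: "isCont f u" if "u > 0" for u
    unfolding f_def gauss_def using that by (intro continuous_intros) auto
  have B: "set_integrable lborel (einterval 0 \<infinity>) f"
    "(LBINT x=0..\<infinity>. f x) = - (0 * exp (- 2 * pi * a * y) + 1 * exp (2 * pi * a * y)) - - (1 * exp (- 2 * pi * a * y) + 1 * exp (2 * pi * a * y))"
  proof -
    have p: "(0::ereal) < \<infinity>" by simp
    have d: "(F has_real_derivative f x) (at x)" if "0 < ereal x" "ereal x < \<infinity>" for x
      by (rule F) (use that in simp)
    have c: "isCont f x" if "0 < ereal x" "ereal x < \<infinity>" for x
      by (rule fc) (use that in simp)
    have n: "AE x in lborel. 0 < ereal x \<longrightarrow> ereal x < \<infinity> \<longrightarrow> 0 \<le> f x"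
      by (intro AE_I2 impI f0) simp
    have l0: "((F \<circ> real_of_ereal) \<longlongrightarrow> - (1 * exp (- 2 * pi * a * y) + 1 * exp (2 * pi * a * y))) (at_right 0)"
      unfolding zero_ereal_def ereal_tendsto_simps1 by (rule lim0)
    have lI: "((F \<circ> real_of_ereal) \<longlongrightarrow> - (0 * exp (- 2 * pi * a * y) + 1 * exp (2 * pi * a * y))) (at_left \<infinity>)"
      unfolding ereal_tendsto_simps1 by (rule limI)
    show "set_integrable lborel (einterval 0 \<infinity>) f"
    "(LBINT x=0..\<infinity>. f x) = - (0 * exp (- 2 * pi * a * y) + 1 * exp (2 * pi * a * y)) - - (1 * exp (- 2 * pi * a * y) + 1 * exp (2 * pi * a * y))"
      by (rule interval_integral_FTC_nonneg[OF p d c n l0 lI]; assumption)+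
  qed
  have ei: "einterval 0 \<infinity> = {0::real<..}" by (auto simp: einterval_def)
  show ?thesis
    using B unfolding interval_lebesgue_integral_def ei set_integrable_def set_lebesgue_integral_def
    by (simp add: has_bochner_integral_iff)
qed

text \<open>A series of theta type in \<open>1/u\<close>: its terms are the inverse Laplace transforms of
  \<open>c\<^sub>n exp(-2\<pi>\<alpha>\<^sub>ny)\<close> as functions of \<open>\<pi>y\<^sup>2\<close>.\<close>

definition theta_kernel :: "(nat \<Rightarrow> real) \<Rightarrow> (nat \<Rightarrow> real) \<Rightarrow> real \<Rightarrow> real" where
  "theta_kernel c \<alpha> u = indicator {0<..} u * (\<Sum>n. c n * \<alpha> n * gauss (1/u) (\<alpha> n)) / (u * sqrt u)"

lemma theta_kernel_measurable [measurable]: "theta_kernel c \<alpha> \<in> borel_measurable borel"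
  unfolding theta_kernel_def[abs_def] gauss_def by measurable

text \<open>Term-by-term application of Levy's integral. The lower bound on \<open>\<alpha>\<close> makes the series
  converge absolutely at each \<open>u\<close>.\<close>

lemma theta_kernel_laplace:
  fixes c \<alpha> :: "nat \<Rightarrow> real"
  assumes y: "y > 0" and \<alpha>: "\<And>n. (real n + 1) / 2 \<le> \<alpha> n" and c: "\<And>n. \<bar>c n\<bar> \<le> C * \<alpha> n"
    and s: "summable (\<lambda>n. \<bar>c n\<bar> * exp (- 2 * pi * \<alpha> n * y))"
  shows "has_bochner_integral lborel (\<lambda>u. theta_kernel c \<alpha> u * exp (- pi * u * y\<^sup>2)) (\<Sum>n. c n * exp (- 2 * pi * \<alpha> n * y))"
proof -
  have \<alpha>0: "\<alpha> n > 0" for n using \<alpha>[of n] by (rule order.strict_trans2[rotated]) simp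
  define f where "f = (\<lambda>n u. c n * (indicator {0<..} u * (\<alpha> n / (u * sqrt u) * gauss (1/u) (\<alpha> n) * exp (- pi * u * y\<^sup>2))))"
  have fi: "has_bochner_integral lborel (f n) (c n * exp (- 2 * pi * \<alpha> n * y))" for n
    unfolding f_def by (intro has_bochner_integral_mult_right levy_laplace \<alpha>0 y)
  have nf: "norm (f n u) = \<bar>c n\<bar> * (indicator {0<..} u * (\<alpha> n / (u * sqrt u) * gauss (1/u) (\<alpha> n) * exp (- pi * u * y\<^sup>2)))" for n u
    using \<alpha>0[of n] by (auto simp: f_def abs_mult indicator_def)
  have ni: "(\<integral>u. norm (f n u) \<partial>lborel) = \<bar>c n\<bar> * exp (- 2 * pi * \<alpha> n * y)" for n
    unfolding nf by (rule has_bochner_integral_integral_eq) (intro has_bochner_integral_mult_right levy_laplace \<alpha>0 y)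
  have C: "C \<ge> 0" using order_trans[OF abs_ge_zero c[of 0]] \<alpha>0[of 0] by (simp add: zero_le_mult_iff)
  have sg: "summable (\<lambda>n. \<bar>c n\<bar> * \<alpha> n * gauss (1/u) (\<alpha> n))" if u: "u > 0" for u
  proof (rule summable_comparison_test')
    show "summable (\<lambda>n. C * ((\<alpha> n)\<^sup>2 * gauss (1/u) (\<alpha> n)))"
      by (intro summable_mult summable_square_gauss \<alpha>) (use u in simp)
    fix n
    have "\<bar>c n\<bar> * (\<alpha> n * gauss (1/u) (\<alpha> n)) \<le> C * \<alpha> n * (\<alpha> n * gauss (1/u) (\<alpha> n))"
      by (intro mult_right_mono c) (use \<alpha>0[of n] in simp)
    then show "norm (\<bar>c n\<bar> * \<alpha> n * gauss (1/u) (\<alpha> n)) \<le> C * ((\<alpha> n)\<^sup>2 * gauss (1/u) (\<alpha> n))"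
      using \<alpha>0[of n] by (simp add: abs_mult power2_eq_square mult_ac)
  qed
  have sn: "summable (\<lambda>n. norm (f n u))" for u
  proof (cases "u > 0")
    case True
    have "summable (\<lambda>n. (exp (- pi * u * y\<^sup>2) / (u * sqrt u)) * (\<bar>c n\<bar> * \<alpha> n * gauss (1/u) (\<alpha> n)))"
      by (rule summable_mult[OF sg[OF True]])
    then show ?thesis unfolding nf using True by (simp add: mult_ac)
  qed (simp add: f_def)
  have sf: "(\<Sum>n. f n u) = theta_kernel c \<alpha> u * exp (- pi * u * y\<^sup>2)" for u
  proof (cases "u > 0")
    case True
    have "summable (\<lambda>n. c n * \<alpha> n * gauss (1/u) (\<alpha> n))"
      by (rule summable_norm_cancel) (use sg[OF True] \<alpha>0 in \<open>simp add: abs_mult less_imp_le\<close>)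
    then have "(\<Sum>n. (exp (- pi * u * y\<^sup>2) / (u * sqrt u)) * (c n * \<alpha> n * gauss (1/u) (\<alpha> n))) =
       (exp (- pi * u * y\<^sup>2) / (u * sqrt u)) * (\<Sum>n. c n * \<alpha> n * gauss (1/u) (\<alpha> n))"
      by (rule suminf_mult)
    moreover have "f n u = (exp (- pi * u * y\<^sup>2) / (u * sqrt u)) * (c n * \<alpha> n * gauss (1/u) (\<alpha> n))" for n
      using True by (simp add: f_def)
    ultimately show ?thesis using True by (simp add: theta_kernel_def)
  qed (simp add: f_def theta_kernel_def)
  have fint: "integrable lborel (f n)" for n using fi by (auto simp: has_bochner_integral_iff)
  have "has_bochner_integral lborel (\<lambda>u. \<Sum>n. f n u) (\<Sum>n. integral\<^sup>L lborel (f n))"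
    unfolding has_bochner_integral_iff
    by (intro conjI integrable_suminf integral_suminf fint AE_I2 sn; simp only: ni s)
  then show ?thesis
    unfolding sf using has_bochner_integral_integral_eq[OF fi] by simp
qed

section \<open>Positivity and boundedness of the three kernels\<close>

text \<open>The coefficients of these three kernels come from expanding \<open>\<pi>/sinh\<^sup>2(\<pi>y)\<close>,
  \<open>\<pi>/cosh\<^sup>2(\<pi>y)\<close> and \<open>1/cosh(\<pi>y)\<close> in powers of \<open>exp(-2\<pi>y)\<close>.\<close>

definition majorant_kernel :: "real \<Rightarrow> real" where
  "majorant_kernel = theta_kernel (\<lambda>n. 4 * pi * real (Suc n)) (\<lambda>n. real (Suc n))"

definition minorant_kernel :: "real \<Rightarrow> real" where
  "minorant_kernel = theta_kernel (\<lambda>n. (-1) ^ n * (4 * pi * real (Suc n))) (\<lambda>n. real (Suc n))"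

definition best_kernel :: "real \<Rightarrow> real" where
  "best_kernel = theta_kernel (\<lambda>n. (-1) ^ n * 2) (\<lambda>n. real n + 1/2)"

lemma sinh_cosh_exp:
  fixes y :: real
  defines "q \<equiv> exp (- 2 * pi * y)"
  shows "4 * q * (sinh (pi * y))\<^sup>2 = (1 - q)\<^sup>2" "4 * q * (cosh (pi * y))\<^sup>2 = (1 + q)\<^sup>2"
    "2 * exp (- pi * y) * cosh (pi * y) = 1 + q"
proof -
  define E where "E = exp (pi * y)"
  have E: "E > 0" by (simp add: E_def)
  have "- 2 * pi * y = - (pi * y + pi * y)" by simp
  then have q: "q = 1 / (E * E)" unfolding q_def E_def by (simp only: exp_minus exp_add inverse_eq_divide)
  have s: "sinh (pi * y) = (E - 1 / E) / 2" "cosh (pi * y) = (E + 1 / E) / 2" "exp (- pi * y) = 1 / E"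
    by (simp_all add: sinh_field_def cosh_field_def E_def exp_minus inverse_eq_divide)
  show "4 * q * (sinh (pi * y))\<^sup>2 = (1 - q)\<^sup>2" "4 * q * (cosh (pi * y))\<^sup>2 = (1 + q)\<^sup>2"
    "2 * exp (- pi * y) * cosh (pi * y) = 1 + q"
    unfolding q s using E by (simp_all add: field_simps power2_eq_square)
qed

lemma exp_Suc_power:
  "exp (- 2 * pi * real (Suc n) * y) = exp (- 2 * pi * y) * exp (- 2 * pi * y) ^ n"
  by (simp add: exp_of_nat_mult[symmetric] exp_add[symmetric] algebra_simps)

lemma majorant_kernel_laplace:
  assumes y: "y > 0"
  shows "has_bochner_integral lborel (\<lambda>u. majorant_kernel u * exp (- pi * u * y\<^sup>2)) (pi / (sinh (pi * y))\<^sup>2)"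
proof -
  define q where "q = exp (- 2 * pi * y)"
  have q: "0 < q" "q < 1" using y by (simp_all add: q_def)
  have "(\<lambda>n. real (Suc n) * q ^ n) sums (1 / (1 - q)\<^sup>2)" by (rule geometric_deriv_sums) (use q in simp)
  then have "(\<lambda>n. (4 * pi * q) * (real (Suc n) * q ^ n)) sums ((4 * pi * q) * (1 / (1 - q)\<^sup>2))" by (rule sums_mult)
  moreover have "(4 * pi * q) * (1 / (1 - q)\<^sup>2) = pi / (sinh (pi * y))\<^sup>2"
    using sinh_cosh_exp(1)[of y] q y unfolding q_def[symmetric] by (simp add: field_simps)
  moreover have "(4 * pi * q) * (real (Suc n) * q ^ n) = 4 * pi * real (Suc n) * exp (- 2 * pi * real (Suc n) * y)" for n
    unfolding exp_Suc_power q_def by (simp add: mult_ac)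
  ultimately have s: "(\<lambda>n. 4 * pi * real (Suc n) * exp (- 2 * pi * real (Suc n) * y)) sums (pi / (sinh (pi * y))\<^sup>2)"
    by (simp only:)
  have "has_bochner_integral lborel (\<lambda>u. majorant_kernel u * exp (- pi * u * y\<^sup>2)) (\<Sum>n. 4 * pi * real (Suc n) * exp (- 2 * pi * real (Suc n) * y))"
    unfolding majorant_kernel_def
    by (rule theta_kernel_laplace[OF y, where C = "4 * pi"]) (use sums_summable[OF s] in \<open>auto simp: abs_mult\<close>)
  then show ?thesis using sums_unique[OF s] by simp
qed

lemma minorant_kernel_laplace:
  assumes y: "y > 0"
  shows "has_bochner_integral lborel (\<lambda>u. minorant_kernel u * exp (- pi * u * y\<^sup>2)) (pi / (cosh (pi * y))\<^sup>2)"
proof -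
  define q where "q = exp (- 2 * pi * y)"
  have q: "0 < q" "q < 1" using y by (simp_all add: q_def)
  have "(\<lambda>n. real (Suc n) * (- q) ^ n) sums (1 / (1 - (- q))\<^sup>2)" by (rule geometric_deriv_sums) (use q in simp)
  then have "(\<lambda>n. (4 * pi * q) * (real (Suc n) * (- q) ^ n)) sums ((4 * pi * q) * (1 / (1 - (- q))\<^sup>2))" by (rule sums_mult)
  moreover have "(4 * pi * q) * (1 / (1 - (- q))\<^sup>2) = pi / (cosh (pi * y))\<^sup>2"
    using sinh_cosh_exp(2)[of y] q y cosh_real_pos[of "pi * y"] unfolding q_def[symmetric] by (simp add: field_simps)
  moreover have "(4 * pi * q) * (real (Suc n) * (- q) ^ n) = (-1) ^ n * (4 * pi * real (Suc n)) * exp (- 2 * pi * real (Suc n) * y)" for n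
    unfolding exp_Suc_power q_def[symmetric] power_minus[of q] by (simp add: mult_ac)
  ultimately have s: "(\<lambda>n. (-1) ^ n * (4 * pi * real (Suc n)) * exp (- 2 * pi * real (Suc n) * y)) sums (pi / (cosh (pi * y))\<^sup>2)"
    by (simp only:)
  have sa: "summable (\<lambda>n. \<bar>(-1) ^ n * (4 * pi * real (Suc n))\<bar> * exp (- 2 * pi * real (Suc n) * y))"
  proof -
    have "summable (\<lambda>n. (4 * pi * q) * (real (Suc n) * q ^ n))"
      by (intro summable_mult sums_summable[OF geometric_deriv_sums]) (use q in simp)
    moreover have "(4 * pi * q) * (real (Suc n) * q ^ n) = \<bar>(-1) ^ n * (4 * pi * real (Suc n))\<bar> * exp (- 2 * pi * real (Suc n) * y)" for n
      unfolding exp_Suc_power q_def by (simp add: mult_ac abs_mult)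
    ultimately show ?thesis by (simp only:)
  qed
  have "has_bochner_integral lborel (\<lambda>u. minorant_kernel u * exp (- pi * u * y\<^sup>2)) (\<Sum>n. (-1) ^ n * (4 * pi * real (Suc n)) * exp (- 2 * pi * real (Suc n) * y))"
    unfolding minorant_kernel_def
    by (rule theta_kernel_laplace[OF y _ _ sa, where C = "4 * pi"]) (auto simp: abs_mult)
  then show ?thesis using sums_unique[OF s] by simp
qed

lemma best_kernel_laplace:
  assumes y: "y > 0"
  shows "has_bochner_integral lborel (\<lambda>u. best_kernel u * exp (- pi * u * y\<^sup>2)) (1 / cosh (pi * y))"
proof -
  define q where "q = exp (- 2 * pi * y)"
  have q: "0 < q" "q < 1" using y by (simp_all add: q_def)
  have e: "exp (- 2 * pi * (real n + 1/2) * y) = exp (- pi * y) * q ^ n" for n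
    unfolding q_def exp_of_nat_mult[symmetric] exp_add[symmetric] by (simp add: algebra_simps)
  have "(\<lambda>n. (2 * exp (- pi * y)) * (- q) ^ n) sums ((2 * exp (- pi * y)) * (1 / (1 - (- q))))"
    by (intro sums_mult geometric_sums) (use q in simp)
  moreover have "(2 * exp (- pi * y)) * (1 / (1 - (- q))) = 1 / cosh (pi * y)"
    using sinh_cosh_exp(3)[of y] q cosh_real_pos[of "pi * y"] unfolding q_def[symmetric] by (simp add: field_simps)
  moreover have "(2 * exp (- pi * y)) * (- q) ^ n = (-1) ^ n * 2 * exp (- 2 * pi * (real n + 1/2) * y)" for n
    unfolding e power_minus[of q] by simp
  ultimately have s: "(\<lambda>n. (-1) ^ n * 2 * exp (- 2 * pi * (real n + 1/2) * y)) sums (1 / cosh (pi * y))"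
    by (simp only:)
  have sa: "summable (\<lambda>n. \<bar>(-1) ^ n * 2\<bar> * exp (- 2 * pi * (real n + 1/2) * y))"
    unfolding e using q by (auto simp: abs_mult intro!: summable_mult summable_geometric)
  have "has_bochner_integral lborel (\<lambda>u. best_kernel u * exp (- pi * u * y\<^sup>2)) (\<Sum>n. (-1) ^ n * 2 * exp (- 2 * pi * (real n + 1/2) * y))"
    unfolding best_kernel_def
    by (rule theta_kernel_laplace[OF y _ _ sa, where C = 4]) (auto simp: abs_mult)
  then show ?thesis using sums_unique[OF s] by simp
qed

text \<open>For \<open>s \<ge> 1\<close> and \<open>x \<ge> 1/2\<close> the Gaussian loses a factor \<open>exp(-2\<pi>) < 1/9\<close> over a unit step
  while \<open>x\<^sup>k\<close> gains at most \<open>3\<^sup>2\<close>.\<close>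

lemma power_gauss_decreasing:
  assumes s: "s \<ge> 1" and x: "x \<ge> 1/2" and k: "k \<le> 2"
  shows "(x + 1) ^ k * gauss s (x + 1) \<le> x ^ k * gauss s x"
proof -
  have "1 + 2 * pi + (2 * pi)\<^sup>2 / 2 \<le> exp (2 * pi)" by (rule exp_lower_Taylor_quadratic) simp
  moreover have "6 * 6 \<le> 2 * pi * (2 * pi)" by (rule mult_mono) (use pi_gt3 in auto)
  ultimately have e9: "9 \<le> exp (2 * pi)" using pi_gt3 by (simp add: power2_eq_square)
  have "gauss s (x + 1) = gauss s x * exp (- (pi * s * (2 * x + 1)))"
    unfolding gauss_def exp_add[symmetric] by (simp add: power2_eq_square algebra_simps)
  also have "\<dots> \<le> gauss s x * exp (- (2 * pi))"
  proof -
    have "2 * pi * 1 \<le> pi * (2 * x + 1) * s" by (rule mult_mono) (use x s in auto)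
    then show ?thesis by (intro mult_left_mono) (auto simp: mult_ac)
  qed
  finally have g: "gauss s (x + 1) \<le> gauss s x * exp (- (2 * pi))" .
  have "(x + 1) ^ k \<le> (3 * x) ^ k" by (rule power_mono) (use x in auto)
  also have "\<dots> = 3 ^ k * x ^ k" by (simp add: power_mult_distrib)
  also have "\<dots> \<le> 3 ^ 2 * x ^ k" by (intro mult_right_mono power_increasing k) (use x in auto)
  finally have "(x + 1) ^ k * gauss s (x + 1) \<le> (9 * x ^ k) * (gauss s x * exp (- (2 * pi)))"
    by (intro mult_mono g) (use x in auto)
  also have "\<dots> = x ^ k * gauss s x * (9 * exp (- (2 * pi)))" by simp
  also have "\<dots> \<le> x ^ k * gauss s x * 1"
    by (rule mult_left_mono) (use e9 x in \<open>auto simp: exp_minus field_simps\<close>)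
  finally show ?thesis by simp
qed

text \<open>Leibniz' criterion, which is what makes the alternating kernels nonnegative for small
  \<open>u\<close>.\<close>

lemma alternating_gauss_sum_bounds:
  assumes s: "s \<ge> 1" and \<alpha>: "\<alpha> = (\<lambda>n. real n + x)" and x: "x \<ge> 1/2" and k: "1 \<le> k" "k \<le> 2"
  shows "0 \<le> (\<Sum>n. (-1) ^ n * (\<alpha> n ^ k * gauss s (\<alpha> n)))"
    "(\<Sum>n. (-1) ^ n * (\<alpha> n ^ k * gauss s (\<alpha> n))) \<le> x ^ k * gauss s x"
proof -
  define a where "a = (\<lambda>n. \<alpha> n ^ k * gauss s (\<alpha> n))"
  have \<alpha>p: "\<alpha> n \<ge> (real n + 1) / 2" "\<alpha> n > 0" for n using x by (auto simp: \<alpha>)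
  have sq: "summable (\<lambda>n. 2 * ((\<alpha> n)\<^sup>2 * gauss s (\<alpha> n)))"
    by (intro summable_mult summable_square_gauss \<alpha>p) (use s in simp)
  have "a n \<le> 2 * ((\<alpha> n)\<^sup>2 * gauss s (\<alpha> n))" for n
  proof -
    have "\<alpha> n * 1 \<le> \<alpha> n * (2 * \<alpha> n)" by (rule mult_left_mono) (use x \<alpha>p(2)[of n] in \<open>auto simp: \<alpha>\<close>)
    moreover have "k = 1 \<or> k = 2" using k by auto
    ultimately have "\<alpha> n ^ k \<le> 2 * (\<alpha> n)\<^sup>2" using k \<alpha>p(2)[of n] by (auto simp: power2_eq_square)
    from mult_right_mono[OF this, of "gauss s (\<alpha> n)"] show ?thesis by (simp add: a_def mult_ac)
  qed
  moreover have a0: "a n \<ge> 0" for n using \<alpha>p(2)[of n] by (simp add: a_def)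
  ultimately have "summable a" by (intro summable_comparison_test'[OF sq]) auto
  then have lim: "a \<longlonglongrightarrow> 0" by (rule summable_LIMSEQ_zero)
  have dec: "a (Suc n) \<le> a n" for n
    using power_gauss_decreasing[OF s, of "\<alpha> n" k] k x by (simp add: a_def \<alpha> add_ac)
  from summable_Leibniz'(2)[OF lim a0 dec, of 0] summable_Leibniz'(4)[OF lim a0 dec, of 0]
  show "0 \<le> (\<Sum>n. (-1) ^ n * (\<alpha> n ^ k * gauss s (\<alpha> n)))"
    "(\<Sum>n. (-1) ^ n * (\<alpha> n ^ k * gauss s (\<alpha> n))) \<le> x ^ k * gauss s x"
    by (simp_all add: a_def \<alpha>)
qed

text \<open>Sums over the half-integers \<open>n + 1/2\<close> fold at the reflection \<open>n \<mapsto> -1-n\<close>.\<close>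

lemma has_sum_int_fold:
  fixes f :: "int \<Rightarrow> real"
  assumes f: "(f has_sum S) UNIV" and sym: "\<And>n. f (- 1 - n) = f n"
  shows "(\<lambda>n. 2 * f (int n)) sums S"
proof -
  have "(\<Sum>n\<in>{- int N..<int N}. f n) = (\<Sum>n<N. 2 * f (int n))" for N
  proof (induction N)
    case (Suc N)
    have "{- int (Suc N)..<int (Suc N)} = insert (int N) (insert (- 1 - int N) {- int N..<int N})" by auto
    then show ?case using Suc sym[of "int N"] by simp
  qed simp
  then show ?thesis using has_sum_int_symmetric_limit[OF f] by (simp add: sums_def)
qed

text \<open>All terms are nonnegative. For \<open>u < 1\<close> the terms decay geometrically, uniformly in \<open>u\<close>.
  For \<open>u \<ge> 1\<close> the dual series has one negative term, that of \<open>n = 0\<close>, and it enters the kernel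
  with the opposite sign; hence it alone bounds the kernel.\<close>

lemma majorant_kernel_bounds: "\<exists>C. \<forall>u. 0 \<le> majorant_kernel u \<and> majorant_kernel u \<le> C"
proof -
  have 0: "0 \<le> majorant_kernel u" for u
  proof -
    have "0 \<le> (\<Sum>n. 4 * pi * real (Suc n) * real (Suc n) * gauss (1/u) (real (Suc n)))" if "u > 0"
    proof (rule suminf_nonneg)
      have "summable (\<lambda>n. (4 * pi) * ((real (Suc n))\<^sup>2 * gauss (1/u) (real (Suc n))))"
        by (intro summable_mult summable_square_gauss) (use that in auto)
      then show "summable (\<lambda>n. 4 * pi * real (Suc n) * real (Suc n) * gauss (1/u) (real (Suc n)))"
        by (simp add: power2_eq_square mult_ac del: of_nat_Suc)
    qed (simp del: of_nat_Suc)
    then show ?thesis by (auto simp: majorant_kernel_def theta_kernel_def indicator_def simp del: of_nat_Suc)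
  qed
  define q where "q = exp (-1 :: real)"
  have q: "0 < q" "q < 1" by (simp_all add: q_def)
  have small: "majorant_kernel u \<le> 8 * pi / (1 - q)" if u: "0 < u" "u < 1" for u
  proof -
    define s where "s = 1 / u"
    have s: "s \<ge> 1" using u by (simp add: s_def)
    define t where "t = (\<lambda>n. s * sqrt s * (4 * pi * real (Suc n) * real (Suc n) * gauss s (real (Suc n))))"
    have us: "1 / (u * sqrt u) = s * sqrt s" using u by (simp add: s_def real_sqrt_divide)
    have sm: "summable (\<lambda>n. 4 * pi * real (Suc n) * real (Suc n) * gauss s (real (Suc n)))"
    proof -
      have "summable (\<lambda>n. (4 * pi) * ((real (Suc n))\<^sup>2 * gauss s (real (Suc n))))"
        by (intro summable_mult summable_square_gauss) (use s in auto)
      then show ?thesis by (simp add: power2_eq_square mult_ac del: of_nat_Suc)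
    qed
    have k: "majorant_kernel u = (\<Sum>n. t n)"
    proof -
      have "majorant_kernel u = (1 / (u * sqrt u)) * (\<Sum>n. 4 * pi * real (Suc n) * real (Suc n) * gauss s (real (Suc n)))"
        using u by (simp add: majorant_kernel_def theta_kernel_def s_def del: of_nat_Suc)
      then show ?thesis unfolding us t_def by (simp only: suminf_mult[OF sm])
    qed
    have tb: "t n \<le> 8 * pi * q ^ n" for n
    proof -
      define m where "m = real (Suc n)"
      have m: "m \<ge> 1" by (simp add: m_def)
      define y where "y = s * m\<^sup>2"
      have y: "y \<ge> m" "y > 0"
      proof -
        have "1 * (m * 1) \<le> s * (m * m)" by (intro mult_mono) (use s m in auto)
        then show "y \<ge> m" by (simp add: y_def power2_eq_square)
        then show "y > 0" using m by linarith
      qed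
      have "sqrt s \<le> s" using s real_sqrt_le_mono[of s "s\<^sup>2"] by (simp add: power2_eq_square)
      then have "s * sqrt s * m\<^sup>2 \<le> s * s * (m\<^sup>2 * m\<^sup>2)"
        using s m by (intro mult_mono) (auto simp: power2_eq_square mult_ge1_I)
      also have "\<dots> = y\<^sup>2" by (simp add: y_def power2_eq_square)
      finally have 1: "s * sqrt s * m\<^sup>2 \<le> y\<^sup>2" .
      have "y\<^sup>2 / 2 \<le> exp y" using exp_lower_Taylor_quadratic[of y] y by simp
      then have 2: "y\<^sup>2 * exp (- (pi * y)) \<le> 2 * exp y * exp (- (pi * y))" by (intro mult_right_mono) auto
      have 3: "exp y * exp (- (pi * y)) \<le> exp (- real n)"
      proof -
        have "2 * y \<le> pi * y" using y pi_gt3 by (intro mult_right_mono) auto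
        then have "y + - (pi * y) \<le> - real n" using y(1) unfolding m_def by linarith
        then show ?thesis unfolding exp_add[symmetric] by simp
      qed
      have "t n = 4 * pi * (s * sqrt s * m\<^sup>2 * exp (- (pi * y)))"
        unfolding t_def m_def[symmetric] by (simp add: gauss_def y_def power2_eq_square mult_ac)
      also have "\<dots> \<le> 4 * pi * (y\<^sup>2 * exp (- (pi * y)))"
        by (intro mult_left_mono mult_right_mono 1) auto
      also have "y\<^sup>2 * exp (- (pi * y)) \<le> 2 * (exp y * exp (- (pi * y)))" using 2 by (simp only: mult.assoc)
      also have "\<dots> \<le> 2 * exp (- real n)" by (intro mult_left_mono 3) simp
      also have "exp (- real n) = q ^ n" by (simp add: q_def exp_of_nat_mult[symmetric])
      finally show ?thesis by simp
    qed
    have "(\<Sum>n. t n) \<le> (\<Sum>n. 8 * pi * q ^ n)"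
      by (rule suminf_le[OF tb]) (use q sm in \<open>auto simp: t_def intro!: summable_mult summable_geometric\<close>)
    also have "\<dots> = 8 * pi / (1 - q)" using q by (simp add: suminf_mult suminf_geometric)
    finally show ?thesis by (simp add: k)
  qed
  have large: "majorant_kernel u \<le> 1" if u: "u \<ge> 1" for u
  proof -
    define T where "T = (\<Sum>n. (real (Suc n))\<^sup>2 * gauss (1/u) (real (Suc n)))"
    have sm: "summable (\<lambda>n. (real (Suc n))\<^sup>2 * gauss (1/u) (real (Suc n)))"
      by (rule summable_square_gauss) (use u in auto)
    have S: "((\<lambda>n::int. gauss2 u (of_int n)) has_sum (- (8 * pi\<^sup>2 / sqrt u) * T)) UNIV"
      using theta_second_derivative[of u 0] u by (simp add: T_def)
    have z: "((\<lambda>n::int. if n = 0 then gauss2 u 0 else 0) has_sum gauss2 u 0) UNIV"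
      by (rule has_sum_finite_neutralI[of "{0}"]) auto
    (* All other terms are nonnegative since \<open>2\<pi>u n\<^sup>2 \<ge> 1\<close>. *)
    have "gauss2 u 0 \<le> - (8 * pi\<^sup>2 / sqrt u) * T"
    proof (rule has_sum_mono[OF z S])
      fix n :: int
      show "(if n = 0 then gauss2 u 0 else 0) \<le> gauss2 u (of_int n)"
      proof (cases "n = 0")
        case False
        then have "1 \<le> \<bar>real_of_int n\<bar>" by linarith
        then have "1 \<le> (real_of_int n)\<^sup>2" by (simp add: abs_le_square_iff[of 1, simplified])
        then have "(2 * pi * u) * 1 \<le> (2 * pi * u) * ((2 * pi * u) * (real_of_int n)\<^sup>2)"
        proof (intro mult_left_mono)
          assume "1 \<le> (real_of_int n)\<^sup>2"
          then have "1 * 1 \<le> (2 * pi * u) * (real_of_int n)\<^sup>2"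
          proof (intro mult_mono)
            have "1 * 1 \<le> (2 * pi) * u" by (rule mult_mono) (use u pi_gt3 in auto)
            then show "1 \<le> 2 * pi * u" by simp
          qed (use u in auto)
          then show "1 \<le> (2 * pi * u) * (real_of_int n)\<^sup>2" by simp
        qed (use u in auto)
        then show ?thesis using False by (simp add: gauss2_def power2_eq_square mult_ac)
      qed simp
    qed
    then have "(8 * pi\<^sup>2 / sqrt u) * T \<le> 2 * pi * u" by (simp add: gauss2_def)
    then have "(8 * pi\<^sup>2 / sqrt u) * T / (2 * pi * u) \<le> 1" using u by (simp add: divide_le_eq)
    also have "(8 * pi\<^sup>2 / sqrt u) * T / (2 * pi * u) = (4 * pi / (u * sqrt u)) * T"
      using u by (simp add: field_simps power2_eq_square)
    also have "\<dots> = majorant_kernel u"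
    proof -
      have "4 * pi * real (Suc n) * real (Suc n) * gauss (1/u) (real (Suc n)) = (4 * pi) * ((real (Suc n))\<^sup>2 * gauss (1/u) (real (Suc n)))" for n
        by (simp add: power2_eq_square)
      then show ?thesis
        unfolding majorant_kernel_def theta_kernel_def T_def using u by (simp only: suminf_mult[OF sm]) simp
    qed
    finally show ?thesis .
  qed
  have "majorant_kernel u \<le> max (8 * pi / (1 - q)) 1" for u
  proof (cases "0 < u")
    case False then show ?thesis by (simp add: majorant_kernel_def theta_kernel_def)
  next
    case True then show ?thesis using small[of u] large[of u] by (cases "u < 1") (simp_all add: le_max_iff_disj)
  qed
  then show ?thesis using 0 by blast
qed

lemma square_exp_le: "s > 0 \<Longrightarrow> c > 0 \<Longrightarrow> s\<^sup>2 * exp (- (c * s)) \<le> 2 / c\<^sup>2" for s c :: real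
proof -
  assume sc: "s > 0" "c > 0"
  have "t\<^sup>2 \<le> 2 * exp t" if "t > 0" for t :: real
    using exp_lower_Taylor_quadratic[of t] that by linarith
  from this[of "c * s"] have "(c * s)\<^sup>2 \<le> 2 * exp (c * s)" using sc by simp
  then have "c\<^sup>2 * (s\<^sup>2 * exp (- (c * s))) \<le> 2" by (simp add: exp_minus field_simps power_mult_distrib)
  then show ?thesis using sc by (simp add: pos_le_divide_eq mult.commute)
qed

text \<open>For \<open>u < 1\<close> the series is alternating with decreasing terms. For \<open>u \<ge> 1\<close> the dual series
  runs over half-integers, where the second derivative of the Gaussian is positive because
  \<open>2\<pi>u/4 > 1\<close>.\<close>

lemma minorant_kernel_bounds: "\<exists>C. \<forall>u. 0 \<le> minorant_kernel u \<and> minorant_kernel u \<le> C"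
proof -
  define q where "q = exp (-1 :: real)"
  have q: "0 < q" "q < 1" by (simp_all add: q_def)
  define T where "T = (\<lambda>s. \<Sum>n. (-1) ^ n * ((real n + 1) ^ 2 * gauss s (real n + 1)))"
  have sm: "summable (\<lambda>n. (-1) ^ n * ((real n + 1) ^ 2 * gauss s (real n + 1)))" if "s > 0" for s
    by (rule summable_norm_cancel) (use summable_square_gauss[OF that, of "\<lambda>n. real n + 1"] in \<open>simp add: abs_mult\<close>)
  have kT: "minorant_kernel u = 4 * pi / (u * sqrt u) * T (1/u)" if u: "u > 0" for u
  proof -
    have "(-1) ^ n * (4 * pi * real (Suc n)) * real (Suc n) * gauss (1/u) (real (Suc n)) = (4 * pi) * ((-1) ^ n * ((real n + 1) ^ 2 * gauss (1/u) (real n + 1)))" for n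
      by (simp add: power2_eq_square mult_ac add_ac)
    moreover have "1/u > 0" using u by simp
    ultimately show ?thesis
      unfolding minorant_kernel_def theta_kernel_def T_def using u by (simp only: suminf_mult[OF sm]) simp
  qed
  have small: "0 \<le> minorant_kernel u \<and> minorant_kernel u \<le> 8 * pi" if u: "0 < u" "u < 1" for u
  proof -
    define s where "s = 1 / u"
    have s: "s \<ge> 1" using u by (simp add: s_def)
    have us: "4 * pi / (u * sqrt u) = 4 * pi * (s * sqrt s)" using u by (simp add: s_def real_sqrt_divide)
    have T: "0 \<le> T s" "T s \<le> gauss s 1"
      using alternating_gauss_sum_bounds[OF s refl, of 1 2] by (simp_all add: T_def)
    have "s * sqrt s * T s \<le> (s * s) * gauss s 1"
      by (intro mult_mono T mult_left_mono) (use s real_sqrt_le_mono[of s "s\<^sup>2"] T in \<open>auto simp: power2_eq_square\<close>)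
    also have "\<dots> \<le> 2 / pi\<^sup>2" using square_exp_le[of s pi] s by (simp add: gauss_def power2_eq_square mult_ac)
    also have "\<dots> \<le> 2" using pi_gt3 mult_mono[of 1 pi 1 pi] by (simp add: field_simps power2_eq_square)
    finally have "s * sqrt s * T s \<le> 2" .
    from mult_left_mono[OF this, of "4 * pi"] T s show ?thesis unfolding kT[OF u(1)] us s_def[symmetric] by simp
  qed
  have large: "0 \<le> minorant_kernel u \<and> minorant_kernel u \<le> 8 / (1 - q)" if u: "u \<ge> 1" for u
  proof -
    define \<phi> where "\<phi> = (\<lambda>n::int. gauss2 u (of_int n + 1/2) / (2 * pi * u))"
    have c: "cos (2 * pi * real (Suc n) * (1/2)) = - ((-1) ^ n)" for n
      using cos_npi[of "Suc n"] by (simp only: mult.assoc) (simp add: mult_ac del: of_nat_Suc)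
    have sm': "summable (\<lambda>n. (-1) ^ n * ((real n + 1) ^ 2 * gauss (1/u) (real n + 1)))" by (rule sm) (use u in simp)
    have "(\<Sum>n. cos (2 * pi * real (Suc n) * (1/2)) * ((real (Suc n))\<^sup>2 * gauss (1/u) (real (Suc n)))) = - T (1/u)"
      unfolding c T_def suminf_minus[OF sm', symmetric] by (simp add: add_ac)
    then have "((\<lambda>n::int. gauss2 u (of_int n + 1/2)) has_sum (- (8 * pi\<^sup>2 / sqrt u) * - T (1/u))) UNIV"
      using theta_second_derivative[of u "1/2"] u by simp
    from has_sum_cmult_right[OF this, of "1 / (2 * pi * u)"]
    have "(\<phi> has_sum (1 / (2 * pi * u) * (- (8 * pi\<^sup>2 / sqrt u) * - T (1/u)))) UNIV" by (simp add: \<phi>_def)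
    also have "1 / (2 * pi * u) * (- (8 * pi\<^sup>2 / sqrt u) * - T (1/u)) = minorant_kernel u"
      using u by (simp add: kT field_simps power2_eq_square)
    finally have S: "(\<phi> has_sum minorant_kernel u) UNIV" .
    have e: "\<phi> n = (2 * pi * u * (of_int n + 1/2)\<^sup>2 - 1) * gauss u (of_int n + 1/2)" for n
      using u by (simp add: \<phi>_def gauss2_def field_simps power2_eq_square)
    have sym: "\<phi> (- 1 - n) = \<phi> n" for n
    proof -
      have "real_of_int (- 1 - n) + 1/2 = - (of_int n + 1/2)" by simp
      then show ?thesis unfolding e by (simp only: gauss_minus power2_minus)
    qed
    have s2: "(\<lambda>n. 2 * \<phi> (int n)) sums minorant_kernel u" by (rule has_sum_int_fold[OF S sym])
    have p0: "\<phi> (int n) \<ge> 0" and p1: "\<phi> (int n) \<le> 4 * q ^ n" for n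
    proof -
      define m where "m = real n + 1/2"
      have m2: "m\<^sup>2 \<ge> 1/4" "m\<^sup>2 \<ge> real n" by (simp_all add: m_def power2_eq_square algebra_simps)
      have f: "\<phi> (int n) = (2 * pi * u * m\<^sup>2 - 1) * gauss u m" by (simp add: e m_def)
      have "6 * (1/4) \<le> (2 * pi * u) * m\<^sup>2"
      proof (rule mult_mono)
        have "6 * 1 \<le> 2 * pi * u" by (rule mult_mono) (use u pi_gt3 in auto)
        then show "6 \<le> 2 * pi * u" by simp
      qed (use m2 u in auto)
      then show "\<phi> (int n) \<ge> 0" unfolding f by simp
      define y where "y = pi * u * m\<^sup>2"
      have y: "y / 2 \<ge> real n"
      proof -
        have "2 * 1 \<le> pi * u" by (rule mult_mono) (use u pi_gt3 in auto)
        then have "2 * real n \<le> pi * u * m\<^sup>2" by (intro mult_mono m2) auto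
        then show ?thesis by (simp add: y_def)
      qed
      have "\<phi> (int n) \<le> 2 * y * exp (- y)" unfolding f gauss_def y_def by (simp add: mult_ac)
      also have "\<dots> \<le> 4 * exp (y / 2) * exp (- y)"
      proof (rule mult_right_mono)
        have "1 + y / 2 \<le> exp (y / 2)" by simp
        then show "2 * y \<le> 4 * exp (y / 2)" by linarith
      qed simp
      also have "\<dots> = 4 * exp (- (y / 2))" unfolding mult.assoc exp_add[symmetric] by simp
      also have "\<dots> \<le> 4 * exp (- real n)" using y by simp
      also have "exp (- real n) = q ^ n" by (simp add: q_def exp_of_nat_mult[symmetric])
      finally show "\<phi> (int n) \<le> 4 * q ^ n" .
    qed
    have "minorant_kernel u \<le> 8 * (1 / (1 - q))"
    proof (rule sums_le[OF _ s2])
      show "(\<lambda>n. 8 * q ^ n) sums (8 * (1 / (1 - q)))" by (intro sums_mult geometric_sums) (use q in simp)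
      show "2 * \<phi> (int n) \<le> 8 * q ^ n" for n using p1[of n] by simp
    qed
    moreover have "0 \<le> minorant_kernel u"
      by (rule sums_le[OF _ sums_zero s2]) (use p0 in simp)
    ultimately show ?thesis by simp
  qed
  have "0 \<le> minorant_kernel u \<and> minorant_kernel u \<le> max (8 * pi) (8 / (1 - q))" for u
  proof (cases "0 < u")
    case False then show ?thesis by (simp add: minorant_kernel_def theta_kernel_def le_max_iff_disj)
  next
    case True then show ?thesis using small[of u] large[of u] by (cases "u < 1") (simp_all add: le_max_iff_disj)
  qed
  then show ?thesis by blast
qed

text \<open>The kernel is self-dual, so the same alternating sum controls both ranges.\<close>

lemma best_kernel_bounds: "\<exists>C. \<forall>u. 0 \<le> best_kernel u \<and> best_kernel u \<le> C"
proof -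
  define T where "T = (\<lambda>s. \<Sum>n. (-1) ^ n * ((real n + 1/2) ^ 1 * gauss s (real n + 1/2)))"
  have Tb: "0 \<le> T s" "T s \<le> 1/2 * gauss s (1/2)" if "s \<ge> 1" for s
    using alternating_gauss_sum_bounds[OF that refl, of "1/2" 1] by (simp_all add: T_def)
  have kT: "best_kernel u = 2 / (u * sqrt u) * T (1/u)" if u: "u > 0" for u
  proof -
    have "summable (\<lambda>n. (-1) ^ n * ((real n + 1/2) ^ 1 * gauss (1/u) (real n + 1/2)))"
    proof (rule summable_norm_cancel, rule summable_comparison_test')
      show "summable (\<lambda>n. 2 * ((real n + 1/2)\<^sup>2 * gauss (1/u) (real n + 1/2)))"
        by (intro summable_mult summable_square_gauss) (use u in auto)
      fix n
      have "(real n + 1/2) * 1 \<le> (real n + 1/2) * (2 * (real n + 1/2))" by (rule mult_left_mono) auto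
      from mult_right_mono[OF this, of "gauss (1/u) (real n + 1/2)"]
      show "norm (norm ((-1) ^ n * ((real n + 1/2) ^ 1 * gauss (1/u) (real n + 1/2)))) \<le> 2 * ((real n + 1/2)\<^sup>2 * gauss (1/u) (real n + 1/2))"
        by (simp add: abs_mult power2_eq_square mult_ac)
    qed
    from suminf_mult[OF this, of 2] u show ?thesis
      by (simp add: best_kernel_def theta_kernel_def T_def mult_ac)
  qed
  have small: "0 \<le> best_kernel u \<and> best_kernel u \<le> 32" if u: "0 < u" "u < 1" for u
  proof -
    define s where "s = 1 / u"
    have s: "s \<ge> 1" using u by (simp add: s_def)
    have us: "2 / (u * sqrt u) = 2 * (s * sqrt s)" using u by (simp add: s_def real_sqrt_divide)
    have "s * sqrt s * T s \<le> (s * s) * (1/2 * gauss s (1/2))"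
      by (intro mult_mono Tb mult_left_mono) (use s real_sqrt_le_mono[of s "s\<^sup>2"] Tb in \<open>auto simp: power2_eq_square\<close>)
    also have "\<dots> \<le> 1/2 * (2 / (pi / 4)\<^sup>2)"
      using square_exp_le[of s "pi / 4"] s by (simp add: gauss_def power2_eq_square mult_ac)
    also have "\<dots> \<le> 16" using pi_gt3 mult_mono[of 1 pi 1 pi] by (simp add: field_simps power2_eq_square)
    finally have "s * sqrt s * T s \<le> 16" .
    then show ?thesis unfolding kT[OF u(1)] us s_def[symmetric] using Tb[OF s] s by simp
  qed
  have large: "0 \<le> best_kernel u \<and> best_kernel u \<le> 1" if u: "u \<ge> 1" for u
  proof -
    define \<phi> where "\<phi> = (\<lambda>n::int. (-1) powi n * ((of_int n + 1/2) * gauss u (of_int n + 1/2)))"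
    have "((\<lambda>n::int. (-1) powi n * gauss1 u (of_int n + 1/2)) has_sum (- (4 * pi / sqrt u) * T (1/u))) UNIV"
      using theta_first_derivative[of u] u by (simp add: T_def)
    from has_sum_cmult_right[OF this, of "- 1 / (2 * pi * u)"]
    have "(\<phi> has_sum (- 1 / (2 * pi * u) * (- (4 * pi / sqrt u) * T (1/u)))) UNIV"
    proof -
      have "- 1 / (2 * pi * u) * (e * gauss1 u x) = e * (x * gauss u x)" for e x
        using u by (simp add: gauss1_def field_simps)
      then show ?thesis using \<open>((\<lambda>n. - 1 / (2 * pi * u) * ((-1) powi n * gauss1 u (of_int n + 1/2))) has_sum _) UNIV\<close>
        unfolding \<phi>_def by (simp only:)
    qed
    also have "- 1 / (2 * pi * u) * (- (4 * pi / sqrt u) * T (1/u)) = best_kernel u"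
      using u by (simp add: kT field_simps)
    finally have S: "(\<phi> has_sum best_kernel u) UNIV" .
    have sym: "\<phi> (- 1 - n) = \<phi> n" for n
    proof -
      have a: "real_of_int (- 1 - n) + 1/2 = - (of_int n + 1/2)" by simp
      have b: "(-1::real) powi (- 1 - n) = - ((-1) powi n)"
        by (cases "even n") (auto simp: power_int_minus_left)
      show ?thesis unfolding \<phi>_def a b gauss_minus by (simp only: mult_minus_left mult_minus_right minus_minus)
    qed
    have "(\<lambda>n. 2 * \<phi> (int n)) sums best_kernel u" by (rule has_sum_int_fold[OF S sym])
    then have "best_kernel u = (\<Sum>n. 2 * \<phi> (int n))" by (rule sums_unique)
    also have "\<dots> = 2 * (\<Sum>n. \<phi> (int n))"
    proof (rule suminf_mult)
      have "summable (\<lambda>n. 1/2 * (2 * \<phi> (int n)))" using \<open>(\<lambda>n. 2 * \<phi> (int n)) sums best_kernel u\<close> by (intro summable_mult sums_summable)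
      then show "summable (\<lambda>n. \<phi> (int n))" by simp
    qed
    also have "(\<Sum>n. \<phi> (int n)) = T u" by (simp add: \<phi>_def T_def)
    finally show ?thesis using Tb[OF u] gauss_le_1[of u "1/2"] u by simp
  qed
  have "0 \<le> best_kernel u \<and> best_kernel u \<le> 32" for u
  proof (cases "0 < u")
    case False then show ?thesis by (simp add: best_kernel_def theta_kernel_def)
  next
    case True then show ?thesis using small[of u] large[of u] by (cases "u < 1") simp_all
  qed
  then show ?thesis by blast
qed

section \<open>Interpolation of a single Gaussian\<close>

text \<open>The factor of \<open>w\<close> in the error, on the real line and, below, in the complex plane. It is
  a Duhamel integral: as a function of \<open>s\<close> it solves \<open>h' = -\<pi>x\<^sup>2h + \<Phi>\<close>.\<close>

definition heat_int :: "(real \<Rightarrow> real) \<Rightarrow> real \<Rightarrow> real \<Rightarrow> real" where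
  "heat_int \<Phi> s x = (\<integral>u. (if 0 < u \<and> u < s then \<Phi> u * exp (- pi * (s - u) * x\<^sup>2) else 0) \<partial>lborel)"

definition complex_heat_int :: "(real \<Rightarrow> real) \<Rightarrow> real \<Rightarrow> complex \<Rightarrow> complex" where
  "complex_heat_int \<Phi> s z = (\<integral>u. (if 0 < u \<and> u < s then of_real (\<Phi> u) * exp (- of_real (pi * (s - u)) * z\<^sup>2) else 0) \<partial>lborel)"

lemma complex_heat_int_of_real: "complex_heat_int \<Phi> s (of_real x) = of_real (heat_int \<Phi> s x)"
proof -
  have "(if 0 < u \<and> u < s then of_real (\<Phi> u) * exp (- of_real (pi * (s - u)) * (of_real x)\<^sup>2) else 0)
     = complex_of_real (if 0 < u \<and> u < s then \<Phi> u * exp (- pi * (s - u) * x\<^sup>2) else 0)" for u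
    by (simp add: exp_of_real[symmetric])
  then show ?thesis unfolding complex_heat_int_def heat_int_def by (simp only: integral_complex_of_real)
qed

lemma heat_int_measurable [measurable]:
  assumes [measurable]: "\<Phi> \<in> borel_measurable borel"
  shows "(\<lambda>p. heat_int \<Phi> (snd p) (fst p)) \<in> borel_measurable (borel \<Otimes>\<^sub>M borel)"
  unfolding heat_int_def by measurable

lemma complex_heat_int_measurable [measurable]:
  assumes [measurable]: "\<Phi> \<in> borel_measurable borel"
  shows "(\<lambda>s. complex_heat_int \<Phi> s z) \<in> borel_measurable borel"
  unfolding complex_heat_int_def by measurable

lemma integrable_indicator_Ioo [simp]: "integrable lborel (\<lambda>u::real. if 0 < u \<and> u < s then c else 0 :: real)"
proof -
  have "integrable lborel (\<lambda>u. indicator {0..s} u * c)" by simp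
  then show ?thesis
    by (rule Bochner_Integration.integrable_bound) (auto simp: indicator_def intro!: AE_I2)
qed

lemma heat_int_nonneg:
  assumes "\<And>u. \<Phi> u \<ge> 0" shows "heat_int \<Phi> s x \<ge> 0"
  unfolding heat_int_def by (rule Bochner_Integration.integral_nonneg) (use assms in auto)

lemma heat_int_le_integral:
  assumes \<Phi>: "integrable lborel \<Phi>" and pos: "\<And>u. \<Phi> u \<ge> 0"
  shows "heat_int \<Phi> s x \<le> (\<integral>u. \<Phi> u \<partial>lborel)"
  unfolding heat_int_def
proof (rule integral_mono'[OF \<Phi>])
  fix u
  have "\<Phi> u * exp (- pi * (s - u) * x\<^sup>2) \<le> \<Phi> u * 1" if "u < s"
    by (rule mult_left_mono) (use that pos in auto)
  then show "(if 0 < u \<and> u < s then \<Phi> u * exp (- pi * (s - u) * x\<^sup>2) else 0) \<le> \<Phi> u"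
    using pos by auto
qed (rule pos)

text \<open>Bounding \<open>\<Phi>\<close> by its supremum leaves an exponential integral of size \<open>1/(\<pi>x\<^sup>2)\<close>. The
  bound is uniform in \<open>s\<close>, which later makes it a bound for every mixture.\<close>

lemma heat_int_le_inverse_square:
  assumes \<Phi>[measurable]: "\<Phi> \<in> borel_measurable borel" and pos: "\<And>u. \<Phi> u \<ge> 0" and C: "\<And>u. \<Phi> u \<le> C" and x: "x \<noteq> 0"
  shows "heat_int \<Phi> s x \<le> C / (pi * x\<^sup>2)"
proof (cases "s > 0")
  case True
  define k where "k = pi * x\<^sup>2"
  have k: "k > 0" using x by (simp add: k_def)
  have C0: "C \<ge> 0" using pos[of 0] C[of 0] by linarith
  have bi: "has_bochner_integral lborel (\<lambda>u. indicator {0..s} u *\<^sub>R (C * exp (- k * (s - u)))) (C / k * exp (- k * (s - s)) - C / k * exp (- k * (s - 0)))"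
  proof (rule has_bochner_integral_FTC_Icc)
    fix u
    have "((\<lambda>u. C / k * exp (- k * (s - u))) has_real_derivative C * exp (- k * (s - u))) (at u within {0..s})"
      using k by (auto intro!: derivative_eq_intros)
    then show "((\<lambda>u. C / k * exp (- k * (s - u))) has_vector_derivative C * exp (- k * (s - u))) (at u within {0..s})"
      by (simp add: has_real_derivative_iff_has_vector_derivative)
  qed (use True in \<open>auto intro!: continuous_intros\<close>)
  have "heat_int \<Phi> s x \<le> (\<integral>u. indicator {0..s} u *\<^sub>R (C * exp (- k * (s - u))) \<partial>lborel)"
    unfolding heat_int_def
  proof (rule integral_mono')
    show "integrable lborel (\<lambda>u. indicator {0..s} u *\<^sub>R (C * exp (- k * (s - u))))" using bi by (auto simp: has_bochner_integral_iff)
    fix u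
    have "\<Phi> u * exp (- pi * (s - u) * x\<^sup>2) \<le> C * exp (- k * (s - u))"
      using mult_right_mono[OF C[of u], of "exp (- k * (s - u))"] by (simp add: k_def mult_ac)
    then show "(if 0 < u \<and> u < s then \<Phi> u * exp (- pi * (s - u) * x\<^sup>2) else 0) \<le> indicator {0..s} u *\<^sub>R (C * exp (- k * (s - u)))"
      using C0 by (auto simp: indicator_def)
  qed (use C0 in \<open>auto simp: indicator_def\<close>)
  also have "\<dots> = C / k * exp (- k * (s - s)) - C / k * exp (- k * (s - 0))" by (rule has_bochner_integral_integral_eq[OF bi])
  also have "\<dots> \<le> C / k" using C0 k by simp
  finally show ?thesis by (simp add: k_def)
next
  case False
  have C0: "C \<ge> 0" using pos[of 0] C[of 0] by linarith
  have "(if 0 < u \<and> u < s then \<Phi> u * exp (- pi * (s - u) * x\<^sup>2) else 0) = 0" for u using False by auto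
  then show ?thesis unfolding heat_int_def using C0 by simp
qed

lemma integrable_exp_decay: "c > 0 \<Longrightarrow> integrable lborel (\<lambda>u. if 0 < u then K * exp (- (u * c)) else 0 :: real)"
proof -
  assume "c > 0"
  from integrable_I0i_exp_mscale[OF this]
  have "integrable lborel (\<lambda>u. K * (indicator {0<..} u * exp (- (u * c))))" by (simp add: set_integrable_def)
  moreover have "K * (indicator {0<..} u * exp (- (u * c))) = (if 0 < u then K * exp (- (u * c)) else 0)" for u
    by (auto simp: indicator_def)
  ultimately show ?thesis by simp
qed

text \<open>What the construction needs from a multiplier \<open>w\<close> with real trace \<open>v\<close> and a kernel \<open>\<Phi>\<close>;
  \<open>laplace\<close> says that \<open>1/w(\<i>y)\<close> is the Laplace transform of \<open>\<Phi>\<close>. In \<open>bound\<close> the factor \<open>v\<close>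
  cannot be dropped: for the majorant the integral grows without bound at \<open>x = 0\<close> as \<open>s\<close>
  increases, and the double zero of \<open>v\<close> compensates.\<close>

locale gaussian_interpolation =
  fixes w :: "complex \<Rightarrow> complex" and v :: "real \<Rightarrow> real" and \<Phi> :: "real \<Rightarrow> real" and \<tau> C D W :: real
  assumes w_holo: "w holomorphic_on UNIV" and w_growth: "\<And>z. cmod (w z) \<le> W * exp (\<tau> * \<bar>Im z\<bar>)"
    and w_even: "\<And>z. w (- z) = w z" and w_real: "\<And>x. w (of_real x) = of_real (v x)" and \<tau>: "\<tau> \<ge> 0"
    and \<Phi>_measurable [measurable]: "\<Phi> \<in> borel_measurable borel"
    and \<Phi>_nonneg: "\<And>u. 0 \<le> \<Phi> u" and \<Phi>_le: "\<And>u. \<Phi> u \<le> C" and \<Phi>_zero: "\<And>u. u \<le> 0 \<Longrightarrow> \<Phi> u = 0"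
    and laplace: "\<And>y. y > 0 \<Longrightarrow> w (\<i> * of_real y) * of_real (\<integral>u. \<Phi> u * exp (- pi * u * y\<^sup>2) \<partial>lborel) = 1"
    and bound: "\<And>s x. s > 0 \<Longrightarrow> \<bar>v x\<bar> * heat_int \<Phi> s x \<le> D / (1 + x\<^sup>2)"
begin

lemma C_nonneg: "C \<ge> 0" using \<Phi>_nonneg[of 0] \<Phi>_le[of 0] by linarith

lemma D_nonneg: "D \<ge> 0"
proof -
  have "0 \<le> \<bar>v 0\<bar> * heat_int \<Phi> 1 0" by (intro mult_nonneg_nonneg heat_int_nonneg \<Phi>_nonneg) simp
  also have "\<dots> \<le> D" using bound[of 1 0] by simp
  finally show ?thesis .
qed

lemma W_nonneg: "W \<ge> 0" using order_trans[OF norm_ge_zero w_growth[of 0]] by simp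

lemma v_measurable [measurable]: "v \<in> borel_measurable borel"
proof -
  have "v = (\<lambda>x. Re (w (0 + of_real x)))" by (simp add: w_real fun_eq_iff)
  moreover have "(\<lambda>x. w (0 + of_real x)) \<in> borel_measurable borel" by (rule entire_measurable_of_real[OF w_holo])
  ultimately show ?thesis by simp
qed

lemma complex_heat_int_holo:
  assumes s: "s > 0"
  shows "complex_heat_int \<Phi> s holomorphic_on UNIV"
  unfolding complex_heat_int_def[abs_def]
proof (rule holomorphic_on_parameter_integral)
  show "(\<lambda>z. if 0 < u \<and> u < s then of_real (\<Phi> u) * exp (- of_real (pi * (s - u)) * z\<^sup>2) else 0) holomorphic_on UNIV" for u
    by (cases "0 < u \<and> u < s") (auto intro!: holomorphic_intros)
  show "(\<lambda>u. if 0 < u \<and> u < s then of_real (\<Phi> u) * exp (- of_real (pi * (s - u)) * z\<^sup>2) else 0) \<in> borel_measurable lborel" for z :: complex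
    by measurable
  fix z0 :: complex
  define K where "K = C * exp (pi * s * (cmod z0 + 1)\<^sup>2)"
  show "\<exists>r>0. \<exists>h. integrable lborel h \<and> (\<forall>z\<in>ball z0 r \<inter> UNIV. \<forall>u\<in>space lborel. cmod (if 0 < u \<and> u < s then of_real (\<Phi> u) * exp (- of_real (pi * (s - u)) * z\<^sup>2) else 0) \<le> h u)"
  proof (intro exI[of _ 1] conjI exI[of _ "\<lambda>u. if 0 < u \<and> u < s then K else 0"] ballI)
    fix z u assume z: "z \<in> ball z0 1 \<inter> UNIV"
    show "cmod (if 0 < u \<and> u < s then of_real (\<Phi> u) * exp (- of_real (pi * (s - u)) * z\<^sup>2) else 0) \<le> (if 0 < u \<and> u < s then K else 0)"
    proof (cases "0 < u \<and> u < s")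
      case True
      have "cmod z \<le> cmod z0 + 1" using z norm_triangle_ineq2[of z z0] by (simp add: dist_norm norm_minus_commute)
      then have z2: "(cmod z)\<^sup>2 \<le> (cmod z0 + 1)\<^sup>2" by (rule power_mono) simp
      have "- (pi * (s - u)) * Re (z\<^sup>2) \<le> (pi * (s - u)) * \<bar>Re (z\<^sup>2)\<bar>"
        using True mult_left_mono[of "- Re (z\<^sup>2)" "\<bar>Re (z\<^sup>2)\<bar>" "pi * (s - u)"] by simp
      also have "\<dots> \<le> (pi * s) * (cmod z)\<^sup>2"
        using True abs_Re_le_cmod[of "z\<^sup>2"] by (intro mult_mono) (auto simp: norm_power)
      also have "\<dots> \<le> (pi * s) * (cmod z0 + 1)\<^sup>2" using z2 s by (intro mult_left_mono) auto
      finally have "exp (- (pi * (s - u)) * Re (z\<^sup>2)) \<le> exp (pi * s * (cmod z0 + 1)\<^sup>2)" by simp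
      then have "\<Phi> u * exp (- (pi * (s - u)) * Re (z\<^sup>2)) \<le> K"
        unfolding K_def by (intro mult_mono \<Phi>_le) (use C_nonneg in auto)
      then show ?thesis using True \<Phi>_nonneg[of u] by (simp add: norm_mult)
    qed auto
  qed simp_all
qed simp

definition approximant :: "real \<Rightarrow> complex \<Rightarrow> complex" where
  "approximant s z = exp (- of_real (pi * s) * z\<^sup>2) - w z * complex_heat_int \<Phi> s z"

definition deviation :: "real \<Rightarrow> real \<Rightarrow> real" where
  "deviation s x = v x * heat_int \<Phi> s x"

lemma approximant_holo: "s > 0 \<Longrightarrow> approximant s holomorphic_on UNIV"
  unfolding approximant_def[abs_def] by (intro holomorphic_intros w_holo complex_heat_int_holo)

lemma approximant_of_real: "approximant s (of_real x) = of_real (gauss s x - deviation s x)"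
proof -
  have "exp (- complex_of_real (pi * s) * (of_real x)\<^sup>2) = of_real (gauss s x)"
    unfolding gauss_def exp_of_real[symmetric] by simp
  then show ?thesis by (simp add: approximant_def deviation_def w_real complex_heat_int_of_real)
qed

text \<open>The Laplace transform of \<open>\<Phi>\<close> as a holomorphic function of \<open>z\<close>; at \<open>z = \<i>y\<close> it is the
  real integral in \<open>laplace\<close>.\<close>

definition laplace_int :: "complex \<Rightarrow> complex" where
  "laplace_int z = (\<integral>u. of_real (\<Phi> u) * exp (of_real (pi * u) * z\<^sup>2) \<partial>lborel)"

lemma laplace_int_holo: "laplace_int holomorphic_on {z. Re (z\<^sup>2) < 0}"
  unfolding laplace_int_def[abs_def]
proof (rule holomorphic_on_parameter_integral)
  show o: "open {z. Re (z\<^sup>2) < 0}" by (intro open_Collect_less continuous_intros)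
  show "(\<lambda>z. of_real (\<Phi> u) * exp (of_real (pi * u) * z\<^sup>2)) holomorphic_on {z. Re (z\<^sup>2) < 0}" for u
    by (intro holomorphic_intros)
  show "(\<lambda>u. of_real (\<Phi> u) * exp (of_real (pi * u) * z\<^sup>2)) \<in> borel_measurable lborel" for z :: complex by measurable
  fix z0 :: complex assume z0: "z0 \<in> {z. Re (z\<^sup>2) < 0}"
  define c where "c = - Re (z0\<^sup>2) / 2"
  have c: "c > 0" using z0 by (simp add: c_def)
  have "open {z. Re (z\<^sup>2) < - c}" by (intro open_Collect_less continuous_intros)
  moreover have "z0 \<in> {z. Re (z\<^sup>2) < - c}" using c by (simp add: c_def)
  ultimately obtain r where r: "r > 0" "ball z0 r \<subseteq> {z. Re (z\<^sup>2) < - c}" by (meson openE)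
  show "\<exists>r>0. \<exists>h. integrable lborel h \<and> (\<forall>z\<in>ball z0 r \<inter> {z. Re (z\<^sup>2) < 0}. \<forall>u\<in>space lborel. cmod (of_real (\<Phi> u) * exp (of_real (pi * u) * z\<^sup>2)) \<le> h u)"
  proof (intro exI[of _ r] conjI exI[of _ "\<lambda>u. if 0 < u then C * exp (- (u * (pi * c))) else 0"] ballI r(1))
    show "integrable lborel (\<lambda>u. if 0 < u then C * exp (- (u * (pi * c))) else 0)" by (rule integrable_exp_decay) (use c in simp)
    fix z u assume "z \<in> ball z0 r \<inter> {z. Re (z\<^sup>2) < 0}"
    then have z: "Re (z\<^sup>2) < - c" using r by auto
    show "cmod (of_real (\<Phi> u) * exp (of_real (pi * u) * z\<^sup>2)) \<le> (if 0 < u then C * exp (- (u * (pi * c))) else 0)"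
    proof (cases "0 < u")
      case True
      have "(pi * u) * Re (z\<^sup>2) \<le> (pi * u) * (- c)" by (rule mult_left_mono) (use True z in auto)
      then have "\<Phi> u * exp ((pi * u) * Re (z\<^sup>2)) \<le> C * exp (- (u * (pi * c)))"
        by (intro mult_mono \<Phi>_le) (use C_nonneg in \<open>auto simp: mult_ac\<close>)
      then show ?thesis using True \<Phi>_nonneg[of u] by (simp add: norm_mult)
    qed (simp add: \<Phi>_zero)
  qed
qed

text \<open>Analytic continuation from the positive imaginary axis to the sector around it, and by
  evenness to the opposite sector.\<close>

lemma laplace_identity:
  assumes z: "Re (z\<^sup>2) < 0"
  shows "w z * laplace_int z = 1"
proof -
  (* The component of \<open>Re z\<^sup>2 < 0\<close> that contains the positive imaginary axis. *)
  define S where "S = {z. \<bar>Re z\<bar> < Im z}"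
  have S: "S = {z. Re z < Im z} \<inter> {z. - Re z < Im z}" by (auto simp: S_def abs_less_iff)
  have oS: "open S" unfolding S by (intro open_Int open_Collect_less continuous_intros)
  have cS: "convex S"
  proof (rule convexI)
    fix x y :: complex and a b :: real assume *: "x \<in> S" "y \<in> S" "0 \<le> a" "0 \<le> b" "a + b = 1"
    have "\<bar>a * Re x + b * Re y\<bar> \<le> a * \<bar>Re x\<bar> + b * \<bar>Re y\<bar>"
      using * by (intro order_trans[OF abs_triangle_ineq]) (simp add: abs_mult)
    also have "\<dots> < a * Im x + b * Im y"
    proof (cases "a = 0")
      case True then show ?thesis using * by (simp add: S_def)
    next
      case False
      then have "a * \<bar>Re x\<bar> < a * Im x" using * by (simp add: S_def)
      moreover have "b * \<bar>Re y\<bar> \<le> b * Im y" using * by (intro mult_left_mono) (auto simp: S_def)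
      ultimately show ?thesis by linarith
    qed
    finally show "a *\<^sub>R x + b *\<^sub>R y \<in> S" by (simp add: S_def)
  qed
  have SN: "S \<subseteq> {z. Re (z\<^sup>2) < 0}"
  proof
    fix z assume "z \<in> S"
    then have "\<bar>Re z\<bar> < \<bar>Im z\<bar>" by (auto simp: S_def)
    then have "(Re z)\<^sup>2 < (Im z)\<^sup>2" using abs_le_square_iff[of "Im z" "Re z"] by linarith
    then show "z \<in> {z. Re (z\<^sup>2) < 0}" by (simp add: power2_eq_square)
  qed
  have upper: "w z * laplace_int z = 1" if z: "z \<in> S" for z
  proof -
    have "w z * laplace_int z - 1 = 0"
    proof (rule analytic_continuation[where f = "\<lambda>z. w z * laplace_int z - 1" and S = S and U = "(\<lambda>y. \<i> * of_real y) ` {0<..}" and \<xi> = \<i>])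
      show "(\<lambda>z. w z * laplace_int z - 1) holomorphic_on S"
        by (intro holomorphic_intros holomorphic_on_subset[OF w_holo] holomorphic_on_subset[OF laplace_int_holo] SN) simp
      show "connected S" by (rule convex_connected[OF cS])
      show "(\<lambda>y. \<i> * of_real y) ` {0<..} \<subseteq> S" by (auto simp: S_def)
      show "\<i> \<in> S" by (simp add: S_def)
      show "\<i> islimpt (\<lambda>y. \<i> * of_real y) ` {0<..}"
        unfolding islimpt_sequential
      proof (intro exI conjI allI)
        define X where "X = (\<lambda>n. 1 + 1 / real (Suc n))"
        show "\<i> * of_real (X n) \<in> (\<lambda>y. \<i> * of_real y) ` {0<..} - {\<i>}" for n
        proof -
          have "X n > 0" by (simp add: X_def add_pos_nonneg)
          moreover have "\<i> * complex_of_real (X n) \<noteq> \<i>" by (simp add: complex_eq_iff X_def)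
          ultimately show ?thesis by blast
        qed
        have "X \<longlonglongrightarrow> 1 + 0" unfolding X_def by (intro tendsto_intros LIMSEQ_Suc[OF lim_1_over_n])
        then have "(\<lambda>n. \<i> * complex_of_real (X n)) \<longlonglongrightarrow> \<i> * of_real (1 + 0)" by (intro tendsto_intros)
        then show "(\<lambda>n. \<i> * complex_of_real (X n)) \<longlonglongrightarrow> \<i>" by simp
      qed
      fix \<zeta> assume "\<zeta> \<in> (\<lambda>y. \<i> * complex_of_real y) ` {0<..}"
      then obtain y where y: "y > 0" "\<zeta> = \<i> * of_real y" by auto
      have "laplace_int \<zeta> = of_real (\<integral>u. \<Phi> u * exp (- pi * u * y\<^sup>2) \<partial>lborel)"
      proof -
        have "of_real (\<Phi> u) * exp (of_real (pi * u) * \<zeta>\<^sup>2) = complex_of_real (\<Phi> u * exp (- pi * u * y\<^sup>2))" for u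
          unfolding of_real_mult[of "\<Phi> u"] exp_of_real[symmetric] by (simp add: y power_mult_distrib)
        then show ?thesis unfolding laplace_int_def by (simp only: integral_complex_of_real)
      qed
      then show "w \<zeta> * laplace_int \<zeta> - 1 = 0" using laplace[OF y(1)] y by simp
    qed (use oS z in auto)
    then show ?thesis by simp
  qed
  have "(Re z)\<^sup>2 < (Im z)\<^sup>2" using z by (simp add: power2_eq_square)
  then have "\<bar>Re z\<bar> < \<bar>Im z\<bar>" using abs_le_square_iff[of "Im z" "Re z"] by linarith
  then have "z \<in> S \<or> - z \<in> S" by (auto simp: S_def abs_if split: if_splits)
  moreover have "laplace_int (- z) = laplace_int z" by (simp add: laplace_int_def)
  ultimately show ?thesis using upper[of z] upper[of "- z"] by (auto simp: w_even)
qed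

text \<open>The integral over \<open>0 < u < s\<close> is harmless where \<open>Re z\<^sup>2\<close> is bounded below. Elsewhere the
  Laplace identity replaces the Gaussian by \<open>w(z)\<close> times the full integral, and the difference
  is the integral over \<open>u \<ge> s\<close>, in which the exponential decays.\<close>

lemma approximant_growth:
  assumes s: "s > 0"
  shows "\<exists>K>0. \<forall>z. cmod (approximant s z) \<le> K * (1 + cmod (w z))"
proof -
  define I where "I = (\<integral>u. (if 0 < u then C * exp (- (u * pi)) else 0) \<partial>lborel)"
  have ii: "integrable lborel (\<lambda>u. if 0 < u then C * exp (- (u * pi)) else 0)" by (rule integrable_exp_decay) simp
  have I: "I \<ge> 0" unfolding I_def by (rule Bochner_Integration.integral_nonneg) (use C_nonneg in auto)
  define K where "K = exp (pi * s) * (1 + C * s + I)"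
  have K: "K > 0" using s C_nonneg I by (simp add: K_def add_pos_nonneg)
  have "cmod (approximant s z) \<le> K * (1 + cmod (w z))" for z
  proof (cases "Re (z\<^sup>2) < -1")
    case False
    have e: "exp (- (pi * t) * Re (z\<^sup>2)) \<le> exp (pi * s)" if "0 \<le> t" "t \<le> s" for t
    proof -
      have "(pi * t) * (- Re (z\<^sup>2)) \<le> (pi * t) * 1" by (rule mult_left_mono) (use False that in auto)
      also have "\<dots> \<le> pi * s" using that by simp
      finally show ?thesis by simp
    qed
    have "cmod (complex_heat_int \<Phi> s z) \<le> (\<integral>u. norm (if 0 < u \<and> u < s then of_real (\<Phi> u) * exp (- of_real (pi * (s - u)) * z\<^sup>2) else 0) \<partial>lborel)"
      unfolding complex_heat_int_def by (rule integral_norm_bound)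
    also have "\<dots> \<le> (\<integral>u. indicator {0..s} u * (C * exp (pi * s)) \<partial>lborel)"
    proof (rule integral_mono')
      show "integrable lborel (\<lambda>u. indicator {0..s} u * (C * exp (pi * s)))" by simp
      fix u
      show "norm (if 0 < u \<and> u < s then of_real (\<Phi> u) * exp (- of_real (pi * (s - u)) * z\<^sup>2) else 0) \<le> indicator {0..s} u * (C * exp (pi * s))"
      proof (cases "0 < u \<and> u < s")
        case True
        have "\<Phi> u * exp (- (pi * (s - u)) * Re (z\<^sup>2)) \<le> C * exp (pi * s)"
          by (intro mult_mono \<Phi>_le e) (use True C_nonneg in auto)
        then show ?thesis using True \<Phi>_nonneg[of u] by (simp add: norm_mult)
      qed (use C_nonneg in auto)
    qed (use C_nonneg in auto)
    also have "\<dots> = s * (C * exp (pi * s))" using s by (simp add: measure_def)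
    finally have J: "cmod (complex_heat_int \<Phi> s z) \<le> C * s * exp (pi * s)" by (simp add: mult_ac)
    have "cmod (approximant s z) \<le> exp (- (pi * s) * Re (z\<^sup>2)) + cmod (w z) * cmod (complex_heat_int \<Phi> s z)"
      unfolding approximant_def by (rule order_trans[OF norm_triangle_ineq4]) (simp add: norm_mult)
    also have "\<dots> \<le> exp (pi * s) + cmod (w z) * (C * s * exp (pi * s))"
      by (intro add_mono mult_left_mono J e) (use s in auto)
    also have "\<dots> \<le> K * 1 + cmod (w z) * K"
    proof (intro add_mono mult_left_mono)
      have "exp (pi * s) * 1 \<le> exp (pi * s) * (1 + C * s + I)" by (rule mult_left_mono) (use C_nonneg s I in auto)
      then show "exp (pi * s) \<le> K * 1" by (simp add: K_def)
      have "exp (pi * s) * (C * s) \<le> exp (pi * s) * (1 + C * s + I)" by (rule mult_left_mono) (use I in auto)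
      then show "C * s * exp (pi * s) \<le> K" by (simp add: K_def mult_ac)
    qed simp
    finally show ?thesis by (simp add: algebra_simps)
  next
    case True
    (* Here the Gaussian is not bounded and must cancel against the integral. *)
    define f where "f = (\<lambda>u. of_real (\<Phi> u) * exp (of_real (pi * u) * z\<^sup>2))"
    define g where "g = (\<lambda>u. if 0 < u \<and> u < s then f u else 0)"
    have fm[measurable]: "f \<in> borel_measurable borel" unfolding f_def by measurable
    have fb: "norm (f u) \<le> (if 0 < u then C * exp (- (u * pi)) else 0)" for u
    proof (cases "0 < u")
      case u: True
      have "(pi * u) * Re (z\<^sup>2) \<le> (pi * u) * (- 1)" by (rule mult_left_mono) (use True u in auto)
      then have "\<Phi> u * exp ((pi * u) * Re (z\<^sup>2)) \<le> C * exp (- (u * pi))"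
        by (intro mult_mono \<Phi>_le) (use C_nonneg in \<open>auto simp: mult_ac\<close>)
      then show ?thesis using u \<Phi>_nonneg[of u] by (simp add: f_def norm_mult)
    qed (simp add: f_def \<Phi>_zero)
    have fi: "integrable lborel f"
    proof (rule Bochner_Integration.integrable_bound[OF ii])
      show "AE u in lborel. norm (f u) \<le> norm (if 0 < u then C * exp (- (u * pi)) else 0)"
        by (intro AE_I2 order_trans[OF fb]) (simp only: real_norm_def abs_ge_self)
    qed simp
    have gi: "integrable lborel g"
      by (rule Bochner_Integration.integrable_bound[OF fi]) (auto simp: g_def intro!: AE_I2)
    define E where "E = exp (- of_real (pi * s) * z\<^sup>2)"
    have "complex_heat_int \<Phi> s z = (\<integral>u. E * g u \<partial>lborel)"
      unfolding complex_heat_int_def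
    proof (intro Bochner_Integration.integral_cong refl)
      fix u
      have "exp (- of_real (pi * (s - u)) * z\<^sup>2) = E * exp (of_real (pi * u) * z\<^sup>2)"
        unfolding E_def exp_add[symmetric] by (simp add: algebra_simps)
      then show "(if 0 < u \<and> u < s then of_real (\<Phi> u) * exp (- of_real (pi * (s - u)) * z\<^sup>2) else 0) = E * g u"
        by (simp add: g_def f_def)
    qed
    then have c: "complex_heat_int \<Phi> s z = E * (\<integral>u. g u \<partial>lborel)" by simp
    have "approximant s z = E * (w z * laplace_int z) - w z * (E * (\<integral>u. g u \<partial>lborel))"
      unfolding approximant_def c E_def[symmetric] using laplace_identity[of z] True by simp
    also have "\<dots> = w z * (E * ((\<integral>u. f u \<partial>lborel) - (\<integral>u. g u \<partial>lborel)))"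
      by (simp add: laplace_int_def f_def algebra_simps)
    also have "(\<integral>u. f u \<partial>lborel) - (\<integral>u. g u \<partial>lborel) = (\<integral>u. f u - g u \<partial>lborel)"
      by (rule Bochner_Integration.integral_diff[OF fi gi, symmetric])
    also have "E * (\<integral>u. f u - g u \<partial>lborel) = (\<integral>u. E * (f u - g u) \<partial>lborel)" by simp
    finally have a: "cmod (approximant s z) = cmod (w z) * cmod (\<integral>u. E * (f u - g u) \<partial>lborel)" by (simp add: norm_mult)
    have "cmod (\<integral>u. E * (f u - g u) \<partial>lborel) \<le> (\<integral>u. norm (E * (f u - g u)) \<partial>lborel)" by (rule integral_norm_bound)
    also have "\<dots> \<le> (\<integral>u. exp (pi * s) * (if 0 < u then C * exp (- (u * pi)) else 0) \<partial>lborel)"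
    proof (rule integral_mono')
      show "integrable lborel (\<lambda>u. exp (pi * s) * (if 0 < u then C * exp (- (u * pi)) else 0))" using ii by (rule integrable_mult_right)
      fix u
      show "norm (E * (f u - g u)) \<le> exp (pi * s) * (if 0 < u then C * exp (- (u * pi)) else 0)"
      proof (cases "u \<ge> s")
        case u: True
        have "pi * (u - s) * Re (z\<^sup>2) \<le> pi * (u - s) * (- 1)" by (rule mult_left_mono) (use True u in auto)
        then have "\<Phi> u * exp (pi * (u - s) * Re (z\<^sup>2)) \<le> C * exp (pi * s - u * pi)"
          by (intro mult_mono \<Phi>_le) (use C_nonneg in \<open>auto simp: algebra_simps\<close>)
        moreover have "E * f u = of_real (\<Phi> u) * exp (of_real (pi * (u - s)) * z\<^sup>2)"
        proof -
          have "E * exp (of_real (pi * u) * z\<^sup>2) = exp (of_real (pi * (u - s)) * z\<^sup>2)"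
            unfolding E_def exp_add[symmetric] by (simp add: algebra_simps)
          then show ?thesis by (simp add: f_def)
        qed
        ultimately have "norm (E * f u) \<le> C * exp (pi * s - u * pi)" using \<Phi>_nonneg[of u] by (simp add: norm_mult)
        also have "C * exp (pi * s - u * pi) = exp (pi * s) * (C * exp (- (u * pi)))"
          by (simp add: exp_diff exp_minus field_simps)
        finally show ?thesis using u s by (simp add: g_def)
      next
        case u: False
        then have "f u - g u = 0" by (auto simp: g_def f_def \<Phi>_zero)
        then show ?thesis using C_nonneg by simp
      qed
    qed (use C_nonneg in auto)
    also have "\<dots> = exp (pi * s) * I" by (simp add: I_def)
    also have "\<dots> \<le> K" unfolding K_def by (rule mult_left_mono) (use C_nonneg s in auto)
    finally have "cmod (approximant s z) \<le> cmod (w z) * K" unfolding a by (rule mult_left_mono) simp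
    also have "\<dots> \<le> K * (1 + cmod (w z))" using K by (simp add: algebra_simps)
    finally show ?thesis .
  qed
  then show ?thesis using K by blast
qed

lemma approximant_exp_type:
  assumes s: "s > 0"
  shows "entire_of_exp_type \<tau> (approximant s)"
  unfolding entire_of_exp_type_def
proof (intro conjI allI impI approximant_holo s)
  fix \<epsilon> :: real assume e: "\<epsilon> > 0"
  obtain K where K: "K > 0" "\<And>z. cmod (approximant s z) \<le> K * (1 + cmod (w z))" using approximant_growth[OF s] by blast
  show "\<exists>C>0. \<forall>z. cmod (approximant s z) \<le> C * exp ((\<tau> + \<epsilon>) * cmod z)"
  proof (intro exI[of _ "K * (1 + W)"] conjI allI)
    fix z
    define X where "X = exp ((\<tau> + \<epsilon>) * cmod z)"
    have "\<tau> * \<bar>Im z\<bar> \<le> (\<tau> + \<epsilon>) * cmod z" by (intro mult_mono abs_Im_le_cmod) (use e \<tau> in auto)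
    then have "exp (\<tau> * \<bar>Im z\<bar>) \<le> X" by (simp add: X_def)
    then have "W * exp (\<tau> * \<bar>Im z\<bar>) \<le> W * X" by (rule mult_left_mono[OF _ W_nonneg])
    then have 1: "cmod (w z) \<le> W * X" using w_growth[of z] by linarith
    have 2: "1 \<le> X" using e \<tau> by (simp add: X_def)
    have "K * (1 + cmod (w z)) \<le> K * (X + W * X)" using K 1 2 by (intro mult_left_mono) auto
    then show "cmod (approximant s z) \<le> K * (1 + W) * X" using K(2)[of z] by (simp add: algebra_simps)
  qed (use K W_nonneg in auto)
qed

lemma deviation_bound: "s > 0 \<Longrightarrow> \<bar>deviation s x\<bar> \<le> D / (1 + x\<^sup>2)"
  using bound[of s x] heat_int_nonneg[of \<Phi> s x] \<Phi>_nonneg by (simp add: deviation_def abs_mult)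

text \<open>Phragmen-Lindeloef upgrades the growth bound, whose constant depends on \<open>s\<close>, to one that
  does not.\<close>

lemma approximant_bound:
  assumes s: "s > 0"
  shows "cmod (approximant s z) \<le> (1 + D) * exp (\<tau> * \<bar>Im z\<bar>)"
proof (rule phragmen_lindelof_exp_type[OF approximant_exp_type[OF s] \<tau>])
  fix x :: real
  have "D / (1 + x\<^sup>2) \<le> D / 1" by (rule divide_left_mono) (use D_nonneg in \<open>auto intro: add_pos_nonneg\<close>)
  then have "\<bar>deviation s x\<bar> \<le> D" using deviation_bound[OF s, of x] by simp
  then have "\<bar>gauss s x - deviation s x\<bar> \<le> 1 + D"
    using gauss_nonneg[of s x] gauss_le_1[of s x] s by linarith
  then show "cmod (approximant s (of_real x)) \<le> 1 + D" unfolding approximant_of_real norm_of_real .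
qed

lemma deviation_measurable [measurable]: "(\<lambda>p. deviation (snd p) (fst p)) \<in> borel_measurable (borel \<Otimes>\<^sub>M borel)"
  unfolding deviation_def by measurable

lemma approximant_measurable [measurable]: "(\<lambda>s. approximant s z) \<in> borel_measurable borel"
  unfolding approximant_def by measurable

lemma integrable_deviation_bound: "integrable lborel (\<lambda>x. D / (1 + x\<^sup>2))"
proof -
  have "integrable lborel (\<lambda>x. D * inverse (1 + x\<^sup>2))"
    using integrable_inverse_1_plus_square by (simp add: set_integrable_def)
  then show ?thesis by (simp add: divide_inverse)
qed

end

section \<open>Averaging over the mixing measure\<close>

locale gaussian_mixture_interpolation = gaussian_interpolation +
  fixes \<nu> :: "real measure"
  assumes finite: "finite_measure \<nu>" and sets_\<nu>: "sets \<nu> = sets (restrict_space borel {0<..})"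
begin

sublocale finite_measure \<nu> by (rule finite)

lemma space_\<nu>: "space \<nu> = {0<..}"
  using sets_eq_imp_space_eq[OF sets_\<nu>] by (simp add: space_restrict_space)

lemma ident_measurable [measurable]: "(\<lambda>s. s) \<in> measurable \<nu> borel"
  unfolding measurable_cong_sets[OF sets_\<nu> refl] by (rule measurable_restrict_space1) simp

lemma borel_imp_\<nu>_measurable: "f \<in> borel_measurable borel \<Longrightarrow> f \<in> borel_measurable \<nu>"
  using measurable_compose[OF ident_measurable] by blast

definition interpolant :: "complex \<Rightarrow> complex" where
  "interpolant z = (\<integral>s. approximant s z \<partial>\<nu>)"

definition averaged_heat :: "real \<Rightarrow> real" where
  "averaged_heat x = (\<integral>s. heat_int \<Phi> s x \<partial>\<nu>)"

definition error :: "real \<Rightarrow> real" where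
  "error x = (\<integral>s. deviation s x \<partial>\<nu>)"

lemma approximant_bound': "s \<in> space \<nu> \<Longrightarrow> cmod (approximant s z) \<le> (1 + D) * exp (\<tau> * \<bar>Im z\<bar>)"
  using approximant_bound by (simp add: space_\<nu>)

lemma integrable_approximant: "integrable \<nu> (\<lambda>s. approximant s z)"
  by (rule integrable_const_bound[where B = "(1 + D) * exp (\<tau> * \<bar>Im z\<bar>)"])
     (auto intro!: AE_I2 approximant_bound' borel_imp_\<nu>_measurable)

lemma interpolant_holo: "interpolant holomorphic_on UNIV"
  unfolding interpolant_def[abs_def]
proof (rule holomorphic_on_parameter_integral)
  show "(\<lambda>z. approximant s z) holomorphic_on UNIV" if "s \<in> space \<nu>" for s
    using approximant_holo that by (simp add: space_\<nu>)
  show "(\<lambda>s. approximant s z) \<in> borel_measurable \<nu>" for z by (rule borel_imp_\<nu>_measurable) simp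
  fix z0 :: complex
  show "\<exists>r>0. \<exists>h. integrable \<nu> h \<and> (\<forall>z\<in>ball z0 r \<inter> UNIV. \<forall>s\<in>space \<nu>. cmod (approximant s z) \<le> h s)"
  proof (intro exI[of _ 1] conjI exI[of _ "\<lambda>_. (1 + D) * exp (\<tau> * (cmod z0 + 1))"] ballI)
    fix z s assume z: "z \<in> ball z0 1 \<inter> UNIV" and s: "s \<in> space \<nu>"
    have "cmod z \<le> cmod z0 + 1" using z norm_triangle_ineq2[of z z0] by (simp add: dist_norm norm_minus_commute)
    then have "\<bar>Im z\<bar> \<le> cmod z0 + 1" using abs_Im_le_cmod[of z] by linarith
    from mult_left_mono[OF this \<tau>]
    have "(1 + D) * exp (\<tau> * \<bar>Im z\<bar>) \<le> (1 + D) * exp (\<tau> * (cmod z0 + 1))"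
      using D_nonneg by (intro mult_left_mono) auto
    then show "cmod (approximant s z) \<le> (1 + D) * exp (\<tau> * (cmod z0 + 1))" using approximant_bound'[OF s, of z] by linarith
  qed simp_all
qed simp

lemma interpolant_exp_type: "entire_of_exp_type \<tau> interpolant"
  unfolding entire_of_exp_type_def
proof (intro conjI allI impI interpolant_holo)
  fix \<epsilon> :: real assume e: "\<epsilon> > 0"
  define m where "m = measure \<nu> (space \<nu>)"
  have m: "m \<ge> 0" by (simp add: m_def)
  show "\<exists>C>0. \<forall>z. cmod (interpolant z) \<le> C * exp ((\<tau> + \<epsilon>) * cmod z)"
  proof (intro exI[of _ "(1 + D) * (m + 1)"] conjI allI)
    fix z
    define X where "X = exp ((\<tau> + \<epsilon>) * cmod z)"
    have "cmod (interpolant z) \<le> (\<integral>s. cmod (approximant s z) \<partial>\<nu>)"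
      unfolding interpolant_def by (rule integral_norm_bound)
    also have "\<dots> \<le> (\<integral>s. (1 + D) * exp (\<tau> * \<bar>Im z\<bar>) \<partial>\<nu>)"
      by (rule integral_mono) (auto intro!: integrable_norm integrable_approximant approximant_bound')
    also have "\<dots> = m * ((1 + D) * exp (\<tau> * \<bar>Im z\<bar>))" by (simp add: m_def)
    also have "\<dots> \<le> (m + 1) * ((1 + D) * X)"
    proof (intro mult_mono)
      have "\<tau> * \<bar>Im z\<bar> \<le> (\<tau> + \<epsilon>) * cmod z" by (intro mult_mono abs_Im_le_cmod) (use e \<tau> in auto)
      then show "exp (\<tau> * \<bar>Im z\<bar>) \<le> X" by (simp add: X_def)
    qed (use m D_nonneg in auto)
    finally show "cmod (interpolant z) \<le> (1 + D) * (m + 1) * X" by (simp add: mult_ac)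
  qed (use m D_nonneg in auto)
qed

lemma integrable_gauss_\<nu>: "integrable \<nu> (\<lambda>s. gauss s x)"
proof (rule integrable_const_bound[where B = 1])
  have "(\<lambda>s. gauss s x) \<in> borel_measurable borel" unfolding gauss_def by measurable
  then show "(\<lambda>s. gauss s x) \<in> borel_measurable \<nu>" by (rule borel_imp_\<nu>_measurable)
qed (auto intro!: AE_I2 gauss_le_1 simp: space_\<nu>)

lemma deviation_measurable_\<nu>: "(\<lambda>s. deviation s x) \<in> borel_measurable \<nu>"
  by (rule borel_imp_\<nu>_measurable) (use measurable_compose[OF measurable_Pair1' deviation_measurable, of x] in simp)

lemma integrable_deviation_\<nu>: "integrable \<nu> (\<lambda>s. deviation s x)"
  by (rule integrable_const_bound[where B = "D / (1 + x\<^sup>2)"])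
     (auto intro!: AE_I2 deviation_bound deviation_measurable_\<nu> simp: space_\<nu>)

lemma interpolant_of_real: "interpolant (of_real x) = of_real (gaussian_mixture \<nu> x - error x)"
proof -
  have "interpolant (of_real x) = of_real (\<integral>s. gauss s x - deviation s x \<partial>\<nu>)"
    unfolding interpolant_def approximant_of_real by (rule integral_complex_of_real)
  also have "(\<integral>s. gauss s x - deviation s x \<partial>\<nu>) = (\<integral>s. gauss s x \<partial>\<nu>) - error x"
    unfolding error_def by (rule Bochner_Integration.integral_diff[OF integrable_gauss_\<nu> integrable_deviation_\<nu>])
  also have "(\<integral>s. gauss s x \<partial>\<nu>) = gaussian_mixture \<nu> x"
    by (simp add: gaussian_mixture_def gauss_def)
  finally show ?thesis .
qed

lemma error_eq: "error x = v x * averaged_heat x"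
  by (simp add: error_def averaged_heat_def deviation_def)

lemma averaged_heat_nonneg: "averaged_heat x \<ge> 0"
  unfolding averaged_heat_def by (intro Bochner_Integration.integral_nonneg heat_int_nonneg \<Phi>_nonneg)

text \<open>Away from \<open>0\<close> the average stays finite for every finite measure; at \<open>0\<close> it may be an
  integral without finite value, which the Bochner integral sets to \<open>0\<close>.\<close>

lemma averaged_heat_le:
  assumes x: "x \<noteq> 0"
  shows "averaged_heat x \<le> measure \<nu> (space \<nu>) * C / pi / x\<^sup>2"
proof -
  have "averaged_heat x \<le> (\<integral>s. C / (pi * x\<^sup>2) \<partial>\<nu>)"
    unfolding averaged_heat_def
  proof (rule integral_mono')
    show "heat_int \<Phi> s x \<le> C / (pi * x\<^sup>2)" for s
      by (rule heat_int_le_inverse_square) (use \<Phi>_nonneg \<Phi>_le x in auto)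
  qed (use C_nonneg in auto)
  then show ?thesis by simp
qed

lemma pair: "pair_sigma_finite lborel \<nu>"
  by (simp add: pair_sigma_finite_def sigma_finite_lborel sigma_finite_measure_axioms)

lemma integrable_deviation_product: "integrable (lborel \<Otimes>\<^sub>M \<nu>) (\<lambda>(x, s). deviation s x)"
proof -
  interpret pair_sigma_finite lborel \<nu> by (rule pair)
  show ?thesis
  proof (rule Fubini_integrable)
    have "(\<lambda>p. (fst p, snd p)) \<in> measurable (lborel \<Otimes>\<^sub>M \<nu>) (borel \<Otimes>\<^sub>M borel)" by measurable
    from measurable_compose[OF this deviation_measurable]
    show m: "(\<lambda>(x, s). deviation s x) \<in> borel_measurable (lborel \<Otimes>\<^sub>M \<nu>)" by (simp add: split_beta')
    show "integrable lborel (\<lambda>x. \<integral>s. norm ((\<lambda>(x, s). deviation s x) (x, s)) \<partial>\<nu>)"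
    proof (rule Bochner_Integration.integrable_bound)
      show "integrable lborel (\<lambda>x. measure \<nu> (space \<nu>) * (D / (1 + x\<^sup>2)))"
        by (intro integrable_mult_right integrable_deviation_bound)
      show "(\<lambda>x. \<integral>s. norm ((\<lambda>(x, s). deviation s x) (x, s)) \<partial>\<nu>) \<in> borel_measurable lborel"
        using m by measurable
      show "AE x in lborel. norm (\<integral>s. norm ((\<lambda>(x, s). deviation s x) (x, s)) \<partial>\<nu>) \<le> norm (measure \<nu> (space \<nu>) * (D / (1 + x\<^sup>2)))"
      proof (intro AE_I2)
        fix x :: real
        have "(\<integral>s. \<bar>deviation s x\<bar> \<partial>\<nu>) \<le> (\<integral>s. D / (1 + x\<^sup>2) \<partial>\<nu>)"
          by (rule integral_mono) (auto intro!: integrable_deviation_\<nu> integrable_abs deviation_bound simp: space_\<nu>)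
        then have "(\<integral>s. \<bar>deviation s x\<bar> \<partial>\<nu>) \<le> measure \<nu> (space \<nu>) * (D / (1 + x\<^sup>2))" by simp
        then show "norm (\<integral>s. norm ((\<lambda>(x, s). deviation s x) (x, s)) \<partial>\<nu>) \<le> norm (measure \<nu> (space \<nu>) * (D / (1 + x\<^sup>2)))"
          using D_nonneg by (simp add: add_pos_nonneg)
      qed
    qed
    show "AE x in lborel. integrable \<nu> (\<lambda>s. (\<lambda>(x, s). deviation s x) (x, s))"
      using integrable_deviation_\<nu> by simp
  qed
qed

lemma integrable_error: "integrable lborel error"
proof -
  interpret pair_sigma_finite lborel \<nu> by (rule pair)
  show ?thesis unfolding error_def[abs_def] by (rule integrable_fst[OF integrable_deviation_product])
qed

lemma integrable_deviation:
  assumes s: "s > 0" shows "integrable lborel (deviation s)"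
proof (rule Bochner_Integration.integrable_bound[OF integrable_deviation_bound])
  show "deviation s \<in> borel_measurable lborel"
    using measurable_compose[OF measurable_Pair2' deviation_measurable, of s] by simp
  show "AE x in lborel. norm (deviation s x) \<le> norm (D / (1 + x\<^sup>2))"
    using deviation_bound[OF s] D_nonneg by (intro AE_I2) (simp add: add_pos_nonneg)
qed

text \<open>Fubini's theorem against a bounded weight: the constants \<open>1\<close> and \<open>-1\<close> for the one-sided
  problems and the square wave for best approximation.\<close>

lemma integral_weighted_error:
  assumes p[measurable]: "p \<in> borel_measurable borel" and p1: "\<And>x. \<bar>p x\<bar> \<le> 1"
  shows "integrable \<nu> (\<lambda>s. \<integral>x. p x * deviation s x \<partial>lborel)"
    and "(\<integral>x. p x * error x \<partial>lborel) = (\<integral>s. (\<integral>x. p x * deviation s x \<partial>lborel) \<partial>\<nu>)"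
proof -
  interpret pair_sigma_finite lborel \<nu> by (rule pair)
  have i: "integrable (lborel \<Otimes>\<^sub>M \<nu>) (\<lambda>(x, s). p x * deviation s x)"
  proof (rule Bochner_Integration.integrable_bound[OF integrable_deviation_product])
    have [measurable]: "(\<lambda>(x, s). deviation s x) \<in> borel_measurable (lborel \<Otimes>\<^sub>M \<nu>)"
      using integrable_deviation_product by auto
    have "(\<lambda>q. p (fst q) * (\<lambda>(x, s). deviation s x) q) \<in> borel_measurable (lborel \<Otimes>\<^sub>M \<nu>)" by measurable
    then show "(\<lambda>(x, s). p x * deviation s x) \<in> borel_measurable (lborel \<Otimes>\<^sub>M \<nu>)" by (simp add: split_beta')
    show "AE q in lborel \<Otimes>\<^sub>M \<nu>. norm (case q of (x, s) \<Rightarrow> p x * deviation s x) \<le> norm (case q of (x, s) \<Rightarrow> deviation s x)"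
      using mult_right_mono[OF p1 abs_ge_zero] by (intro AE_I2) (auto simp: abs_mult)
  qed
  show "integrable \<nu> (\<lambda>s. \<integral>x. p x * deviation s x \<partial>lborel)" by (rule integrable_snd[OF i])
  have "(\<integral>x. p x * error x \<partial>lborel) = (\<integral>x. (\<integral>s. p x * deviation s x \<partial>\<nu>) \<partial>lborel)"
    by (simp add: error_def)
  also have "\<dots> = (\<integral>s. (\<integral>x. p x * deviation s x \<partial>lborel) \<partial>\<nu>)"
    by (simp only: integral_fst[OF i] integral_snd[OF i])
  finally show "(\<integral>x. p x * error x \<partial>lborel) = (\<integral>s. (\<integral>x. p x * deviation s x \<partial>lborel) \<partial>\<nu>)" .
qed

lemma integrable_approximant_real:
  assumes s: "s > 0" shows "integrable lborel (\<lambda>x. approximant s (of_real x))"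
  unfolding approximant_of_real
  by (intro integrable_of_real Bochner_Integration.integrable_diff integrable_gauss integrable_deviation s)

end

section \<open>Criteria for extremality\<close>

lemma entire_of_exp_type_diff:
  assumes F: "entire_of_exp_type \<tau> F" and G: "entire_of_exp_type \<tau> G"
  shows "entire_of_exp_type \<tau> (\<lambda>z. F z - G z)"
  unfolding entire_of_exp_type_def
proof (intro conjI allI impI)
  show "(\<lambda>z. F z - G z) holomorphic_on UNIV"
    using F G by (intro holomorphic_intros) (auto simp: entire_of_exp_type_def)
  fix \<epsilon> :: real assume "\<epsilon> > 0"
  then obtain A B where A: "A > 0" "\<And>z. cmod (F z) \<le> A * exp ((\<tau> + \<epsilon>) * cmod z)"
    and B: "B > 0" "\<And>z. cmod (G z) \<le> B * exp ((\<tau> + \<epsilon>) * cmod z)"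
    using F G unfolding entire_of_exp_type_def by meson
  show "\<exists>C>0. \<forall>z. cmod (F z - G z) \<le> C * exp ((\<tau> + \<epsilon>) * cmod z)"
  proof (intro exI[of _ "A + B"] conjI allI)
    fix z show "cmod (F z - G z) \<le> (A + B) * exp ((\<tau> + \<epsilon>) * cmod z)"
      using norm_triangle_ineq4[of "F z" "G z"] A(2)[of z] B(2)[of z] by (simp add: distrib_right)
  qed (use A B in simp)
qed

lemma entire_of_exp_type_shift:
  assumes F: "entire_of_exp_type \<tau> F" and \<tau>: "\<tau> \<ge> 0"
  shows "entire_of_exp_type \<tau> (\<lambda>z. F (z + a))"
  unfolding entire_of_exp_type_def
proof (intro conjI allI impI)
  show "(\<lambda>z. F (z + a)) holomorphic_on UNIV"
    by (rule holomorphic_on_compose_gen[of "\<lambda>z. z + a" UNIV F UNIV, unfolded comp_def])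
       (use F in \<open>auto intro!: holomorphic_intros simp: entire_of_exp_type_def\<close>)
  fix \<epsilon> :: real assume e: "\<epsilon> > 0"
  then obtain A where A: "A > 0" "\<And>z. cmod (F z) \<le> A * exp ((\<tau> + \<epsilon>) * cmod z)"
    using F unfolding entire_of_exp_type_def by meson
  show "\<exists>C>0. \<forall>z. cmod (F (z + a)) \<le> C * exp ((\<tau> + \<epsilon>) * cmod z)"
  proof (intro exI[of _ "A * exp ((\<tau> + \<epsilon>) * cmod a)"] conjI allI)
    fix z
    have "(\<tau> + \<epsilon>) * cmod (z + a) \<le> (\<tau> + \<epsilon>) * cmod a + (\<tau> + \<epsilon>) * cmod z"
      using mult_left_mono[OF norm_triangle_ineq[of z a], of "\<tau> + \<epsilon>"] e \<tau> by (simp add: distrib_left)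
    then have "exp ((\<tau> + \<epsilon>) * cmod (z + a)) \<le> exp ((\<tau> + \<epsilon>) * cmod a) * exp ((\<tau> + \<epsilon>) * cmod z)"
      unfolding exp_add[symmetric] by simp
    then have "A * exp ((\<tau> + \<epsilon>) * cmod (z + a)) \<le> A * (exp ((\<tau> + \<epsilon>) * cmod a) * exp ((\<tau> + \<epsilon>) * cmod z))"
      by (rule mult_left_mono) (use A in simp)
    then show "cmod (F (z + a)) \<le> A * exp ((\<tau> + \<epsilon>) * cmod a) * exp ((\<tau> + \<epsilon>) * cmod z)"
      using A(2)[of "z + a"] by (simp only: mult.assoc)
  qed (use A in simp)
qed

lemma entire_of_exp_type_square:
  assumes F: "entire_of_exp_type \<tau> F"
  shows "entire_of_exp_type (2 * \<tau>) (\<lambda>z. (F z)\<^sup>2)"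
  unfolding entire_of_exp_type_def
proof (intro conjI allI impI)
  show "(\<lambda>z. (F z)\<^sup>2) holomorphic_on UNIV"
    using F by (intro holomorphic_intros) (auto simp: entire_of_exp_type_def)
  fix \<epsilon> :: real assume "\<epsilon> > 0"
  then have "\<epsilon> / 2 > 0" by simp
  then obtain A where A: "A > 0" "\<And>z. cmod (F z) \<le> A * exp ((\<tau> + \<epsilon> / 2) * cmod z)"
    using F unfolding entire_of_exp_type_def by meson
  show "\<exists>C>0. \<forall>z. cmod ((F z)\<^sup>2) \<le> C * exp ((2 * \<tau> + \<epsilon>) * cmod z)"
  proof (intro exI[of _ "A\<^sup>2"] conjI allI)
    fix z
    have "(cmod (F z))\<^sup>2 \<le> (A * exp ((\<tau> + \<epsilon> / 2) * cmod z))\<^sup>2" by (rule power_mono[OF A(2)]) simp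
    also have "\<dots> = A\<^sup>2 * exp ((2 * \<tau> + \<epsilon>) * cmod z)"
      by (simp add: power_mult_distrib power2_eq_square exp_add[symmetric] algebra_simps)
    finally show "cmod ((F z)\<^sup>2) \<le> A\<^sup>2 * exp ((2 * \<tau> + \<epsilon>) * cmod z)" by (simp add: norm_power)
  qed (use A in simp)
qed

lemma L1_dist_eq_integral:
  assumes "integrable lborel (\<lambda>x. complex_of_real (g x) - H (of_real x))"
  shows "L1_dist g H = ennreal (\<integral>x. cmod (complex_of_real (g x) - H (of_real x)) \<partial>lborel)"
  unfolding L1_dist_def by (rule nn_integral_eq_integral) (use assms in auto)

lemma integrable_of_L1_dist_finite:
  assumes [measurable]: "g \<in> borel_measurable borel" and H: "H holomorphic_on UNIV" and fin: "L1_dist g H < \<infinity>"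
  shows "integrable lborel (\<lambda>x. complex_of_real (g x) - H (of_real x))"
proof (rule integrableI_bounded)
  have [measurable]: "(\<lambda>x::real. H (of_real x)) \<in> borel_measurable borel"
    using entire_measurable_of_real[OF H, of 0] by simp
  show "(\<lambda>x. complex_of_real (g x) - H (of_real x)) \<in> borel_measurable lborel" by measurable
qed (use fin in \<open>simp add: L1_dist_def\<close>)

lemma deriv_of_real_valued:
  assumes F: "F holomorphic_on UNIV" and r: "\<And>x. F (of_real x) = of_real (f x)"
  shows "(f has_real_derivative Re (deriv F (of_real x))) (at x)" "Im (deriv F (of_real x)) = 0"
proof -
  have "(F has_field_derivative deriv F (of_real x)) (at (of_real x))"
    by (rule holomorphic_derivI[OF F]) auto
  then have v: "((\<lambda>x. complex_of_real (f x)) has_vector_derivative deriv F (of_real x)) (at x)"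
    using has_vector_derivative_real_field[of F "deriv F (of_real x)" x UNIV] by (simp add: r)
  have "((\<lambda>x. Re (complex_of_real (f x))) has_vector_derivative Re (deriv F (of_real x))) (at x)"
    by (rule bounded_linear.has_vector_derivative[OF bounded_linear_Re v])
  then show "(f has_real_derivative Re (deriv F (of_real x))) (at x)"
    by (simp add: has_real_derivative_iff_has_vector_derivative)
  have "((\<lambda>x. Im (complex_of_real (f x))) has_vector_derivative Im (deriv F (of_real x))) (at x)"
    by (rule bounded_linear.has_vector_derivative[OF bounded_linear_Im v])
  then have "((\<lambda>x::real. 0::real) has_vector_derivative Im (deriv F (of_real x))) (at x)" by simp
  then show "Im (deriv F (of_real x)) = 0"
    using vector_derivative_unique_at has_vector_derivative_const by blast
qed

text \<open>A function with a one-sided quadratic bound at a zero has a local maximum there after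
  subtraction of the parabola.\<close>

lemma derivative_zero_of_quadratic_bound:
  fixes f :: "real \<Rightarrow> real"
  assumes f: "(f has_real_derivative l) (at x0)" and 0: "f x0 = 0"
    and d: "d > 0" and b: "\<And>x. \<bar>x0 - x\<bar> < d \<Longrightarrow> f x \<le> K * (x - x0)\<^sup>2"
  shows "l = 0"
proof (rule DERIV_local_max[where f = "\<lambda>x. f x - K * (x - x0)\<^sup>2"])
  show "((\<lambda>x. f x - K * (x - x0)\<^sup>2) has_real_derivative l) (at x0)"
    using f by (auto intro!: derivative_eq_intros)
  show "\<forall>y. \<bar>x0 - y\<bar> < d \<longrightarrow> f y - K * (y - x0)\<^sup>2 \<le> f x0 - K * (x0 - x0)\<^sup>2"
    using b 0 by simp
qed (rule d)

text \<open>The sign \<open>\<sigma> = 1\<close> stands for minorants and \<open>\<sigma> = -1\<close> for majorants. The quadrature formula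
  for \<open>H - e\<close> expresses the difference of the two distances as \<open>\<sigma> \<Sum>\<^sub>n (g - H)(n+a) \<ge> 0\<close>. In
  case of equality every summand vanishes; near a node \<open>H - e\<close> is then bounded on one side by
  the error of \<open>e\<close>, so it has a double zero wherever that error is quadratically small.\<close>

theorem one_sided_extremal:
  fixes g err :: "real \<Rightarrow> real" and e H :: "complex \<Rightarrow> complex" and \<sigma> a :: real
  assumes \<sigma>: "\<sigma> = 1 \<or> \<sigma> = -1" and g: "g \<in> borel_measurable borel"
    and e: "entire_of_exp_type (2 * pi) e" and e_real: "\<And>x. e (of_real x) = of_real (g x - err x)"
    and err_int: "integrable lborel err" and err_sign: "\<And>x. 0 \<le> \<sigma> * err x"
    and nodes: "\<And>n::int. err (of_int n + a) = 0"
    and touch: "\<And>n::int. n \<noteq> 0 \<or> a \<noteq> 0 \<Longrightarrow> \<exists>d>0. \<exists>K. \<forall>x. \<bar>of_int n + a - x\<bar> < d \<longrightarrow> \<bar>err x\<bar> \<le> K * (x - (of_int n + a))\<^sup>2"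
    and H: "entire_of_exp_type (2 * pi) H" and H_real: "\<And>x. H (of_real x) \<in> \<real>"
    and H_sign: "\<And>x. 0 \<le> \<sigma> * (g x - Re (H (of_real x)))"
  shows "L1_dist g e \<le> L1_dist g H" "L1_dist g H \<le> L1_dist g e \<Longrightarrow> H = e"
proof -
  have ge: "complex_of_real (g x) - e (of_real x) = of_real (err x)" for x by (simp add: e_real)
  have Le: "L1_dist g e = ennreal (\<integral>x. \<bar>err x\<bar> \<partial>lborel)"
    using L1_dist_eq_integral[of g e] err_int by (simp add: ge)
  have core: "L1_dist g e \<le> L1_dist g H \<and> (L1_dist g H \<le> L1_dist g e \<longrightarrow> H = e)" if fin: "L1_dist g H < \<infinity>"
  proof -
    note H_holo = entire_of_exp_type_holo[OF H]
    have gHi: "integrable lborel (\<lambda>x. complex_of_real (g x) - H (of_real x))"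
      by (rule integrable_of_L1_dist_finite[OF g H_holo fin])
    define h where "h = (\<lambda>x. Re (H (of_real x)))"
    have h: "H (of_real x) = of_real (h x)" for x using H_real[of x] by (simp add: h_def complex_is_Real_iff complex_eq_iff)
    define F where "F = (\<lambda>z. H z - e z)"
    define \<delta> where "\<delta> = (\<lambda>x. err x - (g x - h x))"
    have F: "entire_of_exp_type (2 * pi) F" unfolding F_def by (rule entire_of_exp_type_diff[OF H e])
    have F\<delta>: "F (of_real x) = of_real (\<delta> x)" for x by (simp add: F_def \<delta>_def e_real h)
    have ghi: "integrable lborel (\<lambda>x. g x - h x)"
      using integrable_Re[OF gHi] by (simp add: h)
    have \<delta>i: "integrable lborel \<delta>" unfolding \<delta>_def by (intro Bochner_Integration.integrable_diff err_int ghi)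
    have Fi: "integrable lborel (\<lambda>x. F (of_real x))" unfolding F\<delta> by (intro integrable_of_real \<delta>i)
    have "((\<lambda>n::int. F (of_real (of_int n + a))) has_sum (\<integral>x. F (of_real x) \<partial>lborel)) UNIV"
      by (rule quadrature[OF F Fi])
    then have "((\<lambda>n::int. complex_of_real (\<delta> (of_int n + a))) has_sum of_real (\<integral>x. \<delta> x \<partial>lborel)) UNIV"
      unfolding F\<delta> integral_complex_of_real .
    from has_sum_Re[OF this] have sum: "((\<lambda>n::int. \<delta> (of_int n + a)) has_sum (\<integral>x. \<delta> x \<partial>lborel)) UNIV" by simp
    from has_sum_cmult_right[OF this, of "- \<sigma>"]
    (* Multiplied by \<open>-\<sigma>\<close>, the samples of \<open>\<delta> = H - e\<close> are all nonnegative. *)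
    have sum': "((\<lambda>n::int. - \<sigma> * \<delta> (of_int n + a)) has_sum (- \<sigma> * (\<integral>x. \<delta> x \<partial>lborel))) UNIV" .
    have at_node: "- \<sigma> * \<delta> (of_int n + a) = \<sigma> * (g (of_int n + a) - h (of_int n + a))" for n
      using nodes[of n] by (simp add: \<delta>_def algebra_simps)
    have nn: "0 \<le> - \<sigma> * \<delta> (of_int n + a)" for n unfolding at_node h_def by (rule H_sign)
    have i0: "0 \<le> - \<sigma> * (\<integral>x. \<delta> x \<partial>lborel)" by (rule has_sum_nonneg[OF sum']) (rule nn)
    have ab: "\<bar>t\<bar> = \<sigma> * t" if "0 \<le> \<sigma> * t" for t using that \<sigma> by auto
    have LH: "L1_dist g H = ennreal (\<integral>x. \<sigma> * (g x - h x) \<partial>lborel)"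
    proof -
      have "cmod (complex_of_real (g x) - H (of_real x)) = \<sigma> * (g x - h x)" for x
      proof -
        have "cmod (complex_of_real (g x) - H (of_real x)) = \<bar>g x - h x\<bar>"
          unfolding h of_real_diff[symmetric] norm_of_real ..
        then show ?thesis using ab[OF H_sign[of x]] by (simp add: h_def)
      qed
      then show ?thesis using L1_dist_eq_integral[OF gHi] by simp
    qed
    have split: "(\<integral>x. \<sigma> * (g x - h x) \<partial>lborel) = (\<integral>x. \<bar>err x\<bar> \<partial>lborel) + (- \<sigma> * (\<integral>x. \<delta> x \<partial>lborel))"
    proof -
      have "(\<integral>x. \<sigma> * (g x - h x) \<partial>lborel) = (\<integral>x. \<bar>err x\<bar> + (- \<sigma>) * \<delta> x \<partial>lborel)"
        by (intro Bochner_Integration.integral_cong refl) (simp add: ab[OF err_sign] \<delta>_def algebra_simps)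
      also have "\<dots> = (\<integral>x. \<bar>err x\<bar> \<partial>lborel) + (\<integral>x. (- \<sigma>) * \<delta> x \<partial>lborel)"
        by (intro Bochner_Integration.integral_add integrable_abs integrable_mult_right err_int \<delta>i)
      finally show ?thesis by simp
    qed
    have uniq: "H = e" if le: "L1_dist g H \<le> L1_dist g e"
    proof -
      have "(\<integral>x. \<sigma> * (g x - h x) \<partial>lborel) \<le> (\<integral>x. \<bar>err x\<bar> \<partial>lborel)"
        using le unfolding LH Le by (simp add: ennreal_le_iff)
      then have z: "- \<sigma> * (\<integral>x. \<delta> x \<partial>lborel) \<le> 0" using split by linarith
      have \<delta>0: "\<delta> (of_int n + a) = 0" for n :: int
        using nonneg_has_sum_le_0D[OF sum' z nn, of n] \<sigma> by auto
      define G where "G = (\<lambda>z. F (z + of_real a))"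
      have G: "entire_of_exp_type (2 * pi) G" unfolding G_def by (rule entire_of_exp_type_shift[OF F]) simp
      have GR: "G (of_real x) = of_real (\<delta> (x + a))" for x unfolding G_def of_real_add[symmetric] F\<delta> ..
      have Gi: "integrable lborel (\<lambda>x. G (of_real x))"
        unfolding GR using lborel_integrable_real_affine[OF \<delta>i, of 1 a] by (simp add: add.commute)
      have "G z = 0" for z
      proof (rule double_zeros_imp_zero[OF G Gi])
        show "G (of_int n) = 0" for n using GR[of "of_int n"] \<delta>0[of n] by simp
        fix n :: int assume n: "n \<noteq> 0"
        obtain d K where d: "d > 0" "\<And>x. \<bar>of_int n + a - x\<bar> < d \<Longrightarrow> \<bar>err x\<bar> \<le> K * (x - (of_int n + a))\<^sup>2"
          using touch[of n] n by blast
        note dG = deriv_of_real_valued[OF entire_of_exp_type_holo[OF G] GR, of "of_int n"]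
        have "\<sigma> * Re (deriv G (of_real (of_int n))) = 0"
        proof (rule derivative_zero_of_quadratic_bound[OF DERIV_cmult[OF dG(1)]])
          show "\<sigma> * \<delta> (of_int n + a) = 0" by (simp add: \<delta>0)
          show "d > 0" by (rule d)
          fix x assume x: "\<bar>of_int n - x\<bar> < d"
          have "\<sigma> * \<delta> (x + a) \<le> \<sigma> * err (x + a)"
            using H_sign[of "x + a"] by (simp add: \<delta>_def h_def right_diff_distrib)
          also have "\<dots> = \<bar>err (x + a)\<bar>" by (rule ab[OF err_sign, symmetric])
          also have "\<dots> \<le> K * (x - of_int n)\<^sup>2" using d(2)[of "x + a"] x by simp
          finally show "\<sigma> * \<delta> (x + a) \<le> K * (x - of_int n)\<^sup>2" .
        qed
        then show "deriv G (of_int n) = 0" using dG(2) \<sigma> by (auto simp: complex_eq_iff)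
      qed
      then have "F w = 0" for w using G_def by (metis diff_add_cancel)
      then show "H = e" by (auto simp: F_def fun_eq_iff)
    qed
    have "L1_dist g e \<le> L1_dist g H" unfolding LH Le split by (intro ennreal_leI) (use i0 in simp)
    then show ?thesis using uniq by blast
  qed
  have top: "L1_dist g H = \<infinity>" if "\<not> L1_dist g H < \<infinity>" using that by (simp add: less_top[symmetric])
  show "L1_dist g e \<le> L1_dist g H" using core top by (cases "L1_dist g H < \<infinity>") auto
  show "H = e" if "L1_dist g H \<le> L1_dist g e"
  proof -
    have "L1_dist g e < \<infinity>" unfolding Le by simp
    then have "L1_dist g H < \<infinity>" using that by (rule le_less_trans[rotated])
    then show ?thesis using core that by blast
  qed
qed

text \<open>All frequencies of the square wave are at least \<open>1/2\<close> in modulus, where the transform of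
  a function of type \<open>\<pi>\<close> vanishes.\<close>

lemma integral_sgn_cos_exp_type:
  assumes F: "entire_of_exp_type pi F" and Fi: "integrable lborel (\<lambda>x. F (of_real x))"
  shows "(\<integral>x. sgn (cos (pi * x)) *\<^sub>R F (of_real x) \<partial>lborel) = 0"
proof -
  have v: "fourier (\<lambda>x. F (of_real x)) (real n + 1/2) = 0" "fourier (\<lambda>x. F (of_real x)) (- (real n + 1/2)) = 0" for n
  proof -
    have "pi * 1 \<le> pi * (2 * (real n + 1/2))" by (rule mult_left_mono) auto
    then have a: "pi \<le> 2 * pi * \<bar>real n + 1/2\<bar>" by simp
    then have b: "pi \<le> 2 * pi * \<bar>- (real n + 1/2)\<bar>" by (simp only: abs_minus_cancel)
    have c: "real n + 1/2 \<noteq> 0" by (simp add: add_nonneg_eq_0_iff)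
    then have d: "- (real n + 1/2) \<noteq> 0" by (simp only: neg_equal_0_iff_equal) simp
    show "fourier (\<lambda>x. F (of_real x)) (real n + 1/2) = 0" by (rule paley_wiener_closed[OF F _ Fi a c]) simp
    show "fourier (\<lambda>x. F (of_real x)) (- (real n + 1/2)) = 0" by (rule paley_wiener_closed[OF F _ Fi b d]) simp
  qed
  show ?thesis by (subst integral_square_wave[OF Fi]) (simp_all only: v, simp_all)
qed

lemma AE_imp_everywhere_le:
  fixes f h :: "real \<Rightarrow> real"
  assumes "continuous_on UNIV f" "continuous_on UNIV h" "AE x in lborel. f x \<le> h x"
  shows "f x \<le> h x"
proof -
  have "closed {x. f x \<le> h x}" by (rule closed_Collect_le[OF assms(1,2)])
  moreover have "AE x in lebesgue. x \<in> {x. f x \<le> h x}" using assms(3) by (simp add: AE_completion)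
  ultimately have "x \<in> {x. f x \<le> h x}" by (rule mem_closed_if_AE_lebesgue)
  then show ?thesis by simp
qed

lemma cos_add_half_int: "cos (pi * (of_int n + 1/2 + t)) = - ((-1) powi n * sin (pi * t))"
proof -
  have c: "cos (pi * of_int n) = (-1) powi n" "sin (pi * of_int n) = 0"
  proof -
    have "cos (pi * of_int n) = (-1) powi n \<and> sin (pi * of_int n) = 0"
    proof (cases "even n")
      case True
      then obtain m where m: "n = 2 * m" by blast
      have e: "pi * real_of_int n = 2 * pi * of_int m" by (simp add: m)
      have "cos (pi * of_int n) = 1" "sin (pi * of_int n) = 0"
        unfolding e by (rule cos_int_2pin sin_int_2pin)+
      then show ?thesis using True by (simp add: power_int_minus_left)
    next
      case False
      then obtain m where m: "n = 2 * m + 1" by (metis oddE)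
      have e: "pi * real_of_int n = 2 * pi * of_int m + pi" by (simp add: m algebra_simps)
      have "cos (pi * of_int n) = -1" "sin (pi * of_int n) = 0"
        unfolding e cos_add sin_add cos_int_2pin sin_int_2pin by simp_all
      then show ?thesis using False by (simp add: power_int_minus_left)
    qed
    then show "cos (pi * of_int n) = (-1) powi n" "sin (pi * of_int n) = 0" by auto
  qed
  have "pi * (of_int n + 1/2 + t) = pi * of_int n + (pi / 2 + pi * t)" by (simp add: algebra_simps)
  then show ?thesis by (simp only: cos_add sin_add c) simp
qed

text \<open>Since \<open>sgn(cos(\<pi>x))\<close> is the sign of \<open>g - k\<close> and annihilates \<open>H - k\<close>, it is a dual
  certificate: \<open>\<parallel>g - k\<parallel>\<^sub>1 = \<integral> sgn(cos(\<pi>x)) (g - H) \<le> \<parallel>g - H\<parallel>\<^sub>1\<close>. Equality forces \<open>g - H\<close> to be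
  real with the same sign pattern, hence \<open>H - k\<close> to vanish at the zeros of the cosine. The
  square of \<open>H - k\<close> then has double zeros there and type \<open>2\<pi>\<close>.\<close>

theorem best_approximation_extremal:
  fixes g J :: "real \<Rightarrow> real" and k H :: "complex \<Rightarrow> complex"
  assumes g: "g \<in> borel_measurable borel"
    and k: "entire_of_exp_type pi k" and k_real: "\<And>x. k (of_real x) = of_real (g x - cos (pi * x) * J x)"
    and err_int: "integrable lborel (\<lambda>x. cos (pi * x) * J x)" and J: "\<And>x. 0 \<le> J x"
    and J_le: "\<And>x. x \<noteq> 0 \<Longrightarrow> J x \<le> K / x\<^sup>2"
    and H: "entire_of_exp_type pi H"
  shows "L1_dist g k \<le> L1_dist g H" "L1_dist g H \<le> L1_dist g k \<Longrightarrow> H = k"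
proof -
  define err where "err = (\<lambda>x. cos (pi * x) * J x)"
  define s where "s = (\<lambda>x. sgn (cos (pi * x)))"
  have serr: "s x * err x = \<bar>err x\<bar>" for x using J[of x] by (simp add: s_def err_def abs_mult abs_sgn[of "cos (pi * x)"])
  have gk: "complex_of_real (g x) - k (of_real x) = of_real (err x)" for x by (simp add: k_real err_def)
  have ei: "integrable lborel err" using err_int by (simp add: err_def[abs_def])
  have Lk: "L1_dist g k = ennreal (\<integral>x. \<bar>err x\<bar> \<partial>lborel)"
    using L1_dist_eq_integral[of g k] ei by (simp add: gk)
  have [measurable]: "s \<in> borel_measurable borel" unfolding s_def by measurable
  have s1: "\<bar>s x\<bar> \<le> 1" for x by (simp add: s_def sgn_if)
  have core: "L1_dist g k \<le> L1_dist g H \<and> (L1_dist g H \<le> L1_dist g k \<longrightarrow> H = k)" if fin: "L1_dist g H < \<infinity>"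
  proof -
    note H_holo = entire_of_exp_type_holo[OF H]
    define u where "u = (\<lambda>x. complex_of_real (g x) - H (of_real x))"
    have ui: "integrable lborel u" unfolding u_def by (rule integrable_of_L1_dist_finite[OF g H_holo fin])
    define F where "F = (\<lambda>z. H z - k z)"
    have F: "entire_of_exp_type pi F" unfolding F_def by (rule entire_of_exp_type_diff[OF H k])
    have Fu: "F (of_real x) = of_real (err x) - u x" for x by (simp add: F_def u_def k_real err_def)
    have Fi: "integrable lborel (\<lambda>x. F (of_real x))"
      unfolding Fu by (intro Bochner_Integration.integrable_diff ui integrable_of_real ei)
    have s_int: "integrable lborel (\<lambda>x. s x *\<^sub>R f x)" if "integrable lborel f" for f :: "real \<Rightarrow> complex"
      by (rule Bochner_Integration.integrable_bound[OF that])
         (use mult_right_mono[OF s1 norm_ge_zero] that in \<open>auto intro!: AE_I2 borel_measurable_scaleR\<close>)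
    have "(\<integral>x. s x *\<^sub>R u x \<partial>lborel) = (\<integral>x. of_real \<bar>err x\<bar> - s x *\<^sub>R F (of_real x) \<partial>lborel)"
      by (intro Bochner_Integration.integral_cong refl) (simp add: Fu serr[symmetric] scaleR_conv_of_real algebra_simps)
    also have "\<dots> = (\<integral>x. of_real \<bar>err x\<bar> \<partial>lborel) - (\<integral>x. s x *\<^sub>R F (of_real x) \<partial>lborel)"
      by (intro Bochner_Integration.integral_diff s_int Fi integrable_of_real integrable_abs ei)
    also have "(\<integral>x. s x *\<^sub>R F (of_real x) \<partial>lborel) = 0"
      unfolding s_def by (rule integral_sgn_cos_exp_type[OF F Fi])
    finally have su: "(\<integral>x. s x *\<^sub>R u x \<partial>lborel) = of_real (\<integral>x. \<bar>err x\<bar> \<partial>lborel)" by simp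
    have Re_su: "(\<integral>x. s x * Re (u x) \<partial>lborel) = (\<integral>x. \<bar>err x\<bar> \<partial>lborel)"
      using integral_Re[OF s_int[OF ui]] su by simp
    have Re_sui: "integrable lborel (\<lambda>x. s x * Re (u x))" using integrable_Re[OF s_int[OF ui]] by simp
    have le: "s x * Re (u x) \<le> cmod (u x)" for x
    proof -
      have "s x * Re (u x) \<le> \<bar>s x\<bar> * \<bar>Re (u x)\<bar>" by (simp add: abs_mult[symmetric])
      also have "\<dots> \<le> 1 * cmod (u x)" by (rule mult_mono[OF s1 abs_Re_le_cmod]) auto
      finally show ?thesis by simp
    qed
    have LH: "L1_dist g H = ennreal (\<integral>x. cmod (u x) \<partial>lborel)"
      using L1_dist_eq_integral[of g H] ui by (simp add: u_def)
    have ineq: "(\<integral>x. \<bar>err x\<bar> \<partial>lborel) \<le> (\<integral>x. cmod (u x) \<partial>lborel)"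
      unfolding Re_su[symmetric] by (rule integral_mono[OF Re_sui integrable_norm[OF ui] le])
    have uniq: "H = k" if eq: "L1_dist g H \<le> L1_dist g k"
    proof -
      have "(\<integral>x. cmod (u x) \<partial>lborel) \<le> (\<integral>x. \<bar>err x\<bar> \<partial>lborel)"
        using eq unfolding LH Lk by (simp add: ennreal_le_iff)
      then have i0: "(\<integral>x. cmod (u x) - s x * Re (u x) \<partial>lborel) = 0"
        using ineq Re_su Re_sui ui by simp
      have ae: "AE x in lborel. cmod (u x) - s x * Re (u x) = 0"
        using integral_nonneg_eq_0_iff_AE[of lborel "\<lambda>x. cmod (u x) - s x * Re (u x)"] i0 Re_sui ui le by simp
      define R where "R = (\<lambda>x::real. Re (F (of_real x)))"
      have Fc: "continuous_on UNIV (\<lambda>x::real. F (of_real x))"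
        using entire_continuous_of_real[OF entire_of_exp_type_holo[OF F], of 0] by simp
      have Rc: "continuous_on UNIV R" unfolding R_def by (intro continuous_intros Fc)
      (* Multiplication by \<open>x\<^sup>2\<close> and \<open>cos(\<pi>x)\<close> clears denominators and signs, so that both
        statements have continuous sides and extend from almost every \<open>x\<close> to all \<open>x\<close>. *)
      have ae2: "AE x in lborel. Im (F (of_real x)) = 0 \<and> x\<^sup>2 * (cos (pi * x) * R x) \<le> K * (cos (pi * x))\<^sup>2"
        using ae AE_cos_neq_0 AE_lborel_singleton[of 0]
      proof eventually_elim
        case (elim x)
        define c where "c = cos (pi * x)"
        have c: "c \<noteq> 0" "s x = sgn c" "\<bar>s x\<bar> = 1" using elim by (simp_all add: c_def s_def abs_sgn_eq)
        have n: "cmod (u x) = s x * Re (u x)" using elim by simp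
        have "\<bar>Re (u x)\<bar> = cmod (u x)" using n c(3) by (metis abs_mult abs_norm_cancel mult_1)
        then have "Im (u x) = 0" by (simp add: norm_complex_def) (metis abs_le_square_iff add_cancel_left_right cmod_power2 norm_complex_def order_refl power2_abs power_zero_numeral real_sqrt_pow2 sum_power2_eq_zero_iff)
        then have im: "Im (F (of_real x)) = 0" by (simp add: Fu)
        have "0 \<le> s x * Re (u x)" unfolding n[symmetric] by simp
        then have "s x * R x \<le> \<bar>err x\<bar>" by (simp add: R_def Fu serr[symmetric] right_diff_distrib)
        also have "\<dots> = \<bar>c\<bar> * J x" using J[of x] by (simp add: err_def c_def abs_mult)
        also have "\<dots> \<le> \<bar>c\<bar> * (K / x\<^sup>2)" by (rule mult_left_mono[OF J_le]) (use elim in auto)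
        finally have "(\<bar>c\<bar> * x\<^sup>2) * (s x * R x) \<le> (\<bar>c\<bar> * x\<^sup>2) * (\<bar>c\<bar> * (K / x\<^sup>2))" by (rule mult_left_mono) simp
        also have "\<dots> = K * (\<bar>c\<bar> * \<bar>c\<bar>)" using elim by simp
        also have "\<bar>c\<bar> * \<bar>c\<bar> = c\<^sup>2" by (simp add: power2_eq_square)
        also have "(\<bar>c\<bar> * x\<^sup>2) * (s x * R x) = x\<^sup>2 * ((\<bar>c\<bar> * sgn c) * R x)" by (simp add: c)
        also have "\<bar>c\<bar> * sgn c = c" by (rule abs_mult_sgn)
        finally show ?case using im by (simp add: c_def)
      qed
      have im0: "Im (F (of_real x)) = 0" for x
      proof -
        have c: "continuous_on UNIV (\<lambda>x::real. Im (F (of_real x)))" by (intro continuous_intros Fc)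
        have "Im (F (of_real x)) \<le> 0" by (rule AE_imp_everywhere_le[OF c]) (use ae2 in auto)
        moreover have "0 \<le> Im (F (of_real x))" by (rule AE_imp_everywhere_le[OF _ c]) (use ae2 in auto)
        ultimately show ?thesis by simp
      qed
      have all: "x\<^sup>2 * (cos (pi * x) * R x) \<le> K * (cos (pi * x))\<^sup>2" for x
        by (rule AE_imp_everywhere_le) (use ae2 Rc in \<open>auto intro!: continuous_intros\<close>)
      (* At a node \<open>x\<^sub>0\<close>, divide by the cosine and approach \<open>x\<^sub>0\<close> from both sides; the two
        signs of the cosine give the two inequalities for \<open>F(x\<^sub>0)\<close>. *)
      have node: "F (of_int n + 1/2) = 0" for n :: int
      proof -
        define x0 where "x0 = of_int n + (1/2 :: real)"
        define p where "p = ((-1) powi n :: real)"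
        have p: "p = 1 \<or> p = -1" by (cases "even n") (auto simp: p_def power_int_minus_left)
        define f where "f = (\<lambda>x. x\<^sup>2 * R x)"
        have fc: "isCont f x" for x
        proof -
          have "continuous_on UNIV f" unfolding f_def by (intro continuous_intros Rc)
          then show ?thesis by (simp add: continuous_on_eq_continuous_at)
        qed
        have c: "cos (pi * (x0 + t)) = - (p * sin (pi * t))" for t
          unfolding x0_def p_def by (rule cos_add_half_int)
        define t where "t = (\<lambda>m::nat. 1 / (real m + 2))"
        have t0: "t \<longlonglongrightarrow> 0" unfolding t_def by real_asymp
        have st: "sin (pi * t m) > 0" for m
        proof (rule sin_gt_zero)
          show "0 < pi * t m" by (simp add: t_def)
          have "t m < 1" by (simp add: t_def)
          then show "pi * t m < pi" by simp
        qed
        have fle: "f (x0 + y) * (- (p * sin (pi * y))) \<le> K * (- (p * sin (pi * y)))\<^sup>2" for y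
          using all[of "x0 + y"] unfolding c f_def by (simp add: mult_ac)
        have up: "f (x0 + - p * t m) \<le> K * sin (pi * t m)" for m
        proof -
          have "- (p * sin (pi * (- p * t m))) = sin (pi * t m)" using p by auto
          then have "f (x0 + - p * t m) * sin (pi * t m) \<le> (K * sin (pi * t m)) * sin (pi * t m)"
            using fle[of "- p * t m"] by (simp add: power2_eq_square mult_ac)
          then show ?thesis using st[of m] by (simp add: mult_le_cancel_right)
        qed
        have lo: "- (K * sin (pi * t m)) \<le> f (x0 + p * t m)" for m
        proof -
          have "- (p * sin (pi * (p * t m))) = - sin (pi * t m)" using p by auto
          then have "- (K * sin (pi * t m)) * sin (pi * t m) \<le> f (x0 + p * t m) * sin (pi * t m)"
            using fle[of "p * t m"] by (simp add: power2_eq_square mult_ac)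
          then show ?thesis by (rule mult_right_le_imp_le[OF _ st[of m]])
        qed
        have "(\<lambda>m. x0 + q * t m) \<longlonglongrightarrow> x0 + q * 0" for q by (intro tendsto_intros t0)
        then have fl: "(\<lambda>m. f (x0 + q * t m)) \<longlonglongrightarrow> f x0" for q
          using isCont_tendsto_compose[OF fc] by fastforce
        have "(\<lambda>m. K * sin (pi * t m)) \<longlonglongrightarrow> K * sin (pi * 0)" by (intro tendsto_intros t0)
        then have kl: "(\<lambda>m. K * sin (pi * t m)) \<longlonglongrightarrow> 0" by simp
        have "f x0 \<le> 0" by (rule LIMSEQ_le[OF fl kl]) (use up in blast)
        moreover have "- 0 \<le> f x0" by (rule LIMSEQ_le[OF tendsto_minus[OF kl] fl]) (use lo in blast)
        ultimately have "f x0 = 0" by simp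
        moreover have "x0 \<noteq> 0"
        proof
          assume "x0 = 0"
          then have "real_of_int (2 * n + 1) = 0" by (simp add: x0_def)
          then have "2 * n + 1 = 0" by linarith
          then show False by presburger
        qed
        ultimately have "R x0 = 0" by (simp add: f_def)
        then have "F (of_real x0) = 0" using im0[of x0] by (simp add: R_def complex_eq_iff)
        then show ?thesis by (simp add: x0_def)
      qed
      define G where "G = (\<lambda>z. F (z + 1/2))"
      have G: "entire_of_exp_type pi G" unfolding G_def by (rule entire_of_exp_type_shift[OF F]) simp
      have Gi: "integrable lborel (\<lambda>x. G (of_real x))"
        using lborel_integrable_real_affine[OF Fi, of 1 "1/2"] by (simp add: G_def add.commute)
      have GC: "integrable_C1 (\<lambda>x. G (of_real x)) (\<lambda>x. deriv G (of_real x))"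
        by (rule entire_of_exp_type_integrable_C1(1)[OF G _ Gi]) simp
      (* An integrable function of exponential type is bounded on the line, so its square is
        integrable too. *)
      define B where "B = (\<integral>x. cmod (G (of_real x)) + cmod (deriv G (of_real x)) \<partial>lborel)"
      have Gb: "cmod (G (of_real x)) \<le> B" for x
      proof (rule order_trans[OF integrable_C1_bound_cell[OF GC]])
        show "(\<integral>y. indicator {x..<x + 1} y * (cmod (G (of_real y)) + cmod (deriv G (of_real y))) \<partial>lborel) \<le> B"
          unfolding B_def by (rule integral_mono') (use GC in \<open>auto simp: integrable_C1_def indicator_def\<close>)
      qed
      have G2: "entire_of_exp_type (2 * pi) (\<lambda>z. (G z)\<^sup>2)" by (rule entire_of_exp_type_square[OF G])
      have "(G z)\<^sup>2 = 0" for z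
      proof (rule double_zeros_imp_zero[OF G2])
        show "integrable lborel (\<lambda>x. (G (of_real x))\<^sup>2)"
        proof (rule Bochner_Integration.integrable_bound)
          show "integrable lborel (\<lambda>x. B *\<^sub>R G (of_real x))" by (intro integrable_scaleR_right Gi)
          show "(\<lambda>x. (G (of_real x))\<^sup>2) \<in> borel_measurable lborel" using Gi by measurable
          show "AE x in lborel. norm ((G (of_real x))\<^sup>2) \<le> norm (B *\<^sub>R G (of_real x))"
            using mult_right_mono[OF order_trans[OF Gb abs_ge_self] norm_ge_zero]
            by (intro AE_I2) (simp add: norm_mult power2_eq_square)
        qed
        fix n :: int
        have Gn: "G (of_int n) = 0" using node[of n] by (simp add: G_def)
        then show "(G (of_int n))\<^sup>2 = 0" by simp
        have "((\<lambda>z. (G z)\<^sup>2) has_field_derivative (2 * G (of_int n) * deriv G (of_int n))) (at (of_int n))"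
          using holomorphic_derivI[OF entire_of_exp_type_holo[OF G], of "of_int n"]
          by (auto intro!: derivative_eq_intros)
        then show "deriv (\<lambda>z. (G z)\<^sup>2) (of_int n) = 0" using Gn DERIV_imp_deriv by fastforce
      qed
      then have "F w = 0" for w using G_def by (metis diff_add_cancel power_eq_0_iff)
      then show "H = k" by (auto simp: F_def fun_eq_iff)
    qed
    have "L1_dist g k \<le> L1_dist g H" unfolding LH Lk by (rule ennreal_leI[OF ineq])
    then show ?thesis using uniq by blast
  qed
  have top: "L1_dist g H = \<infinity>" if "\<not> L1_dist g H < \<infinity>" using that by (simp add: less_top[symmetric])
  show "L1_dist g k \<le> L1_dist g H" using core top by (cases "L1_dist g H < \<infinity>") auto
  show "H = k" if "L1_dist g H \<le> L1_dist g k"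
  proof -
    have "L1_dist g k < \<infinity>" unfolding Lk by simp
    then have "L1_dist g H < \<infinity>" using that by (rule le_less_trans[rotated])
    then show ?thesis using core that by blast
  qed
qed

section \<open>The three interpolation problems\<close>

lemma norm_sin_cos_le:
  "cmod (sin (of_real pi * z)) \<le> exp (pi * \<bar>Im z\<bar>)" "cmod (cos (of_real pi * z)) \<le> exp (pi * \<bar>Im z\<bar>)"
proof -
  define p where "p = exp (\<i> * (of_real pi * z))"
  define q where "q = exp (- (\<i> * (of_real pi * z)))"
  have "pi * Im z \<le> pi * \<bar>Im z\<bar>" "pi * (- Im z) \<le> pi * \<bar>Im z\<bar>" by (rule mult_left_mono; simp)+
  then have b: "cmod p \<le> exp (pi * \<bar>Im z\<bar>)" "cmod q \<le> exp (pi * \<bar>Im z\<bar>)" by (simp_all add: p_def q_def)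
  have "cmod (sin (of_real pi * z)) = cmod (p - q) / 2" by (simp add: sin_exp_eq p_def q_def norm_divide norm_mult)
  then show "cmod (sin (of_real pi * z)) \<le> exp (pi * \<bar>Im z\<bar>)" using norm_triangle_ineq4[of p q] b by simp
  have "cmod (cos (of_real pi * z)) = cmod (p + q) / 2" by (simp add: cos_exp_eq p_def q_def norm_divide)
  then show "cmod (cos (of_real pi * z)) \<le> exp (pi * \<bar>Im z\<bar>)" using norm_triangle_ineq[of p q] b by simp
qed

lemma norm_square_over_pi_le:
  assumes "cmod t \<le> exp (pi * y)"
  shows "cmod (t\<^sup>2 / of_real pi) \<le> (1 / pi) * exp (2 * pi * y)"
proof -
  have "(cmod t)\<^sup>2 \<le> (exp (pi * y))\<^sup>2" by (rule power_mono[OF assms]) simp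
  also have "\<dots> = exp (2 * pi * y)" by (simp add: power2_eq_square exp_add[symmetric])
  finally show ?thesis by (simp add: norm_divide norm_power divide_right_mono)
qed

lemma sin_cos_imaginary:
  "sin (of_real pi * (\<i> * of_real y)) = \<i> * of_real (sinh (pi * y))"
  "cos (of_real pi * (\<i> * of_real y)) = of_real (cosh (pi * y))"
  by (simp_all add: complex_eq_iff Re_sin Im_sin Re_cos Im_cos sinh_field_def cosh_field_def)

text \<open>A nonnegative kernel whose Laplace transform stays bounded at \<open>0\<close> is integrable, by
  monotone convergence. It applies to the minorant and best kernels, where \<open>w\<close> does not vanish
  at \<open>0\<close>.\<close>

lemma integrable_of_laplace_bound:
  fixes \<Phi> L :: "real \<Rightarrow> real"
  assumes pos: "\<And>u. 0 \<le> \<Phi> u" and zero: "\<And>u. u \<le> 0 \<Longrightarrow> \<Phi> u = 0" and m: "\<Phi> \<in> borel_measurable borel"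
    and L: "\<And>y. y > 0 \<Longrightarrow> has_bochner_integral lborel (\<lambda>u. \<Phi> u * exp (- pi * u * y\<^sup>2)) (L y)"
    and B: "\<And>y. y > 0 \<Longrightarrow> L y \<le> B"
  shows "integrable lborel \<Phi>"
proof -
  define y where "y = (\<lambda>n::nat. 1 / real (Suc n))"
  have y: "y n > 0" for n by (simp add: y_def)
  define f where "f = (\<lambda>n u. \<Phi> u * exp (- pi * u * (y n)\<^sup>2))"
  have fi: "integrable lborel (f n)" "integral\<^sup>L lborel (f n) = L (y n)" for n
    using L[OF y[of n]] by (auto simp: f_def has_bochner_integral_iff)
  have fm: "f n u \<le> f m u" if "n \<le> m" for n m u
  proof (cases "u > 0")
    case True
    have "y m \<le> y n" unfolding y_def using that by (intro divide_left_mono) auto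
    then have "(y m)\<^sup>2 \<le> (y n)\<^sup>2" by (rule power_mono) (use y[of m] in simp)
    then have "pi * u * (y m)\<^sup>2 \<le> pi * u * (y n)\<^sup>2" using True by (intro mult_left_mono) auto
    then show ?thesis unfolding f_def by (intro mult_left_mono pos) simp
  qed (simp add: f_def zero)
  have mono: "AE u in lborel. mono (\<lambda>n. f n u)" using fm by (intro AE_I2 monoI)
  have lim: "AE u in lborel. (\<lambda>n. f n u) \<longlonglongrightarrow> \<Phi> u"
  proof (intro AE_I2)
    fix u
    have "y \<longlonglongrightarrow> 0" unfolding y_def by (rule LIMSEQ_Suc[OF lim_1_over_n])
    then have "(\<lambda>n. \<Phi> u * exp (- pi * u * (y n)\<^sup>2)) \<longlonglongrightarrow> \<Phi> u * exp (- pi * u * 0\<^sup>2)" by (intro tendsto_intros)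
    then show "(\<lambda>n. f n u) \<longlonglongrightarrow> \<Phi> u" by (simp add: f_def)
  qed
  have "incseq (\<lambda>n. integral\<^sup>L lborel (f n))" by (intro monoI integral_mono fi fm)
  moreover have "\<forall>n. integral\<^sup>L lborel (f n) \<le> B" using B y fi by simp
  ultimately obtain l where l: "(\<lambda>n. integral\<^sup>L lborel (f n)) \<longlonglongrightarrow> l" using incseq_convergent by blast
  show ?thesis by (rule integrable_monotone_convergence[OF fi(1) mono lim l]) (use m in simp)
qed

lemma heat_int_decay:
  assumes m: "\<Phi> \<in> borel_measurable borel" and pos: "\<And>u. \<Phi> u \<ge> 0" and C: "\<And>u. \<Phi> u \<le> C" and i: "integrable lborel \<Phi>"
  shows "heat_int \<Phi> s x \<le> ((\<integral>u. \<Phi> u \<partial>lborel) + C / pi) / (1 + x\<^sup>2)"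
proof -
  have C0: "C \<ge> 0" using pos[of 0] C[of 0] by linarith
  have 1: "heat_int \<Phi> s x \<le> (\<integral>u. \<Phi> u \<partial>lborel)" by (rule heat_int_le_integral[OF i pos])
  have 2: "x\<^sup>2 * heat_int \<Phi> s x \<le> C / pi"
  proof (cases "x = 0")
    case False
    have "x\<^sup>2 * heat_int \<Phi> s x \<le> x\<^sup>2 * (C / (pi * x\<^sup>2))"
      by (intro mult_left_mono heat_int_le_inverse_square m pos C False) simp
    then show ?thesis using False by simp
  qed (use C0 in simp)
  have "heat_int \<Phi> s x * (1 + x\<^sup>2) \<le> (\<integral>u. \<Phi> u \<partial>lborel) + C / pi" using 1 2 by (simp add: algebra_simps)
  moreover have "1 + x\<^sup>2 > 0" by (simp add: add_pos_nonneg)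
  ultimately show ?thesis by (simp add: pos_le_divide_eq)
qed

lemma theta_kernel_zero: "u \<le> 0 \<Longrightarrow> theta_kernel c \<alpha> u = 0"
  by (simp add: theta_kernel_def)

lemma theta_kernels_measurable:
  "majorant_kernel \<in> borel_measurable borel" "minorant_kernel \<in> borel_measurable borel" "best_kernel \<in> borel_measurable borel"
  unfolding majorant_kernel_def minorant_kernel_def best_kernel_def by measurable

text \<open>Near \<open>x = 0\<close> the inverse square bound of the heat integral is balanced by
  \<open>sin\<^sup>2(\<pi>x) \<le> \<pi>\<^sup>2x\<^sup>2\<close>.\<close>

lemma majorant_interpolation:
  "\<exists>C D. gaussian_interpolation (\<lambda>z. - ((sin (of_real pi * z))\<^sup>2 / of_real pi)) (\<lambda>x. - ((sin (pi * x))\<^sup>2 / pi)) majorant_kernel (2 * pi) C D (1 / pi)"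
proof -
  obtain C where C: "\<And>u. 0 \<le> majorant_kernel u" "\<And>u. majorant_kernel u \<le> C" using majorant_kernel_bounds by blast
  have C0: "C \<ge> 0" using C(1)[of 0] C(2)[of 0] by linarith
  define D where "D = C * (pi\<^sup>2 + 1) / pi\<^sup>2"
  have "gaussian_interpolation (\<lambda>z. - ((sin (of_real pi * z))\<^sup>2 / of_real pi)) (\<lambda>x. - ((sin (pi * x))\<^sup>2 / pi)) majorant_kernel (2 * pi) C D (1 / pi)"
  proof
    show "(\<lambda>z. - ((sin (of_real pi * z))\<^sup>2 / of_real pi)) holomorphic_on UNIV" by (intro holomorphic_intros) auto
    show "cmod (- ((sin (of_real pi * z))\<^sup>2 / of_real pi)) \<le> 1 / pi * exp (2 * pi * \<bar>Im z\<bar>)" for z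
      unfolding norm_minus_cancel by (rule norm_square_over_pi_le[OF norm_sin_cos_le(1)])
    show "- ((sin (of_real pi * - z))\<^sup>2 / of_real pi) = - ((sin (of_real pi * z))\<^sup>2 / of_real pi)" for z :: complex by simp
    show "- ((sin (complex_of_real pi * of_real x))\<^sup>2 / of_real pi) = of_real (- ((sin (pi * x))\<^sup>2 / pi))" for x
      unfolding of_real_mult[symmetric] sin_of_real by simp
    fix y :: real assume y: "y > 0"
    have "sinh (pi * y) \<noteq> 0" using y by simp
    then show "- ((sin (of_real pi * (\<i> * of_real y)))\<^sup>2 / of_real pi) * of_real (\<integral>u. majorant_kernel u * exp (- pi * u * y\<^sup>2) \<partial>lborel) = 1"
      unfolding sin_cos_imaginary has_bochner_integral_integral_eq[OF majorant_kernel_laplace[OF y]] by (simp add: power_mult_distrib)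
  next
    fix s x :: real assume s: "s > 0"
    have p: "1 + x\<^sup>2 > 0" by (simp add: add_pos_nonneg)
    show "\<bar>- ((sin (pi * x))\<^sup>2 / pi)\<bar> * heat_int majorant_kernel s x \<le> D / (1 + x\<^sup>2)"
    proof (cases "x = 0")
      case False
      have x2: "x\<^sup>2 > 0" using False by simp
      have "\<bar>sin (pi * x)\<bar> \<le> \<bar>pi * x\<bar>" by (rule abs_sin_x_le_abs_x)
      then have "(sin (pi * x))\<^sup>2 \<le> (pi * x)\<^sup>2" by (simp only: abs_le_square_iff)
      moreover have "(sin (pi * x))\<^sup>2 * x\<^sup>2 \<le> 1 * x\<^sup>2"
        by (rule mult_right_mono) (use abs_sin_le_one[of "pi * x"] in \<open>auto simp: abs_square_le_1\<close>)
      ultimately have sx: "(sin (pi * x))\<^sup>2 * (1 + x\<^sup>2) \<le> (pi\<^sup>2 + 1) * x\<^sup>2"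
        by (simp add: algebra_simps power_mult_distrib)
      have h: "heat_int majorant_kernel s x \<le> C / (pi * x\<^sup>2)"
        by (rule heat_int_le_inverse_square) (use C False theta_kernels_measurable in auto)
      have "\<bar>- ((sin (pi * x))\<^sup>2 / pi)\<bar> * heat_int majorant_kernel s x \<le> ((sin (pi * x))\<^sup>2 / pi) * (C / (pi * x\<^sup>2))"
        using mult_left_mono[OF h, of "(sin (pi * x))\<^sup>2 / pi"] by simp
      also have "\<dots> = (C / pi\<^sup>2) * ((sin (pi * x))\<^sup>2 / x\<^sup>2)" by (simp add: power2_eq_square mult_ac)
      also have "\<dots> \<le> (C / pi\<^sup>2) * ((pi\<^sup>2 + 1) / (1 + x\<^sup>2))"
      proof (rule mult_left_mono)
        have "(sin (pi * x))\<^sup>2 \<le> (pi\<^sup>2 + 1) * x\<^sup>2 / (1 + x\<^sup>2)" using sx p by (simp only: pos_le_divide_eq)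
        then have "(sin (pi * x))\<^sup>2 / x\<^sup>2 \<le> (pi\<^sup>2 + 1) * x\<^sup>2 / (1 + x\<^sup>2) / x\<^sup>2" by (rule divide_right_mono) simp
        also have "\<dots> = (pi\<^sup>2 + 1) / (1 + x\<^sup>2)" using False by simp
        finally show "(sin (pi * x))\<^sup>2 / x\<^sup>2 \<le> (pi\<^sup>2 + 1) / (1 + x\<^sup>2)" .
      qed (use C0 in simp)
      finally show ?thesis by (simp add: D_def)
    qed (use C0 in \<open>simp add: D_def\<close>)
  qed (use C theta_kernels_measurable in \<open>auto simp: majorant_kernel_def theta_kernel_zero\<close>)
  then show ?thesis by blast
qed

lemma minorant_interpolation:
  "\<exists>C D. gaussian_interpolation (\<lambda>z. (cos (of_real pi * z))\<^sup>2 / of_real pi) (\<lambda>x. (cos (pi * x))\<^sup>2 / pi) minorant_kernel (2 * pi) C D (1 / pi)"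
proof -
  obtain C where C: "\<And>u. 0 \<le> minorant_kernel u" "\<And>u. minorant_kernel u \<le> C" using minorant_kernel_bounds by blast
  have zero: "minorant_kernel u = 0" if "u \<le> 0" for u using that by (simp add: minorant_kernel_def theta_kernel_zero)
  have i: "integrable lborel minorant_kernel"
  proof (rule integrable_of_laplace_bound[OF C(1) zero theta_kernels_measurable(2) minorant_kernel_laplace])
    fix y :: real
    have "1 \<le> (cosh (pi * y))\<^sup>2" using cosh_real_ge_1[of "pi * y"] by simp
    then have "pi / (cosh (pi * y))\<^sup>2 \<le> pi / 1" by (intro divide_left_mono) auto
    then show "pi / (cosh (pi * y))\<^sup>2 \<le> pi" by simp
  qed
  define D where "D = (\<integral>u. minorant_kernel u \<partial>lborel) + C / pi"
  have "gaussian_interpolation (\<lambda>z. (cos (of_real pi * z))\<^sup>2 / of_real pi) (\<lambda>x. (cos (pi * x))\<^sup>2 / pi) minorant_kernel (2 * pi) C D (1 / pi)"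
  proof
    show "(\<lambda>z. (cos (of_real pi * z))\<^sup>2 / of_real pi) holomorphic_on UNIV" by (intro holomorphic_intros) auto
    show "cmod ((cos (of_real pi * z))\<^sup>2 / of_real pi) \<le> 1 / pi * exp (2 * pi * \<bar>Im z\<bar>)" for z
      by (rule norm_square_over_pi_le[OF norm_sin_cos_le(2)])
    show "(cos (of_real pi * - z))\<^sup>2 / of_real pi = (cos (of_real pi * z))\<^sup>2 / of_real pi" for z :: complex by simp
    show "(cos (complex_of_real pi * of_real x))\<^sup>2 / of_real pi = of_real ((cos (pi * x))\<^sup>2 / pi)" for x
      unfolding of_real_mult[symmetric] cos_of_real by simp
    fix y :: real assume y: "y > 0"
    have "cosh (pi * y) \<noteq> 0" using cosh_real_pos[of "pi * y"] by linarith
    then show "((cos (of_real pi * (\<i> * of_real y)))\<^sup>2 / of_real pi) * of_real (\<integral>u. minorant_kernel u * exp (- pi * u * y\<^sup>2) \<partial>lborel) = 1"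
      unfolding sin_cos_imaginary has_bochner_integral_integral_eq[OF minorant_kernel_laplace[OF y]] by simp
  next
    fix s x :: real assume s: "s > 0"
    have "(cos (pi * x))\<^sup>2 \<le> 1" using abs_cos_le_one[of "pi * x"] by (simp add: abs_square_le_1)
    then have "\<bar>(cos (pi * x))\<^sup>2 / pi\<bar> \<le> 1" using pi_gt3 by (simp add: divide_le_eq)
    then have "\<bar>(cos (pi * x))\<^sup>2 / pi\<bar> * heat_int minorant_kernel s x \<le> 1 * heat_int minorant_kernel s x"
      by (rule mult_right_mono) (rule heat_int_nonneg[OF C(1)])
    also have "\<dots> \<le> D / (1 + x\<^sup>2)"
      unfolding D_def using heat_int_decay[OF theta_kernels_measurable(2) C i] by simp
    finally show "\<bar>(cos (pi * x))\<^sup>2 / pi\<bar> * heat_int minorant_kernel s x \<le> D / (1 + x\<^sup>2)" .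
  qed (use C theta_kernels_measurable zero in auto)
  then show ?thesis by blast
qed

lemma best_interpolation:
  "\<exists>C D. gaussian_interpolation (\<lambda>z. cos (of_real pi * z)) (\<lambda>x. cos (pi * x)) best_kernel pi C D 1"
proof -
  obtain C where C: "\<And>u. 0 \<le> best_kernel u" "\<And>u. best_kernel u \<le> C" using best_kernel_bounds by blast
  have zero: "best_kernel u = 0" if "u \<le> 0" for u using that by (simp add: best_kernel_def theta_kernel_zero)
  have i: "integrable lborel best_kernel"
  proof (rule integrable_of_laplace_bound[OF C(1) zero theta_kernels_measurable(3) best_kernel_laplace])
    fix y :: real
    show "1 / cosh (pi * y) \<le> 1" using cosh_real_ge_1[of "pi * y"] by (simp add: divide_le_eq)
  qed
  define D where "D = (\<integral>u. best_kernel u \<partial>lborel) + C / pi"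
  have "gaussian_interpolation (\<lambda>z. cos (of_real pi * z)) (\<lambda>x. cos (pi * x)) best_kernel pi C D 1"
  proof
    show "(\<lambda>z. cos (complex_of_real pi * z)) holomorphic_on UNIV" by (intro holomorphic_intros)
    show "cmod (cos (of_real pi * z)) \<le> 1 * exp (pi * \<bar>Im z\<bar>)" for z
      using norm_sin_cos_le(2)[of z] by simp
    show "cos (of_real pi * - z) = cos (of_real pi * z)" for z :: complex by simp
    show "cos (complex_of_real pi * of_real x) = of_real (cos (pi * x))" for x
      unfolding of_real_mult[symmetric] cos_of_real by simp
    fix y :: real assume y: "y > 0"
    have "cosh (pi * y) \<noteq> 0" using cosh_real_pos[of "pi * y"] by linarith
    then show "cos (of_real pi * (\<i> * of_real y)) * of_real (\<integral>u. best_kernel u * exp (- pi * u * y\<^sup>2) \<partial>lborel) = 1"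
      unfolding sin_cos_imaginary has_bochner_integral_integral_eq[OF best_kernel_laplace[OF y]] by simp
  next
    fix s x :: real assume s: "s > 0"
    have "\<bar>cos (pi * x)\<bar> * heat_int best_kernel s x \<le> 1 * heat_int best_kernel s x"
      by (rule mult_right_mono[OF abs_cos_le_one]) (rule heat_int_nonneg[OF C(1)])
    also have "\<dots> \<le> D / (1 + x\<^sup>2)"
      unfolding D_def using heat_int_decay[OF theta_kernels_measurable(3) C i] by simp
    finally show "\<bar>cos (pi * x)\<bar> * heat_int best_kernel s x \<le> D / (1 + x\<^sup>2)" .
  qed (use C theta_kernels_measurable zero in auto)
  then show ?thesis by blast
qed

section \<open>Values of the minimal integrals\<close>

lemma gaussian_hat_eq:
  assumes s: "s > 0" shows "gaussian_hat s t = gauss (1/s) t / sqrt s"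
proof -
  have "s powr (- 1 / 2) = 1 / sqrt s"
    using s by (simp add: powr_minus powr_half_sqrt inverse_eq_divide)
  then show ?thesis unfolding gaussian_hat_def gauss_def by (simp add: inverse_eq_divide)
qed

text \<open>Sums over the nonzero integers, and over \<open>\<int>\<close> folded at \<open>-1/2\<close>, as ordinary series.\<close>

lemma infsum_two_halves:
  fixes h :: "int \<Rightarrow> real" and a b :: "nat \<Rightarrow> int"
  assumes A: "A = range a \<union> range b" "inj a" "inj b" "range a \<inter> range b = {}"
    and eq: "\<And>n. h (b n) = h (a n)" and s: "summable (\<lambda>n. norm (h (a n)))"
  shows "infsum h A = (\<Sum>n. 2 * h (a n))"
proof -
  have hs: "((\<lambda>n. h (a n)) has_sum (\<Sum>n. h (a n))) UNIV"
    by (rule norm_summable_imp_has_sum[OF s summable_sums[OF summable_norm_cancel[OF s]]])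
  have "(h has_sum (\<Sum>n. h (a n))) (range a)"
    using has_sum_reindex[OF A(2), of h "\<Sum>n. h (a n)"] hs by (simp add: comp_def)
  moreover have "(h has_sum (\<Sum>n. h (a n))) (range b)"
    using has_sum_reindex[OF A(3), of h "\<Sum>n. h (a n)"] hs by (simp add: comp_def eq)
  ultimately have "(h has_sum ((\<Sum>n. h (a n)) + (\<Sum>n. h (a n)))) A"
    unfolding A(1) by (rule has_sum_Un_disjoint[OF _ _ A(4)])
  then have "infsum h A = 2 * (\<Sum>n. h (a n))" by (simp add: infsumI)
  also have "\<dots> = (\<Sum>n. 2 * h (a n))" by (rule suminf_mult[symmetric]) (rule summable_norm_cancel[OF s])
  finally show ?thesis .
qed

lemma summable_gauss:
  assumes s: "s > 0" and \<alpha>: "\<And>n. \<alpha> n \<ge> (real n + 1) / 2"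
  shows "summable (\<lambda>n. gauss s (\<alpha> n))"
proof (rule summable_comparison_test')
  show "summable (\<lambda>n. 4 * ((\<alpha> n)\<^sup>2 * gauss s (\<alpha> n)))" by (intro summable_mult summable_square_gauss s \<alpha>)
  fix n
  have "1/2 \<le> \<alpha> n" using \<alpha>[of n] by (rule order_trans[rotated]) simp
  then have "(1/2)\<^sup>2 \<le> (\<alpha> n)\<^sup>2" by (rule power_mono) simp
  then have "1 \<le> 4 * (\<alpha> n)\<^sup>2" by (simp add: power2_eq_square)
  from mult_right_mono[OF this, of "gauss s (\<alpha> n)"]
  show "norm (gauss s (\<alpha> n)) \<le> 4 * ((\<alpha> n)\<^sup>2 * gauss s (\<alpha> n))" by simp
qed

text \<open>The interpolating function and the Gaussian agree at the nodes; quadrature for the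
  former and Poisson summation for the latter evaluate the same sum over the nodes in two
  ways.\<close>

lemma integral_gauss_minus_interpolant:
  assumes s: "s > 0" and F: "entire_of_exp_type (2 * pi) F" and Fr: "\<And>x. F (of_real x) = of_real (gauss s x - d x)"
    and d: "integrable lborel d" and nodes: "\<And>n::int. d (of_int n + a) = 0"
  shows "(\<integral>x. d x \<partial>lborel) = - (\<Sum>n. 2 * (cos (2 * pi * real (Suc n) * a) * gaussian_hat s (real (Suc n))))"
proof -
  have gi: "integrable lborel (gauss s)" by (rule integrable_gauss[OF s])
  have Fi: "integrable lborel (\<lambda>x. F (of_real x))"
    unfolding Fr by (intro integrable_of_real Bochner_Integration.integrable_diff gi d)
  define f where "f = (\<lambda>x. complex_of_real (gauss s (x + a)))"
  define c where "c = (\<lambda>n. cos (2 * pi * real (Suc n) * a) * gaussian_hat s (real (Suc n)))"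
  have ff: "fourier f \<xi> = cis (2 * pi * \<xi> * a) * of_real (gaussian_hat s \<xi>)" for \<xi>
    unfolding f_def by (simp only: fourier_shift[of "\<lambda>x. complex_of_real (gauss s x)"] fourier_gauss[OF s] gaussian_hat_eq[OF s])
  have fp: "fourier f (real (Suc n)) + fourier f (- real (Suc n)) = of_real (2 * c n)" for n
  proof -
    define k where "k = real (Suc n)"
    have m: "gaussian_hat s (- k) = gaussian_hat s k" by (simp add: gaussian_hat_def)
    have "cis (2 * pi * k * a) + cis (2 * pi * (- k) * a) = of_real (2 * cos (2 * pi * k * a))" by (simp add: complex_eq_iff)
    then have "fourier f k + fourier f (- k) = of_real (2 * cos (2 * pi * k * a)) * of_real (gaussian_hat s k)"
      unfolding ff m distrib_right[symmetric] by simp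
    then show ?thesis by (simp add: c_def k_def[symmetric] del: of_nat_Suc)
  qed
  have cn: "summable (\<lambda>n. norm (c n))"
  proof (rule summable_comparison_test')
    show "summable (\<lambda>n. 1 / sqrt s * gauss (1/s) (real (Suc n)))" by (intro summable_mult summable_gauss) (use s in auto)
    fix n
    have "\<bar>cos (2 * pi * real (Suc n) * a)\<bar> * gaussian_hat s (real (Suc n)) \<le> 1 * gaussian_hat s (real (Suc n))"
      by (rule mult_right_mono[OF abs_cos_le_one]) (simp add: gaussian_hat_eq[OF s] s less_imp_le)
    then show "norm (norm (c n)) \<le> 1 / sqrt s * gauss (1/s) (real (Suc n))"
      using s by (simp add: c_def abs_mult gaussian_hat_eq del: of_nat_Suc)
  qed
  have "((\<lambda>n::int. f (of_int n)) has_sum (fourier f 0 + (\<Sum>n. fourier f (real (Suc n)) + fourier f (- real (Suc n))))) UNIV"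
  proof (rule poisson_summation)
    show "integrable_C1 f (\<lambda>x. of_real (gauss1 s (x + a)))"
      unfolding f_def by (rule integrable_C1_shift[OF gauss_integrable_C1(1)[OF s]])
    show "summable (\<lambda>n. cmod (fourier f (real (Suc n)) + fourier f (- real (Suc n))))"
      unfolding fp norm_of_real abs_mult using summable_mult[OF cn, of 2] by simp
  qed
  also have "(\<Sum>n. fourier f (real (Suc n)) + fourier f (- real (Suc n))) = (\<Sum>n. of_real (2 * c n))" by (simp only: fp)
  also have "\<dots> = of_real (\<Sum>n. 2 * c n)"
    by (rule suminf_of_real[symmetric]) (intro summable_mult summable_norm_cancel[OF cn])
  also have "fourier f 0 = of_real (\<integral>x. gauss s x \<partial>lborel)"
  proof -
    have "fourier f 0 = fourier (\<lambda>x. complex_of_real (gauss s x)) 0"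
      unfolding f_def fourier_shift[of "\<lambda>x. complex_of_real (gauss s x)"] by simp
    then show ?thesis by (simp add: fourier_def)
  qed
  finally have p: "((\<lambda>n::int. f (of_int n)) has_sum of_real ((\<integral>x. gauss s x \<partial>lborel) + (\<Sum>n. 2 * c n))) UNIV" by simp
  have "((\<lambda>n::int. F (of_real (of_int n + a))) has_sum (\<integral>x. F (of_real x) \<partial>lborel)) UNIV" by (rule quadrature[OF F Fi])
  moreover have "F (of_real (of_int n + a)) = f (of_int n)" for n unfolding Fr f_def nodes by simp
  moreover have "(\<integral>x. F (of_real x) \<partial>lborel) = of_real ((\<integral>x. gauss s x \<partial>lborel) - (\<integral>x. d x \<partial>lborel))"
    unfolding Fr integral_complex_of_real using gi d by simp
  ultimately have "((\<lambda>n::int. f (of_int n)) has_sum of_real ((\<integral>x. gauss s x \<partial>lborel) - (\<integral>x. d x \<partial>lborel))) UNIV" by simp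
  from has_sum_unique[OF this p] have "(\<integral>x. gauss s x \<partial>lborel) - (\<integral>x. d x \<partial>lborel) = (\<integral>x. gauss s x \<partial>lborel) + (\<Sum>n. 2 * c n)"
    by (simp only: of_real_eq_iff)
  then show ?thesis by (simp add: c_def)
qed

lemma infsum_nonzero_int:
  fixes h :: "int \<Rightarrow> real"
  assumes sym: "\<And>n. h (- n) = h n" and s: "summable (\<lambda>n. norm (h (int (Suc n))))"
  shows "infsum h {n. n \<noteq> 0} = (\<Sum>n. 2 * h (int (Suc n)))"
proof (rule infsum_two_halves[where b = "\<lambda>n. - int (Suc n)"])
  show "{n. n \<noteq> 0} = range (\<lambda>n. int (Suc n)) \<union> range (\<lambda>n. - int (Suc n))"
  proof (intro set_eqI iffI)
    fix n :: int assume "n \<in> {n. n \<noteq> 0}"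
    then have "n = int (Suc (nat (n - 1))) \<or> n = - int (Suc (nat (- n - 1)))" by auto
    then show "n \<in> range (\<lambda>n. int (Suc n)) \<union> range (\<lambda>n. - int (Suc n))" by blast
  qed auto
qed (use sym s in \<open>auto simp: inj_def simp del: of_nat_Suc\<close>)

lemma gaussian_hat_minus: "gaussian_hat s (- t) = gaussian_hat s t"
  by (simp add: gaussian_hat_def)

lemma summable_gaussian_hat:
  assumes s: "s > 0" and \<alpha>: "\<And>n. \<alpha> n \<ge> (real n + 1) / 2"
  shows "summable (\<lambda>n. norm (gaussian_hat s (\<alpha> n)))"
proof -
  have "summable (\<lambda>n. 1 / sqrt s * gauss (1/s) (\<alpha> n))" by (intro summable_mult summable_gauss \<alpha>) (use s in simp)
  then show ?thesis using s by (simp add: gaussian_hat_eq)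
qed

lemma infsum_gaussian_hat_nonzero:
  assumes s: "s > 0"
  shows "(\<Sum>\<^sub>\<infinity>n\<in>{n::int. n \<noteq> 0}. gaussian_hat s (of_int n)) = (\<Sum>n. 2 * gaussian_hat s (real (Suc n)))"
    "(\<Sum>\<^sub>\<infinity>n\<in>{n::int. n \<noteq> 0}. (-1) powi (n + 1) * gaussian_hat s (of_int n)) = (\<Sum>n. 2 * ((-1) ^ n * gaussian_hat s (real (Suc n))))"
proof -
  have sm: "summable (\<lambda>n. norm (gaussian_hat s (real (Suc n))))" by (rule summable_gaussian_hat[OF s]) auto
  show "(\<Sum>\<^sub>\<infinity>n\<in>{n::int. n \<noteq> 0}. gaussian_hat s (of_int n)) = (\<Sum>n. 2 * gaussian_hat s (real (Suc n)))"
    using infsum_nonzero_int[of "\<lambda>n. gaussian_hat s (of_int n)"] sm by (simp add: gaussian_hat_minus)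
  define h where "h = (\<lambda>n::int. (-1) powi (n + 1) * gaussian_hat s (of_int n))"
  have hS: "h (int (Suc n)) = (-1) ^ n * gaussian_hat s (real (Suc n))" for n
    by (cases "even n") (simp_all add: h_def power_int_minus_left)
  have hm: "h (- n) = h n" for n
    by (cases "even n") (simp_all add: h_def power_int_minus_left gaussian_hat_minus)
  have "infsum h {n. n \<noteq> 0} = (\<Sum>n. 2 * h (int (Suc n)))"
    by (rule infsum_nonzero_int[of h, OF hm]) (use sm in \<open>simp only: hS norm_mult norm_power norm_minus_cancel norm_one power_one mult_1\<close>)
  then show "(\<Sum>\<^sub>\<infinity>n\<in>{n::int. n \<noteq> 0}. (-1) powi (n + 1) * gaussian_hat s (of_int n)) = (\<Sum>n. 2 * ((-1) ^ n * gaussian_hat s (real (Suc n))))"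
    unfolding hS by (simp only: h_def)
qed

lemma infsum_gaussian_hat_half:
  assumes s: "s > 0"
  shows "(\<Sum>\<^sub>\<infinity>n::int. (-1) powi n / (of_int n + 1/2) * gaussian_hat s (of_int n + 1/2)) = (\<Sum>n. 2 * ((-1) ^ n / (real n + 1/2) * gaussian_hat s (real n + 1/2)))"
proof -
  define h where "h = (\<lambda>n::int. (-1) powi n / (of_int n + 1/2) * gaussian_hat s (of_int n + 1/2))"
  have hS: "h (int n) = (-1) ^ n / (real n + 1/2) * gaussian_hat s (real n + 1/2)" for n by (simp add: h_def)
  have "infsum h UNIV = (\<Sum>n. 2 * h (int n))"
  proof (rule infsum_two_halves[where b = "\<lambda>n. - 1 - int n"])
    show "UNIV = range int \<union> range (\<lambda>n. - 1 - int n)"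
    proof (intro set_eqI iffI)
      fix n :: int
      have "n = int (nat n) \<or> n = - 1 - int (nat (- 1 - n))" by auto
      then show "n \<in> range int \<union> range (\<lambda>n. - 1 - int n)" by blast
    qed auto
    show "h (- 1 - int n) = h (int n)" for n
    proof -
      have a: "real_of_int (- 1 - int n) + 1/2 = - (real n + 1/2)" by simp
      have b: "(-1::real) powi (- 1 - int n) = - ((-1) ^ n)" by (cases "even n") (auto simp: power_int_minus_left)
      show ?thesis unfolding hS unfolding h_def a b gaussian_hat_minus by (simp only: minus_divide_left[symmetric] minus_divide_right[symmetric] mult_minus_left minus_minus)
    qed
    show "summable (\<lambda>n. norm (h (int n)))"
    proof (rule summable_comparison_test')
      show "summable (\<lambda>n. 2 * norm (gaussian_hat s (real n + 1/2)))" by (intro summable_mult summable_gaussian_hat[OF s]) auto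
      fix n
      have "1 / (real n + 1/2) \<le> 1 / (1/2)" by (rule divide_left_mono) auto
      then have "1 / (real n + 1/2) * norm (gaussian_hat s (real n + 1/2)) \<le> 2 * norm (gaussian_hat s (real n + 1/2))"
        by (intro mult_right_mono) auto
      then show "norm (norm (h (int n))) \<le> 2 * norm (gaussian_hat s (real n + 1/2))"
        by (simp add: hS abs_mult abs_divide)
    qed
  qed (auto simp: inj_def)
  then show ?thesis unfolding hS by (simp only: h_def)
qed

section \<open>Extremal functions of Gaussian mixtures\<close>

context gaussian_mixture_interpolation
begin

text \<open>Read off from the decomposition into a holomorphic part and the error.\<close>

lemma gaussian_mixture_measurable: "gaussian_mixture \<nu> \<in> borel_measurable borel"
proof -
  have [measurable]: "(\<lambda>x::real. interpolant (of_real x)) \<in> borel_measurable borel"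
    using entire_measurable_of_real[OF interpolant_holo, of 0] by simp
  have [measurable]: "error \<in> borel_measurable borel" using integrable_error by auto
  have "gaussian_mixture \<nu> = (\<lambda>x. Re (interpolant (of_real x)) + error x)" by (simp add: interpolant_of_real)
  then show ?thesis by simp
qed

text \<open>At a node other than \<open>0\<close> the averaged heat integral is bounded nearby, so the double
  zero of \<open>v\<close> is inherited by the error.\<close>

lemma error_touches_zero:
  assumes x0: "x0 \<noteq> 0" and v: "\<And>x. \<bar>v x\<bar> \<le> pi * (x - x0)\<^sup>2"
  shows "\<exists>d>0. \<exists>K. \<forall>x. \<bar>x0 - x\<bar> < d \<longrightarrow> \<bar>error x\<bar> \<le> K * (x - x0)\<^sup>2"
proof (intro exI conjI allI impI)
  define B where "B = measure \<nu> (space \<nu>) * C / pi"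
  have B: "B \<ge> 0" using C_nonneg by (simp add: B_def)
  show "\<bar>x0\<bar> / 2 > 0" using x0 by simp
  fix x assume "\<bar>x0 - x\<bar> < \<bar>x0\<bar> / 2"
  then have xx: "\<bar>x0\<bar> / 2 \<le> \<bar>x\<bar>" by linarith
  then have "x \<noteq> 0" using x0 by auto
  then have J: "averaged_heat x \<le> B / x\<^sup>2" using averaged_heat_le unfolding B_def by simp
  have "(\<bar>x0\<bar> / 2)\<^sup>2 \<le> \<bar>x\<bar>\<^sup>2" by (rule power_mono[OF xx]) simp
  then have "B / x\<^sup>2 \<le> B / (\<bar>x0\<bar> / 2)\<^sup>2" using B x0 \<open>x \<noteq> 0\<close> by (intro divide_left_mono) auto
  with J have J': "averaged_heat x \<le> B / (\<bar>x0\<bar> / 2)\<^sup>2" by linarith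
  have "\<bar>error x\<bar> = \<bar>v x\<bar> * averaged_heat x" using averaged_heat_nonneg[of x] by (simp add: error_eq abs_mult)
  also have "\<dots> \<le> (pi * (x - x0)\<^sup>2) * (B / (\<bar>x0\<bar> / 2)\<^sup>2)"
    by (intro mult_mono v J' averaged_heat_nonneg) simp
  finally show "\<bar>error x\<bar> \<le> (pi * (B / (\<bar>x0\<bar> / 2)\<^sup>2)) * (x - x0)\<^sup>2" by (simp only: mult_ac)
qed

end

lemma sin_pi_square_le: "(sin (pi * t))\<^sup>2 / pi \<le> pi * t\<^sup>2"
proof -
  have "(sin (pi * t))\<^sup>2 \<le> (pi * t)\<^sup>2" using abs_sin_x_le_abs_x[of "pi * t"] by (simp only: abs_le_square_iff)
  then have "(sin (pi * t))\<^sup>2 / pi \<le> (pi * t)\<^sup>2 / pi" by (rule divide_right_mono) simp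
  then show ?thesis by (simp add: power2_eq_square mult_ac)
qed

lemma sin_pi_minus_int: "(sin (pi * (x - of_int n)))\<^sup>2 = (sin (pi * x))\<^sup>2"
proof -
  have s: "sin (pi * of_int n) = 0" using sin_int_times_real sin_times_pi_eq_0[of "of_int n"] by (simp add: mult.commute)
  then have "(cos (pi * of_int n))\<^sup>2 = 1" using sin_cos_squared_add[of "pi * of_int n"] by simp
  then show ?thesis by (simp add: right_diff_distrib sin_diff s power_mult_distrib)
qed

lemma cos_square_shift: "(cos (pi * x))\<^sup>2 = (sin (pi * (x - (of_int n + 1/2))))\<^sup>2"
proof -
  have "cos (pi * x) = - ((-1) powi n * sin (pi * (x - (of_int n + 1/2))))"
    using cos_add_half_int[of n "x - (of_int n + 1/2)"] by simp
  then show ?thesis by (cases "even n") (simp_all add: power_int_minus_left)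
qed

lemma cos_half_int: "cos (pi * (of_int n + 1/2)) = 0"
  using cos_add_half_int[of n 0] by simp

lemma ex1_and_all:
  assumes "P l" "\<And>H. P H \<Longrightarrow> H = l" "Q l"
  shows "(\<exists>!l. P l) \<and> (\<forall>l. P l \<longrightarrow> Q l)"
  using assms by metis

theorem extremal_minorant_gaussian_mixture:
  fixes \<nu> :: "real measure"
  assumes "finite_measure \<nu>" "sets \<nu> = sets (restrict_space borel {0<..})"
  defines "g \<equiv> gaussian_mixture \<nu>"
  shows "(\<exists>!l. extremal_minorant (2 * pi) g l) \<and>
     (\<forall>l. extremal_minorant (2 * pi) g l \<longrightarrow>
        interpolates_at l g (range (\<lambda>n::int. of_int n + 1/2)) \<and>
        integrable lborel (\<lambda>x. g x - Re (l (complex_of_real x))) \<and>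
        integrable \<nu> (\<lambda>s. \<Sum>\<^sub>\<infinity>n\<in>{n::int. n \<noteq> 0}. (-1) powi (n + 1) * gaussian_hat s (of_int n)) \<and>
        (LINT x|lborel. g x - Re (l (complex_of_real x))) =
          (LINT s|\<nu>. (\<Sum>\<^sub>\<infinity>n\<in>{n::int. n \<noteq> 0}. (-1) powi (n + 1) * gaussian_hat s (of_int n))))"
proof -
  define v where "v = (\<lambda>x. (cos (pi * x))\<^sup>2 / pi)"
  obtain C D where "gaussian_interpolation (\<lambda>z. (cos (of_real pi * z))\<^sup>2 / of_real pi) v minorant_kernel (2 * pi) C D (1 / pi)"
    using minorant_interpolation unfolding v_def by blast
  then interpret gaussian_mixture_interpolation "\<lambda>z. (cos (of_real pi * z))\<^sup>2 / of_real pi" v minorant_kernel "2 * pi" C D "1 / pi" \<nu>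
    by (intro gaussian_mixture_interpolation.intro gaussian_mixture_interpolation_axioms.intro assms)
  have real: "interpolant (of_real x) = of_real (g x - error x)" for x unfolding g_def by (rule interpolant_of_real)
  have v0: "v (of_int n + 1/2) = 0" for n :: int unfolding v_def cos_half_int by simp
  have e0: "0 \<le> 1 * error x" for x unfolding error_eq unfolding v_def using averaged_heat_nonneg[of x] by simp
  have nodes: "error (of_int n + 1/2) = 0" for n :: int by (simp add: error_eq v0)
  have touch: "\<exists>d>0. \<exists>K. \<forall>x. \<bar>of_int n + 1/2 - x\<bar> < d \<longrightarrow> \<bar>error x\<bar> \<le> K * (x - (of_int n + 1/2))\<^sup>2" for n :: int
  proof (rule error_touches_zero)
    show "of_int n + 1/2 \<noteq> (0::real)"
    proof
      assume "of_int n + 1/2 = (0::real)"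
      then have "real_of_int (2 * n + 1) = 0" by simp
      then have "2 * n + 1 = 0" by linarith
      then show False by presburger
    qed
    show "\<bar>v x\<bar> \<le> pi * (x - (of_int n + 1/2))\<^sup>2" for x
      unfolding v_def cos_square_shift[of x n] using sin_pi_square_le[of "x - (of_int n + 1/2)"] by simp
  qed
  have ext: "L1_dist g interpolant \<le> L1_dist g H" "L1_dist g H \<le> L1_dist g interpolant \<Longrightarrow> H = interpolant"
    if H: "minorant (2 * pi) g H" for H
  proof -
    have H': "entire_of_exp_type (2 * pi) H" "\<And>x. H (of_real x) \<in> \<real>" "\<And>x. 0 \<le> 1 * (g x - Re (H (of_real x)))"
      using H by (auto simp: minorant_def)
    note E = one_sided_extremal[where \<sigma> = 1 and a = "1/2", OF _ gaussian_mixture_measurable[folded g_def] interpolant_exp_type real integrable_error e0 nodes touch H']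
    show "L1_dist g interpolant \<le> L1_dist g H" by (rule E(1)) simp
    show "H = interpolant" if "L1_dist g H \<le> L1_dist g interpolant" by (rule E(2)) (use that in simp_all)
  qed
  have min: "minorant (2 * pi) g interpolant"
    unfolding minorant_def using interpolant_exp_type e0 by (simp add: real)
  have rhs: "(\<Sum>\<^sub>\<infinity>n\<in>{n::int. n \<noteq> 0}. (-1) powi (n + 1) * gaussian_hat s (of_int n)) = (\<integral>x. 1 * deviation s x \<partial>lborel)" if s: "s \<in> space \<nu>" for s
  proof -
    have s0: "s > 0" using s by (simp add: space_\<nu>)
    have c: "cos (2 * pi * real (Suc n) * (1/2)) = - ((-1) ^ n)" for n
      using cos_npi[of "Suc n"] by (simp only: mult.assoc) (simp add: mult_ac del: of_nat_Suc)
    have sm: "summable (\<lambda>n. 2 * ((-1) ^ n * gaussian_hat s (real (Suc n))))"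
    proof (rule summable_mult, rule summable_norm_cancel)
      have "summable (\<lambda>n. norm (gaussian_hat s (real (Suc n))))" by (rule summable_gaussian_hat[OF s0]) auto
      then show "summable (\<lambda>n. norm ((-1) ^ n * gaussian_hat s (real (Suc n))))" by (simp add: abs_mult)
    qed
    have "(\<integral>x. deviation s x \<partial>lborel) = - (\<Sum>n. 2 * (cos (2 * pi * real (Suc n) * (1/2)) * gaussian_hat s (real (Suc n))))"
      by (rule integral_gauss_minus_interpolant[OF s0 approximant_exp_type[OF s0] approximant_of_real integrable_deviation[OF s0]])
         (simp add: deviation_def v0)
    also have "\<dots> = - (\<Sum>n. - (2 * ((-1) ^ n * gaussian_hat s (real (Suc n)))))" unfolding c by simp
    also have "\<dots> = (\<Sum>n. 2 * ((-1) ^ n * gaussian_hat s (real (Suc n))))" by (simp only: suminf_minus[OF sm] minus_minus)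
    also have "\<dots> = (\<Sum>\<^sub>\<infinity>n\<in>{n::int. n \<noteq> 0}. (-1) powi (n + 1) * gaussian_hat s (of_int n))"
      by (rule infsum_gaussian_hat_nonzero(2)[OF s0, symmetric])
    finally show ?thesis by simp
  qed
  have W: "integrable \<nu> (\<lambda>s. \<integral>x. 1 * deviation s x \<partial>lborel)"
    "(\<integral>x. 1 * error x \<partial>lborel) = (\<integral>s. (\<integral>x. 1 * deviation s x \<partial>lborel) \<partial>\<nu>)"
    by (rule integral_weighted_error; simp)+
  show ?thesis
  proof (rule ex1_and_all[where l = interpolant])
    show "extremal_minorant (2 * pi) g interpolant" unfolding extremal_minorant_def using min ext(1) by blast
    show "H = interpolant" if "extremal_minorant (2 * pi) g H" for H
      using that ext(2)[of H] min unfolding extremal_minorant_def by blast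
    have d: "g x - Re (interpolant (of_real x)) = 1 * error x" for x by (simp add: real)
    show "interpolates_at interpolant g (range (\<lambda>n::int. of_int n + 1/2)) \<and>
        integrable lborel (\<lambda>x. g x - Re (interpolant (complex_of_real x))) \<and>
        integrable \<nu> (\<lambda>s. \<Sum>\<^sub>\<infinity>n\<in>{n::int. n \<noteq> 0}. (-1) powi (n + 1) * gaussian_hat s (of_int n)) \<and>
        (LINT x|lborel. g x - Re (interpolant (complex_of_real x))) =
          (LINT s|\<nu>. (\<Sum>\<^sub>\<infinity>n\<in>{n::int. n \<noteq> 0}. (-1) powi (n + 1) * gaussian_hat s (of_int n)))"
    proof (intro conjI)
      show "interpolates_at interpolant g (range (\<lambda>n::int. of_int n + 1/2))"
        unfolding interpolates_at_def real using nodes by (auto simp del: of_real_diff)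
      show "integrable lborel (\<lambda>x. g x - Re (interpolant (complex_of_real x)))"
        unfolding d using integrable_error by simp
      show "integrable \<nu> (\<lambda>s. \<Sum>\<^sub>\<infinity>n\<in>{n::int. n \<noteq> 0}. (-1) powi (n + 1) * gaussian_hat s (of_int n))"
        using W(1) by (rule iffD2[OF Bochner_Integration.integrable_cong[OF refl], rotated]) (rule rhs)
      show "(LINT x|lborel. g x - Re (interpolant (complex_of_real x))) =
          (LINT s|\<nu>. (\<Sum>\<^sub>\<infinity>n\<in>{n::int. n \<noteq> 0}. (-1) powi (n + 1) * gaussian_hat s (of_int n)))"
        unfolding d W(2) by (rule Bochner_Integration.integral_cong[OF refl]) (rule rhs[symmetric])
    qed
  qed
qed

theorem extremal_majorant_gaussian_mixture:
  fixes \<nu> :: "real measure"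
  assumes "finite_measure \<nu>" "sets \<nu> = sets (restrict_space borel {0<..})"
  defines "g \<equiv> gaussian_mixture \<nu>"
  shows "(\<exists>!m. extremal_majorant (2 * pi) g m) \<and>
     (\<forall>m. extremal_majorant (2 * pi) g m \<longrightarrow>
        interpolates_at m g (range (\<lambda>n::int. of_int n)) \<and>
        integrable lborel (\<lambda>x. Re (m (complex_of_real x)) - g x) \<and>
        integrable \<nu> (\<lambda>s. \<Sum>\<^sub>\<infinity>n\<in>{n::int. n \<noteq> 0}. gaussian_hat s (of_int n)) \<and>
        (LINT x|lborel. Re (m (complex_of_real x)) - g x) =
          (LINT s|\<nu>. (\<Sum>\<^sub>\<infinity>n\<in>{n::int. n \<noteq> 0}. gaussian_hat s (of_int n))))"
proof -
  define v where "v = (\<lambda>x. - ((sin (pi * x))\<^sup>2 / pi))"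
  obtain C D where "gaussian_interpolation (\<lambda>z. - ((sin (of_real pi * z))\<^sup>2 / of_real pi)) v majorant_kernel (2 * pi) C D (1 / pi)"
    using majorant_interpolation unfolding v_def by blast
  then interpret gaussian_mixture_interpolation "\<lambda>z. - ((sin (of_real pi * z))\<^sup>2 / of_real pi)" v majorant_kernel "2 * pi" C D "1 / pi" \<nu>
    by (intro gaussian_mixture_interpolation.intro gaussian_mixture_interpolation_axioms.intro assms)
  have real: "interpolant (of_real x) = of_real (g x - error x)" for x unfolding g_def by (rule interpolant_of_real)
  have v0: "v (of_int n) = 0" for n :: int
    unfolding v_def using sin_pi_minus_int[of "of_int n" n] by simp
  have e0: "0 \<le> - 1 * error x" for x unfolding error_eq unfolding v_def using averaged_heat_nonneg[of x] by simp
  have nodes: "error (of_int n + 0) = 0" for n :: int by (simp add: error_eq v0)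
  have touch: "\<exists>d>0. \<exists>K. \<forall>x. \<bar>of_int n + 0 - x\<bar> < d \<longrightarrow> \<bar>error x\<bar> \<le> K * (x - (of_int n + 0))\<^sup>2"
    if "n \<noteq> 0 \<or> 0 \<noteq> (0::real)" for n :: int
  proof (rule error_touches_zero)
    show "of_int n + 0 \<noteq> (0::real)" using that by simp
    show "\<bar>v x\<bar> \<le> pi * (x - (of_int n + 0))\<^sup>2" for x
      unfolding v_def using sin_pi_square_le[of "x - of_int n"] sin_pi_minus_int[of x n] by simp
  qed
  have ext: "L1_dist g interpolant \<le> L1_dist g H" "L1_dist g H \<le> L1_dist g interpolant \<Longrightarrow> H = interpolant"
    if H: "majorant (2 * pi) g H" for H
  proof -
    have H': "entire_of_exp_type (2 * pi) H" "\<And>x. H (of_real x) \<in> \<real>" "\<And>x. 0 \<le> - 1 * (g x - Re (H (of_real x)))"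
      using H by (auto simp: majorant_def)
    note E = one_sided_extremal[where \<sigma> = "- 1" and a = 0, OF _ gaussian_mixture_measurable[folded g_def] interpolant_exp_type real integrable_error e0 nodes touch H']
    show "L1_dist g interpolant \<le> L1_dist g H" by (rule E(1)) simp_all
    show "H = interpolant" if "L1_dist g H \<le> L1_dist g interpolant" by (rule E(2)) (use that in simp_all)
  qed
  have maj: "majorant (2 * pi) g interpolant"
    unfolding majorant_def using interpolant_exp_type e0 by (simp add: real)
  have rhs: "(\<Sum>\<^sub>\<infinity>n\<in>{n::int. n \<noteq> 0}. gaussian_hat s (of_int n)) = (\<integral>x. - 1 * deviation s x \<partial>lborel)" if s: "s \<in> space \<nu>" for s
  proof -
    have s0: "s > 0" using s by (simp add: space_\<nu>)
    have "(\<integral>x. deviation s x \<partial>lborel) = - (\<Sum>n. 2 * (cos (2 * pi * real (Suc n) * 0) * gaussian_hat s (real (Suc n))))"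
      by (rule integral_gauss_minus_interpolant[OF s0 approximant_exp_type[OF s0] approximant_of_real integrable_deviation[OF s0]])
         (simp add: deviation_def v0)
    also have "\<dots> = - (\<Sum>\<^sub>\<infinity>n\<in>{n::int. n \<noteq> 0}. gaussian_hat s (of_int n))"
      unfolding infsum_gaussian_hat_nonzero(1)[OF s0] by simp
    finally show ?thesis by simp
  qed
  have W: "integrable \<nu> (\<lambda>s. \<integral>x. - 1 * deviation s x \<partial>lborel)"
    "(\<integral>x. - 1 * error x \<partial>lborel) = (\<integral>s. (\<integral>x. - 1 * deviation s x \<partial>lborel) \<partial>\<nu>)"
    by (rule integral_weighted_error; simp)+
  show ?thesis
  proof (rule ex1_and_all[where l = interpolant])
    show "extremal_majorant (2 * pi) g interpolant" unfolding extremal_majorant_def using maj ext(1) by blast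
    show "H = interpolant" if "extremal_majorant (2 * pi) g H" for H
      using that ext(2)[of H] maj unfolding extremal_majorant_def by blast
    have d: "Re (interpolant (of_real x)) - g x = - 1 * error x" for x by (simp add: real)
    show "interpolates_at interpolant g (range (\<lambda>n::int. of_int n)) \<and>
        integrable lborel (\<lambda>x. Re (interpolant (complex_of_real x)) - g x) \<and>
        integrable \<nu> (\<lambda>s. \<Sum>\<^sub>\<infinity>n\<in>{n::int. n \<noteq> 0}. gaussian_hat s (of_int n)) \<and>
        (LINT x|lborel. Re (interpolant (complex_of_real x)) - g x) =
          (LINT s|\<nu>. (\<Sum>\<^sub>\<infinity>n\<in>{n::int. n \<noteq> 0}. gaussian_hat s (of_int n)))"
    proof (intro conjI)
      show "interpolates_at interpolant g (range (\<lambda>n::int. of_int n))"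
        unfolding interpolates_at_def real using nodes by (auto simp del: of_real_diff)
      show "integrable lborel (\<lambda>x. Re (interpolant (complex_of_real x)) - g x)"
        unfolding d using integrable_error by simp
      show "integrable \<nu> (\<lambda>s. \<Sum>\<^sub>\<infinity>n\<in>{n::int. n \<noteq> 0}. gaussian_hat s (of_int n))"
        using W(1) by (rule iffD2[OF Bochner_Integration.integrable_cong[OF refl], rotated]) (rule rhs)
      show "(LINT x|lborel. Re (interpolant (complex_of_real x)) - g x) =
          (LINT s|\<nu>. (\<Sum>\<^sub>\<infinity>n\<in>{n::int. n \<noteq> 0}. gaussian_hat s (of_int n)))"
        unfolding d W(2) by (rule Bochner_Integration.integral_cong[OF refl]) (rule rhs[symmetric])
    qed
  qed
qed

theorem best_approximation_gaussian_mixture: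
  fixes \<nu> :: "real measure"
  assumes "finite_measure \<nu>" "sets \<nu> = sets (restrict_space borel {0<..})"
  defines "g \<equiv> gaussian_mixture \<nu>"
  shows "(\<exists>!k. best_approximation pi g k) \<and>
     (\<forall>k. best_approximation pi g k \<longrightarrow>
        interpolates_at k g (range (\<lambda>n::int. of_int n + 1/2)) \<and>
        integrable lborel (\<lambda>x. cmod (complex_of_real (g x) - k (complex_of_real x))) \<and>
        integrable \<nu> (\<lambda>s. 1 / pi * (\<Sum>\<^sub>\<infinity>n::int. (-1) powi n / (of_int n + 1/2) * gaussian_hat s (of_int n + 1/2))) \<and>
        (LINT x|lborel. cmod (complex_of_real (g x) - k (complex_of_real x))) =
          (LINT s|\<nu>. 1 / pi * (\<Sum>\<^sub>\<infinity>n::int. (-1) powi n / (of_int n + 1/2) * gaussian_hat s (of_int n + 1/2))))"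
proof -
  define v where "v = (\<lambda>x. cos (pi * x))"
  define \<sigma> where "\<sigma> = (\<lambda>x. sgn (cos (pi * x)))"
  obtain C D where "gaussian_interpolation (\<lambda>z. cos (of_real pi * z)) v best_kernel pi C D 1"
    using best_interpolation unfolding v_def by blast
  then interpret gaussian_mixture_interpolation "\<lambda>z. cos (of_real pi * z)" v best_kernel pi C D 1 \<nu>
    by (intro gaussian_mixture_interpolation.intro gaussian_mixture_interpolation_axioms.intro assms)
  have real: "interpolant (of_real x) = of_real (g x - cos (pi * x) * averaged_heat x)" for x
    unfolding g_def interpolant_of_real error_eq unfolding v_def ..
  have ei: "integrable lborel (\<lambda>x. cos (pi * x) * averaged_heat x)"
    using integrable_error unfolding error_eq[abs_def] unfolding v_def .
  note E = best_approximation_extremal[OF gaussian_mixture_measurable[folded g_def] interpolant_exp_type real ei averaged_heat_nonneg averaged_heat_le]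
  have \<sigma>m: "\<sigma> \<in> borel_measurable borel" unfolding \<sigma>_def by measurable
  have \<sigma>1: "\<bar>\<sigma> x\<bar> \<le> 1" for x by (simp add: \<sigma>_def sgn_if)
  have rhs: "1 / pi * (\<Sum>\<^sub>\<infinity>n::int. (-1) powi n / (of_int n + 1/2) * gaussian_hat s (of_int n + 1/2)) = (\<integral>x. \<sigma> x * deviation s x \<partial>lborel)" if s: "s \<in> space \<nu>" for s
  proof -
    have s0: "s > 0" using s by (simp add: space_\<nu>)
    define c where "c = (\<lambda>n::nat. (-1) ^ n / (real n + 1/2) * gaussian_hat s (real n + 1/2))"
    define G where "G = (\<lambda>x. complex_of_real (gauss s x))"
    have Gi: "integrable lborel G" unfolding G_def by (intro integrable_of_real integrable_gauss s0)
    have FG: "fourier G \<xi> = of_real (gaussian_hat s \<xi>)" for \<xi>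
      unfolding G_def fourier_gauss[OF s0] gaussian_hat_eq[OF s0] ..
    have sm: "summable (\<lambda>n. norm (gaussian_hat s (real n + 1/2)))" by (rule summable_gaussian_hat[OF s0]) auto
    have sum2: "fourier G (- (real n + 1/2)) + fourier G (real n + 1/2) = of_real (2 * gaussian_hat s (real n + 1/2))" for n
      unfolding FG gaussian_hat_minus by simp
    have cs: "summable c"
    proof (rule summable_norm_cancel, rule summable_comparison_test')
      show "summable (\<lambda>n. 2 * norm (gaussian_hat s (real n + 1/2)))" by (rule summable_mult[OF sm])
      fix n
      have "1 / (real n + 1/2) \<le> 1 / (1/2)" by (rule divide_left_mono) auto
      then have "1 / (real n + 1/2) * norm (gaussian_hat s (real n + 1/2)) \<le> 2 * norm (gaussian_hat s (real n + 1/2))"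
        by (intro mult_right_mono) auto
      then show "norm (norm (c n)) \<le> 2 * norm (gaussian_hat s (real n + 1/2))"
        by (simp add: c_def abs_mult abs_divide)
    qed
    have "(\<integral>x. \<sigma> x *\<^sub>R G x \<partial>lborel) = (\<Sum>n. (2 / pi * (-1) ^ n / real (2*n+1)) *\<^sub>R (fourier G (- (real n + 1/2)) + fourier G (real n + 1/2)))"
      unfolding \<sigma>_def
      by (rule integral_square_wave[OF Gi]) (unfold sum2 norm_of_real abs_mult, use summable_mult[OF sm, of 2] in simp)
    also have "\<dots> = (\<Sum>n. of_real (1 / pi * (2 * c n)))"
    proof (rule suminf_cong)
      fix n
      have "2 / pi * (-1) ^ n / real (2*n+1) * (2 * y) = 1 / pi * (2 * ((-1) ^ n / (real n + 1/2) * y))" for y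
        by (simp add: field_simps)
      then show "(2 / pi * (-1) ^ n / real (2*n+1)) *\<^sub>R (fourier G (- (real n + 1/2)) + fourier G (real n + 1/2)) = of_real (1 / pi * (2 * c n))"
        unfolding sum2 scaleR_conv_of_real of_real_mult[symmetric] c_def by (simp only:)
    qed
    also have "\<dots> = of_real (\<Sum>n. 1 / pi * (2 * c n))" by (rule suminf_of_real[symmetric]) (intro summable_mult cs)
    also have "(\<Sum>n. 1 / pi * (2 * c n)) = 1 / pi * (\<Sum>n. 2 * c n)" by (rule suminf_mult) (intro summable_mult cs)
    also have "(\<Sum>n. 2 * c n) = (\<Sum>\<^sub>\<infinity>n::int. (-1) powi n / (of_int n + 1/2) * gaussian_hat s (of_int n + 1/2))"
      unfolding c_def by (rule infsum_gaussian_hat_half[OF s0, symmetric])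
    finally have A: "(\<integral>x. \<sigma> x *\<^sub>R G x \<partial>lborel) = of_real (1 / pi * (\<Sum>\<^sub>\<infinity>n::int. (-1) powi n / (of_int n + 1/2) * gaussian_hat s (of_int n + 1/2)))" .
    have Fi: "integrable lborel (\<lambda>x. approximant s (of_real x))" by (rule integrable_approximant_real[OF s0])
    (* The square wave annihilates the approximant, so the Gaussian alone determines the
      weighted error. *)
    have B: "(\<integral>x. \<sigma> x *\<^sub>R approximant s (of_real x) \<partial>lborel) = 0"
      unfolding \<sigma>_def by (rule integral_sgn_cos_exp_type[OF approximant_exp_type[OF s0] Fi])
    have si: "integrable lborel (\<lambda>x. \<sigma> x *\<^sub>R f x)" if "integrable lborel f" for f :: "real \<Rightarrow> complex"
      by (rule Bochner_Integration.integrable_bound[OF that])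
         (use mult_right_mono[OF \<sigma>1 norm_ge_zero] that \<sigma>m in \<open>auto intro!: AE_I2 borel_measurable_scaleR\<close>)
    have "complex_of_real (\<integral>x. \<sigma> x * deviation s x \<partial>lborel) = (\<integral>x. of_real (\<sigma> x * deviation s x) \<partial>lborel)"
      by (rule integral_complex_of_real[symmetric])
    also have "\<dots> = (\<integral>x. \<sigma> x *\<^sub>R G x - \<sigma> x *\<^sub>R approximant s (of_real x) \<partial>lborel)"
    proof (rule Bochner_Integration.integral_cong[OF refl])
      fix x
      have "complex_of_real (a * d) = a *\<^sub>R of_real y - a *\<^sub>R of_real (y - d)" for a d y :: real
        by (simp add: scaleR_conv_of_real algebra_simps)
      then show "complex_of_real (\<sigma> x * deviation s x) = \<sigma> x *\<^sub>R G x - \<sigma> x *\<^sub>R approximant s (of_real x)"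
        unfolding approximant_of_real G_def .
    qed
    also have "\<dots> = (\<integral>x. \<sigma> x *\<^sub>R G x \<partial>lborel) - (\<integral>x. \<sigma> x *\<^sub>R approximant s (of_real x) \<partial>lborel)"
      by (rule Bochner_Integration.integral_diff[OF si[OF Gi] si[OF Fi]])
    also have "\<dots> = (\<integral>x. \<sigma> x *\<^sub>R G x \<partial>lborel)" unfolding B by (rule diff_0_right)
    finally show ?thesis unfolding A of_real_eq_iff by (rule sym)
  qed
  have W: "integrable \<nu> (\<lambda>s. \<integral>x. \<sigma> x * deviation s x \<partial>lborel)"
    "(\<integral>x. \<sigma> x * error x \<partial>lborel) = (\<integral>s. (\<integral>x. \<sigma> x * deviation s x \<partial>lborel) \<partial>\<nu>)"
    by (rule integral_weighted_error[OF \<sigma>m \<sigma>1])+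
  show ?thesis
  proof (rule ex1_and_all[where l = interpolant])
    show "best_approximation pi g interpolant" unfolding best_approximation_def using interpolant_exp_type E(1) by blast
    show "H = interpolant" if "best_approximation pi g H" for H
      using that E(2)[of H] interpolant_exp_type unfolding best_approximation_def by blast
    have d: "cmod (complex_of_real (g x) - interpolant (of_real x)) = \<sigma> x * error x" for x
    proof -
      have "cmod (complex_of_real (g x) - interpolant (of_real x)) = \<bar>cos (pi * x) * averaged_heat x\<bar>"
        unfolding real of_real_diff[symmetric] norm_of_real by simp
      moreover have "error x = cos (pi * x) * averaged_heat x" unfolding error_eq unfolding v_def ..
      ultimately show ?thesis using averaged_heat_nonneg[of x] by (simp add: \<sigma>_def abs_mult abs_sgn[of "cos (pi * x)"])
    qed
    have i: "integrable lborel (\<lambda>x. \<sigma> x * error x)"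
      by (rule Bochner_Integration.integrable_bound[OF integrable_error])
         (use mult_right_mono[OF \<sigma>1 abs_ge_zero] \<sigma>m integrable_error in \<open>auto simp: abs_mult intro!: AE_I2\<close>)
    show "interpolates_at interpolant g (range (\<lambda>n::int. of_int n + 1/2)) \<and>
        integrable lborel (\<lambda>x. cmod (complex_of_real (g x) - interpolant (complex_of_real x))) \<and>
        integrable \<nu> (\<lambda>s. 1 / pi * (\<Sum>\<^sub>\<infinity>n::int. (-1) powi n / (of_int n + 1/2) * gaussian_hat s (of_int n + 1/2))) \<and>
        (LINT x|lborel. cmod (complex_of_real (g x) - interpolant (complex_of_real x))) =
          (LINT s|\<nu>. 1 / pi * (\<Sum>\<^sub>\<infinity>n::int. (-1) powi n / (of_int n + 1/2) * gaussian_hat s (of_int n + 1/2)))"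
    proof (intro conjI)
      show "interpolates_at interpolant g (range (\<lambda>n::int. of_int n + 1/2))"
        unfolding interpolates_at_def
      proof
        fix x :: real assume "x \<in> range (\<lambda>n::int. of_int n + 1/2)"
        then obtain n :: int where "x = of_int n + 1/2" by blast
        then have "cos (pi * x) = 0" by (simp only: cos_half_int)
        then show "interpolant (of_real x) = of_real (g x)" by (simp add: real)
      qed
      show "integrable lborel (\<lambda>x. cmod (complex_of_real (g x) - interpolant (complex_of_real x)))"
        unfolding d by (rule i)
      show "integrable \<nu> (\<lambda>s. 1 / pi * (\<Sum>\<^sub>\<infinity>n::int. (-1) powi n / (of_int n + 1/2) * gaussian_hat s (of_int n + 1/2)))"
        using W(1) by (rule iffD2[OF Bochner_Integration.integrable_cong[OF refl], rotated]) (rule rhs)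
      show "(LINT x|lborel. cmod (complex_of_real (g x) - interpolant (complex_of_real x))) =
          (LINT s|\<nu>. 1 / pi * (\<Sum>\<^sub>\<infinity>n::int. (-1) powi n / (of_int n + 1/2) * gaussian_hat s (of_int n + 1/2)))"
        unfolding d W(2) by (rule Bochner_Integration.integral_cong[OF refl]) (rule rhs[symmetric])
    qed
  qed
qed

theorem corollary17:
  fixes \<nu> :: "real measure" and g :: "real \<Rightarrow> real"
  assumes "finite_measure \<nu>"
    and "sets \<nu> = sets (restrict_space borel {0<..})"
    and "g = gaussian_mixture \<nu>"
  shows
    "(\<exists>!l. extremal_minorant (2 * pi) g l) \<and>
     (\<forall>l. extremal_minorant (2 * pi) g l \<longrightarrow>
        interpolates_at l g (range (\<lambda>n::int. of_int n + 1/2)) \<and>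
        integrable lborel (\<lambda>x. g x - Re (l (complex_of_real x))) \<and>
        integrable \<nu> (\<lambda>s. \<Sum>\<^sub>\<infinity>n\<in>{n::int. n \<noteq> 0}. (-1) powi (n + 1) * gaussian_hat s (of_int n)) \<and>
        (LINT x|lborel. g x - Re (l (complex_of_real x))) =
          (LINT s|\<nu>. (\<Sum>\<^sub>\<infinity>n\<in>{n::int. n \<noteq> 0}. (-1) powi (n + 1) * gaussian_hat s (of_int n))))
     \<and>
     (\<exists>!m. extremal_majorant (2 * pi) g m) \<and>
     (\<forall>m. extremal_majorant (2 * pi) g m \<longrightarrow>
        interpolates_at m g (range (\<lambda>n::int. of_int n)) \<and>
        integrable lborel (\<lambda>x. Re (m (complex_of_real x)) - g x) \<and>
        integrable \<nu> (\<lambda>s. \<Sum>\<^sub>\<infinity>n\<in>{n::int. n \<noteq> 0}. gaussian_hat s (of_int n)) \<and>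
        (LINT x|lborel. Re (m (complex_of_real x)) - g x) =
          (LINT s|\<nu>. (\<Sum>\<^sub>\<infinity>n\<in>{n::int. n \<noteq> 0}. gaussian_hat s (of_int n))))
     \<and>
     (\<exists>!k. best_approximation pi g k) \<and>
     (\<forall>k. best_approximation pi g k \<longrightarrow>
        interpolates_at k g (range (\<lambda>n::int. of_int n + 1/2)) \<and>
        integrable lborel (\<lambda>x. cmod (complex_of_real (g x) - k (complex_of_real x))) \<and>
        integrable \<nu> (\<lambda>s. 1 / pi * (\<Sum>\<^sub>\<infinity>n::int. (-1) powi n / (of_int n + 1/2) * gaussian_hat s (of_int n + 1/2))) \<and>
        (LINT x|lborel. cmod (complex_of_real (g x) - k (complex_of_real x))) =
          (LINT s|\<nu>. 1 / pi * (\<Sum>\<^sub>\<infinity>n::int. (-1) powi n / (of_int n + 1/2) * gaussian_hat s (of_int n + 1/2))))"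
proof -
  note c = assms(1,2)
  show ?thesis
    unfolding assms(3)
    by (intro conjI conjunct1[OF extremal_minorant_gaussian_mixture[OF c]] conjunct2[OF extremal_minorant_gaussian_mixture[OF c]]
        conjunct1[OF extremal_majorant_gaussian_mixture[OF c]] conjunct2[OF extremal_majorant_gaussian_mixture[OF c]]
        conjunct1[OF best_approximation_gaussian_mixture[OF c]] conjunct2[OF best_approximation_gaussian_mixture[OF c]])
qed

end
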